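(* Let $0\le t\le T$. A random datum $\xi\in\mathbb{L}^2(\Omega,\mathcal{F}_{[0,t]},\mathbb{P};\mathbb{R}^n)$ is approximately reachable in time $t$ (equivalently, the system $$dX_r^{x,u}=(A_rX_r^{x,u}+B_ru_r)dr+\int_EC_r(\theta)X_r^{x,u}\,\tilde q(dr,d\theta),\qquad X_0^{x,u}=x\in\mathbb{R}^n,\tag{S}$$ is approximately terminal controllable in time $t$ to $\xi$) if and only if $V(t,\xi)=0$, where $$V(t,\xi):=\inf_{u\in\mathcal{U}}\mathbb{E}\left[\int_0^t\int_E\|\mathbf{Z}_r^{u,t,\xi}(\theta)\|^2\,\hat q(dr,d\theta)\right]$$ and $(\mathbf{X}^{u,t,\xi},\mathbf{Z}^{u,t,\xi})$ is the solution of the backward stochastic differential equation $$d\mathbf{X}_r^{u,t,\xi}=(A_r\mathbf{X}_r^{u,t,\xi}+B_ru_r)dr+\int_EC_r(\theta)\mathbf{X}_r^{u,t,\xi}\,\tilde q(dr,d\theta)+\int_E\mathbf{Z}_r^{u,t,\xi}(\theta)\,\tilde q(dr,d\theta),\ 0\le r\le t,\qquad\mathbf{X}_t^{u,t,\xi}=\xi.$$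
   Context: **Mode process.** Fix $T>0$, an integer $J>1$, and integers $n,d\ge1$. $E$ is a metric space with Borel $\sigma$-field $\mathcal{B}(E)$; $\lambda:E\times\mathbb{R}_+\to\mathbb{R}_+$ is continuous and bounded; $Q:E\times\mathbb{R}_+\to\mathcal{P}(E)$ (probability measures on $E$) satisfies $Q(\gamma,t,\{\gamma\})=0$ for all $(\gamma,t)$, and $\gamma\mapsto Q(\gamma,t,\cdot)$ is weakly continuous uniformly in $t$. Fix $\gamma_0\in E$. On $(\Omega,\mathbb{P})$ the mode process $\Gamma$ has jump times $T_0:=0<T_1<\dots<T_J$ and marks $\gamma_j=\Gamma_{T_j}$: given the past up to the $(j-1)$-th jump ($1\le j\le J$), $\mathbb{P}(T_j-T_{j-1}\ge t)=\exp(-\int_0^t\lambda(\gamma_{j-1},T_{j-1}+r)dr)$, and given in addition $T_j$, $\gamma_j$ has law $Q(\gamma_{j-1},T_j,\cdot)$; $\Gamma_t=\gamma_{j}$ on $[T_j,T_{j+1})$; after the $J$-th jump there are no further jumps. $\mathcal{F}_{[0,t]}:=\sigma\{\Gamma_s:s\in[0,t]\}$; $\mathcal{P}$ is the predictable $\sigma$-field. $q(A):=\sum_{j=1}^J\mathbf{1}_{(T_j,\Gamma_{T_j})\in A}$ for $A\in\mathcal{B}(\mathbb{R}_+)\otimes\mathcal{B}(E)$, $\hat q$ is its compensator, equal to $\lambda(\gamma_j,t)Q(\gamma_j,t,d\theta)dt$ on $T_j<t\le T_{j+1}$, $j<J$, and to $0$ after $T_J$; $\tilde q:=q-\hat q$.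 **Spaces.** For a Euclidean space $\mathcal{E}$: $\mathbb{L}^p(\Omega\times[0,T],\mathcal{P},\mathbb{P}\times\mathcal{L}eb;\mathcal{E})$ is the usual space of predictable processes; $\mathbb{L}^2(\Omega;\mathbb{D}([0,t];\mathcal{E}))$ is the space of progressively measurable càdlàg processes whose supremum norm over $[0,t]$ is square-integrable; $\mathbb{L}^2(\Omega\times[0,t]\times E,q;\mathcal{E})$ is the space of $\mathcal{P}\otimes\mathcal{B}(E)$-measurable $\Phi$ with $\mathbb{E}[\int_{[0,t]\times E}\|\Phi_r(\theta)\|^2q(dr,d\theta)]<\infty$. $\mathcal{U}:=\mathbb{L}^2(\Omega\times[0,T],\mathcal{P},\mathbb{P}\times\mathcal{L}eb;\mathbb{R}^d)$ is the set of admissible controls. **Coefficients (standing assumption).** $A\in\mathbb{L}^\infty(\Omega\times[0,T],\mathcal{P},\mathbb{P}\times\mathcal{L}eb;\mathbb{R}^{n\times n})$, $B\in\mathbb{L}^\infty(\Omega\times[0,T],\mathcal{P},\mathbb{P}\times\mathcal{L}eb;\mathbb{R}^{n\times d})$, $C\in\mathbb{L}^2(\Omega\times[0,T]\times E,q;\mathbb{R}^{n\times n})$ with $\mathrm{esssup}_{\omega}\sup_{r\in[0,T],\theta\in E}\|C_r(\omega,\theta)\|<\infty$; and $A_t,B_t,C_t(\cdot)$ vanish on $\{t>T_J\}$. In stochastic integrals against $\tilde q$, càdlàg processes are taken at their left limits. For every $x\in\mathbb{R}^n$, $u\in\mathcal{U}$, (S) has a unique solution in $\mathbb{L}^2(\Omega;\mathbb{D}([0,T];\mathbb{R}^n))$,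 and for every $u\in\mathcal{U}$, $\xi\in\mathbb{L}^2(\Omega,\mathcal{F}_{[0,t]},\mathbb{P};\mathbb{R}^n)$ the BSDE has a unique solution in $\mathbb{L}^2(\Omega;\mathbb{D}([0,t];\mathbb{R}^n))\times\mathbb{L}^2(\Omega\times[0,t]\times E,q;\mathbb{R}^n)$. **Reachability.** $\xi\in\mathbb{L}^2(\Omega,\mathcal{F}_{[0,t]},\mathbb{P};\mathbb{R}^n)$ is approximately reachable in time $t$ (equivalently, (S) is approximately terminal controllable in time $t$ to $\xi$) if for every $\varepsilon>0$ there are $x^\varepsilon\in\mathbb{R}^n$ and $u^\varepsilon\in\mathcal{U}$ such that $\|X_t^{x^\varepsilon,u^\varepsilon}-\xi\|_{\mathbb{L}^2(\Omega,\mathcal{F}_{[0,t]},\mathbb{P};\mathbb{R}^n)}\le\varepsilon$. *)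

theory Defs
  imports "HOL-Probability.Probability"
begin

section \<open>Data\<close>

text \<open>
  The jump times are extended reals: a rate with finite total mass leaves positive probability
  that the next jump never happens, and then its time is \<open>\<infinity>\<close> and its mark is irrelevant.
  Only times \<open>r \<ge> 0\<close> matter for \<open>rate\<close> and \<open>trans_law\<close>, and only \<open>r \<in> {0..horizon}\<close> for the coefficients.
\<close>

record ('w, 'e, 'n::finite, 'd::finite) switch_system =
  Prb :: "'w measure"
  horizon :: real
  max_jumps :: nat
  rate :: "'e \<Rightarrow> real \<Rightarrow> real"
  trans_law :: "'e \<Rightarrow> real \<Rightarrow> 'e measure"
  mode0 :: 'e
  jump :: "nat \<Rightarrow> 'w \<Rightarrow> ereal"
  mark :: "nat \<Rightarrow> 'w \<Rightarrow> 'e"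
  coef_A :: "real \<Rightarrow> 'w \<Rightarrow> real^'n^'n"
  coef_B :: "real \<Rightarrow> 'w \<Rightarrow> real^'d^'n"
  coef_C :: "real \<Rightarrow> 'e \<Rightarrow> 'w \<Rightarrow> real^'n^'n"

section \<open>Mode process, filtration, random measures\<close>

definition mode :: "('w, 'e::metric_space, 'n::finite, 'd::finite) switch_system \<Rightarrow> real \<Rightarrow> 'w \<Rightarrow> 'e" where
  "mode S r \<omega> = mark S (Max {j. j \<le> max_jumps S \<and> jump S j \<omega> \<le> ereal r}) \<omega>"

definition filt :: "('w, 'e::metric_space, 'n::finite, 'd::finite) switch_system \<Rightarrow> real \<Rightarrow> 'w measure" where
  "filt S t = sigma (space (Prb S))
     {mode S s -` D \<inter> space (Prb S) | s D. s \<in> {0..t} \<and> D \<in> sets borel}"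

definition past :: "('w, 'e::metric_space, 'n::finite, 'd::finite) switch_system \<Rightarrow> nat \<Rightarrow> 'w measure" where
  "past S j = sigma (space (Prb S))
     ({jump S i -` D \<inter> space (Prb S) | i D. i \<le> j \<and> D \<in> sets borel} \<union>
      {mark S i -` D \<inter> space (Prb S) | i D. i \<le> j \<and> D \<in> sets borel})"

text \<open>The past up to the \<open>j\<close>-th jump together with the time of the next one.\<close>

definition past_next :: "('w, 'e::metric_space, 'n::finite, 'd::finite) switch_system \<Rightarrow> nat \<Rightarrow> 'w measure" where
  "past_next S j = sigma (space (Prb S))
     (sets (past S j) \<union> {jump S (Suc j) -` D \<inter> space (Prb S) | D. D \<in> sets borel})"

text \<open>The predictable \<open>\<sigma>\<close>-field on \<open>\<Omega> \<times> [0,t]\<close>.\<close>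

definition predictable :: "('w, 'e::metric_space, 'n::finite, 'd::finite) switch_system \<Rightarrow> real \<Rightarrow> ('w \<times> real) measure" where
  "predictable S t = sigma (space (Prb S) \<times> {0..t})
     ({G \<times> {0} | G. G \<in> sets (filt S 0)} \<union>
      {G \<times> {r<..s} | G r s. 0 \<le> r \<and> r \<le> s \<and> s \<le> t \<and> G \<in> sets (filt S r)})"

text \<open>The counting measure of the points \<open>(T\<^sub>j, \<gamma>\<^sub>j)\<close>, \<open>1 \<le> j \<le> J\<close>, with \<open>T\<^sub>j < \<infinity>\<close>.\<close>

definition q_meas :: "('w, 'e::metric_space, 'n::finite, 'd::finite) switch_system \<Rightarrow> 'w \<Rightarrow> (real \<times> 'e) measure" where
  "q_meas S \<omega> = distr (count_space {j \<in> {1..max_jumps S}. jump S j \<omega> < \<infinity>}) (borel \<Otimes>\<^sub>M borel)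
     (\<lambda>j. (real_of_ereal (jump S j \<omega>), mark S j \<omega>))"

text \<open>The compensator of \<open>q_meas\<close>: \<open>\<lambda>(\<gamma>\<^sub>j,r) Q(\<gamma>\<^sub>j,r,d\<theta>) dr\<close> on \<open>T\<^sub>j < r \<le> T\<^sub>j\<^sub>+\<^sub>1\<close>, \<open>j < J\<close>, and \<open>0\<close> after \<open>T\<^sub>J\<close>.\<close>

definition q_hat :: "('w, 'e::metric_space, 'n::finite, 'd::finite) switch_system \<Rightarrow> 'w \<Rightarrow> (real \<times> 'e) measure" where
  "q_hat S \<omega> = measure_of UNIV (sets (borel \<Otimes>\<^sub>M borel))
     (\<lambda>D. \<integral>\<^sup>+ r. (\<Sum>j<max_jumps S.
         indicator {s. jump S j \<omega> < ereal s \<and> ereal s \<le> jump S (Suc j) \<omega>} r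
         * ennreal (rate S (mark S j \<omega>) r)
         * emeasure (trans_law S (mark S j \<omega>) r) (Pair r -` D)) \<partial>lborel)"

text \<open>The integral of \<open>f\<close> over \<open>(0,r] \<times> E\<close> against \<open>q - q_hat\<close>.\<close>

definition q_tilde_int :: "('w, 'e::metric_space, 'n::finite, 'd::finite) switch_system
    \<Rightarrow> 'w \<Rightarrow> real \<Rightarrow> (real \<times> 'e \<Rightarrow> real^'n) \<Rightarrow> real^'n" where
  "q_tilde_int S \<omega> r f =
     (LINT p:{0<..r} \<times> UNIV|q_meas S \<omega>. f p) - (LINT p:{0<..r} \<times> UNIV|q_hat S \<omega>. f p)"

text \<open>
  \<open>trans_kernel\<close> says that \<open>Q\<close> is a Markov kernel into the Borel probability measures on \<open>E\<close>. The two
  laws are conditional probabilities, prescribed on the events where the jump in question is finite.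
\<close>

locale mode_process = prob_space "Prb S"
  for S :: "('w, 'e::metric_space, 'n::finite, 'd::finite) switch_system" +
  assumes horizon_pos: "horizon S > 0"
    and max_jumps_gt_1: "max_jumps S > 1"
    and rate_nonneg: "\<And>\<gamma> t. 0 \<le> t \<Longrightarrow> 0 \<le> rate S \<gamma> t"
    and rate_continuous: "continuous_on (UNIV \<times> {0..}) (\<lambda>(\<gamma>, t). rate S \<gamma> t)"
    and rate_bounded: "\<exists>K. \<forall>\<gamma>. \<forall>t\<ge>0. rate S \<gamma> t \<le> K"
    and trans_kernel: "(\<lambda>(\<gamma>, t). trans_law S \<gamma> t)
      \<in> (borel \<Otimes>\<^sub>M restrict_space borel {0..}) \<rightarrow>\<^sub>M prob_algebra borel"
    and trans_no_self: "\<And>\<gamma> t. 0 \<le> t \<Longrightarrow> measure (trans_law S \<gamma> t) {\<gamma>} = 0"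
    and trans_weakly_continuous: "\<And>(f :: 'e \<Rightarrow> real) \<gamma> \<epsilon>.
      continuous_on UNIV f \<Longrightarrow> bounded (range f) \<Longrightarrow> \<epsilon> > 0 \<Longrightarrow>
      \<exists>\<delta>>0. \<forall>\<gamma>'. dist \<gamma>' \<gamma> < \<delta> \<longrightarrow>
        (\<forall>t\<ge>0. \<bar>(\<integral>\<theta>. f \<theta> \<partial>trans_law S \<gamma>' t) - (\<integral>\<theta>. f \<theta> \<partial>trans_law S \<gamma> t)\<bar> < \<epsilon>)"
    and jump_measurable: "\<And>j. j \<le> max_jumps S \<Longrightarrow> jump S j \<in> borel_measurable (Prb S)"
    and mark_measurable: "\<And>j. j \<le> max_jumps S \<Longrightarrow> mark S j \<in> borel_measurable (Prb S)"
    and jump_0: "\<And>\<omega>. \<omega> \<in> space (Prb S) \<Longrightarrow> jump S 0 \<omega> = 0"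
    and mark_0: "\<And>\<omega>. \<omega> \<in> space (Prb S) \<Longrightarrow> mark S 0 \<omega> = mode0 S"
    and jump_less: "\<And>j \<omega>. j < max_jumps S \<Longrightarrow> \<omega> \<in> space (Prb S) \<Longrightarrow>
      jump S j \<omega> < \<infinity> \<Longrightarrow> jump S j \<omega> < jump S (Suc j) \<omega>"
    and jump_infinite: "\<And>j \<omega>. j < max_jumps S \<Longrightarrow> \<omega> \<in> space (Prb S) \<Longrightarrow>
      jump S j \<omega> = \<infinity> \<Longrightarrow> jump S (Suc j) \<omega> = \<infinity>"
    and jump_law: "\<And>j t. j < max_jumps S \<Longrightarrow> 0 \<le> t \<Longrightarrow>
      AE \<omega> in Prb S. jump S j \<omega> < \<infinity> \<longrightarrow>
        real_cond_exp (Prb S) (past S j)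
          (indicator {\<omega> \<in> space (Prb S). jump S j \<omega> + ereal t \<le> jump S (Suc j) \<omega>}) \<omega>
        = exp (- (LINT r:{0..t}|lborel. rate S (mark S j \<omega>) (real_of_ereal (jump S j \<omega>) + r)))"
    and mark_law: "\<And>j D. j < max_jumps S \<Longrightarrow> D \<in> sets borel \<Longrightarrow>
      AE \<omega> in Prb S. jump S (Suc j) \<omega> < \<infinity> \<longrightarrow>
        real_cond_exp (Prb S) (past_next S j)
          (indicator {\<omega> \<in> space (Prb S). mark S (Suc j) \<omega> \<in> D}) \<omega>
        = measure (trans_law S (mark S j \<omega>) (real_of_ereal (jump S (Suc j) \<omega>))) D"

text \<open>The set function in \<open>q_hat\<close> is countably additive, so \<open>measure_of\<close> does not fall back to zero.\<close>

lemma (in mode_process) emeasure_q_hat: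
  assumes D: "D \<in> sets (borel \<Otimes>\<^sub>M borel)" and \<omega>: "\<omega> \<in> space (Prb S)"
  shows "emeasure (q_hat S \<omega>) D = (\<integral>\<^sup>+ r. (\<Sum>j<max_jumps S.
         indicator {s. jump S j \<omega> < ereal s \<and> ereal s \<le> jump S (Suc j) \<omega>} r
         * ennreal (rate S (mark S j \<omega>) r)
         * emeasure (trans_law S (mark S j \<omega>) r) (Pair r -` D)) \<partial>lborel)" (is "_ = ?\<mu> D")
proof -
  have jump_nonneg: "0 \<le> jump S j \<omega>" if "j \<le> max_jumps S" for j
    using that
  proof (induction j)
    case 0 then show ?case using jump_0[OF \<omega>] by simp
  next
    case (Suc j)
    then show ?case using jump_less[of j \<omega>] jump_infinite[of j \<omega>] \<omega>
      by (cases "jump S j \<omega> = \<infinity>") (auto simp: less_le)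
  qed
  define I where "I j = {s. jump S j \<omega> < ereal s \<and> ereal s \<le> jump S (Suc j) \<omega>}" for j
  have I_pos: "s \<ge> 0" if "s \<in> I j" "j < max_jumps S" for s j
    using that jump_nonneg[of j] unfolding I_def by (auto simp: order.strict_implies_order dest: le_less_trans)
  have I_meas[measurable]: "I j \<in> sets borel" for j unfolding I_def by measurable
  have ker: "(\<lambda>r. trans_law S \<gamma> r) \<in> restrict_space borel {0..} \<rightarrow>\<^sub>M prob_algebra borel" for \<gamma>
    using measurable_compose[OF measurable_Pair1'[of \<gamma> borel "restrict_space borel {0..}"] trans_kernel] by simp
  have prb: "prob_space (trans_law S \<gamma> r)" "sets (trans_law S \<gamma> r) = sets borel" if "r \<ge> 0" for \<gamma> r
    using measurable_space[OF ker, of r \<gamma>] that by (auto simp: space_prob_algebra space_restrict_space)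
  have sec: "Pair r -` X \<in> sets borel" if "X \<in> sets (borel \<Otimes>\<^sub>M borel)" for r :: real and X :: "(real \<times> 'e) set"
    using sets_Pair1[OF that] by simp
  have em: "(\<lambda>r. emeasure (trans_law S \<gamma> r) (Pair r -` X)) \<in> borel_measurable (restrict_space borel {0..})"
    if X: "X \<in> sets (borel \<Otimes>\<^sub>M borel)" for \<gamma> and X :: "(real \<times> 'e) set"
  proof (rule emeasure_measurable_subprob_algebra2[of _ _ borel])
    have "id \<in> (restrict_space borel {0..} \<Otimes>\<^sub>M borel) \<rightarrow>\<^sub>M (borel \<Otimes>\<^sub>M borel :: (real \<times> 'e) measure)"
      unfolding id_def by (rule measurable_pair) (auto intro!: measurable_compose[OF measurable_fst] simp: measurable_restrict_space1 comp_def)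
    from measurable_sets[OF this X]
    show "(SIGMA r:space (restrict_space borel {0..}). Pair r -` X) \<in> sets (restrict_space borel {0..} \<Otimes>\<^sub>M borel)"
      by (rule back_subst[of "\<lambda>A. A \<in> _"]) (auto simp: space_pair_measure space_restrict_space)
    show "(\<lambda>r. trans_law S \<gamma> r) \<in> restrict_space borel {0..} \<rightarrow>\<^sub>M subprob_algebra borel"
      using measurable_prob_algebraD[OF ker] .
  qed
  have rt: "(\<lambda>r. ennreal (rate S \<gamma> r)) \<in> borel_measurable (restrict_space borel {0..})" for \<gamma>
  proof -
    have "continuous_on {0..} (\<lambda>r. rate S \<gamma> r)"
      by (rule continuous_on_compose2[OF rate_continuous, of "{0..}" "\<lambda>r. (\<gamma>, r)", simplified])
        (auto intro: continuous_on_Pair continuous_on_const continuous_on_id)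
    then have "(\<lambda>r. rate S \<gamma> r) \<in> borel_measurable (restrict_space borel {0..})"
      by (rule borel_measurable_continuous_on_restrict)
    then show ?thesis by measurable
  qed
  let ?f = "\<lambda>X j r. indicator (I j) r * ennreal (rate S (mark S j \<omega>) r)
         * emeasure (trans_law S (mark S j \<omega>) r) (Pair r -` X)"
  have f_meas: "?f X j \<in> borel_measurable borel"
    if X: "X \<in> sets (borel \<Otimes>\<^sub>M borel)" and j: "j < max_jumps S" for X j
  proof -
    have "(\<lambda>r. ennreal (rate S (mark S j \<omega>) r) * emeasure (trans_law S (mark S j \<omega>) r) (Pair r -` X))
        \<in> borel_measurable (restrict_space borel {0..})"
      using rt em[OF X] by measurable
    then have "(\<lambda>r. ennreal (rate S (mark S j \<omega>) r) * emeasure (trans_law S (mark S j \<omega>) r) (Pair r -` X)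
        * indicator {0..} r) \<in> borel_measurable borel"
      by (subst (asm) borel_measurable_restrict_space_iff_ennreal) auto
    then have "(\<lambda>r. indicator (I j) r * (ennreal (rate S (mark S j \<omega>) r) * emeasure (trans_law S (mark S j \<omega>) r) (Pair r -` X)
        * indicator {0..} r)) \<in> borel_measurable borel"
      by measurable
    also have "(\<lambda>r. indicator (I j) r * (ennreal (rate S (mark S j \<omega>) r) * emeasure (trans_law S (mark S j \<omega>) r) (Pair r -` X)
        * indicator {0..} r)) = ?f X j"
      using I_pos[OF _ j] by (auto simp: indicator_def mult.assoc fun_eq_iff)
    finally show ?thesis .
  qed
  let ?B = "sets (borel \<Otimes>\<^sub>M borel) :: (real \<times> 'e) set set"
  have pos: "positive ?B ?\<mu>" by (simp add: positive_def)
  have ca: "countably_additive ?B ?\<mu>"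
  proof (rule countably_additiveI)
    fix X :: "nat \<Rightarrow> (real \<times> 'e) set"
    assume X: "range X \<subseteq> ?B" and dj: "disjoint_family X"
    have fs: "(\<Sum>i. ?f (X i) j r) = ?f (\<Union>i. X i) j r" if "j < max_jumps S" for j r
    proof (cases "r \<in> I j")
      case True
      then have "r \<ge> 0" using I_pos that by auto
      have "(\<Sum>i. emeasure (trans_law S (mark S j \<omega>) r) (Pair r -` X i))
          = emeasure (trans_law S (mark S j \<omega>) r) (\<Union>i. Pair r -` X i)"
        using X dj sec prb(2)[OF \<open>r \<ge> 0\<close>] by (intro suminf_emeasure) (auto simp: disjoint_family_on_def)
      then show ?thesis by (simp add: vimage_UN)
    qed simp
    have "(\<Sum>i. ?\<mu> (X i)) = (\<integral>\<^sup>+ r. (\<Sum>i. \<Sum>j<max_jumps S. ?f (X i) j r) \<partial>lborel)"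
      unfolding I_def[symmetric] using X f_meas by (intro nn_integral_suminf[symmetric]) auto
    also have "\<dots> = (\<integral>\<^sup>+ r. (\<Sum>j<max_jumps S. \<Sum>i. ?f (X i) j r) \<partial>lborel)"
      by (simp add: suminf_sum)
    also have "\<dots> = ?\<mu> (\<Union>i. X i)"
      unfolding I_def[symmetric] using fs by (intro nn_integral_cong sum.cong) auto
    finally show "(\<Sum>i. ?\<mu> (X i)) = ?\<mu> (\<Union> (range X))" .
  qed
  show ?thesis
    unfolding q_hat_def
    by (rule emeasure_measure_of_sigma)
      (use pos ca D sets.sigma_algebra_axioms[of "borel \<Otimes>\<^sub>M borel :: (real \<times> 'e) measure"] in \<open>auto simp: space_pair_measure\<close>)
qed

section \<open>Spaces\<close>

definition L2_pred :: "('w, 'e::metric_space, 'n::finite, 'd::finite) switch_system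
    \<Rightarrow> (real \<Rightarrow> 'w \<Rightarrow> 'v::euclidean_space) set" where
  "L2_pred S = {f. (\<lambda>(\<omega>, r). f r \<omega>) \<in> borel_measurable (predictable S (horizon S)) \<and>
     (\<integral>\<^sup>+ (\<omega>, r) \<in> space (Prb S) \<times> {0..horizon S}. ennreal ((norm (f r \<omega>))\<^sup>2)
        \<partial>(Prb S \<Otimes>\<^sub>M lborel)) < \<infinity>}"

definition Linf_pred :: "('w, 'e::metric_space, 'n::finite, 'd::finite) switch_system
    \<Rightarrow> (real \<Rightarrow> 'w \<Rightarrow> 'v::euclidean_space) set" where
  "Linf_pred S = {f. (\<lambda>(\<omega>, r). f r \<omega>) \<in> borel_measurable (predictable S (horizon S)) \<and>
     (\<exists>K. AE (\<omega>, r) in Prb S \<Otimes>\<^sub>M lborel. r \<in> {0..horizon S} \<longrightarrow> norm (f r \<omega>) \<le> K)}"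

definition L2_q :: "('w, 'e::metric_space, 'n::finite, 'd::finite) switch_system \<Rightarrow> real
    \<Rightarrow> (real \<Rightarrow> 'e \<Rightarrow> 'w \<Rightarrow> 'v::euclidean_space) set" where
  "L2_q S t = {\<Phi>. (\<lambda>((\<omega>, r), \<theta>). \<Phi> r \<theta> \<omega>) \<in> borel_measurable (predictable S t \<Otimes>\<^sub>M borel) \<and>
     (\<integral>\<^sup>+ \<omega>. (\<integral>\<^sup>+ (r, \<theta>) \<in> {0..t} \<times> UNIV. ennreal ((norm (\<Phi> r \<theta> \<omega>))\<^sup>2) \<partial>q_meas S \<omega>) \<partial>Prb S) < \<infinity>}"

definition L2_at :: "('w, 'e::metric_space, 'n::finite, 'd::finite) switch_system \<Rightarrow> real
    \<Rightarrow> ('w \<Rightarrow> 'v::euclidean_space) set" where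
  "L2_at S t = {\<xi> \<in> borel_measurable (filt S t).
     (\<integral>\<^sup>+ \<omega>. ennreal ((norm (\<xi> \<omega>))\<^sup>2) \<partial>Prb S) < \<infinity>}"

definition cadlag_on :: "real \<Rightarrow> (real \<Rightarrow> 'v::euclidean_space) \<Rightarrow> bool" where
  "cadlag_on t x \<longleftrightarrow>
     (\<forall>r\<in>{0..<t}. (x \<longlongrightarrow> x r) (at_right r)) \<and> (\<forall>r\<in>{0<..t}. \<exists>l. (x \<longlongrightarrow> l) (at_left r))"

definition progressive :: "('w, 'e::metric_space, 'n::finite, 'd::finite) switch_system \<Rightarrow> real
    \<Rightarrow> (real \<Rightarrow> 'w \<Rightarrow> 'v::euclidean_space) \<Rightarrow> bool" where
  "progressive S t X \<longleftrightarrow> (\<forall>s\<in>{0..t}.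
     (\<lambda>(\<omega>, r). X r \<omega>) \<in> borel_measurable (filt S s \<Otimes>\<^sub>M restrict_space borel {0..s}))"

definition L2_cadlag :: "('w, 'e::metric_space, 'n::finite, 'd::finite) switch_system \<Rightarrow> real
    \<Rightarrow> (real \<Rightarrow> 'w \<Rightarrow> 'v::euclidean_space) set" where
  "L2_cadlag S t = {X. progressive S t X \<and> (\<forall>\<omega>\<in>space (Prb S). cadlag_on t (\<lambda>r. X r \<omega>)) \<and>
     (\<integral>\<^sup>+ \<omega>. (SUP r\<in>{0..t}. ennreal (norm (X r \<omega>)))\<^sup>2 \<partial>Prb S) < \<infinity>}"

text \<open>
  The value at \<open>r = 0\<close> is junk; \<open>left_lim\<close> is only integrated against \<open>q - q_hat\<close> over \<open>(0,r]\<close>.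
\<close>

definition left_lim :: "(real \<Rightarrow> 'v::euclidean_space) \<Rightarrow> real \<Rightarrow> 'v" where
  "left_lim x r = Lim (at_left r) x"

abbreviation admissible :: "('w, 'e::metric_space, 'n::finite, 'd::finite) switch_system
    \<Rightarrow> (real \<Rightarrow> 'w \<Rightarrow> real^'d) set" where
  "admissible S \<equiv> L2_pred S"

section \<open>The controlled system and the backward equation\<close>

locale control_system = mode_process S
  for S :: "('w, 'e::metric_space, 'n::finite, 'd::finite) switch_system" +
  assumes A_Linf: "coef_A S \<in> Linf_pred S"
    and B_Linf: "coef_B S \<in> Linf_pred S"
    and C_L2: "coef_C S \<in> L2_q S (horizon S)"
    and C_bounded: "\<exists>K. AE \<omega> in Prb S. \<forall>r\<in>{0..horizon S}. \<forall>\<theta>. norm (coef_C S r \<theta> \<omega>) \<le> K"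
    and A_vanishes: "AE (\<omega>, r) in Prb S \<Otimes>\<^sub>M lborel.
      r \<in> {0..horizon S} \<longrightarrow> jump S (max_jumps S) \<omega> < ereal r \<longrightarrow> coef_A S r \<omega> = 0"
    and B_vanishes: "AE (\<omega>, r) in Prb S \<Otimes>\<^sub>M lborel.
      r \<in> {0..horizon S} \<longrightarrow> jump S (max_jumps S) \<omega> < ereal r \<longrightarrow> coef_B S r \<omega> = 0"
    and C_vanishes: "AE \<omega> in Prb S. \<forall>r\<in>{0..horizon S}. \<forall>\<theta>.
      jump S (max_jumps S) \<omega> < ereal r \<longrightarrow> coef_C S r \<theta> \<omega> = 0"

definition sde_solution :: "('w, 'e::metric_space, 'n::finite, 'd::finite) switch_system
    \<Rightarrow> real^'n \<Rightarrow> (real \<Rightarrow> 'w \<Rightarrow> real^'d) \<Rightarrow> (real \<Rightarrow> 'w \<Rightarrow> real^'n) \<Rightarrow> bool" where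
  "sde_solution S x u X \<longleftrightarrow> X \<in> L2_cadlag S (horizon S) \<and>
     (AE \<omega> in Prb S. \<forall>r\<in>{0..horizon S}.
        X r \<omega> = x
          + (LINT s:{0..r}|lborel. coef_A S s \<omega> *v X s \<omega> + coef_B S s \<omega> *v u s \<omega>)
          + q_tilde_int S \<omega> r (\<lambda>(s, \<theta>). coef_C S s \<theta> \<omega> *v left_lim (\<lambda>s. X s \<omega>) s))"

definition bsde_solution :: "('w, 'e::metric_space, 'n::finite, 'd::finite) switch_system
    \<Rightarrow> (real \<Rightarrow> 'w \<Rightarrow> real^'d) \<Rightarrow> real \<Rightarrow> ('w \<Rightarrow> real^'n)
    \<Rightarrow> (real \<Rightarrow> 'w \<Rightarrow> real^'n) \<Rightarrow> (real \<Rightarrow> 'e \<Rightarrow> 'w \<Rightarrow> real^'n) \<Rightarrow> bool" where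
  "bsde_solution S u t \<xi> X Z \<longleftrightarrow> X \<in> L2_cadlag S t \<and> Z \<in> L2_q S t \<and>
     (AE \<omega> in Prb S. \<forall>r\<in>{0..t}.
        X r \<omega> = X 0 \<omega>
          + (LINT s:{0..r}|lborel. coef_A S s \<omega> *v X s \<omega> + coef_B S s \<omega> *v u s \<omega>)
          + q_tilde_int S \<omega> r (\<lambda>(s, \<theta>). coef_C S s \<theta> \<omega> *v left_lim (\<lambda>s. X s \<omega>) s)
          + q_tilde_int S \<omega> r (\<lambda>(s, \<theta>). Z s \<theta> \<omega>)) \<and>
     (AE \<omega> in Prb S. X t \<omega> = \<xi> \<omega>)"

text \<open>Unique solvability; \<open>X\<close> is unique up to indistinguishability, \<open>Z\<close> as an element of \<open>L\<^sup>2(q)\<close>.\<close>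

definition sde_well_posed :: "('w, 'e::metric_space, 'n::finite, 'd::finite) switch_system \<Rightarrow> bool" where
  "sde_well_posed S \<longleftrightarrow> (\<forall>x. \<forall>u\<in>admissible S.
     (\<exists>X. sde_solution S x u X) \<and>
     (\<forall>X X'. sde_solution S x u X \<longrightarrow> sde_solution S x u X' \<longrightarrow>
        (AE \<omega> in Prb S. \<forall>r\<in>{0..horizon S}. X r \<omega> = X' r \<omega>)))"

definition bsde_well_posed :: "('w, 'e::metric_space, 'n::finite, 'd::finite) switch_system \<Rightarrow> bool" where
  "bsde_well_posed S \<longleftrightarrow> (\<forall>t\<in>{0..horizon S}. \<forall>u\<in>admissible S. \<forall>\<xi>\<in>L2_at S t.
     (\<exists>X Z. bsde_solution S u t \<xi> X Z) \<and>
     (\<forall>X Z X' Z'. bsde_solution S u t \<xi> X Z \<longrightarrow> bsde_solution S u t \<xi> X' Z' \<longrightarrow>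
        (AE \<omega> in Prb S. \<forall>r\<in>{0..t}. X r \<omega> = X' r \<omega>) \<and>
        (\<integral>\<^sup>+ \<omega>. (\<integral>\<^sup>+ (r, \<theta>) \<in> {0..t} \<times> UNIV.
            ennreal ((norm (Z r \<theta> \<omega> - Z' r \<theta> \<omega>))\<^sup>2) \<partial>q_meas S \<omega>) \<partial>Prb S) = 0))"

text \<open>The solution processes, meaningful under well-posedness.\<close>

definition state :: "('w, 'e::metric_space, 'n::finite, 'd::finite) switch_system
    \<Rightarrow> real^'n \<Rightarrow> (real \<Rightarrow> 'w \<Rightarrow> real^'d) \<Rightarrow> real \<Rightarrow> 'w \<Rightarrow> real^'n" where
  "state S x u = (SOME X. sde_solution S x u X)"

definition bsde_Z :: "('w, 'e::metric_space, 'n::finite, 'd::finite) switch_system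
    \<Rightarrow> (real \<Rightarrow> 'w \<Rightarrow> real^'d) \<Rightarrow> real \<Rightarrow> ('w \<Rightarrow> real^'n) \<Rightarrow> real \<Rightarrow> 'e \<Rightarrow> 'w \<Rightarrow> real^'n" where
  "bsde_Z S u t \<xi> = (SOME Z. \<exists>X. bsde_solution S u t \<xi> X Z)"

text \<open>
  Equivalently in terminology: the system is approximately terminal controllable in time \<open>t\<close> to \<open>\<xi>\<close>.
\<close>

definition approx_reachable :: "('w, 'e::metric_space, 'n::finite, 'd::finite) switch_system
    \<Rightarrow> real \<Rightarrow> ('w \<Rightarrow> real^'n) \<Rightarrow> bool" where
  "approx_reachable S t \<xi> \<longleftrightarrow> (\<forall>\<epsilon>>0. \<exists>x. \<exists>u\<in>admissible S.
     sqrt (\<integral>\<omega>. (norm (state S x u t \<omega> - \<xi> \<omega>))\<^sup>2 \<partial>Prb S) \<le> \<epsilon>)"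

definition V_value :: "('w, 'e::metric_space, 'n::finite, 'd::finite) switch_system
    \<Rightarrow> real \<Rightarrow> ('w \<Rightarrow> real^'n) \<Rightarrow> ennreal" where
  "V_value S t \<xi> = (INF u\<in>admissible S.
     \<integral>\<^sup>+ \<omega>. (\<integral>\<^sup>+ (r, \<theta>) \<in> {0..t} \<times> UNIV. ennreal ((norm (bsde_Z S u t \<xi> r \<theta> \<omega>))\<^sup>2) \<partial>q_hat S \<omega>) \<partial>Prb S)"

end

theory Submission
  imports Defs
begin

text \<open>
  Let \<open>X\<close> solve the controlled equation and \<open>(\<^bold>X, \<^bold>Z)\<close> the backward equation with datum \<open>\<xi>\<close> for the same
  control. The difference \<open>D = X - \<^bold>X\<close> satisfies \<open>dD = A D dr + \<integral> (C D\<^sub>- - \<^bold>Z) dq~\<close> and \<open>D\<^sub>t = X\<^sub>t - \<xi>\<close>. Along each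
  path \<open>D\<close> has finite variation, and Fubini's theorem gives the energy identity
  \<open>|D\<^sub>r|\<^sup>2 = |D\<^sub>0|\<^sup>2 + 2 \<integral> \<langle>D\<^sub>-, dD\<rangle> + \<Sum> |\<Delta>D|\<^sup>2\<close> on \<open>(0, r]\<close>. Its \<open>q~\<close>-part has mean zero because \<open>D\<^sub>-\<close> is predictable
  and \<open>q\<^sup>^\<close> compensates \<open>q\<close>; as there are at most \<open>J\<close> jumps, no localisation is needed. Gronwall's lemma
  applied forward from \<open>D\<^sub>0 = 0\<close> bounds \<open>E|X\<^sub>t - \<xi>|\<^sup>2\<close> by the energy of \<open>\<^bold>Z\<close>, where \<open>\<^bold>X\<^sub>0\<close> is admissible as
  an initial value because the \<open>\<sigma>\<close>-field at time \<open>0\<close> is trivial. Applied backward from \<open>t\<close> it bounds the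
  energy of \<open>\<^bold>Z\<close> by \<open>E|X\<^sub>t - \<xi>|\<^sup>2\<close>. So one of the two infima vanishes if and only if the other does.

  The compensator property itself is derived from the conditional laws of the jump times and marks:
  up to the next jump every predictable set coincides with a product-measurable set over the past
  \<open>\<sigma>\<close>-field of the last jump.
\<close>

section \<open>Jump times, marks and filtrations\<close>

text \<open>The constant in both bounds depends only on \<open>t\<close>, the coefficient bounds and
  the rate bound, not on the control, the initial value or the target; this uniformity turns
  estimates for single solutions into a statement about infima. The value function integrates
  against \<open>q_hat\<close>, while the spaces and the squared jumps use \<open>q_meas\<close>;
  the compensator formula identifies the two energies of a predictable integrand, so the estimates
  are carried out with \<open>q_meas\<close>. The integrand of the difference equation is
  \<open>C D_- - Z\<close> and not \<open>Z\<close>, so each bound pays for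
  \<open>|C D_-|^2\<close>. The expected q-integral of \<open>|D_-|^2\<close> is at most a constant
  times the time integral of \<open>E |D|^2\<close>, a term that Gronwall absorbs. Backward in time
  this works because the squared jumps enter the balance with the favourable sign. For the
  compensator formula the obstacle is that the laws are prescribed only as conditional expectations
  of single events, each up to its own null set. Both sides are therefore viewed as measures on the
  predictable sigma-field times the marks and compared on an intersection-stable generator.\<close>

context mode_process
begin

lemma jump_le_Suc:
  assumes "j < max_jumps S" "\<omega> \<in> space (Prb S)"
  shows "jump S j \<omega> \<le> jump S (Suc j) \<omega>"
  using jump_less[OF assms] jump_infinite[OF assms] by (cases "jump S j \<omega> = \<infinity>") (auto simp: less_le)

lemma jump_mono:
  assumes "i \<le> j" "j \<le> max_jumps S" "\<omega> \<in> space (Prb S)"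
  shows "jump S i \<omega> \<le> jump S j \<omega>"
  using assms(1,2)
proof (induction rule: dec_induct)
  case (step n)
  then show ?case using jump_le_Suc[of n \<omega>] assms(3) by (auto intro: order_trans)
qed simp

lemma jump_nonneg: "j \<le> max_jumps S \<Longrightarrow> \<omega> \<in> space (Prb S) \<Longrightarrow> 0 \<le> jump S j \<omega>"
  using jump_mono[of 0 j \<omega>] jump_0 by simp

lemma jump_strict_mono:
  assumes "i < j" "j \<le> max_jumps S" "\<omega> \<in> space (Prb S)" "jump S i \<omega> < \<infinity>"
  shows "jump S i \<omega> < jump S j \<omega>"
  using jump_less[of i \<omega>] jump_mono[of "Suc i" j \<omega>] assms by (auto intro: less_le_trans)

lemma jump_pos:
  assumes "0 < j" "j \<le> max_jumps S" "\<omega> \<in> space (Prb S)"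
  shows "0 < jump S j \<omega>"
  using jump_strict_mono[of 0 j \<omega>] assms jump_0 by simp

lemma jump_real:
  assumes "j \<le> max_jumps S" "\<omega> \<in> space (Prb S)" "jump S j \<omega> < \<infinity>"
  shows "jump S j \<omega> = ereal (real_of_ereal (jump S j \<omega>))"
  using jump_nonneg[OF assms(1,2)] assms(3) by (cases "jump S j \<omega>") auto

section \<open>The sigma-fields of the past and of the mode process\<close>

lemma space_past [simp]: "space (past S j) = space (Prb S)"
  and space_past_next [simp]: "space (past_next S j) = space (Prb S)"
  and space_filt [simp]: "space (filt S r) = space (Prb S)"
  and space_predictable [simp]: "space (predictable S t) = space (Prb S) \<times> {0..t}"
  unfolding past_def past_next_def filt_def predictable_def by (auto simp: space_measure_of_conv)

lemma sets_past: "sets (past S j) = sigma_sets (space (Prb S))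
     ({jump S i -` D \<inter> space (Prb S) | i D. i \<le> j \<and> D \<in> sets borel} \<union>
      {mark S i -` D \<inter> space (Prb S) | i D. i \<le> j \<and> D \<in> sets borel})"
  unfolding past_def by (intro sets_measure_of) auto

lemma sets_past_next: "sets (past_next S j) = sigma_sets (space (Prb S))
     (sets (past S j) \<union> {jump S (Suc j) -` D \<inter> space (Prb S) | D. D \<in> sets borel})"
  unfolding past_next_def using sets.sets_into_space[of _ "past S j"] by (intro sets_measure_of) auto

lemma sets_filt: "sets (filt S r) = sigma_sets (space (Prb S))
     {mode S s -` D \<inter> space (Prb S) | s D. s \<in> {0..r} \<and> D \<in> sets borel}"
  unfolding filt_def by (intro sets_measure_of) auto

lemma measurable_jump_past: "i \<le> j \<Longrightarrow> jump S i \<in> borel_measurable (past S j)"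
  and measurable_mark_past: "i \<le> j \<Longrightarrow> mark S i \<in> borel_measurable (past S j)"
  unfolding measurable_def by (auto simp: sets_past intro!: sigma_sets.Basic)

lemma subalgebra_past:
  assumes "j \<le> max_jumps S"
  shows "subalgebra (Prb S) (past S j)"
proof -
  have "sets (past S j) \<subseteq> sets (Prb S)"
    unfolding sets_past using assms
    by (intro sets.sigma_sets_subset) (auto intro!: measurable_sets[OF jump_measurable] measurable_sets[OF mark_measurable])
  then show ?thesis by (simp add: subalgebra_def)
qed

lemma subalgebra_past_next:
  assumes "j < max_jumps S"
  shows "subalgebra (Prb S) (past_next S j)"
proof -
  have "sets (past_next S j) \<subseteq> sets (Prb S)"
    unfolding sets_past_next using subalgebra_past[of j] assms
    by (intro sets.sigma_sets_subset) (auto simp: subalgebra_def intro!: measurable_sets[OF jump_measurable])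
  then show ?thesis by (simp add: subalgebra_def)
qed

lemma subalgebra_past_next_past: "subalgebra (past_next S j) (past S j)"
  by (auto simp: subalgebra_def sets_past_next)

lemma measurable_jump_past_next: "jump S (Suc j) \<in> borel_measurable (past_next S j)"
  unfolding measurable_def by (auto simp: sets_past_next intro!: sigma_sets.Basic)

text \<open>The mode as seen through the jumps up to index \<open>k\<close> only. Before the next
  jump it equals \<open>mode S s\<close> (\<open>mode_eq_current_mark\<close>), so events of the
  mode process become events of \<open>past S k\<close>; with \<open>k = max_jumps S\<close> it also
  gives measurability of the mode itself.\<close>

lemma measurable_current_mark:
  assumes "k \<le> max_jumps S" "0 \<le> s"
  shows "(\<lambda>\<omega>. mark S (Max {i. i \<le> k \<and> jump S i \<omega> \<le> ereal s}) \<omega>) \<in> borel_measurable (past S k)"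
proof -
  \<comment> \<open>Clipping the index at \<open>k\<close> gives a family that is measurable for
    \<open>past S k\<close> at every \<open>i\<close>, as the composition over a countable index
    requires. The maximum never exceeds \<open>k\<close>, so the clipping changes nothing.\<close>
  have [measurable]: "jump S (min i k) \<in> borel_measurable (past S k)"
    "mark S (min i k) \<in> borel_measurable (past S k)" for i
    using measurable_jump_past measurable_mark_past by auto
  have "(\<lambda>\<omega>. Max {i. i \<le> k \<and> jump S (min i k) \<omega> \<le> ereal s}) \<in> past S k \<rightarrow>\<^sub>M count_space UNIV"
    by measurable
  then have "(\<lambda>\<omega>. mark S (min (Max {i. i \<le> k \<and> jump S (min i k) \<omega> \<le> ereal s}) k) \<omega>)
      \<in> borel_measurable (past S k)"
    by (rule measurable_compose_countable[rotated]) simp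
  moreover have "mark S (min (Max {i. i \<le> k \<and> jump S (min i k) \<omega> \<le> ereal s}) k) \<omega>
      = mark S (Max {i. i \<le> k \<and> jump S i \<omega> \<le> ereal s}) \<omega>" if "\<omega> \<in> space (past S k)" for \<omega>
  proof -
    have eq: "{i. i \<le> k \<and> jump S (min i k) \<omega> \<le> ereal s} = {i. i \<le> k \<and> jump S i \<omega> \<le> ereal s}"
      by (auto simp: min_def)
    have "Max {i. i \<le> k \<and> jump S i \<omega> \<le> ereal s} \<in> {i. i \<le> k \<and> jump S i \<omega> \<le> ereal s}"
      using jump_0[of \<omega>] that assms by (intro Max_in) auto
    then show ?thesis unfolding eq by (simp add: min_def)
  qed
  ultimately show ?thesis by (subst (asm) measurable_cong) auto
qed

lemma mode_eq_current_mark: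
  assumes "k \<le> max_jumps S" "\<omega> \<in> space (Prb S)" "k < max_jumps S \<Longrightarrow> ereal s < jump S (Suc k) \<omega>"
  shows "mode S s \<omega> = mark S (Max {i. i \<le> k \<and> jump S i \<omega> \<le> ereal s}) \<omega>"
proof -
  have "i \<le> k" if "i \<le> max_jumps S" "jump S i \<omega> \<le> ereal s" for i
  proof (rule ccontr)
    assume "\<not> i \<le> k"
    then have "jump S (Suc k) \<omega> \<le> jump S i \<omega>" "k < max_jumps S"
      using that assms(2) by (auto intro!: jump_mono)
    with assms(3) that(2) show False by (auto dest: order_trans simp: not_less[symmetric])
  qed
  then have "{i. i \<le> max_jumps S \<and> jump S i \<omega> \<le> ereal s} = {i. i \<le> k \<and> jump S i \<omega> \<le> ereal s}"
    using assms(1) by auto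
  then show ?thesis by (simp add: mode_def)
qed

lemma measurable_mode: "0 \<le> s \<Longrightarrow> mode S s \<in> borel_measurable (Prb S)"
  using measurable_from_subalg[OF subalgebra_past measurable_current_mark[of "max_jumps S" s]]
  by (subst measurable_cong[OF mode_eq_current_mark]) auto

lemma subalgebra_filt: "subalgebra (Prb S) (filt S r)"
proof -
  have "sets (filt S r) \<subseteq> sets (Prb S)"
    unfolding sets_filt
    by (intro sets.sigma_sets_subset) (auto intro!: measurable_sets[OF measurable_mode])
  then show ?thesis by (simp add: subalgebra_def)
qed

lemma filt_mono: "r \<le> s \<Longrightarrow> sets (filt S r) \<subseteq> sets (filt S s)"
  unfolding sets_filt by (intro sigma_sets_mono') fastforce

text \<open>The first jump time is strictly positive, so the mode at time 0 is the constant
  \<open>mode0 S\<close> and every generator is empty or full; this alternative is stable under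
  complements and countable unions.\<close>

lemma filt_0_trivial:
  assumes "G \<in> sets (filt S 0)"
  shows "G = {} \<or> G = space (Prb S)"
proof -
  have m: "mode S 0 \<omega> = mode0 S" if "\<omega> \<in> space (Prb S)" for \<omega>
  proof -
    have "mode S 0 \<omega> = mark S (Max {i. i \<le> 0 \<and> jump S i \<omega> \<le> ereal 0}) \<omega>"
      using that jump_pos[of 1 \<omega>] max_jumps_gt_1
      by (intro mode_eq_current_mark) (auto simp: zero_ereal_def)
    also have "{i. i \<le> 0 \<and> jump S i \<omega> \<le> ereal 0} = {0}" using jump_0[OF that] by auto
    finally show ?thesis using mark_0[OF that] by simp
  qed
  have "G \<in> sigma_sets (space (Prb S)) {mode S s -` D \<inter> space (Prb S) | s D. s \<in> {0..0} \<and> D \<in> sets borel}"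
    using assms by (simp add: sets_filt)
  then show ?thesis
  proof induction
    case (Union a)
    show ?case
    proof (cases "\<exists>i. a i = space (Prb S)")
      case True
      then show ?thesis using Union(2) by auto
    next
      case False
      then have "a i = {}" for i using Union(2) by blast
      then show ?thesis by auto
    qed
  next
    case (Basic a)
    then obtain D where "a = mode S 0 -` D \<inter> space (Prb S)" by auto
    then show ?case using m by (cases "mode0 S \<in> D") auto
  qed auto
qed

text \<open>Before the next jump, all information about the mode process is already in the past of the last one.\<close>

lemma filt_eq_past_before_jump:
  assumes j: "j < max_jumps S" and "G \<in> sets (filt S r)"
  shows "\<exists>H\<in>sets (past S j). \<forall>\<omega>. ereal r < jump S (Suc j) \<omega> \<longrightarrow> (\<omega> \<in> G \<longleftrightarrow> \<omega> \<in> H)"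
proof -
  have "G \<in> sigma_sets (space (Prb S)) {mode S s -` D \<inter> space (Prb S) | s D. s \<in> {0..r} \<and> D \<in> sets borel}"
    using assms by (simp add: sets_filt)
  then show ?thesis
  proof induction
    case (Basic a)
    then obtain s D where *: "a = mode S s -` D \<inter> space (Prb S)" "0 \<le> s" "s \<le> r" "D \<in> sets borel" by auto
    let ?m = "\<lambda>\<omega>. mark S (Max {i. i \<le> j \<and> jump S i \<omega> \<le> ereal s}) \<omega>"
    have "?m -` D \<inter> space (past S j) \<in> sets (past S j)"
      using j * by (intro measurable_sets[OF measurable_current_mark]) auto
    moreover have "\<omega> \<in> a \<longleftrightarrow> \<omega> \<in> ?m -` D \<inter> space (past S j)" if "ereal r < jump S (Suc j) \<omega>" for \<omega>
    proof -
      have "ereal s < jump S (Suc j) \<omega>" using that *(3) by (metis ereal_less_eq(3) le_less_trans)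
      then show ?thesis using mode_eq_current_mark[of j \<omega> s] j *(1) by auto
    qed
    ultimately show ?case by blast
  next
    case Empty
    then show ?case by (auto intro!: bexI[of _ "{}"])
  next
    case (Compl a)
    then obtain H where "H \<in> sets (past S j)" "\<forall>\<omega>. ereal r < jump S (Suc j) \<omega> \<longrightarrow> (\<omega> \<in> a \<longleftrightarrow> \<omega> \<in> H)" by auto
    then show ?case by (intro bexI[of _ "space (past S j) - H"] sets.compl_sets) auto
  next
    case (Union a)
    then obtain H where "\<And>i. H i \<in> sets (past S j)"
      "\<And>i. \<forall>\<omega>. ereal r < jump S (Suc j) \<omega> \<longrightarrow> (\<omega> \<in> a i \<longleftrightarrow> \<omega> \<in> H i)" by metis
    then show ?case by (intro bexI[of _ "\<Union>i. H i"]) auto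
  qed
qed

text \<open>
  Times are truncated at \<open>0\<close>, below which \<open>rate\<close> and \<open>trans_law\<close> are unspecified. As \<open>'e\<close> need not be
  separable, joint continuity does not give measurability for the product \<open>\<sigma>\<close>-field; the time
  variable is discretised instead.
\<close>

lemma measurable_rate: "(\<lambda>(\<gamma>, v). rate S \<gamma> (max 0 v)) \<in> borel_measurable (borel \<Otimes>\<^sub>M borel)"
proof -
  have cont: "continuous_on UNIV (\<lambda>\<gamma>. rate S \<gamma> (max 0 v))" "continuous_on UNIV (\<lambda>v. rate S \<gamma> (max 0 v))" for \<gamma> v
    by (rule continuous_on_compose2[OF rate_continuous, where f="\<lambda>\<gamma>. (\<gamma>, max 0 v)", simplified]
        continuous_on_compose2[OF rate_continuous, where f="\<lambda>v. (\<gamma>, max 0 v)", simplified],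
        auto intro!: continuous_intros)+
  define g where "g n p = rate S (fst p) (max 0 (real_of_int \<lfloor>real (Suc n) * snd p\<rfloor> / real (Suc n)))" for n and p :: "'e \<times> real"
  have "g n \<in> borel_measurable (borel \<Otimes>\<^sub>M borel)" for n
  proof -
    have 1: "(\<lambda>p::'e \<times> real. rate S (fst p) (max 0 (real_of_int i / real (Suc n)))) \<in> borel_measurable (borel \<Otimes>\<^sub>M borel)" for i
      using borel_measurable_continuous_onI[OF cont(1)] by measurable
    show ?thesis unfolding g_def[abs_def]
      by (rule measurable_compose_countable[OF 1]) measurable
  qed
  moreover have "(\<lambda>n. g n p) \<longlonglongrightarrow> (case p of (\<gamma>, v) \<Rightarrow> rate S \<gamma> (max 0 v))" for p
  proof -
    obtain \<gamma> v where p: "p = (\<gamma>, v)" by (cases p)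
    have "(\<lambda>n. real_of_int \<lfloor>real (Suc n) * v\<rfloor> / real (Suc n)) \<longlonglongrightarrow> v"
    proof (rule real_tendsto_sandwich[OF _ _ _ tendsto_const])
      show "\<forall>\<^sub>F n in sequentially. v - 1 / real (Suc n) \<le> real_of_int \<lfloor>real (Suc n) * v\<rfloor> / real (Suc n)"
      proof (intro always_eventually allI)
        fix n
        have "v - 1 / real (Suc n) = (real (Suc n) * v - 1) / real (Suc n)" by (simp add: field_simps)
        also have "\<dots> \<le> real_of_int \<lfloor>real (Suc n) * v\<rfloor> / real (Suc n)"
          by (intro divide_right_mono) linarith+
        finally show "v - 1 / real (Suc n) \<le> real_of_int \<lfloor>real (Suc n) * v\<rfloor> / real (Suc n)" .
      qed
      show "\<forall>\<^sub>F n in sequentially. real_of_int \<lfloor>real (Suc n) * v\<rfloor> / real (Suc n) \<le> v"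
        by (intro always_eventually allI) (simp add: field_simps)
      show "(\<lambda>n. v - 1 / real (Suc n)) \<longlonglongrightarrow> v"
        using tendsto_diff[OF tendsto_const LIMSEQ_inverse_real_of_nat, of v] by (simp add: inverse_eq_divide)
    qed
    then show ?thesis unfolding g_def p using cont(2)[of \<gamma>]
      by (auto intro!: continuous_on_tendsto_compose[OF cont(2)[of \<gamma>]])
  qed
  ultimately show ?thesis by (rule borel_measurable_LIMSEQ_real[rotated])
qed

lemma measurable_trans_law: "(\<lambda>(\<gamma>, v). trans_law S \<gamma> (max 0 v)) \<in> borel \<Otimes>\<^sub>M borel \<rightarrow>\<^sub>M prob_algebra borel"
proof -
  have "(\<lambda>p. (fst p, max 0 (snd p))) \<in> (borel \<Otimes>\<^sub>M borel :: ('e \<times> real) measure) \<rightarrow>\<^sub>M borel \<Otimes>\<^sub>M restrict_space borel {0..}"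
    by (intro measurable_Pair measurable_restrict_space2) auto
  from measurable_compose[OF this trans_kernel] show ?thesis by (simp add: case_prod_beta)
qed

lemma rate_cont: "continuous_on UNIV (\<lambda>v. rate S \<gamma> (max 0 v))"
  by (rule continuous_on_compose2[OF rate_continuous, where f="\<lambda>v. (\<gamma>, max 0 v)", simplified])
    (auto intro!: continuous_intros)

lemma prob_space_trans_law: "0 \<le> v \<Longrightarrow> prob_space (trans_law S \<gamma> v)"
  and sets_trans_law: "0 \<le> v \<Longrightarrow> sets (trans_law S \<gamma> v) = sets borel"
  using measurable_space[OF measurable_trans_law, of "(\<gamma>, v)"] by (auto simp: space_prob_algebra space_pair_measure)

end

section \<open>The compensator formula\<close>

text \<open>The density of a waiting time is hazard times survival, and a primitive of it is minus
  the survival function.\<close>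

lemma nn_integral_hazard_survival:
  fixes g :: "real \<Rightarrow> real"
  assumes g: "continuous_on UNIV g" "\<And>v. 0 \<le> g v" and b: "0 \<le> b"
  shows "(\<integral>\<^sup>+v. ennreal (g v * exp (- (LINT r:{0..v}|lborel. g r))) * indicator {0..b} v \<partial>lborel)
    = ennreal (1 - exp (- (LINT r:{0..b}|lborel. g r)))"
proof -
  \<comment> \<open>The primitive starts at -1 so that 0 is an interior point and the derivative
    there is two-sided. Only the differences \<open>G v - G 0\<close> enter.\<close>
  define G where "G v = integral {-1..v} g" for v
  have int: "g integrable_on {u..v}" for u v
    by (rule integrable_continuous_interval) (rule continuous_on_subset[OF g(1)], simp)
  have L: "(LINT r:{0..v}|lborel. g r) = G v - G 0" if "0 \<le> v" for v
  proof -
    have "(LINT r:{0..v}|lborel. g r) = integral {0..v} g"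
      by (intro set_borel_integral_eq_integral borel_integrable_atLeastAtMost' continuous_on_subset[OF g(1)]) simp
    also have "\<dots> = G v - G 0"
      using Henstock_Kurzweil_Integration.integral_combine[of "-1" 0 v g, OF _ that int] unfolding G_def by simp
    finally show ?thesis .
  qed
  have DG: "(G has_real_derivative g x) (at x)" if "0 \<le> x" for x
  proof -
    have "(G has_real_derivative g x) (at x within {-1..x + 1})"
      unfolding G_def using that by (intro integral_has_real_derivative continuous_on_subset[OF g(1)]) auto
    then show ?thesis using that by (subst (asm) at_within_interior) auto
  qed
  have [measurable]: "g \<in> borel_measurable borel"
    by (rule borel_measurable_continuous_onI[OF g(1)])
  have "continuous_on {x. 0 \<le> x} G"
    by (intro continuous_at_imp_continuous_on ballI DERIV_isCont[OF DG]) auto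
  \<comment> \<open>Continuity of \<open>G\<close> is at hand on the half-line only; the truncated
    version is measurable on the whole line and agrees with \<open>G\<close> on
    \<open>{0..b}\<close>.\<close>
  then have "continuous_on UNIV (\<lambda>v. G (max 0 v))"
    by (rule continuous_on_compose2) (auto intro!: continuous_intros)
  then have [measurable]: "(\<lambda>v. G (max 0 v)) \<in> borel_measurable borel"
    by (rule borel_measurable_continuous_onI)
  have "(\<integral>\<^sup>+v. ennreal (g v * exp (- (LINT r:{0..v}|lborel. g r))) * indicator {0..b} v \<partial>lborel)
      = (\<integral>\<^sup>+v. ennreal (g v * exp (G 0 - G (max 0 v))) * indicator {0..b} v \<partial>lborel)"
    by (intro nn_integral_cong) (auto simp: L split: split_indicator)
  also have "\<dots> = ennreal ((- exp (G 0 - G b)) - (- exp (G 0 - G 0)))"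
  proof (rule nn_integral_FTC_Icc)
    show "DERIV (\<lambda>v. - exp (G 0 - G v)) x :> g x * exp (G 0 - G (max 0 x))" if "x \<in> {0..b}" for x
      using that by (auto intro!: derivative_eq_intros DG)
  qed (use g b in auto)
  finally show ?thesis using L[OF b] by simp
qed

text \<open>An infinite jump time is sent to 0 by \<open>real_of_ereal\<close>, so the laws below
  carry an indicator of finite jump times.\<close>

definition rjump :: "('w, 'e::metric_space, 'n::finite, 'd::finite) switch_system \<Rightarrow> nat \<Rightarrow> 'w \<Rightarrow> real" where
  "rjump S j \<omega> = real_of_ereal (jump S j \<omega>)"

text \<open>The clock restarts at the \<open>j\<close>-th jump: \<open>v\<close> is the time elapsed
  since then, as in \<open>jump_law\<close>. With the truncation the hazard is nonnegative and
  continuous on the whole line.\<close>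

definition hazard :: "('w, 'e::metric_space, 'n::finite, 'd::finite) switch_system \<Rightarrow> nat \<Rightarrow> 'w \<Rightarrow> real \<Rightarrow> real" where
  "hazard S j \<omega> v = rate S (mark S j \<omega>) (max 0 (rjump S j \<omega> + v))"

section \<open>The laws of the next jump time and of the next mark\<close>

context mode_process
begin

lemma measurable_rjump_past: "i \<le> j \<Longrightarrow> rjump S i \<in> borel_measurable (past S j)"
  unfolding rjump_def using measurable_jump_past[of i j] by measurable

lemma measurable_hazard: "(\<lambda>(\<omega>, v). hazard S j \<omega> v) \<in> borel_measurable (past S j \<Otimes>\<^sub>M borel)"
proof -
  have [measurable]: "rjump S j \<in> borel_measurable (past S j)" "mark S j \<in> borel_measurable (past S j)"
    using measurable_rjump_past measurable_mark_past by auto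
  have "(\<lambda>p. (mark S j (fst p), rjump S j (fst p) + snd p)) \<in> past S j \<Otimes>\<^sub>M borel \<rightarrow>\<^sub>M borel \<Otimes>\<^sub>M borel"
    by measurable
  from measurable_compose[OF this measurable_rate] show ?thesis
    by (simp add: hazard_def case_prod_beta)
qed

lemma hazard_nonneg: "0 \<le> hazard S j \<omega> v"
  by (simp add: hazard_def rate_nonneg)

lemma hazard_cont: "continuous_on UNIV (hazard S j \<omega>)"
  unfolding hazard_def
  by (rule continuous_on_compose2[OF rate_cont[of "mark S j \<omega>"], of UNIV "\<lambda>v. rjump S j \<omega> + v", simplified])
    (auto intro!: continuous_intros)

lemma hazard_bounded: "\<exists>K. \<forall>j \<omega> v. hazard S j \<omega> v \<le> K"
  using rate_bounded unfolding hazard_def by (meson max.cobounded1)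

lemma ereal_rjump: "j \<le> max_jumps S \<Longrightarrow> \<omega> \<in> space (Prb S) \<Longrightarrow> jump S j \<omega> < \<infinity> \<Longrightarrow> jump S j \<omega> = ereal (rjump S j \<omega>)"
  using jump_real by (simp add: rjump_def)

lemma rjump_nonneg: "j \<le> max_jumps S \<Longrightarrow> \<omega> \<in> space (Prb S) \<Longrightarrow> 0 \<le> rjump S j \<omega>"
  using jump_nonneg by (simp add: rjump_def real_of_ereal_pos)

lemma measurable_hazard_integral:
  "(\<lambda>\<omega>. LINT r:{0..b}|lborel. hazard S j \<omega> r) \<in> borel_measurable (past S j)"
  "(\<lambda>p. LINT r:{0..snd p}|lborel. hazard S j (fst p) r) \<in> borel_measurable (past S j \<Otimes>\<^sub>M borel)"
proof -
  have [measurable]: "(\<lambda>p. hazard S j (fst p) (snd p)) \<in> borel_measurable (past S j \<Otimes>\<^sub>M borel)"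
    using measurable_hazard[of j] by (simp add: case_prod_beta)
  show "(\<lambda>\<omega>. LINT r:{0..b}|lborel. hazard S j \<omega> r) \<in> borel_measurable (past S j)"
    unfolding set_lebesgue_integral_def
  proof (rule lborel.borel_measurable_lebesgue_integral)
    show "(\<lambda>(\<omega>, r). indicator {0..b} r *\<^sub>R hazard S j \<omega> r) \<in> borel_measurable (past S j \<Otimes>\<^sub>M lborel)"
      using measurable_hazard[of j] by (auto simp: case_prod_beta)
  qed
  have "(\<lambda>q. hazard S j (fst (fst q)) (snd q)) \<in> borel_measurable ((past S j \<Otimes>\<^sub>M borel) \<Otimes>\<^sub>M borel)"
    by (rule measurable_compose[of "\<lambda>q. (fst (fst q), snd q)" _ "past S j \<Otimes>\<^sub>M borel" "\<lambda>p. hazard S j (fst p) (snd p)", simplified])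
      measurable
  then have "(\<lambda>q. indicator {q. 0 \<le> snd q \<and> snd q \<le> snd (fst q)} q *\<^sub>R hazard S j (fst (fst q)) (snd q)) \<in> borel_measurable ((past S j \<Otimes>\<^sub>M borel) \<Otimes>\<^sub>M lborel)"
    by measurable
  then show "(\<lambda>p. LINT r:{0..snd p}|lborel. hazard S j (fst p) r) \<in> borel_measurable (past S j \<Otimes>\<^sub>M borel)"
    unfolding set_lebesgue_integral_def
    by (intro lborel.borel_measurable_lebesgue_integral) (auto simp: case_prod_beta indicator_def)
qed

text \<open>\<open>jump_law\<close> tested against a bounded weight known at the \<open>j\<close>-th
  jump, by the defining property of the conditional expectation. The weight is general because it is
  applied both to the indicator of an event and to its product with the hazard at a fixed
  time.\<close>

lemma survival_law:
  assumes j: "j < max_jumps S" and b: "0 \<le> b" and W[measurable]: "W \<in> borel_measurable (past S j)"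
    and K: "\<And>\<omega>. 0 \<le> W \<omega>" "\<And>\<omega>. W \<omega> \<le> K"
  shows "(\<integral>\<^sup>+\<omega>. ennreal (W \<omega>) * indicator {\<omega>. jump S j \<omega> < \<infinity> \<and> jump S j \<omega> + ereal b \<le> jump S (Suc j) \<omega>} \<omega> \<partial>Prb S)
    = (\<integral>\<^sup>+\<omega>. ennreal (W \<omega> * exp (- (LINT r:{0..b}|lborel. hazard S j \<omega> r))) * indicator {\<omega>. jump S j \<omega> < \<infinity>} \<omega> \<partial>Prb S)"
proof -
  have sub: "subalgebra (Prb S) (past S j)" using subalgebra_past j by simp
  interpret sub: finite_measure_subalgebra "Prb S" "past S j"
    by unfold_locales (rule sub)
  define B where "B = {\<omega> \<in> space (Prb S). jump S j \<omega> + ereal b \<le> jump S (Suc j) \<omega>}"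
  have [measurable]: "jump S j \<in> borel_measurable (Prb S)" "jump S (Suc j) \<in> borel_measurable (Prb S)"
    using j by (auto intro: jump_measurable)
  have [measurable]: "jump S j \<in> borel_measurable (past S j)" by (rule measurable_jump_past) simp
  have W_P[measurable]: "W \<in> borel_measurable (Prb S)" by (rule measurable_from_subalg[OF sub W])
  have L[measurable]: "(\<lambda>\<omega>. LINT r:{0..b}|lborel. hazard S j \<omega> r) \<in> borel_measurable (Prb S)"
    by (rule measurable_from_subalg[OF sub measurable_hazard_integral(1)])
  have B[measurable]: "B \<in> sets (Prb S)" unfolding B_def by measurable
  \<comment> \<open>\<open>jump_law\<close> says nothing where the \<open>j\<close>-th jump is
    infinite; the cut-off weight vanishes there.\<close>
  define W' where "W' \<omega> = W \<omega> * indicator {\<omega> \<in> space (past S j). jump S j \<omega> < \<infinity>} \<omega>" for \<omega>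
  have W'[measurable]: "W' \<in> borel_measurable (past S j)" unfolding W'_def by measurable
  have W'_P[measurable]: "W' \<in> borel_measurable (Prb S)" by (rule measurable_from_subalg[OF sub W'])
  have W'_K: "0 \<le> W' \<omega>" "W' \<omega> \<le> K" for \<omega>
    using K[of \<omega>] by (auto simp: W'_def indicator_def)
  have E1: "exp (- (LINT r:{0..b}|lborel. hazard S j \<omega> r)) \<le> 1" for \<omega>
    by (auto simp: set_lebesgue_integral_def hazard_nonneg intro!: integral_nonneg_AE)
  have i1: "integrable (Prb S) (\<lambda>\<omega>. W' \<omega> * indicator B \<omega>)"
    by (rule integrable_const_bound[where B=K]) (use W'_K in \<open>auto simp: indicator_def intro: order_trans[OF W'_K]\<close>)
  have i2: "integrable (Prb S) (\<lambda>\<omega>. W' \<omega> * exp (- (LINT r:{0..b}|lborel. hazard S j \<omega> r)))"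
    by (rule integrable_const_bound[where B=K])
      (use W'_K E1 in \<open>auto simp: abs_mult intro!: order_trans[OF mult_left_le W'_K(2)]\<close>)
  have "(\<integral>\<omega>. W' \<omega> * indicator B \<omega> \<partial>Prb S) = (\<integral>\<omega>. W' \<omega> * real_cond_exp (Prb S) (past S j) (indicator B) \<omega> \<partial>Prb S)"
    by (rule sub.real_cond_exp_intg(2)[symmetric, OF i1]) simp_all
  also have "\<dots> = (\<integral>\<omega>. W' \<omega> * exp (- (LINT r:{0..b}|lborel. hazard S j \<omega> r)) \<partial>Prb S)"
  proof (rule integral_cong_AE)
    show "AE \<omega> in Prb S. W' \<omega> * real_cond_exp (Prb S) (past S j) (indicator B) \<omega>
        = W' \<omega> * exp (- (LINT r:{0..b}|lborel. hazard S j \<omega> r))"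
      using jump_law[OF j b] AE_space
    proof eventually_elim
      case (elim \<omega>)
      have "(LINT r:{0..b}|lborel. hazard S j \<omega> r) = (LINT r:{0..b}|lborel. rate S (mark S j \<omega>) (real_of_ereal (jump S j \<omega>) + r))"
        using rjump_nonneg[of j \<omega>] j elim
        by (intro set_lebesgue_integral_cong) (auto simp: hazard_def rjump_def)
      then show ?case using elim by (auto simp: W'_def B_def)
    qed
  qed simp_all
  finally have "ennreal (\<integral>\<omega>. W' \<omega> * indicator B \<omega> \<partial>Prb S) = ennreal (\<integral>\<omega>. W' \<omega> * exp (- (LINT r:{0..b}|lborel. hazard S j \<omega> r)) \<partial>Prb S)"
    by simp
  then have "(\<integral>\<^sup>+\<omega>. ennreal (W' \<omega> * indicator B \<omega>) \<partial>Prb S) = (\<integral>\<^sup>+\<omega>. ennreal (W' \<omega> * exp (- (LINT r:{0..b}|lborel. hazard S j \<omega> r))) \<partial>Prb S)"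
    using W'_K nn_integral_eq_integral[OF i1] nn_integral_eq_integral[OF i2] by simp
  moreover have "(\<integral>\<^sup>+\<omega>. ennreal (W' \<omega> * indicator B \<omega>) \<partial>Prb S) = (\<integral>\<^sup>+\<omega>. ennreal (W \<omega>) * indicator {\<omega>. jump S j \<omega> < \<infinity> \<and> jump S j \<omega> + ereal b \<le> jump S (Suc j) \<omega>} \<omega> \<partial>Prb S)"
    by (intro nn_integral_cong) (auto simp: W'_def B_def indicator_def)
  moreover have "(\<integral>\<^sup>+\<omega>. ennreal (W' \<omega> * exp (- (LINT r:{0..b}|lborel. hazard S j \<omega> r))) \<partial>Prb S)
    = (\<integral>\<^sup>+\<omega>. ennreal (W \<omega> * exp (- (LINT r:{0..b}|lborel. hazard S j \<omega> r))) * indicator {\<omega>. jump S j \<omega> < \<infinity>} \<omega> \<partial>Prb S)"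
    by (intro nn_integral_cong) (auto simp: W'_def indicator_def)
  ultimately show ?thesis by simp
qed

text \<open>Both sides are integrals of \<open>h\<close> against measures on the past times the
  elapsed time, so it suffices to compare these on sets \<open>H \<times> {..<b}\<close>. For
  \<open>b \<le> 0\<close> both vanish. For \<open>b > 0\<close> each of them, increased by the mass
  of waiting at least \<open>b\<close>, gives the mass of \<open>H\<close> with a finite
  \<open>j\<close>-th jump.\<close>

lemma next_jump_law:
  assumes j: "j < max_jumps S" and h: "h \<in> borel_measurable (past S j \<Otimes>\<^sub>M borel)"
  shows "(\<integral>\<^sup>+\<omega>. indicator {\<omega>. jump S (Suc j) \<omega> < \<infinity>} \<omega> * h (\<omega>, rjump S (Suc j) \<omega> - rjump S j \<omega>) \<partial>Prb S)
    = (\<integral>\<^sup>+\<omega>. \<integral>\<^sup>+v. indicator {v. jump S j \<omega> < \<infinity> \<and> 0 \<le> v \<and> jump S j \<omega> + ereal v \<le> jump S (Suc j) \<omega>} v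
         * ennreal (hazard S j \<omega> v) * h (\<omega>, v) \<partial>lborel \<partial>Prb S)"
proof -
  let ?N = "past S j \<Otimes>\<^sub>M borel :: ('w \<times> real) measure"
  have sub: "subalgebra (Prb S) (past S j)" using subalgebra_past j by simp
  have [measurable]: "jump S j \<in> borel_measurable (Prb S)" "jump S (Suc j) \<in> borel_measurable (Prb S)"
    using j by (auto intro: jump_measurable)
  have [measurable]: "rjump S j \<in> borel_measurable (Prb S)" "rjump S (Suc j) \<in> borel_measurable (Prb S)"
    unfolding rjump_def[abs_def] by measurable
  have id1: "(\<lambda>\<omega>. \<omega>) \<in> Prb S \<rightarrow>\<^sub>M past S j" by (rule measurable_from_subalg[OF sub]) simp
  have id2: "(\<lambda>p. p) \<in> Prb S \<Otimes>\<^sub>M lborel \<rightarrow>\<^sub>M ?N"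
  proof -
    have "(\<lambda>p. (fst p, snd p)) \<in> Prb S \<Otimes>\<^sub>M lborel \<rightarrow>\<^sub>M ?N"
      by (intro measurable_Pair measurable_compose[OF measurable_fst id1]) simp
    then show ?thesis by simp
  qed
  have [measurable]: "(\<lambda>p. hazard S j (fst p) (snd p)) \<in> borel_measurable (Prb S \<Otimes>\<^sub>M lborel)"
    using measurable_compose[OF id2 measurable_hazard] by (simp add: case_prod_beta)
  have [measurable]: "(\<lambda>p. LINT r:{0..snd p}|lborel. hazard S j (fst p) r) \<in> borel_measurable (Prb S \<Otimes>\<^sub>M lborel)"
    using measurable_compose[OF id2 measurable_hazard_integral(2)] by simp
  define w where "w p = indicator {p. jump S j (fst p) < \<infinity> \<and> 0 \<le> snd p \<and> jump S j (fst p) + ereal (snd p) \<le> jump S (Suc j) (fst p)} p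
      * ennreal (hazard S j (fst p) (snd p))" for p
  have w[measurable]: "w \<in> borel_measurable (Prb S \<Otimes>\<^sub>M lborel)" unfolding w_def[abs_def] by measurable
  \<comment> \<open>\<open>M1\<close> is the joint law of the past and the waiting time,
    \<open>M3\<close> its compensated counterpart: the density \<open>w\<close> is the hazard at the
    elapsed times that the next jump does not precede.\<close>
  define M1 where "M1 = distr (density (Prb S) (indicator {\<omega>\<in>space (Prb S). jump S (Suc j) \<omega> < \<infinity>})) ?N (\<lambda>\<omega>. (\<omega>, rjump S (Suc j) \<omega> - rjump S j \<omega>))"
  define M3 where "M3 = distr (density (Prb S \<Otimes>\<^sub>M lborel) w) ?N (\<lambda>p. p)"
  have m1: "(\<lambda>\<omega>. (\<omega>, rjump S (Suc j) \<omega> - rjump S j \<omega>)) \<in> Prb S \<rightarrow>\<^sub>M ?N"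
    by (intro measurable_Pair id1) measurable
  have I1: "(\<integral>\<^sup>+p. h p \<partial>M1) = (\<integral>\<^sup>+\<omega>. indicator {\<omega>. jump S (Suc j) \<omega> < \<infinity>} \<omega> * h (\<omega>, rjump S (Suc j) \<omega> - rjump S j \<omega>) \<partial>Prb S)"
    if h: "h \<in> borel_measurable ?N" for h
    unfolding M1_def using measurable_compose[OF m1 h] m1 h
    by (subst nn_integral_distr) (auto simp: nn_integral_density intro!: nn_integral_cong split: split_indicator)
  have I3: "(\<integral>\<^sup>+p. h p \<partial>M3) = (\<integral>\<^sup>+\<omega>. \<integral>\<^sup>+v. w (\<omega>, v) * h (\<omega>, v) \<partial>lborel \<partial>Prb S)"
    if h: "h \<in> borel_measurable ?N" for h
    unfolding M3_def using measurable_compose[OF id2 h] id2 h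
    by (subst nn_integral_distr) (auto simp: nn_integral_density lborel.nn_integral_fst[symmetric])
  \<comment> \<open>Half-lines open at \<open>b\<close> are the complements of the events in
    \<open>jump_law\<close>, which use a weak inequality.\<close>
  have sN: "sets ?N = sigma_sets (space (Prb S) \<times> UNIV) {H \<times> {..<b} | H b. H \<in> sets (past S j)}"
  proof -
    have "sets ?N = sets (sigma (space (past S j) \<times> space borel) {a \<times> b | a b. a \<in> sets (past S j) \<and> b \<in> range (lessThan :: real \<Rightarrow> _)})"
    proof (rule sets_pair_eq)
      show "sets (borel :: real measure) = sigma_sets (space borel) (range lessThan)"
        by (subst borel_Iio) auto
      show "sets (past S j) = sigma_sets (space (past S j)) (sets (past S j))" by (rule sets.sigma_sets_eq[symmetric])
      show "countable {space (past S j)}" "{space (past S j)} \<subseteq> sets (past S j)" "\<Union>{space (past S j)} = space (past S j)"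
        using sets.top[of "past S j"] by auto
      show "countable (range (\<lambda>n. {..<real n}))" "range (\<lambda>n. {..<real n}) \<subseteq> range (lessThan :: real \<Rightarrow> _)" by auto
      show "\<Union> (range (\<lambda>n. {..<real n})) = space borel" by (auto simp: reals_Archimedean2)
    qed (use sets.sets_into_space[of _ "past S j"] in auto)
    also have "{a \<times> b | a b. a \<in> sets (past S j) \<and> b \<in> range (lessThan :: real \<Rightarrow> _)} = {H \<times> {..<b} | H b. H \<in> sets (past S j)}"
      by blast
    also have "sets (sigma (space (past S j) \<times> space borel) {H \<times> {..<b::real} | H b. H \<in> sets (past S j)}) = sigma_sets (space (Prb S) \<times> UNIV) {H \<times> {..<b} | H b. H \<in> sets (past S j)}"
      using sets.sets_into_space[of _ "past S j"] by (subst sets_measure_of) auto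
    finally show ?thesis .
  qed
  have gen: "emeasure M1 (H \<times> {..<b}) = emeasure M3 (H \<times> {..<b})" "emeasure M1 (H \<times> {..<b}) \<noteq> \<infinity>" if H[measurable]: "H \<in> sets (past S j)" for H b
  proof -
    have H_P[measurable]: "H \<in> sets (Prb S)" using sub H by (auto simp: subalgebra_def)
    have HN: "H \<times> {..<b} \<in> sets ?N" by auto
    have e1: "emeasure M1 (H \<times> {..<b}) = (\<integral>\<^sup>+\<omega>. indicator {\<omega>. jump S (Suc j) \<omega> < \<infinity>} \<omega> * indicator (H \<times> {..<b}) (\<omega>, rjump S (Suc j) \<omega> - rjump S j \<omega>) \<partial>Prb S)"
      using I1[of "indicator (H \<times> {..<b})"] HN by (simp add: M1_def)
    have e3: "emeasure M3 (H \<times> {..<b}) = (\<integral>\<^sup>+\<omega>. \<integral>\<^sup>+v. w (\<omega>, v) * indicator (H \<times> {..<b}) (\<omega>, v) \<partial>lborel \<partial>Prb S)"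
      using I3[of "indicator (H \<times> {..<b})"] HN by (simp add: M3_def)
    have "emeasure M1 (H \<times> {..<b}) \<le> (\<integral>\<^sup>+\<omega>. 1 \<partial>Prb S)"
      unfolding e1 by (intro nn_integral_mono) (auto split: split_indicator)
    then have fin: "emeasure M1 (H \<times> {..<b}) < \<infinity>" by (simp add: emeasure_space_1 le_less_trans)
    then show "emeasure M1 (H \<times> {..<b}) \<noteq> \<infinity>" by simp
    show "emeasure M1 (H \<times> {..<b}) = emeasure M3 (H \<times> {..<b})"
    proof (cases "b \<le> 0")
      case True
      have "w (\<omega>, v) * indicator (H \<times> {..<b}) (\<omega>, v) = 0" for \<omega> v
        using True by (auto simp: w_def split: split_indicator)
      then have "emeasure M3 (H \<times> {..<b}) = 0" unfolding e3 by (simp only: nn_integral_const mult_zero_left)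
      moreover have "rjump S j \<omega> \<le> rjump S (Suc j) \<omega>" if "\<omega> \<in> space (Prb S)" "jump S (Suc j) \<omega> < \<infinity>" for \<omega>
        using jump_le_Suc[OF j that(1)] j that ereal_rjump[of j \<omega>] ereal_rjump[of "Suc j" \<omega>]
        by (cases "jump S j \<omega> < \<infinity>") auto
      then have "emeasure M1 (H \<times> {..<b}) = 0"
        unfolding e1 using True by (subst nn_integral_0_iff_AE) (fastforce intro!: AE_I2 split: split_indicator)+
      ultimately show ?thesis by simp
    next
      case False
      let ?F = "indicator {\<omega>. jump S j \<omega> < \<infinity>} :: 'w \<Rightarrow> ennreal"
      let ?L = "\<lambda>v \<omega>. LINT r:{0..v}|lborel. hazard S j \<omega> r"
      \<comment> \<open>The mass of waiting at least \<open>b\<close> on \<open>H\<close>. It is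
        finite, so it can be added to both sides and cancelled at the end.\<close>
      define X where "X = (\<integral>\<^sup>+\<omega>. ennreal (indicator H \<omega>) * indicator {\<omega>. jump S j \<omega> < \<infinity> \<and> jump S j \<omega> + ereal b \<le> jump S (Suc j) \<omega>} \<omega> \<partial>Prb S)"
      have L_nn: "0 \<le> ?L v \<omega>" for v \<omega>
        by (auto simp: set_lebesgue_integral_def hazard_nonneg intro!: integral_nonneg_AE)
      have hL[measurable]: "?L v \<in> borel_measurable (Prb S)" for v
        by (rule measurable_from_subalg[OF sub measurable_hazard_integral(1)])
      have X: "X = (\<integral>\<^sup>+\<omega>. ennreal (indicator H \<omega> * exp (- ?L b \<omega>)) * ?F \<omega> \<partial>Prb S)"
        unfolding X_def using False by (intro survival_law[OF j, where K=1]) (auto simp: indicator_def)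
      have "X \<le> (\<integral>\<^sup>+\<omega>. 1 \<partial>Prb S)"
        unfolding X_def by (intro nn_integral_mono) (auto split: split_indicator)
      then have X_fin: "X < \<infinity>" by (simp add: emeasure_space_1 le_less_trans)
      have "emeasure M1 (H \<times> {..<b}) + X = (\<integral>\<^sup>+\<omega>. indicator H \<omega> * ?F \<omega> \<partial>Prb S)"
        unfolding e1 X_def
      proof (subst nn_integral_add[symmetric])
        show "(\<integral>\<^sup>+\<omega>. indicator {\<omega>. jump S (Suc j) \<omega> < \<infinity>} \<omega> * indicator (H \<times> {..<b}) (\<omega>, rjump S (Suc j) \<omega> - rjump S j \<omega>)
            + ennreal (indicator H \<omega>) * indicator {\<omega>. jump S j \<omega> < \<infinity> \<and> jump S j \<omega> + ereal b \<le> jump S (Suc j) \<omega>} \<omega> \<partial>Prb S)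
          = (\<integral>\<^sup>+\<omega>. indicator H \<omega> * ?F \<omega> \<partial>Prb S)"
        proof (rule nn_integral_cong)
          fix \<omega> assume \<omega>: "\<omega> \<in> space (Prb S)"
          show "indicator {\<omega>. jump S (Suc j) \<omega> < \<infinity>} \<omega> * indicator (H \<times> {..<b}) (\<omega>, rjump S (Suc j) \<omega> - rjump S j \<omega>)
            + ennreal (indicator H \<omega>) * indicator {\<omega>. jump S j \<omega> < \<infinity> \<and> jump S j \<omega> + ereal b \<le> jump S (Suc j) \<omega>} \<omega>
            = indicator H \<omega> * ?F \<omega>"
          proof (cases "jump S j \<omega> < \<infinity>")
            case True
            then obtain x where x: "jump S j \<omega> = ereal x" using ereal_rjump[of j \<omega>] j \<omega> by auto
            show ?thesis
            proof (cases "jump S (Suc j) \<omega> < \<infinity>")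
              case True
              then obtain y where y: "jump S (Suc j) \<omega> = ereal y" using ereal_rjump[of "Suc j" \<omega>] j \<omega> by auto
              show ?thesis using x y by (auto simp: rjump_def split: split_indicator)
            next
              case False
              then show ?thesis using x by (auto split: split_indicator)
            qed
          next
            case False
            then show ?thesis using jump_infinite[OF j \<omega>] by (auto split: split_indicator)
          qed
        qed
      qed (use H in measurable)
      moreover have "emeasure M3 (H \<times> {..<b}) + X = (\<integral>\<^sup>+\<omega>. indicator H \<omega> * ?F \<omega> \<partial>Prb S)"
      proof -
        interpret PL: pair_sigma_finite "Prb S" lborel by unfold_locales
        \<comment> \<open>The interval may be closed at \<open>b\<close> because a point is Lebesgue
          null, and cut at 0 because \<open>w\<close> vanishes at negative times.\<close>
        have "emeasure M3 (H \<times> {..<b}) = (\<integral>\<^sup>+\<omega>. \<integral>\<^sup>+v. w (\<omega>, v) * indicator (H \<times> {0..b}) (\<omega>, v) \<partial>lborel \<partial>Prb S)"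
          unfolding e3
        proof (rule nn_integral_cong, rule nn_integral_cong_AE)
          fix \<omega>
          show "AE v in lborel. w (\<omega>, v) * indicator (H \<times> {..<b}) (\<omega>, v) = w (\<omega>, v) * indicator (H \<times> {0..b}) (\<omega>, v)"
            using AE_lborel_singleton[of b] by eventually_elim (auto simp: w_def split: split_indicator)
        qed
        \<comment> \<open>Time goes outside so that, for fixed \<open>v\<close>,
          \<open>survival_law\<close> replaces the event of no earlier jump by its conditional
          probability. Afterwards time goes inside again and the exponential integral is evaluated
          path by path.\<close>
        also have "\<dots> = (\<integral>\<^sup>+v. \<integral>\<^sup>+\<omega>. w (\<omega>, v) * indicator (H \<times> {0..b}) (\<omega>, v) \<partial>Prb S \<partial>lborel)"
          by (subst PL.Fubini) auto
        also have "\<dots> = (\<integral>\<^sup>+v. indicator {0..b} v * (\<integral>\<^sup>+\<omega>. ennreal (indicator H \<omega> * hazard S j \<omega> v) * indicator {\<omega>. jump S j \<omega> < \<infinity> \<and> jump S j \<omega> + ereal v \<le> jump S (Suc j) \<omega>} \<omega> \<partial>Prb S) \<partial>lborel)"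
          by (intro nn_integral_cong) (auto simp: w_def ennreal_mult' hazard_nonneg split: split_indicator intro!: nn_integral_cong)
        also have "\<dots> = (\<integral>\<^sup>+v. indicator {0..b} v * (\<integral>\<^sup>+\<omega>. ennreal ((indicator H \<omega> * hazard S j \<omega> v) * exp (- ?L v \<omega>)) * ?F \<omega> \<partial>Prb S) \<partial>lborel)"
        proof (intro nn_integral_cong)
          fix v :: real
          obtain K where K: "\<And>j \<omega> v. hazard S j \<omega> v \<le> K" using hazard_bounded by auto
          have "(\<lambda>\<omega>. (\<omega>, v)) \<in> past S j \<rightarrow>\<^sub>M past S j \<Otimes>\<^sub>M borel" by measurable
          from measurable_compose[OF this measurable_hazard]
          have [measurable]: "(\<lambda>\<omega>. hazard S j \<omega> v) \<in> borel_measurable (past S j)" by simp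
          have "0 \<le> K" using order_trans[OF hazard_nonneg K] .
          then have "(\<integral>\<^sup>+\<omega>. ennreal (indicator H \<omega> * hazard S j \<omega> v) * indicator {\<omega>. jump S j \<omega> < \<infinity> \<and> jump S j \<omega> + ereal v \<le> jump S (Suc j) \<omega>} \<omega> \<partial>Prb S)
            = (\<integral>\<^sup>+\<omega>. ennreal ((indicator H \<omega> * hazard S j \<omega> v) * exp (- ?L v \<omega>)) * ?F \<omega> \<partial>Prb S)" if "0 \<le> v"
            using K hazard_nonneg by (intro survival_law[OF j that, where K=K]) (auto simp: indicator_def)
          then show "indicator {0..b} v * (\<integral>\<^sup>+\<omega>. ennreal (indicator H \<omega> * hazard S j \<omega> v) * indicator {\<omega>. jump S j \<omega> < \<infinity> \<and> jump S j \<omega> + ereal v \<le> jump S (Suc j) \<omega>} \<omega> \<partial>Prb S)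
            = indicator {0..b} v * (\<integral>\<^sup>+\<omega>. ennreal ((indicator H \<omega> * hazard S j \<omega> v) * exp (- ?L v \<omega>)) * ?F \<omega> \<partial>Prb S)"
            by (auto split: split_indicator)
        qed
        also have "\<dots> = (\<integral>\<^sup>+v. \<integral>\<^sup>+\<omega>. indicator {0..b} v * (ennreal ((indicator H \<omega> * hazard S j \<omega> v) * exp (- ?L v \<omega>)) * ?F \<omega>) \<partial>Prb S \<partial>lborel)"
          by (intro nn_integral_cong) (auto split: split_indicator)
        also have "\<dots> = (\<integral>\<^sup>+\<omega>. \<integral>\<^sup>+v. indicator {0..b} v * (ennreal ((indicator H \<omega> * hazard S j \<omega> v) * exp (- ?L v \<omega>)) * ?F \<omega>) \<partial>lborel \<partial>Prb S)"
          by (rule PL.Fubini') (simp add: case_prod_beta)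
        also have "\<dots> = (\<integral>\<^sup>+\<omega>. indicator H \<omega> * ?F \<omega> * ennreal (1 - exp (- ?L b \<omega>)) \<partial>Prb S)"
        proof (intro nn_integral_cong)
          fix \<omega>
          have "(\<integral>\<^sup>+v. indicator {0..b} v * (ennreal ((indicator H \<omega> * hazard S j \<omega> v) * exp (- ?L v \<omega>)) * ?F \<omega>) \<partial>lborel)
            = indicator H \<omega> * ?F \<omega> * (\<integral>\<^sup>+v. ennreal (hazard S j \<omega> v * exp (- ?L v \<omega>)) * indicator {0..b} v \<partial>lborel)"
            by (auto split: split_indicator intro!: nn_integral_cong simp: mult.commute)
          also have "(\<integral>\<^sup>+v. ennreal (hazard S j \<omega> v * exp (- ?L v \<omega>)) * indicator {0..b} v \<partial>lborel) = ennreal (1 - exp (- ?L b \<omega>))"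
            using False by (intro nn_integral_hazard_survival hazard_cont hazard_nonneg) auto
          finally show "(\<integral>\<^sup>+v. indicator {0..b} v * (ennreal ((indicator H \<omega> * hazard S j \<omega> v) * exp (- ?L v \<omega>)) * ?F \<omega>) \<partial>lborel)
            = indicator H \<omega> * ?F \<omega> * ennreal (1 - exp (- ?L b \<omega>))" .
        qed
        finally have "emeasure M3 (H \<times> {..<b}) + X = (\<integral>\<^sup>+\<omega>. indicator H \<omega> * ?F \<omega> * ennreal (1 - exp (- ?L b \<omega>)) + ennreal (indicator H \<omega> * exp (- ?L b \<omega>)) * ?F \<omega> \<partial>Prb S)"
          unfolding X by (subst nn_integral_add) (use H in auto)
        \<comment> \<open>The two weights add up to 1: one minus the survival probability from the
          integral, the survival probability itself from \<open>X\<close>.\<close>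
        also have "\<dots> = (\<integral>\<^sup>+\<omega>. indicator H \<omega> * ?F \<omega> \<partial>Prb S)"
          using L_nn by (intro nn_integral_cong) (auto split: split_indicator simp flip: ennreal_plus)
        finally show ?thesis .
      qed
      ultimately show ?thesis using X_fin
        by (metis ennreal_add_left_cancel add.commute infinity_ennreal_def less_irrefl)
    qed
  qed
  have "M1 = M3"
  proof (rule measure_eqI_generator_eq[where E="{H \<times> {..<b::real} | H b. H \<in> sets (past S j)}" and \<Omega>="space (Prb S) \<times> UNIV"
        and A="\<lambda>n. space (Prb S) \<times> {..<real n}"])
    show "Int_stable {H \<times> {..<b::real} | H b. H \<in> sets (past S j)}"
    proof (rule Int_stableI)
      fix a b assume "a \<in> {H \<times> {..<b::real} | H b. H \<in> sets (past S j)}" "b \<in> {H \<times> {..<b::real} | H b. H \<in> sets (past S j)}"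
      then obtain H b1 H' b2 where "a = H \<times> {..<b1}" "b = H' \<times> {..<b2}" "H \<in> sets (past S j)" "H' \<in> sets (past S j)" by auto
      then have "a \<inter> b = (H \<inter> H') \<times> {..<min b1 b2}" "H \<inter> H' \<in> sets (past S j)" by auto
      then show "a \<inter> b \<in> {H \<times> {..<b::real} | H b. H \<in> sets (past S j)}" by blast
    qed
    show "(\<Union>i. space (Prb S) \<times> {..<real i}) = space (Prb S) \<times> UNIV" by (auto simp: reals_Archimedean2)
    show "range (\<lambda>n. space (Prb S) \<times> {..<real n}) \<subseteq> {H \<times> {..<b::real} | H b. H \<in> sets (past S j)}"
      using sets.top[of "past S j"] by auto
    show "{H \<times> {..<b::real} | H b. H \<in> sets (past S j)} \<subseteq> Pow (space (Prb S) \<times> UNIV)"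
    proof safe
      fix H \<omega> and b v :: real assume "H \<in> sets (past S j)" "\<omega> \<in> H"
      then show "\<omega> \<in> space (Prb S)" using sets.sets_into_space[of H "past S j"] by auto
    qed simp
    show "sets M1 = sigma_sets (space (Prb S) \<times> UNIV) {H \<times> {..<b::real} | H b. H \<in> sets (past S j)}"
      "sets M3 = sigma_sets (space (Prb S) \<times> UNIV) {H \<times> {..<b::real} | H b. H \<in> sets (past S j)}"
      by (simp_all add: sN M1_def M3_def)
    show "emeasure M1 (space (Prb S) \<times> {..<real n}) \<noteq> \<infinity>" for n
      using gen(2) sets.top[of "past S j"] by simp
    show "emeasure M1 X = emeasure M3 X" if "X \<in> {H \<times> {..<b::real} | H b. H \<in> sets (past S j)}" for X
      using that gen(1) by auto
  qed
  then show ?thesis using I1[OF h] I3[OF h] by (simp add: w_def indicator_def)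
qed

text \<open>Translation by the last jump time turns elapsed into absolute time and the hazard into
  the rate. The left endpoint becomes excluded, at the cost of a Lebesgue null set; this matches the
  intervals in \<open>q_hat\<close>.\<close>

lemma next_jump_time_law:
  assumes j: "j < max_jumps S" and g[measurable]: "g \<in> borel_measurable (past S j \<Otimes>\<^sub>M borel)"
  shows "(\<integral>\<^sup>+\<omega>. indicator {\<omega>. jump S (Suc j) \<omega> < \<infinity>} \<omega> * g (\<omega>, rjump S (Suc j) \<omega>) \<partial>Prb S)
    = (\<integral>\<^sup>+\<omega>. \<integral>\<^sup>+v. indicator {v. jump S j \<omega> < ereal v \<and> ereal v \<le> jump S (Suc j) \<omega>} v
         * ennreal (rate S (mark S j \<omega>) (max 0 v)) * g (\<omega>, v) \<partial>lborel \<partial>Prb S)"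
proof -
  have [measurable]: "rjump S j \<in> borel_measurable (past S j)" "mark S j \<in> borel_measurable (past S j)"
    using measurable_rjump_past measurable_mark_past by auto
  let ?h = "\<lambda>p. g (fst p, rjump S j (fst p) + snd p)"
  have h: "?h \<in> borel_measurable (past S j \<Otimes>\<^sub>M borel)" by measurable
  have "(\<integral>\<^sup>+\<omega>. indicator {\<omega>. jump S (Suc j) \<omega> < \<infinity>} \<omega> * g (\<omega>, rjump S (Suc j) \<omega>) \<partial>Prb S)
    = (\<integral>\<^sup>+\<omega>. \<integral>\<^sup>+v. indicator {v. jump S j \<omega> < \<infinity> \<and> 0 \<le> v \<and> jump S j \<omega> + ereal v \<le> jump S (Suc j) \<omega>} v
         * ennreal (hazard S j \<omega> v) * g (\<omega>, rjump S j \<omega> + v) \<partial>lborel \<partial>Prb S)"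
    using next_jump_law[OF j h] by simp
  also have "\<dots> = (\<integral>\<^sup>+\<omega>. \<integral>\<^sup>+v. indicator {v. jump S j \<omega> < ereal v \<and> ereal v \<le> jump S (Suc j) \<omega>} v
         * ennreal (rate S (mark S j \<omega>) (max 0 v)) * g (\<omega>, v) \<partial>lborel \<partial>Prb S)"
  proof (rule nn_integral_cong)
    fix \<omega> assume \<omega>: "\<omega> \<in> space (Prb S)"
    show "(\<integral>\<^sup>+v. indicator {v. jump S j \<omega> < \<infinity> \<and> 0 \<le> v \<and> jump S j \<omega> + ereal v \<le> jump S (Suc j) \<omega>} v
         * ennreal (hazard S j \<omega> v) * g (\<omega>, rjump S j \<omega> + v) \<partial>lborel)
      = (\<integral>\<^sup>+v. indicator {v. jump S j \<omega> < ereal v \<and> ereal v \<le> jump S (Suc j) \<omega>} v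
         * ennreal (rate S (mark S j \<omega>) (max 0 v)) * g (\<omega>, v) \<partial>lborel)"
    proof (cases "jump S j \<omega> < \<infinity>")
      case False
      then show ?thesis by simp
    next
      case True
      define x where "x = rjump S j \<omega>"
      have x: "jump S j \<omega> = ereal x" using ereal_rjump[of j \<omega>] j \<omega> True by (simp add: x_def)
      have [measurable]: "(\<lambda>v. g (\<omega>, v)) \<in> borel_measurable borel"
        using \<omega> by (intro measurable_compose[OF measurable_Pair1' g]) simp
      have [measurable]: "(\<lambda>v. rate S (mark S j \<omega>) (max 0 v)) \<in> borel_measurable borel"
        by (rule borel_measurable_continuous_onI[OF rate_cont])
      have "(\<integral>\<^sup>+v. indicator {v. jump S j \<omega> < ereal v \<and> ereal v \<le> jump S (Suc j) \<omega>} v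
         * ennreal (rate S (mark S j \<omega>) (max 0 v)) * g (\<omega>, v) \<partial>lborel)
         = (\<integral>\<^sup>+v. indicator {v. ereal x < ereal (x + v) \<and> ereal (x + v) \<le> jump S (Suc j) \<omega>} v
         * ennreal (rate S (mark S j \<omega>) (max 0 (x + v))) * g (\<omega>, x + v) \<partial>lborel)"
        by (subst nn_integral_real_affine[where c=1 and t=x]) (auto simp: x indicator_def)
      also have "\<dots> = (\<integral>\<^sup>+v. indicator {v. jump S j \<omega> < \<infinity> \<and> 0 \<le> v \<and> jump S j \<omega> + ereal v \<le> jump S (Suc j) \<omega>} v
         * ennreal (hazard S j \<omega> v) * g (\<omega>, rjump S j \<omega> + v) \<partial>lborel)"
        using AE_lborel_singleton[of 0]
        by (intro nn_integral_cong_AE, eventually_elim) (auto simp: x hazard_def x_def[symmetric] split: split_indicator)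
      finally show ?thesis ..
    qed
  qed
  finally show ?thesis .
qed

text \<open>The event \<open>A\<close> depends only on the past and on the next jump time, so it may
  be tested against the conditional expectation given \<open>past_next S j\<close>. Half-open time
  intervals are enough because the predictable generators have this form.\<close>

lemma next_mark_law:
  assumes j: "j < max_jumps S" and H: "H \<in> sets (past S j)" and D[measurable]: "D \<in> sets borel"
  shows "(\<integral>\<^sup>+\<omega>. indicator {\<omega>. jump S (Suc j) \<omega> < \<infinity>} \<omega> * (indicator H \<omega> * indicator {r<..s} (rjump S (Suc j) \<omega>) * indicator D (mark S (Suc j) \<omega>)) \<partial>Prb S)
    = (\<integral>\<^sup>+\<omega>. indicator {\<omega>. jump S (Suc j) \<omega> < \<infinity>} \<omega> * (indicator H \<omega> * indicator {r<..s} (rjump S (Suc j) \<omega>)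
        * emeasure (trans_law S (mark S j \<omega>) (max 0 (rjump S (Suc j) \<omega>))) D) \<partial>Prb S)"
proof -
  have sub: "subalgebra (Prb S) (past_next S j)" using subalgebra_past_next j by simp
  interpret sub: finite_measure_subalgebra "Prb S" "past_next S j"
    by unfold_locales (rule sub)
  have [measurable]: "jump S (Suc j) \<in> borel_measurable (past_next S j)" by (rule measurable_jump_past_next)
  then have [measurable]: "rjump S (Suc j) \<in> borel_measurable (past_next S j)" unfolding rjump_def[abs_def] by measurable
  have [measurable]: "H \<in> sets (past_next S j)" using H subalgebra_past_next_past by (auto simp: subalgebra_def)
  have [measurable]: "mark S (Suc j) \<in> borel_measurable (Prb S)" using j by (intro mark_measurable) auto
  have [measurable]: "mark S j \<in> borel_measurable (past_next S j)"
    by (rule measurable_from_subalg[OF subalgebra_past_next_past measurable_mark_past]) simp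
  define A where "A = {\<omega> \<in> space (past_next S j). \<omega> \<in> H \<and> jump S (Suc j) \<omega> < \<infinity> \<and> r < rjump S (Suc j) \<omega> \<and> rjump S (Suc j) \<omega> \<le> s}"
  define B where "B = {\<omega> \<in> space (Prb S). mark S (Suc j) \<omega> \<in> D}"
  have A[measurable]: "A \<in> sets (past_next S j)" unfolding A_def by measurable
  have A_P[measurable]: "A \<in> sets (Prb S)" using A sub by (auto simp: subalgebra_def)
  have B[measurable]: "B \<in> sets (Prb S)" unfolding B_def by measurable
  let ?Q = "\<lambda>\<omega>. trans_law S (mark S j \<omega>) (max 0 (rjump S (Suc j) \<omega>))"
  have "(\<lambda>\<omega>. (mark S j \<omega>, rjump S (Suc j) \<omega>)) \<in> past_next S j \<rightarrow>\<^sub>M borel \<Otimes>\<^sub>M borel" by measurable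
  from measurable_compose[OF this measurable_trans_law]
  have "?Q \<in> past_next S j \<rightarrow>\<^sub>M prob_algebra borel" by simp
  then have "(\<lambda>\<omega>. measure (?Q \<omega>) D) \<in> borel_measurable (past_next S j)"
    using sets.top[of "past_next S j"] by (intro measure_measurable_prob_algebra2[where N=borel] pair_measureI[OF _ D]) auto
  then have [measurable]: "(\<lambda>\<omega>. measure (?Q \<omega>) D) \<in> borel_measurable (Prb S)"
    by (rule measurable_from_subalg[OF sub])
  have Q1: "measure (?Q \<omega>) D \<le> 1" and Q2: "emeasure (?Q \<omega>) D = ennreal (measure (?Q \<omega>) D)" for \<omega>
  proof -
    interpret Q: prob_space "?Q \<omega>" by (rule prob_space_trans_law) simp
    show "measure (?Q \<omega>) D \<le> 1" by simp
    show "emeasure (?Q \<omega>) D = ennreal (measure (?Q \<omega>) D)" by (rule Q.emeasure_eq_measure)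
  qed
  have "(\<integral>\<omega>. indicator A \<omega> * indicator B \<omega> \<partial>Prb S) = (\<integral>\<omega>. indicator A \<omega> * real_cond_exp (Prb S) (past_next S j) (indicator B) \<omega> \<partial>Prb S)"
    by (rule sub.real_cond_exp_intg(2)[symmetric])
      (auto intro!: integrable_const_bound[where B=1] simp: indicator_def)
  also have "\<dots> = (\<integral>\<omega>. indicator A \<omega> * measure (?Q \<omega>) D \<partial>Prb S)"
  proof (rule integral_cong_AE)
    show "AE \<omega> in Prb S. indicator A \<omega> * real_cond_exp (Prb S) (past_next S j) (indicator B) \<omega> = indicator A \<omega> * measure (?Q \<omega>) D"
      using mark_law[OF j D] AE_space
    proof eventually_elim
      case (elim \<omega>)
      then show ?case using rjump_nonneg[of "Suc j" \<omega>] j by (auto simp: A_def B_def rjump_def split: split_indicator)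
    qed
  qed simp_all
  finally have eq: "(\<integral>\<omega>. indicator A \<omega> * indicator B \<omega> \<partial>Prb S) = (\<integral>\<omega>. indicator A \<omega> * measure (?Q \<omega>) D \<partial>Prb S)" .
  have "(\<integral>\<^sup>+\<omega>. ennreal (indicator A \<omega> * indicator B \<omega>) \<partial>Prb S) = (\<integral>\<^sup>+\<omega>. ennreal (indicator A \<omega> * measure (?Q \<omega>) D) \<partial>Prb S)"
  proof (subst nn_integral_eq_integral)
    show "integrable (Prb S) (\<lambda>\<omega>. indicat_real A \<omega> * indicat_real B \<omega>)"
      by (auto intro!: integrable_const_bound[where B=1] simp: indicator_def)
    have "integrable (Prb S) (\<lambda>\<omega>. indicat_real A \<omega> * measure (?Q \<omega>) D)"
      using Q1 by (auto intro!: integrable_const_bound[where B=1] simp: indicator_def)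
    from nn_integral_eq_integral[OF this] show "ennreal (\<integral>\<omega>. indicator A \<omega> * indicator B \<omega> \<partial>Prb S)
       = (\<integral>\<^sup>+\<omega>. ennreal (indicator A \<omega> * measure (?Q \<omega>) D) \<partial>Prb S)" unfolding eq by simp
  qed auto
  moreover have "(\<integral>\<^sup>+\<omega>. ennreal (indicator A \<omega> * indicator B \<omega>) \<partial>Prb S)
    = (\<integral>\<^sup>+\<omega>. indicator {\<omega>. jump S (Suc j) \<omega> < \<infinity>} \<omega> * (indicator H \<omega> * indicator {r<..s} (rjump S (Suc j) \<omega>) * indicator D (mark S (Suc j) \<omega>)) \<partial>Prb S)"
    by (intro nn_integral_cong) (auto simp: A_def B_def split: split_indicator)
  moreover have "(\<integral>\<^sup>+\<omega>. ennreal (indicator A \<omega> * measure (?Q \<omega>) D) \<partial>Prb S)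
    = (\<integral>\<^sup>+\<omega>. indicator {\<omega>. jump S (Suc j) \<omega> < \<infinity>} \<omega> * (indicator H \<omega> * indicator {r<..s} (rjump S (Suc j) \<omega>)
        * emeasure (?Q \<omega>) D) \<partial>Prb S)"
    unfolding Q2 by (intro nn_integral_cong) (auto simp: A_def split: split_indicator)
  ultimately show ?thesis by simp
qed

text \<open>An event of \<open>filt S r\<close> need not belong to the past of the
  \<open>j\<close>-th jump, but it coincides with such an event wherever the next jump comes after
  \<open>r\<close>. Both integrands live there: on the left the next jump lies in
  \<open>{r<..s}\<close>, on the right \<open>v\<close> does and is not later than the next
  jump.\<close>

lemma next_point_law:
  assumes j: "j < max_jumps S" and r: "0 \<le> r" and G: "G \<in> sets (filt S r)" and D[measurable]: "D \<in> sets borel"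
  shows "(\<integral>\<^sup>+\<omega>. indicator {\<omega>. jump S (Suc j) \<omega> < \<infinity>} \<omega> * (indicator G \<omega> * indicator {r<..s} (rjump S (Suc j) \<omega>) * indicator D (mark S (Suc j) \<omega>)) \<partial>Prb S)
    = (\<integral>\<^sup>+\<omega>. \<integral>\<^sup>+v. indicator {v. jump S j \<omega> < ereal v \<and> ereal v \<le> jump S (Suc j) \<omega>} v
         * ennreal (rate S (mark S j \<omega>) (max 0 v))
         * (indicator G \<omega> * indicator {r<..s} v * emeasure (trans_law S (mark S j \<omega>) (max 0 v)) D) \<partial>lborel \<partial>Prb S)"
proof -
  obtain H where H[measurable]: "H \<in> sets (past S j)" and GH: "\<And>\<omega>. ereal r < jump S (Suc j) \<omega> \<Longrightarrow> \<omega> \<in> G \<longleftrightarrow> \<omega> \<in> H"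
    using filt_eq_past_before_jump[OF j G] by blast
  have [measurable]: "mark S j \<in> borel_measurable (past S j)"
    using measurable_mark_past by auto
  let ?g = "\<lambda>p. indicator H (fst p) * indicator {r<..s} (snd p) * emeasure (trans_law S (mark S j (fst p)) (max 0 (snd p))) D"
  have "(\<lambda>p. (mark S j (fst p), snd p)) \<in> past S j \<Otimes>\<^sub>M borel \<rightarrow>\<^sub>M borel \<Otimes>\<^sub>M borel" by measurable
  from measurable_prob_algebraD[OF measurable_compose[OF this measurable_trans_law]]
  have "(\<lambda>p. trans_law S (mark S j (fst p)) (max 0 (snd p))) \<in> past S j \<Otimes>\<^sub>M borel \<rightarrow>\<^sub>M subprob_algebra borel" by simp
  then have [measurable]: "(\<lambda>p. emeasure (trans_law S (mark S j (fst p)) (max 0 (snd p))) D) \<in> borel_measurable (past S j \<Otimes>\<^sub>M borel)"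
    by (intro emeasure_measurable_subprob_algebra2[where N=borel] pair_measureI[OF _ D]) auto
  have g: "?g \<in> borel_measurable (past S j \<Otimes>\<^sub>M borel)" by measurable
  have "(\<integral>\<^sup>+\<omega>. indicator {\<omega>. jump S (Suc j) \<omega> < \<infinity>} \<omega> * (indicator G \<omega> * indicator {r<..s} (rjump S (Suc j) \<omega>) * indicator D (mark S (Suc j) \<omega>)) \<partial>Prb S)
    = (\<integral>\<^sup>+\<omega>. indicator {\<omega>. jump S (Suc j) \<omega> < \<infinity>} \<omega> * (indicator H \<omega> * indicator {r<..s} (rjump S (Suc j) \<omega>) * indicator D (mark S (Suc j) \<omega>)) \<partial>Prb S)"
  proof (rule nn_integral_cong)
    fix \<omega> assume \<omega>: "\<omega> \<in> space (Prb S)"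
    have "ereal r < jump S (Suc j) \<omega>" if "jump S (Suc j) \<omega> < \<infinity>" "r < rjump S (Suc j) \<omega>"
      using ereal_rjump[of "Suc j" \<omega>] j \<omega> that by simp
    then show "indicator {\<omega>. jump S (Suc j) \<omega> < \<infinity>} \<omega> * (indicator G \<omega> * indicator {r<..s} (rjump S (Suc j) \<omega>) * indicator D (mark S (Suc j) \<omega>))
        = (indicator {\<omega>. jump S (Suc j) \<omega> < \<infinity>} \<omega> * (indicator H \<omega> * indicator {r<..s} (rjump S (Suc j) \<omega>) * indicator D (mark S (Suc j) \<omega>)) :: ennreal)"
      using GH[of \<omega>] by (auto split: split_indicator)
  qed
  also have "\<dots> = (\<integral>\<^sup>+\<omega>. indicator {\<omega>. jump S (Suc j) \<omega> < \<infinity>} \<omega> * ?g (\<omega>, rjump S (Suc j) \<omega>) \<partial>Prb S)"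
    using next_mark_law[OF j H D] by simp
  also have "\<dots> = (\<integral>\<^sup>+\<omega>. \<integral>\<^sup>+v. indicator {v. jump S j \<omega> < ereal v \<and> ereal v \<le> jump S (Suc j) \<omega>} v
         * ennreal (rate S (mark S j \<omega>) (max 0 v)) * ?g (\<omega>, v) \<partial>lborel \<partial>Prb S)"
    by (rule next_jump_time_law[OF j g])
  also have "\<dots> = (\<integral>\<^sup>+\<omega>. \<integral>\<^sup>+v. indicator {v. jump S j \<omega> < ereal v \<and> ereal v \<le> jump S (Suc j) \<omega>} v
         * ennreal (rate S (mark S j \<omega>) (max 0 v))
         * (indicator G \<omega> * indicator {r<..s} v * emeasure (trans_law S (mark S j \<omega>) (max 0 v)) D) \<partial>lborel \<partial>Prb S)"
  proof (rule nn_integral_cong, rule nn_integral_cong)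
    fix \<omega> and v :: real
    have "ereal r < jump S (Suc j) \<omega>" if "r < v" "ereal v \<le> jump S (Suc j) \<omega>"
      using that by (metis ereal_less(2) less_le_trans less_ereal.simps(1))
    then show "indicator {v. jump S j \<omega> < ereal v \<and> ereal v \<le> jump S (Suc j) \<omega>} v * ennreal (rate S (mark S j \<omega>) (max 0 v)) * ?g (\<omega>, v)
      = indicator {v. jump S j \<omega> < ereal v \<and> ereal v \<le> jump S (Suc j) \<omega>} v
         * ennreal (rate S (mark S j \<omega>) (max 0 v))
         * (indicator G \<omega> * indicator {r<..s} v * emeasure (trans_law S (mark S j \<omega>) (max 0 v)) D)"
      using GH[of \<omega>] by (auto split: split_indicator)
  qed
  finally show ?thesis .
qed

section \<open>Integration against the point measure and its compensator\<close>

lemma nn_integral_q_meas: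
  assumes [measurable]: "f \<in> borel_measurable (borel \<Otimes>\<^sub>M borel)"
  shows "(\<integral>\<^sup>+p. f p \<partial>q_meas S \<omega>) = (\<Sum>j<max_jumps S. indicator {\<omega>. jump S (Suc j) \<omega> < \<infinity>} \<omega> * f (rjump S (Suc j) \<omega>, mark S (Suc j) \<omega>))"
proof -
  have "(\<integral>\<^sup>+p. f p \<partial>q_meas S \<omega>) = (\<Sum>j\<in>{j \<in> {1..max_jumps S}. jump S j \<omega> < \<infinity>}. f (rjump S j \<omega>, mark S j \<omega>))"
    unfolding q_meas_def rjump_def by (subst nn_integral_distr) (auto simp: nn_integral_count_space_finite space_pair_measure)
  also have "\<dots> = (\<Sum>j\<in>{1..max_jumps S}. indicator {\<omega>. jump S j \<omega> < \<infinity>} \<omega> * f (rjump S j \<omega>, mark S j \<omega>))"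
    by (rule sum.mono_neutral_cong_left) auto
  also have "\<dots> = (\<Sum>j<max_jumps S. indicator {\<omega>. jump S (Suc j) \<omega> < \<infinity>} \<omega> * f (rjump S (Suc j) \<omega>, mark S (Suc j) \<omega>))"
    by (simp add: sum.atLeast1_atMost_eq)
  finally show ?thesis .
qed

lemma sets_q_meas [simp, measurable_cong]: "sets (q_meas S \<omega>) = sets (borel \<Otimes>\<^sub>M borel)"
  by (simp add: q_meas_def)

lemma sets_q_hat [simp, measurable_cong]: "sets (q_hat S \<omega>) = sets (borel \<Otimes>\<^sub>M borel)"
  unfolding q_hat_def using sets.sigma_sets_eq[of "borel \<Otimes>\<^sub>M borel :: (real \<times> 'e) measure"]
  by (simp add: space_pair_measure)

lemma space_q [simp]: "space (q_meas S \<omega>) = UNIV" "space (q_hat S \<omega>) = UNIV"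
  using sets_eq_imp_space_eq[OF sets_q_meas] sets_eq_imp_space_eq[OF sets_q_hat] by (auto simp: space_pair_measure)

lemma measurable_trans_law': "(\<lambda>v. trans_law S \<gamma> (max 0 v)) \<in> borel \<rightarrow>\<^sub>M subprob_algebra borel"
proof -
  have "(\<lambda>v. (\<gamma>, v)) \<in> borel \<rightarrow>\<^sub>M (borel \<Otimes>\<^sub>M borel :: ('e \<times> real) measure)" by measurable
  from measurable_prob_algebraD[OF measurable_compose[OF this measurable_trans_law]] show ?thesis by simp
qed

text \<open>\<open>emeasure_q_hat\<close> is the case of indicators, and measurable induction gives
  the rest. The truncated time may be inserted because no stage interval contains negative
  times.\<close>

lemma nn_integral_q_hat:
  assumes f: "f \<in> borel_measurable (borel \<Otimes>\<^sub>M borel)" and \<omega>: "\<omega> \<in> space (Prb S)"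
  shows "(\<integral>\<^sup>+p. f p \<partial>q_hat S \<omega>) = (\<integral>\<^sup>+v. (\<Sum>j<max_jumps S.
         indicator {v. jump S j \<omega> < ereal v \<and> ereal v \<le> jump S (Suc j) \<omega>} v
         * ennreal (rate S (mark S j \<omega>) (max 0 v))
         * (\<integral>\<^sup>+\<theta>. f (v, \<theta>) \<partial>trans_law S (mark S j \<omega>) (max 0 v))) \<partial>lborel)"
    (is "_ = (\<integral>\<^sup>+v. (\<Sum>j<max_jumps S. ?w j v * ?I f j v) \<partial>lborel)")
proof -
  have [measurable]: "(\<lambda>v. rate S \<gamma> (max 0 v)) \<in> borel_measurable borel" for \<gamma>
    by (rule borel_measurable_continuous_onI[OF rate_cont])
  have I[measurable]: "?I f j \<in> borel_measurable borel" if "f \<in> borel_measurable (borel \<Otimes>\<^sub>M borel)" for f j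
    using that by (intro nn_integral_measurable_subprob_algebra2[OF _ measurable_trans_law']) simp
  have fm: "(\<lambda>\<theta>. f (v, \<theta>)) \<in> borel_measurable (trans_law S \<gamma> (max 0 v))" if [measurable]: "f \<in> borel_measurable (borel \<Otimes>\<^sub>M borel)" for f :: "real \<times> 'e \<Rightarrow> ennreal" and v \<gamma>
    by (subst measurable_cong_sets[OF sets_trans_law refl]) auto
  show ?thesis
    using f
  proof (induction rule: borel_measurable_induct)
    case (cong f g)
    then have "f = g" by (auto simp: space_pair_measure)
    then show ?case using cong by simp
  next
    case (set A)
    have "emeasure (trans_law S (mark S j \<omega>) v) (Pair v -` A) = ?I (indicator A) j v" if "0 \<le> v" for j v
    proof -
      have "Pair v -` A \<in> sets (trans_law S (mark S j \<omega>) v)"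
        using sets_Pair1[OF set, of v] sets_trans_law[OF that] by simp
      then have "emeasure (trans_law S (mark S j \<omega>) v) (Pair v -` A) = (\<integral>\<^sup>+\<theta>. indicator (Pair v -` A) \<theta> \<partial>trans_law S (mark S j \<omega>) v)"
        by (rule nn_integral_indicator[symmetric])
      then show ?thesis using that by (simp add: indicator_def)
    qed
    moreover have "0 \<le> v" if "jump S j \<omega> < ereal v" "j < max_jumps S" for j v
      using jump_nonneg[of j \<omega>] that \<omega> by (metis ereal_less_eq(5) less_imp_le order_trans le_less_trans)
    ultimately show ?case
      using set \<omega> by (subst nn_integral_indicator) (auto simp: emeasure_q_hat intro!: nn_integral_cong sum.cong split: split_indicator)
  next
    case (mult f c)
    have "?I (\<lambda>p. c * f p) j v = c * ?I f j v" for j v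
      using mult by (intro nn_integral_cmult fm) simp
    then show ?case using mult
      by (simp add: nn_integral_cmult sum_distrib_left[symmetric] mult.left_commute[of _ c] cong: nn_integral_cong)
  next
    case (add f g)
    have "?I (\<lambda>p. g p + f p) j v = ?I g j v + ?I f j v" for j v
      using add by (intro nn_integral_add fm) simp_all
    then show ?case using add
      by (simp add: nn_integral_add distrib_left sum.distrib cong: nn_integral_cong)
  next
    case (seq U)
    have Um: "U i \<in> borel_measurable (borel \<Otimes>\<^sub>M borel)" for i using seq by simp
    have incU: "incseq U" using seq by simp
    have inc: "incseq (\<lambda>i. U i p)" for p using incU unfolding incseq_def le_fun_def by blast
    have "?I (\<lambda>p. SUP i. U i p) j v = (SUP i. ?I (U i) j v)" for j v
      using fm[OF Um] incU by (intro nn_integral_monotone_convergence_SUP) (auto simp: incseq_def le_fun_def)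
    moreover have incI: "incseq (\<lambda>i. ?I (U i) j v)" for j v
      using inc by (auto simp: incseq_def intro!: nn_integral_mono)
    ultimately have "(\<integral>\<^sup>+v. (\<Sum>j<max_jumps S. ?w j v * ?I (\<lambda>p. SUP i. U i p) j v) \<partial>lborel)
       = (\<integral>\<^sup>+v. (SUP i. \<Sum>j<max_jumps S. ?w j v * ?I (U i) j v) \<partial>lborel)"
      by (intro nn_integral_cong) (auto simp: SUP_mult_left_ennreal incseq_def intro!: ennreal_SUP_sum[symmetric] mult_left_mono)
    also have "\<dots> = (SUP i. \<integral>\<^sup>+v. (\<Sum>j<max_jumps S. ?w j v * ?I (U i) j v) \<partial>lborel)"
      using incI Um by (intro nn_integral_monotone_convergence_SUP) (auto simp: incseq_def le_fun_def intro!: sum_mono mult_left_mono)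
    also have "\<dots> = (SUP i. \<integral>\<^sup>+p. U i p \<partial>q_hat S \<omega>)" using seq by simp
    also have "\<dots> = (\<integral>\<^sup>+p. (SUP i. U i p) \<partial>q_hat S \<omega>)"
      using Um incU by (intro nn_integral_monotone_convergence_SUP[symmetric]) auto
    finally show ?case by (simp add: SUP_apply[abs_def])
  qed
qed

text \<open>The predictable sigma-field is coarser than the product sigma-field on Omega x [0,t].
  The statement is about the identity so that composition transfers the measurability of any
  predictable process.\<close>

lemma id_predictable:
  assumes "0 \<le> t"
  shows "(\<lambda>p. p) \<in> Prb S \<Otimes>\<^sub>M restrict_space lborel {0..t} \<rightarrow>\<^sub>M predictable S t"
  unfolding predictable_def
proof (rule measurable_measure_of)
  have F: "G \<in> sets (Prb S)" if "G \<in> sets (filt S r)" for G r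
    using subalgebra_filt that by (auto simp: subalgebra_def)
  have sp: "G \<subseteq> space (Prb S)" if "G \<in> sets (filt S r)" for G r
    using sets.sets_into_space[OF that] by simp
  show "{G \<times> {0} | G. G \<in> sets (filt S 0)} \<union>
      {G \<times> {r<..s} | G r s. 0 \<le> r \<and> r \<le> s \<and> s \<le> t \<and> G \<in> sets (filt S r)} \<subseteq> Pow (space (Prb S) \<times> {0..t})"
    using sp assms by fastforce
  show "(\<lambda>p. p) \<in> space (Prb S \<Otimes>\<^sub>M restrict_space lborel {0..t}) \<rightarrow> space (Prb S) \<times> {0..t}"
    by (auto simp: space_pair_measure space_restrict_space)
  fix y assume y: "y \<in> {G \<times> {0} | G. G \<in> sets (filt S 0)} \<union>
      {G \<times> {r<..s} | G r s. 0 \<le> r \<and> r \<le> s \<and> s \<le> t \<and> G \<in> sets (filt S r)}"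
  obtain G B where GB: "y = G \<times> B" "G \<in> sets (Prb S)" "B \<in> sets borel" "B \<subseteq> {0..t}"
  proof (cases "y \<in> {G \<times> {0} | G. G \<in> sets (filt S 0)}")
    case True
    then obtain G where "y = G \<times> {0}" "G \<in> sets (filt S 0)" by auto
    then show ?thesis using that[of G "{0}"] F assms by auto
  next
    case False
    then obtain G r s where "y = G \<times> {r<..s}" "G \<in> sets (filt S r)" "0 \<le> r" "s \<le> t" using y by auto
    then show ?thesis using F by (intro that[of G "{r<..s}"]) auto
  qed
  then have "B \<in> sets (restrict_space lborel {0..t})" by (auto simp: sets_restrict_space_iff)
  then have "G \<times> B \<in> sets (Prb S \<Otimes>\<^sub>M restrict_space lborel {0..t})" using GB by auto
  moreover have "G \<times> B \<subseteq> space (Prb S \<Otimes>\<^sub>M restrict_space lborel {0..t})"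
    using sets.sets_into_space[OF calculation] .
  ultimately show "(\<lambda>p. p) -` y \<inter> space (Prb S \<Otimes>\<^sub>M restrict_space lborel {0..t}) \<in> sets (Prb S \<Otimes>\<^sub>M restrict_space lborel {0..t})"
    using GB(1) by (simp add: Int_absorb2)
qed

lemma id_predictable_mark:
  assumes "0 \<le> t"
  shows "(\<lambda>p. p) \<in> (Prb S \<Otimes>\<^sub>M restrict_space lborel {0..t}) \<Otimes>\<^sub>M borel \<rightarrow>\<^sub>M predictable S t \<Otimes>\<^sub>M borel"
proof -
  have "(\<lambda>p. (fst p, snd p)) \<in> (Prb S \<Otimes>\<^sub>M restrict_space lborel {0..t}) \<Otimes>\<^sub>M borel \<rightarrow>\<^sub>M predictable S t \<Otimes>\<^sub>M borel"
    by (intro measurable_Pair measurable_compose[OF measurable_fst id_predictable[OF assms]]) simp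
  then show ?thesis by simp
qed

lemma measurable_section:
  assumes t: "0 \<le> t" and \<omega>: "\<omega> \<in> space (Prb S)"
    and \<Phi>: "\<Phi> \<in> borel_measurable (predictable S t \<Otimes>\<^sub>M borel)"
  shows "(\<lambda>p. \<Phi> ((\<omega>, fst p), snd p)) \<in> borel_measurable (restrict_space (borel \<Otimes>\<^sub>M borel) ({0..t} \<times> UNIV))"
proof -
  have "(\<lambda>p. ((\<omega>, fst p), snd p)) \<in> restrict_space (borel \<Otimes>\<^sub>M borel) ({0..t} \<times> UNIV) \<rightarrow>\<^sub>M (Prb S \<Otimes>\<^sub>M restrict_space lborel {0..t}) \<Otimes>\<^sub>M borel"
    using \<omega> by (intro measurable_Pair measurable_restrict_space2 measurable_const)
      (auto simp: space_restrict_space intro!: measurable_restrict_space1)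
  from measurable_compose[OF this measurable_compose[OF id_predictable_mark[OF t] \<Phi>]] show ?thesis by simp
qed

lemma measurable_section_indicator:
  fixes \<Phi> :: "('w \<times> real) \<times> 'e \<Rightarrow> ennreal"
  assumes t: "0 \<le> t" and \<omega>: "\<omega> \<in> space (Prb S)"
    and \<Phi>: "\<Phi> \<in> borel_measurable (predictable S t \<Otimes>\<^sub>M borel)"
  shows "(\<lambda>p. \<Phi> ((\<omega>, fst p), snd p) * indicator ({0..t} \<times> UNIV) p) \<in> borel_measurable (borel \<Otimes>\<^sub>M borel)"
  using measurable_section[OF assms]
  by (subst (asm) borel_measurable_restrict_space_iff_ennreal) (auto simp: space_pair_measure)

section \<open>The Doleans measures of the two random measures\<close>

text \<open>
  Clipping the jump time only makes the map take values in \<open>\<Omega> \<times> [0, t]\<close>; the density discards the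
  clipped points.
\<close>

definition point_law :: "real \<Rightarrow> nat \<Rightarrow> (('w \<times> real) \<times> 'e) measure" where
  "point_law t j = distr (density (Prb S) (indicator {\<omega> \<in> space (Prb S). jump S (Suc j) \<omega> \<le> ereal t})) (predictable S t \<Otimes>\<^sub>M borel)
     (\<lambda>\<omega>. ((\<omega>, max 0 (min t (rjump S (Suc j) \<omega>))), mark S (Suc j) \<omega>))"

definition compensator_weight :: "nat \<Rightarrow> 'w \<times> real \<Rightarrow> ennreal" where
  "compensator_weight j p = indicator {p. jump S j (fst p) < ereal (snd p) \<and> ereal (snd p) \<le> jump S (Suc j) (fst p)} p
     * ennreal (rate S (mark S j (fst p)) (max 0 (snd p)))"

text \<open>The share of the stage between jumps \<open>j\<close> and \<open>j + 1\<close> in the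
  Doleans measure of \<open>q_hat\<close>, just as \<open>point_law\<close> is its share in that of
  \<open>q_meas\<close>. As a kernel composition it has iterated integrals: weight in time,
  transition law in the mark.\<close>

definition compensator_law :: "real \<Rightarrow> nat \<Rightarrow> (('w \<times> real) \<times> 'e) measure" where
  "compensator_law t j = density (Prb S \<Otimes>\<^sub>M restrict_space lborel {0..t}) (compensator_weight j)
     \<bind> (\<lambda>p. distr (trans_law S (mark S j (fst p)) (max 0 (snd p))) (predictable S t \<Otimes>\<^sub>M borel) (Pair p))"

lemma measurable_compensator_weight:
  assumes j: "j < max_jumps S"
  shows "compensator_weight j \<in> borel_measurable (Prb S \<Otimes>\<^sub>M borel)"
proof -
  have [measurable]: "jump S j \<in> borel_measurable (Prb S)" "jump S (Suc j) \<in> borel_measurable (Prb S)" "mark S j \<in> borel_measurable (Prb S)"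
    using j by (auto intro: jump_measurable mark_measurable)
  have "(\<lambda>p. (mark S j (fst p), snd p)) \<in> Prb S \<Otimes>\<^sub>M borel \<rightarrow>\<^sub>M borel \<Otimes>\<^sub>M borel" by measurable
  from measurable_compose[OF this measurable_rate]
  have [measurable]: "(\<lambda>p. rate S (mark S j (fst p)) (max 0 (snd p))) \<in> borel_measurable (Prb S \<Otimes>\<^sub>M borel)" by simp
  show ?thesis unfolding compensator_weight_def[abs_def] by measurable
qed

lemma measurable_mark_kernel:
  assumes j: "j < max_jumps S"
  shows "(\<lambda>p. trans_law S (mark S j (fst p)) (max 0 (snd p))) \<in> Prb S \<Otimes>\<^sub>M borel \<rightarrow>\<^sub>M subprob_algebra borel"
proof -
  have [measurable]: "mark S j \<in> borel_measurable (Prb S)"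
    using j by (auto intro: mark_measurable)
  have "(\<lambda>p. (mark S j (fst p), snd p)) \<in> Prb S \<Otimes>\<^sub>M borel \<rightarrow>\<^sub>M borel \<Otimes>\<^sub>M borel" by measurable
  from measurable_prob_algebraD[OF measurable_compose[OF this measurable_trans_law]] show ?thesis by simp
qed

lemma id_restrict_time: "(\<lambda>p. p) \<in> Prb S \<Otimes>\<^sub>M restrict_space lborel {0..t} \<rightarrow>\<^sub>M Prb S \<Otimes>\<^sub>M borel"
proof -
  have "(\<lambda>p. (fst p, snd p)) \<in> Prb S \<Otimes>\<^sub>M restrict_space lborel {0..t} \<rightarrow>\<^sub>M Prb S \<Otimes>\<^sub>M borel"
    by (intro measurable_Pair measurable_compose[OF measurable_snd measurable_restrict_space1]) auto
  then show ?thesis by simp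
qed

lemma nn_integral_point_law:
  assumes t: "0 \<le> t" and j: "j < max_jumps S" and \<Phi>: "\<Phi> \<in> borel_measurable (predictable S t \<Otimes>\<^sub>M borel)"
  shows "(\<integral>\<^sup>+x. \<Phi> x \<partial>point_law t j) = (\<integral>\<^sup>+\<omega>. indicator {\<omega>. jump S (Suc j) \<omega> < \<infinity>} \<omega>
    * (\<Phi> ((\<omega>, rjump S (Suc j) \<omega>), mark S (Suc j) \<omega>) * indicator {0..t} (rjump S (Suc j) \<omega>)) \<partial>Prb S)"
    and "(\<lambda>\<omega>. indicator {\<omega>. jump S (Suc j) \<omega> < \<infinity>} \<omega>
    * (\<Phi> ((\<omega>, rjump S (Suc j) \<omega>), mark S (Suc j) \<omega>) * indicator {0..t} (rjump S (Suc j) \<omega>))) \<in> borel_measurable (Prb S)"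
proof -
  have [measurable]: "jump S (Suc j) \<in> borel_measurable (Prb S)" "mark S (Suc j) \<in> borel_measurable (Prb S)"
    using j by (auto intro: jump_measurable mark_measurable)
  have [measurable]: "rjump S (Suc j) \<in> borel_measurable (Prb S)" unfolding rjump_def[abs_def] by measurable
  let ?m = "\<lambda>\<omega>. ((\<omega>, max 0 (min t (rjump S (Suc j) \<omega>))), mark S (Suc j) \<omega>)"
  have "?m \<in> Prb S \<rightarrow>\<^sub>M (Prb S \<Otimes>\<^sub>M restrict_space lborel {0..t}) \<Otimes>\<^sub>M borel"
    using t by (intro measurable_Pair measurable_restrict_space2) auto
  from measurable_compose[OF this id_predictable_mark[OF t]]
  have m: "?m \<in> Prb S \<rightarrow>\<^sub>M predictable S t \<Otimes>\<^sub>M borel" by simp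
  have [measurable]: "(\<lambda>\<omega>. \<Phi> (?m \<omega>)) \<in> borel_measurable (Prb S)"
    using measurable_compose[OF m \<Phi>] by simp
  \<comment> \<open>If the jump occurs by time \<open>t\<close>, the clipped time is the jump time;
    otherwise both sides vanish.\<close>
  have eq: "indicator {\<omega> \<in> space (Prb S). jump S (Suc j) \<omega> \<le> ereal t} \<omega> * \<Phi> (?m \<omega>) = indicator {\<omega>. jump S (Suc j) \<omega> < \<infinity>} \<omega>
    * (\<Phi> ((\<omega>, rjump S (Suc j) \<omega>), mark S (Suc j) \<omega>) * indicator {0..t} (rjump S (Suc j) \<omega>))" if \<omega>: "\<omega> \<in> space (Prb S)" for \<omega>
  proof (cases "jump S (Suc j) \<omega> < \<infinity>")
    case True
    obtain x where x: "jump S (Suc j) \<omega> = ereal x" "rjump S (Suc j) \<omega> = x"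
      using ereal_rjump[OF _ \<omega> True] j by auto
    have "0 \<le> x" using rjump_nonneg[of "Suc j" \<omega>] x \<omega> j by auto
    then show ?thesis using x \<omega> by (auto split: split_indicator simp: min_def max_def)
  qed auto
  show "(\<lambda>\<omega>. indicator {\<omega>. jump S (Suc j) \<omega> < \<infinity>} \<omega>
    * (\<Phi> ((\<omega>, rjump S (Suc j) \<omega>), mark S (Suc j) \<omega>) * indicator {0..t} (rjump S (Suc j) \<omega>))) \<in> borel_measurable (Prb S)"
    by (subst measurable_cong[OF eq[symmetric]]) auto
  show "(\<integral>\<^sup>+x. \<Phi> x \<partial>point_law t j) = (\<integral>\<^sup>+\<omega>. indicator {\<omega>. jump S (Suc j) \<omega> < \<infinity>} \<omega>
    * (\<Phi> ((\<omega>, rjump S (Suc j) \<omega>), mark S (Suc j) \<omega>) * indicator {0..t} (rjump S (Suc j) \<omega>)) \<partial>Prb S)"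
  proof -
    have "(\<integral>\<^sup>+x. \<Phi> x \<partial>point_law t j) = (\<integral>\<^sup>+\<omega>. indicator {\<omega> \<in> space (Prb S). jump S (Suc j) \<omega> \<le> ereal t} \<omega> * \<Phi> (?m \<omega>) \<partial>Prb S)"
      unfolding point_law_def using m \<Phi>
      by (subst nn_integral_distr) (auto simp: nn_integral_density)
    also have "\<dots> = (\<integral>\<^sup>+\<omega>. indicator {\<omega>. jump S (Suc j) \<omega> < \<infinity>} \<omega>
      * (\<Phi> ((\<omega>, rjump S (Suc j) \<omega>), mark S (Suc j) \<omega>) * indicator {0..t} (rjump S (Suc j) \<omega>)) \<partial>Prb S)"
      by (rule nn_integral_cong) (rule eq)
    finally show ?thesis .
  qed
qed

lemma nn_integral_compensator_law:
  assumes t: "0 \<le> t" and j: "j < max_jumps S" and \<Phi>: "\<Phi> \<in> borel_measurable (predictable S t \<Otimes>\<^sub>M borel)"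
  shows "(\<integral>\<^sup>+x. \<Phi> x \<partial>compensator_law t j) = (\<integral>\<^sup>+\<omega>. \<integral>\<^sup>+v. compensator_weight j (\<omega>, v) *
     (\<integral>\<^sup>+\<theta>. \<Phi> ((\<omega>, v), \<theta>) * indicator {0..t} v \<partial>trans_law S (mark S j \<omega>) (max 0 v)) \<partial>lborel \<partial>Prb S)"
    and "(\<lambda>\<omega>. \<integral>\<^sup>+v. compensator_weight j (\<omega>, v) *
     (\<integral>\<^sup>+\<theta>. \<Phi> ((\<omega>, v), \<theta>) * indicator {0..t} v \<partial>trans_law S (mark S j \<omega>) (max 0 v)) \<partial>lborel) \<in> borel_measurable (Prb S)" (is "?I \<in> _")
    and "sets (compensator_law t j) = sets (predictable S t \<Otimes>\<^sub>M borel)"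
proof -
  let ?L = "restrict_space lborel {0..t}" and ?N = "predictable S t \<Otimes>\<^sub>M borel :: (('w \<times> real) \<times> 'e) measure"
  interpret L: sigma_finite_measure ?L
    by (rule sigma_finite_measure_restrict_space) (auto intro: lborel.sigma_finite_measure_axioms)
  let ?k = "\<lambda>p. trans_law S (mark S j (fst p)) (max 0 (snd p))"
  have k: "?k \<in> Prb S \<Otimes>\<^sub>M ?L \<rightarrow>\<^sub>M subprob_algebra borel"
    using measurable_compose[OF id_restrict_time measurable_mark_kernel[OF j]] by simp
  have w: "compensator_weight j \<in> borel_measurable (Prb S \<Otimes>\<^sub>M ?L)"
    using measurable_compose[OF id_restrict_time measurable_compensator_weight[OF j]] by simp
  have kk: "(\<lambda>p. distr (?k p) ?N (Pair p)) \<in> Prb S \<Otimes>\<^sub>M ?L \<rightarrow>\<^sub>M subprob_algebra ?N"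
    using id_predictable_mark[OF t] by (intro measurable_distr2[OF _ k]) (simp add: id_def)
  then have kk': "(\<lambda>p. distr (?k p) ?N (Pair p)) \<in> density (Prb S \<Otimes>\<^sub>M ?L) (compensator_weight j) \<rightarrow>\<^sub>M subprob_algebra ?N" by simp
  have PN: "Pair p \<in> ?k p \<rightarrow>\<^sub>M ?N" if "p \<in> space (Prb S \<Otimes>\<^sub>M ?L)" for p
  proof -
    have "Pair p \<in> borel \<rightarrow>\<^sub>M (Prb S \<Otimes>\<^sub>M ?L) \<Otimes>\<^sub>M borel" using that by (rule measurable_Pair1')
    from measurable_compose[OF this id_predictable_mark[OF t]]
    show ?thesis by (subst measurable_cong_sets[OF sets_trans_law refl]) auto
  qed
  have m: "(\<lambda>p. \<integral>\<^sup>+\<theta>. \<Phi> (p, \<theta>) \<partial>?k p) \<in> borel_measurable (Prb S \<Otimes>\<^sub>M ?L)"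
    using measurable_compose[OF id_predictable_mark[OF t] \<Phi>]
    by (intro nn_integral_measurable_subprob_algebra2[OF _ k]) simp
  have P0: "space (Prb S \<Otimes>\<^sub>M ?L) \<noteq> {}"
    using not_empty t by (auto simp: space_pair_measure space_restrict_space)
  show "sets (compensator_law t j) = sets ?N"
    unfolding compensator_law_def by (rule sets_bind[OF _ ]) (use measurable_space[OF kk] P0 in \<open>auto simp: space_subprob_algebra\<close>)
  have "(\<integral>\<^sup>+x. \<Phi> x \<partial>compensator_law t j) = (\<integral>\<^sup>+p. \<integral>\<^sup>+x. \<Phi> x \<partial>distr (?k p) ?N (Pair p) \<partial>density (Prb S \<Otimes>\<^sub>M ?L) (compensator_weight j))"
    unfolding compensator_law_def by (rule nn_integral_bind[OF \<Phi> kk'])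
  also have "\<dots> = (\<integral>\<^sup>+p. compensator_weight j p * (\<integral>\<^sup>+x. \<Phi> x \<partial>distr (?k p) ?N (Pair p)) \<partial>(Prb S \<Otimes>\<^sub>M ?L))"
    using w nn_integral_measurable_subprob_algebra2[of "\<lambda>_. \<Phi>", OF _ kk] \<Phi>
    by (intro nn_integral_density) auto
  also have "\<dots> = (\<integral>\<^sup>+p. compensator_weight j p * (\<integral>\<^sup>+\<theta>. \<Phi> (p, \<theta>) \<partial>?k p) \<partial>(Prb S \<Otimes>\<^sub>M ?L))"
    using PN \<Phi> by (intro nn_integral_cong arg_cong2[where f="(*)"] refl nn_integral_distr) auto
  also have "\<dots> = (\<integral>\<^sup>+\<omega>. \<integral>\<^sup>+v. compensator_weight j (\<omega>, v) * (\<integral>\<^sup>+\<theta>. \<Phi> ((\<omega>, v), \<theta>) \<partial>?k (\<omega>, v)) \<partial>?L \<partial>Prb S)"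
    by (intro L.nn_integral_fst[symmetric] borel_measurable_times_ennreal w m)
  finally have 1: "(\<integral>\<^sup>+x. \<Phi> x \<partial>compensator_law t j) = \<dots>" .
  have 2: "(\<integral>\<^sup>+v. compensator_weight j (\<omega>, v) * (\<integral>\<^sup>+\<theta>. \<Phi> ((\<omega>, v), \<theta>) \<partial>?k (\<omega>, v)) \<partial>?L) = ?I \<omega>" for \<omega>
    by (subst nn_integral_restrict_space) (auto intro!: nn_integral_cong split: split_indicator)
  show "(\<integral>\<^sup>+x. \<Phi> x \<partial>compensator_law t j) = (\<integral>\<^sup>+\<omega>. ?I \<omega> \<partial>Prb S)"
    unfolding 1 2 ..
  have "(\<lambda>\<omega>. \<integral>\<^sup>+v. compensator_weight j (\<omega>, v) * (\<integral>\<^sup>+\<theta>. \<Phi> ((\<omega>, v), \<theta>) \<partial>?k (\<omega>, v)) \<partial>?L) \<in> borel_measurable (Prb S)"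
    by (intro L.borel_measurable_nn_integral_fst[of "\<lambda>p. compensator_weight j p * (\<integral>\<^sup>+\<theta>. \<Phi> (p, \<theta>) \<partial>?k p)"]
        borel_measurable_times_ennreal w m)
  then show "?I \<in> borel_measurable (Prb S)" unfolding 2 .
qed

text \<open>The measures are compared on products of a predictable generator with a Borel set of
  marks. Generators at time 0 have mass 0 for both, since jump times are positive and a single time
  is Lebesgue null; the half-open ones are \<open>next_point_law\<close>.\<close>

lemma point_law_eq_compensator_law:
  assumes t: "0 \<le> t" and j: "j < max_jumps S"
  shows "point_law t j = compensator_law t j"
proof -
  define E0 where "E0 = {G \<times> {0} | G. G \<in> sets (filt S 0)} \<union>
      {G \<times> {r<..s} | G r s. 0 \<le> r \<and> r \<le> s \<and> s \<le> t \<and> G \<in> sets (filt S r)}"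
  define E where "E = {a \<times> D | a D. a \<in> E0 \<and> D \<in> sets (borel :: 'e measure)}"
  have sp: "G \<subseteq> space (Prb S)" if "G \<in> sets (filt S r)" for G r
    using sets.sets_into_space[OF that] by simp
  have top: "space (Prb S) \<in> sets (filt S r)" for r
    using sets.top[of "filt S r"] by simp
  have E0_sub: "E0 \<subseteq> Pow (space (Prb S) \<times> {0..t})"
    unfolding E0_def using sp t by fastforce
  have E0_sets: "sets (predictable S t) = sigma_sets (space (Prb S) \<times> {0..t}) E0"
    unfolding predictable_def E0_def[symmetric] using E0_sub by (rule sets_measure_of)
  let ?N = "predictable S t \<Otimes>\<^sub>M borel :: (('w \<times> real) \<times> 'e) measure"
  \<comment> \<open>Two generators already cover the base space. They serve as countable cover for
    the product sigma-field and as the exhaustion by sets of finite mass in the uniqueness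
    argument.\<close>
  let ?C = "{space (Prb S) \<times> {0}, space (Prb S) \<times> {0<..t}}"
  have C: "?C \<subseteq> E0" "\<Union>?C = space (Prb S) \<times> {0..t}"
    unfolding E0_def using top t by (auto intro!: exI[of _ "space (Prb S)"])
  have E_sub: "E \<subseteq> Pow ((space (Prb S) \<times> {0..t}) \<times> UNIV)"
    unfolding E_def using E0_sub by auto
  have E_sets: "sets ?N = sigma_sets ((space (Prb S) \<times> {0..t}) \<times> UNIV) E"
  proof -
    have "sets ?N = sets (sigma (space (predictable S t) \<times> space borel) E)"
      unfolding E_def
    proof (rule sets_pair_eq)
      show "sets borel = sigma_sets (space borel) (sets (borel :: 'e measure))" by (rule sets.sigma_sets_eq[symmetric])
      show "countable ?C" "?C \<subseteq> E0" "\<Union>?C = space (predictable S t)" using C by auto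
      show "countable {UNIV :: 'e set}" "{UNIV :: 'e set} \<subseteq> sets borel" "\<Union>{UNIV :: 'e set} = space borel" by auto
    qed (use E0_sub E0_sets in auto)
    then show ?thesis using E_sub by simp
  qed
  have eq: "emeasure (point_law t j) X = emeasure (compensator_law t j) X" if "X \<in> E" for X
  proof -
    obtain a D where X: "X = a \<times> D" "a \<in> E0" and D: "D \<in> sets borel" using \<open>X \<in> E\<close> unfolding E_def by blast
    have XN: "X \<in> sets ?N" using E_sets that by auto
    have e1: "emeasure (point_law t j) X = (\<integral>\<^sup>+\<omega>. indicator {\<omega>. jump S (Suc j) \<omega> < \<infinity>} \<omega>
      * (indicator X ((\<omega>, rjump S (Suc j) \<omega>), mark S (Suc j) \<omega>) * indicator {0..t} (rjump S (Suc j) \<omega>)) \<partial>Prb S)"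
      using nn_integral_point_law(1)[OF t j, of "indicator X"] XN by (simp add: point_law_def)
    have e2: "emeasure (compensator_law t j) X = (\<integral>\<^sup>+\<omega>. \<integral>\<^sup>+v. compensator_weight j (\<omega>, v) *
      (\<integral>\<^sup>+\<theta>. indicator X ((\<omega>, v), \<theta>) * indicator {0..t} v \<partial>trans_law S (mark S j \<omega>) (max 0 v)) \<partial>lborel \<partial>Prb S)"
      using nn_integral_compensator_law(1,3)[OF t j, of "indicator X"] XN by simp
    show ?thesis
    proof (cases "\<exists>G. a = G \<times> {0} \<and> G \<in> sets (filt S 0)")
      case True
      then obtain G where a: "a = G \<times> {0}" by auto
      have "indicator {\<omega>. jump S (Suc j) \<omega> < \<infinity>} \<omega>
        * (indicator X ((\<omega>, rjump S (Suc j) \<omega>), mark S (Suc j) \<omega>) * indicator {0..t} (rjump S (Suc j) \<omega>)) = (0::ennreal)"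
        if "\<omega> \<in> space (Prb S)" for \<omega>
        using jump_pos[of "Suc j" \<omega>] ereal_rjump[of "Suc j" \<omega>] j that
        by (cases "jump S (Suc j) \<omega> < \<infinity>") (auto simp: X a split: split_indicator)
      then have "emeasure (point_law t j) X = (\<integral>\<^sup>+\<omega>. 0 \<partial>Prb S)" unfolding e1 by (intro nn_integral_cong)
      moreover have "emeasure (compensator_law t j) X = (\<integral>\<^sup>+\<omega>. \<integral>\<^sup>+(v::real). 0 \<partial>lborel \<partial>Prb S)"
        unfolding e2
      proof (rule nn_integral_cong, rule nn_integral_cong_AE)
        fix \<omega>
        show "AE v in lborel. compensator_weight j (\<omega>, v) *
          (\<integral>\<^sup>+\<theta>. indicator X ((\<omega>, v), \<theta>) * indicator {0..t} v \<partial>trans_law S (mark S j \<omega>) (max 0 v)) = 0"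
          using AE_lborel_singleton[of 0] by eventually_elim (simp add: X a)
      qed
      ultimately show ?thesis by simp
    next
      case False
      then obtain G r s where a: "a = G \<times> {r<..s}" "0 \<le> r" "r \<le> s" "s \<le> t" "G \<in> sets (filt S r)"
        using X(2) by (auto simp: E0_def)
      have "emeasure (point_law t j) X = (\<integral>\<^sup>+\<omega>. indicator {\<omega>. jump S (Suc j) \<omega> < \<infinity>} \<omega> * (indicator G \<omega> * indicator {r<..s} (rjump S (Suc j) \<omega>) * indicator D (mark S (Suc j) \<omega>)) \<partial>Prb S)"
        unfolding e1 unfolding X a(1) using a(2-4) by (intro nn_integral_cong) (auto split: split_indicator)
      also have "\<dots> = (\<integral>\<^sup>+\<omega>. \<integral>\<^sup>+v. indicator {v. jump S j \<omega> < ereal v \<and> ereal v \<le> jump S (Suc j) \<omega>} v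
         * ennreal (rate S (mark S j \<omega>) (max 0 v))
         * (indicator G \<omega> * indicator {r<..s} v * emeasure (trans_law S (mark S j \<omega>) (max 0 v)) D) \<partial>lborel \<partial>Prb S)"
        by (rule next_point_law[OF j a(2,5) D])
      also have "\<dots> = emeasure (compensator_law t j) X"
        unfolding e2
      proof (rule nn_integral_cong, rule nn_integral_cong)
        fix \<omega> and v :: real
        have "D \<in> sets (trans_law S (mark S j \<omega>) (max 0 v))" using D sets_trans_law[of "max 0 v"] by simp
        then have "emeasure (trans_law S (mark S j \<omega>) (max 0 v)) D = (\<integral>\<^sup>+\<theta>. indicator D \<theta> \<partial>trans_law S (mark S j \<omega>) (max 0 v))"
          by simp
        then have "indicator G \<omega> * indicator {r<..s} v * emeasure (trans_law S (mark S j \<omega>) (max 0 v)) D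
          = (\<integral>\<^sup>+\<theta>. indicator X ((\<omega>, v), \<theta>) * indicator {0..t} v \<partial>trans_law S (mark S j \<omega>) (max 0 v))"
          using a(2-4) by (auto simp: X a(1) indicator_times split: split_indicator)
        then show "indicator {v. jump S j \<omega> < ereal v \<and> ereal v \<le> jump S (Suc j) \<omega>} v
           * ennreal (rate S (mark S j \<omega>) (max 0 v))
           * (indicator G \<omega> * indicator {r<..s} v * emeasure (trans_law S (mark S j \<omega>) (max 0 v)) D)
          = compensator_weight j (\<omega>, v) * (\<integral>\<^sup>+\<theta>. indicator X ((\<omega>, v), \<theta>) * indicator {0..t} v \<partial>trans_law S (mark S j \<omega>) (max 0 v))"
          by (simp add: compensator_weight_def indicator_def)
      qed
      finally show ?thesis .
    qed
  qed
  have fin: "emeasure (point_law t j) X \<noteq> \<infinity>" if "X \<in> sets ?N" for X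
  proof -
    have "emeasure (point_law t j) X = (\<integral>\<^sup>+\<omega>. indicator {\<omega>. jump S (Suc j) \<omega> < \<infinity>} \<omega>
      * (indicator X ((\<omega>, rjump S (Suc j) \<omega>), mark S (Suc j) \<omega>) * indicator {0..t} (rjump S (Suc j) \<omega>)) \<partial>Prb S)"
      using nn_integral_point_law(1)[OF t j, of "indicator X"] that by (simp add: point_law_def)
    also have "\<dots> \<le> (\<integral>\<^sup>+\<omega>. 1 \<partial>Prb S)"
      by (intro nn_integral_mono) (auto split: split_indicator)
    finally have "emeasure (point_law t j) X \<le> (\<integral>\<^sup>+\<omega>. 1 \<partial>Prb S)" .
    then show ?thesis by (auto simp: emeasure_space_1 top_unique)
  qed
  show ?thesis
  proof (rule measure_eqI_generator_eq_countable[where E=E and \<Omega>="(space (Prb S) \<times> {0..t}) \<times> UNIV" and A="(\<lambda>c. c \<times> UNIV) ` ?C"])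
    show "Int_stable E"
    proof (rule Int_stableI)
      fix x y assume "x \<in> E" "y \<in> E"
      then obtain a D b D' where *: "x = a \<times> D" "y = b \<times> D'" "a \<in> E0" "b \<in> E0" "D \<in> sets borel" "D' \<in> sets borel"
        by (auto simp: E_def)
      \<comment> \<open>Disjoint generators meet in the empty set, which is a generator itself, with
        empty \<open>G\<close>.\<close>
      have emp: "{} \<in> E0" unfolding E0_def by (auto intro!: exI[of _ "{}"])
      have "a \<inter> b \<in> E0"
      proof (cases "\<exists>G. a = G \<times> {0} \<and> G \<in> sets (filt S 0)")
        case True
        then obtain G where a: "a = G \<times> {0}" "G \<in> sets (filt S 0)" by auto
        show ?thesis
        proof (cases "\<exists>G. b = G \<times> {0} \<and> G \<in> sets (filt S 0)")
          case True
          then obtain G' where "b = G' \<times> {0}" "G' \<in> sets (filt S 0)" by auto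
          then have "a \<inter> b = (G \<inter> G') \<times> {0}" "G \<inter> G' \<in> sets (filt S 0)" using a by auto
          then show ?thesis unfolding E0_def by blast
        next
          case False
          then have "a \<inter> b = {}" using *(4) a by (auto simp: E0_def)
          then show ?thesis using emp by simp
        qed
      next
        case False
        then obtain G r s where a: "a = G \<times> {r<..s}" "0 \<le> r" "r \<le> s" "s \<le> t" "G \<in> sets (filt S r)"
          using *(3) by (auto simp: E0_def)
        show ?thesis
        proof (cases "\<exists>G. b = G \<times> {0} \<and> G \<in> sets (filt S 0)")
          case True
          then have "a \<inter> b = {}" using a by auto
          then show ?thesis using emp by simp
        next
          case False
          then obtain G' r' s' where b: "b = G' \<times> {r'<..s'}" "0 \<le> r'" "r' \<le> s'" "s' \<le> t" "G' \<in> sets (filt S r')"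
            using *(4) by (auto simp: E0_def)
          have ab: "a \<inter> b = (G \<inter> G') \<times> {max r r'<..min s s'}" using a b by auto
          \<comment> \<open>The intersection starts at the later of the two left endpoints, and both
            events are known by then.\<close>
          have "G \<inter> G' \<in> sets (filt S (max r r'))"
            using a(5) b(5) filt_mono[of r "max r r'"] filt_mono[of r' "max r r'"] by auto
          show ?thesis
          proof (cases "max r r' \<le> min s s'")
            case True
            then show ?thesis unfolding ab E0_def using a(2,4) \<open>G \<inter> G' \<in> _\<close>
              by (intro UnI2 CollectI exI[of _ "G \<inter> G'"] exI[of _ "max r r'"] exI[of _ "min s s'"]) auto
          next
            case False
            then have "a \<inter> b = {}" unfolding ab by auto
            then show ?thesis using emp by simp
          qed
        qed
      qed
      moreover have "x \<inter> y = (a \<inter> b) \<times> (D \<inter> D')" using * by auto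
      ultimately show "x \<inter> y \<in> E" using * unfolding E_def by blast
    qed
    show "sets (point_law t j) = sigma_sets ((space (Prb S) \<times> {0..t}) \<times> UNIV) E" using E_sets by (simp add: point_law_def)
    show "sets (compensator_law t j) = sigma_sets ((space (Prb S) \<times> {0..t}) \<times> UNIV) E"
      using E_sets nn_integral_compensator_law(3)[OF t j, of "\<lambda>_. 0"] by simp
    have "(UNIV :: 'e set) \<in> sets borel" by simp
    then have A: "(\<lambda>c. c \<times> UNIV) ` ?C \<subseteq> E" unfolding E_def using C(1) by blast
    then show "(\<lambda>c. c \<times> UNIV) ` ?C \<subseteq> E" .
    show "\<Union> ((\<lambda>c. c \<times> UNIV) ` ?C) = (space (Prb S) \<times> {0..t}) \<times> UNIV" using C(2) by auto
    show "emeasure (point_law t j) a \<noteq> \<infinity>" if "a \<in> (\<lambda>c. c \<times> UNIV) ` ?C" for a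
      using that A E_sets by (intro fin) auto
  qed (use E_sub eq in auto)
qed

text \<open>Each inner integral is a finite sum over the stages, and stage by stage the expectations
  are integrals against the equal measures \<open>point_law\<close> and
  \<open>compensator_law\<close>. Measurability in \<open>\<omega>\<close> is recorded because both
  integrals serve later as random variables.\<close>

theorem compensator_formula:
  assumes t: "0 \<le> t" and \<Phi>: "\<Phi> \<in> borel_measurable (predictable S t \<Otimes>\<^sub>M borel)"
  shows "(\<integral>\<^sup>+\<omega>. (\<integral>\<^sup>+p. \<Phi> ((\<omega>, fst p), snd p) * indicator ({0..t} \<times> UNIV) p \<partial>q_meas S \<omega>) \<partial>Prb S)
    = (\<integral>\<^sup>+\<omega>. (\<integral>\<^sup>+p. \<Phi> ((\<omega>, fst p), snd p) * indicator ({0..t} \<times> UNIV) p \<partial>q_hat S \<omega>) \<partial>Prb S)"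
    and "(\<lambda>\<omega>. \<integral>\<^sup>+p. \<Phi> ((\<omega>, fst p), snd p) * indicator ({0..t} \<times> UNIV) p \<partial>q_meas S \<omega>) \<in> borel_measurable (Prb S)"
    and "(\<lambda>\<omega>. \<integral>\<^sup>+p. \<Phi> ((\<omega>, fst p), snd p) * indicator ({0..t} \<times> UNIV) p \<partial>q_hat S \<omega>) \<in> borel_measurable (Prb S)"
proof -
  let ?q = "\<lambda>j \<omega>. indicator {\<omega>. jump S (Suc j) \<omega> < \<infinity>} \<omega>
    * (\<Phi> ((\<omega>, rjump S (Suc j) \<omega>), mark S (Suc j) \<omega>) * indicator {0..t} (rjump S (Suc j) \<omega>))"
  let ?c = "\<lambda>j \<omega>. \<integral>\<^sup>+v. compensator_weight j (\<omega>, v) *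
     (\<integral>\<^sup>+\<theta>. \<Phi> ((\<omega>, v), \<theta>) * indicator {0..t} v \<partial>trans_law S (mark S j \<omega>) (max 0 v)) \<partial>lborel"
  have q: "(\<integral>\<^sup>+p. \<Phi> ((\<omega>, fst p), snd p) * indicator ({0..t} \<times> UNIV) p \<partial>q_meas S \<omega>) = (\<Sum>j<max_jumps S. ?q j \<omega>)"
    if "\<omega> \<in> space (Prb S)" for \<omega>
    using measurable_section_indicator[OF t that \<Phi>] by (subst nn_integral_q_meas) (auto simp: indicator_times)
  have c: "(\<integral>\<^sup>+p. \<Phi> ((\<omega>, fst p), snd p) * indicator ({0..t} \<times> UNIV) p \<partial>q_hat S \<omega>) = (\<Sum>j<max_jumps S. ?c j \<omega>)"
    if \<omega>: "\<omega> \<in> space (Prb S)" for \<omega>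
  proof -
    have "(\<integral>\<^sup>+p. \<Phi> ((\<omega>, fst p), snd p) * indicator ({0..t} \<times> UNIV) p \<partial>q_hat S \<omega>)
      = (\<integral>\<^sup>+v. (\<Sum>j<max_jumps S. compensator_weight j (\<omega>, v) *
        (\<integral>\<^sup>+\<theta>. \<Phi> ((\<omega>, v), \<theta>) * indicator {0..t} v \<partial>trans_law S (mark S j \<omega>) (max 0 v))) \<partial>lborel)"
      using measurable_section_indicator[OF t \<omega> \<Phi>] \<omega>
      by (subst nn_integral_q_hat) (auto simp: indicator_times compensator_weight_def indicator_def)
    also have "\<dots> = (\<Sum>j<max_jumps S. ?c j \<omega>)"
    proof (rule nn_integral_sum)
      fix j assume "j \<in> {..<max_jumps S}"
      have [measurable]: "(\<lambda>v. \<integral>\<^sup>+\<theta>. \<Phi> ((\<omega>, v), \<theta>) * indicator {0..t} v \<partial>trans_law S (mark S j \<omega>) (max 0 v)) \<in> borel_measurable borel"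
        using measurable_section_indicator[OF t \<omega> \<Phi>]
        by (intro nn_integral_measurable_subprob_algebra2[OF _ measurable_trans_law']) (simp add: case_prod_beta indicator_times)
      have [measurable]: "(\<lambda>v. compensator_weight j (\<omega>, v)) \<in> borel_measurable borel"
        using \<omega> measurable_compensator_weight[of j] \<open>j \<in> _\<close> by (intro measurable_compose[OF measurable_Pair1']) auto
      show "(\<lambda>v. compensator_weight j (\<omega>, v) * (\<integral>\<^sup>+\<theta>. \<Phi> ((\<omega>, v), \<theta>) * indicator {0..t} v \<partial>trans_law S (mark S j \<omega>) (max 0 v))) \<in> borel_measurable lborel"
        by measurable
    qed
    finally show ?thesis .
  qed
  have mq: "?q j \<in> borel_measurable (Prb S)" and mc: "?c j \<in> borel_measurable (Prb S)" if "j < max_jumps S" for j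
    using nn_integral_point_law(2)[OF t that \<Phi>] nn_integral_compensator_law(2)[OF t that \<Phi>] by auto
  show "(\<lambda>\<omega>. \<integral>\<^sup>+p. \<Phi> ((\<omega>, fst p), snd p) * indicator ({0..t} \<times> UNIV) p \<partial>q_meas S \<omega>) \<in> borel_measurable (Prb S)"
    by (rule iffD2[OF measurable_cong[OF q]]) (auto simp only: lessThan_iff intro!: borel_measurable_sum mq)
  show "(\<lambda>\<omega>. \<integral>\<^sup>+p. \<Phi> ((\<omega>, fst p), snd p) * indicator ({0..t} \<times> UNIV) p \<partial>q_hat S \<omega>) \<in> borel_measurable (Prb S)"
    by (rule iffD2[OF measurable_cong[OF c]]) (auto simp only: lessThan_iff intro!: borel_measurable_sum mc)
  have "(\<integral>\<^sup>+\<omega>. (\<integral>\<^sup>+p. \<Phi> ((\<omega>, fst p), snd p) * indicator ({0..t} \<times> UNIV) p \<partial>q_meas S \<omega>) \<partial>Prb S) = (\<integral>\<^sup>+\<omega>. (\<Sum>j<max_jumps S. ?q j \<omega>) \<partial>Prb S)"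
    by (intro nn_integral_cong q)
  also have "\<dots> = (\<Sum>j<max_jumps S. \<integral>\<^sup>+\<omega>. ?q j \<omega> \<partial>Prb S)"
    by (rule nn_integral_sum) (use mq in auto)
  also have "\<dots> = (\<Sum>j<max_jumps S. \<integral>\<^sup>+\<omega>. ?c j \<omega> \<partial>Prb S)"
  proof (rule sum.cong[OF refl])
    fix j assume "j \<in> {..<max_jumps S}"
    then have j: "j < max_jumps S" by simp
    show "(\<integral>\<^sup>+\<omega>. ?q j \<omega> \<partial>Prb S) = (\<integral>\<^sup>+\<omega>. ?c j \<omega> \<partial>Prb S)"
      using nn_integral_point_law(1)[OF t j \<Phi>] nn_integral_compensator_law(1)[OF t j \<Phi>] point_law_eq_compensator_law[OF t j] by simp
  qed
  also have "\<dots> = (\<integral>\<^sup>+\<omega>. (\<Sum>j<max_jumps S. ?c j \<omega>) \<partial>Prb S)"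
    by (rule nn_integral_sum[symmetric]) (use mc in auto)
  also have "\<dots> = (\<integral>\<^sup>+\<omega>. (\<integral>\<^sup>+p. \<Phi> ((\<omega>, fst p), snd p) * indicator ({0..t} \<times> UNIV) p \<partial>q_hat S \<omega>) \<partial>Prb S)"
    by (intro nn_integral_cong c[symmetric])
  finally show "(\<integral>\<^sup>+\<omega>. (\<integral>\<^sup>+p. \<Phi> ((\<omega>, fst p), snd p) * indicator ({0..t} \<times> UNIV) p \<partial>q_meas S \<omega>) \<partial>Prb S)
    = (\<integral>\<^sup>+\<omega>. (\<integral>\<^sup>+p. \<Phi> ((\<omega>, fst p), snd p) * indicator ({0..t} \<times> UNIV) p \<partial>q_hat S \<omega>) \<partial>Prb S)" .
qed

end

section \<open>The energy identity along a path\<close>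

text \<open>Fubini on the sectors \<open>\<tau> y < \<tau> x\<close>, \<open>\<tau> x < \<tau> y\<close> and the diagonal.\<close>

lemma inner_integrals_split:
  fixes h1 h2 :: "'a \<Rightarrow> 'v::euclidean_space" and \<tau> :: "'a \<Rightarrow> real"
  assumes fin: "finite_measure M1" "finite_measure M2"
    and h: "integrable M1 h1" "integrable M2 h2"
    and \<tau>[measurable]: "\<tau> \<in> borel_measurable M1" "\<tau> \<in> borel_measurable M2"
  shows "inner (\<integral>x. h1 x \<partial>M1) (\<integral>y. h2 y \<partial>M2)
      = (\<integral>x. inner (h1 x) (\<integral>y. indicator {y. \<tau> y < \<tau> x} y *\<^sub>R h2 y \<partial>M2) \<partial>M1)
      + (\<integral>y. inner (h2 y) (\<integral>x. indicator {x. \<tau> x < \<tau> y} x *\<^sub>R h1 x \<partial>M1) \<partial>M2)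
      + (\<integral>x. inner (h1 x) (\<integral>y. indicator {y. \<tau> y = \<tau> x} y *\<^sub>R h2 y \<partial>M2) \<partial>M1)"
    and "integrable M1 (\<lambda>x. inner (h1 x) (\<integral>y. indicator {y. \<tau> y < \<tau> x} y *\<^sub>R h2 y \<partial>M2))"
    and "integrable M1 (\<lambda>x. inner (h1 x) (\<integral>y. indicator {y. \<tau> y = \<tau> x} y *\<^sub>R h2 y \<partial>M2))"
proof -
  interpret M1: finite_measure M1 by fact
  interpret M2: finite_measure M2 by fact
  interpret P: pair_sigma_finite M1 M2 by unfold_locales
  have [measurable]: "h1 \<in> borel_measurable M1" "h2 \<in> borel_measurable M2" using h by auto
  let ?F = "\<lambda>p. inner (h1 (fst p)) (h2 (snd p))"
  have F: "integrable (M1 \<Otimes>\<^sub>M M2) ?F"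
  proof (rule P.Fubini_integrable)
    have "integrable M1 (\<lambda>x. norm (h1 x) * (\<integral>y. norm (h2 y) \<partial>M2))" using h by simp
    then show "integrable M1 (\<lambda>x. \<integral>y. norm (?F (x, y)) \<partial>M2)"
    proof (rule Bochner_Integration.integrable_bound)
      show "AE x in M1. norm (\<integral>y. norm (?F (x, y)) \<partial>M2) \<le> norm (norm (h1 x) * (\<integral>y. norm (h2 y) \<partial>M2))"
      proof (rule AE_I2)
        fix x
        have "(\<integral>y. norm (?F (x, y)) \<partial>M2) \<le> (\<integral>y. norm (h1 x) * norm (h2 y) \<partial>M2)"
          using h by (intro integral_mono) (auto simp: Cauchy_Schwarz_ineq2)
        moreover have "0 \<le> (\<integral>y. norm (?F (x, y)) \<partial>M2)" by (rule integral_nonneg_AE) simp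
        ultimately show "norm (\<integral>y. norm (?F (x, y)) \<partial>M2) \<le> norm (norm (h1 x) * (\<integral>y. norm (h2 y) \<partial>M2))"
          by simp
      qed
    qed measurable
    show "AE x in M1. integrable M2 (\<lambda>y. ?F (x, y))" using h by (auto intro!: AE_I2)
  qed measurable
  have S[measurable]: "{p \<in> space (M1 \<Otimes>\<^sub>M M2). \<tau> (snd p) < \<tau> (fst p)} \<in> sets (M1 \<Otimes>\<^sub>M M2)"
    "{p \<in> space (M1 \<Otimes>\<^sub>M M2). \<tau> (fst p) < \<tau> (snd p)} \<in> sets (M1 \<Otimes>\<^sub>M M2)"
    "{p \<in> space (M1 \<Otimes>\<^sub>M M2). \<tau> (snd p) = \<tau> (fst p)} \<in> sets (M1 \<Otimes>\<^sub>M M2)"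
    by measurable
  let ?A = "\<lambda>p. indicator {p. \<tau> (snd p) < \<tau> (fst p)} p *\<^sub>R ?F p"
    and ?B = "\<lambda>p. indicator {p. \<tau> (fst p) < \<tau> (snd p)} p *\<^sub>R ?F p"
    and ?C = "\<lambda>p. indicator {p. \<tau> (snd p) = \<tau> (fst p)} p *\<^sub>R ?F p"
  have iA: "integrable (M1 \<Otimes>\<^sub>M M2) ?A" and iB: "integrable (M1 \<Otimes>\<^sub>M M2) ?B" and iC: "integrable (M1 \<Otimes>\<^sub>M M2) ?C"
    by (rule Bochner_Integration.integrable_bound[OF F]; auto simp: indicator_def intro!: measurable)+
  have "inner (\<integral>x. h1 x \<partial>M1) (\<integral>y. h2 y \<partial>M2) = (\<integral>x. inner (h1 x) (\<integral>y. h2 y \<partial>M2) \<partial>M1)"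
    using h by simp
  also have "\<dots> = (\<integral>x. \<integral>y. ?F (x, y) \<partial>M2 \<partial>M1)" using h by simp
  also have "\<dots> = integral\<^sup>L (M1 \<Otimes>\<^sub>M M2) ?F" by (rule P.integral_fst'[OF F])
  also have "\<dots> = (\<integral>p. ?A p + ?B p + ?C p \<partial>(M1 \<Otimes>\<^sub>M M2))"
    by (intro Bochner_Integration.integral_cong) (auto split: split_indicator)
  also have "\<dots> = integral\<^sup>L (M1 \<Otimes>\<^sub>M M2) ?A + integral\<^sup>L (M1 \<Otimes>\<^sub>M M2) ?B + integral\<^sup>L (M1 \<Otimes>\<^sub>M M2) ?C"
    using iA iB iC by simp
  finally have eq: "inner (\<integral>x. h1 x \<partial>M1) (\<integral>y. h2 y \<partial>M2) = \<dots>" .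
  have i2: "integrable M2 (\<lambda>y. indicator {y. R (\<tau> y)} y *\<^sub>R h2 y)" if [measurable]: "Measurable.pred borel R" for R
    by (rule Bochner_Integration.integrable_bound[OF h(2)]) (auto simp: indicator_def)
  have i1: "integrable M1 (\<lambda>y. indicator {y. R (\<tau> y)} y *\<^sub>R h1 y)" if [measurable]: "Measurable.pred borel R" for R
    by (rule Bochner_Integration.integrable_bound[OF h(1)]) (auto simp: indicator_def)
  have eA: "(\<integral>y. ?A (x, y) \<partial>M2) = inner (h1 x) (\<integral>y. indicator {y. \<tau> y < \<tau> x} y *\<^sub>R h2 y \<partial>M2)" for x
    using i2[of "\<lambda>s. s < \<tau> x"] by (simp flip: integral_inner_right add: indicator_def)
  have eC: "(\<integral>y. ?C (x, y) \<partial>M2) = inner (h1 x) (\<integral>y. indicator {y. \<tau> y = \<tau> x} y *\<^sub>R h2 y \<partial>M2)" for x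
    using i2[of "\<lambda>s. s = \<tau> x"] by (simp flip: integral_inner_right add: indicator_def)
  have eB: "(\<integral>x. ?B (x, y) \<partial>M1) = inner (h2 y) (\<integral>x. indicator {x. \<tau> x < \<tau> y} x *\<^sub>R h1 x \<partial>M1)" for y
    using i1[of "\<lambda>s. s < \<tau> y"] by (simp flip: integral_inner_right add: indicator_def inner_commute)
  show "integrable M1 (\<lambda>x. inner (h1 x) (\<integral>y. indicator {y. \<tau> y < \<tau> x} y *\<^sub>R h2 y \<partial>M2))"
    using P.integrable_fst'[OF iA] unfolding eA .
  show "integrable M1 (\<lambda>x. inner (h1 x) (\<integral>y. indicator {y. \<tau> y = \<tau> x} y *\<^sub>R h2 y \<partial>M2))"
    using P.integrable_fst'[OF iC] unfolding eC .
  have "integral\<^sup>L (M1 \<Otimes>\<^sub>M M2) ?B = (\<integral>y. \<integral>x. ?B (x, y) \<partial>M1 \<partial>M2)"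
    using P.integral_snd[of "\<lambda>x y. ?B (x, y)"] iB unfolding case_prod_unfold prod.collapse by simp
  then show "inner (\<integral>x. h1 x \<partial>M1) (\<integral>y. h2 y \<partial>M2)
      = (\<integral>x. inner (h1 x) (\<integral>y. indicator {y. \<tau> y < \<tau> x} y *\<^sub>R h2 y \<partial>M2) \<partial>M1)
      + (\<integral>y. inner (h2 y) (\<integral>x. indicator {x. \<tau> x < \<tau> y} x *\<^sub>R h1 x \<partial>M1) \<partial>M2)
      + (\<integral>x. inner (h1 x) (\<integral>y. indicator {y. \<tau> y = \<tau> x} y *\<^sub>R h2 y \<partial>M2) \<partial>M1)"
    unfolding eq P.integral_fst'[OF iA, symmetric] P.integral_fst'[OF iC, symmetric] eA eB eC by simp
qed

text \<open>The square of the sum expands into pairs of indices. The two strict sectors of the pair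
  \<open>(i, k)\<close> contribute \<open>A i k\<close> and \<open>A k i\<close>; summed over all
  pairs these coincide, whence the factor 2. The constant \<open>c\<close> joins the integral over
  the strict past.\<close>

lemma norm_square_sum_integrals:
  fixes h :: "'i \<Rightarrow> 'a \<Rightarrow> 'v::euclidean_space" and \<tau> :: "'a \<Rightarrow> real"
  assumes I: "finite I" and fin: "\<And>i. i \<in> I \<Longrightarrow> finite_measure (M i)"
    and h: "\<And>i. i \<in> I \<Longrightarrow> integrable (M i) (h i)"
    and \<tau>: "\<And>i. i \<in> I \<Longrightarrow> \<tau> \<in> borel_measurable (M i)"
  shows "(norm (c + (\<Sum>i\<in>I. \<integral>x. h i x \<partial>M i)))\<^sup>2 = (norm c)\<^sup>2
    + 2 * (\<Sum>i\<in>I. \<integral>x. inner (h i x) (c + (\<Sum>k\<in>I. \<integral>y. indicator {y. \<tau> y < \<tau> x} y *\<^sub>R h k y \<partial>M k)) \<partial>M i)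
    + (\<Sum>i\<in>I. \<Sum>k\<in>I. \<integral>x. inner (h i x) (\<integral>y. indicator {y. \<tau> y = \<tau> x} y *\<^sub>R h k y \<partial>M k) \<partial>M i)"
proof -
  define D where "D = (\<Sum>i\<in>I. \<integral>x. h i x \<partial>M i)"
  define A where "A i k = (\<integral>x. inner (h i x) (\<integral>y. indicator {y. \<tau> y < \<tau> x} y *\<^sub>R h k y \<partial>M k) \<partial>M i)" for i k
  define C where "C i k = (\<integral>x. inner (h i x) (\<integral>y. indicator {y. \<tau> y = \<tau> x} y *\<^sub>R h k y \<partial>M k) \<partial>M i)" for i k
  have "inner D D = (\<Sum>i\<in>I. \<Sum>k\<in>I. inner (\<integral>x. h i x \<partial>M i) (\<integral>y. h k y \<partial>M k))"
    unfolding D_def by (simp add: inner_sum_left inner_sum_right) (rule sum.swap)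
  also have "\<dots> = (\<Sum>i\<in>I. \<Sum>k\<in>I. A i k + A k i + C i k)"
    unfolding A_def C_def by (intro sum.cong refl inner_integrals_split fin h \<tau>)
  also have "\<dots> = 2 * (\<Sum>i\<in>I. \<Sum>k\<in>I. A i k) + (\<Sum>i\<in>I. \<Sum>k\<in>I. C i k)"
    using sum.swap[of "\<lambda>i k. A k i" I I] by (simp add: sum.distrib)
  finally have DD: "inner D D = \<dots>" .
  have "(\<integral>x. inner (h i x) (c + (\<Sum>k\<in>I. \<integral>y. indicator {y. \<tau> y < \<tau> x} y *\<^sub>R h k y \<partial>M k)) \<partial>M i)
      = inner (\<integral>x. h i x \<partial>M i) c + (\<Sum>k\<in>I. A i k)" if i: "i \<in> I" for i
  proof -
    have iA: "integrable (M i) (\<lambda>x. inner (h i x) (\<integral>y. indicator {y. \<tau> y < \<tau> x} y *\<^sub>R h k y \<partial>M k))" if "k \<in> I" for k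
      using i that by (intro inner_integrals_split(2) fin h \<tau>)
    show ?thesis
      using h[OF i] iA unfolding A_def by (simp add: inner_add_right inner_sum_right)
  qed
  then have S: "(\<Sum>i\<in>I. \<integral>x. inner (h i x) (c + (\<Sum>k\<in>I. \<integral>y. indicator {y. \<tau> y < \<tau> x} y *\<^sub>R h k y \<partial>M k)) \<partial>M i)
      = inner D c + (\<Sum>i\<in>I. \<Sum>k\<in>I. A i k)"
    by (simp add: sum.distrib D_def inner_sum_left)
  have "(norm (c + D))\<^sup>2 = (norm c)\<^sup>2 + 2 * inner D c + inner D D"
    by (simp add: power2_norm_eq_inner inner_add_left inner_add_right inner_commute)
  then show ?thesis unfolding S DD D_def[symmetric] C_def[symmetric] by simp
qed

text \<open>For \<open>s n\<close> tending to \<open>l\<close> strictly from below, the sets where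
  \<open>\<tau>\<close> is at most \<open>s n\<close> exhaust the set where \<open>\<tau>\<close> is
  less than \<open>l\<close>. So the left limit of an indefinite integral is the integral over the
  strict past.\<close>

lemma tendsto_integral_below:
  fixes h :: "'a \<Rightarrow> 'v::euclidean_space" and \<tau> :: "'a \<Rightarrow> real"
  assumes h: "integrable M h" and \<tau>[measurable]: "\<tau> \<in> borel_measurable M"
    and s: "\<And>n. s n < (l::real)" "s \<longlonglongrightarrow> l"
  shows "(\<lambda>n. \<integral>x. indicator {x. \<tau> x \<le> s n} x *\<^sub>R h x \<partial>M) \<longlonglongrightarrow> (\<integral>x. indicator {x. \<tau> x < l} x *\<^sub>R h x \<partial>M)"
proof (rule integral_dominated_convergence[where w="\<lambda>x. norm (h x)"])
  have [measurable]: "h \<in> borel_measurable M" using h by auto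
  show "(\<lambda>x. indicator {x. \<tau> x < l} x *\<^sub>R h x) \<in> borel_measurable M" by measurable
  show "(\<lambda>x. indicator {x. \<tau> x \<le> s n} x *\<^sub>R h x) \<in> borel_measurable M" for n by measurable
  show "AE x in M. norm (indicator {x. \<tau> x \<le> s n} x *\<^sub>R h x) \<le> norm (h x)" for n
    by (auto split: split_indicator)
  show "AE x in M. (\<lambda>n. indicator {x. \<tau> x \<le> s n} x *\<^sub>R h x) \<longlonglongrightarrow> indicator {x. \<tau> x < l} x *\<^sub>R h x"
  proof (rule AE_I2)
    fix x
    have "\<forall>\<^sub>F n in sequentially. indicator {x. \<tau> x \<le> s n} x *\<^sub>R h x = indicator {x. \<tau> x < l} x *\<^sub>R h x"
    proof (cases "\<tau> x < l")
      case True
      then have "\<forall>\<^sub>F n in sequentially. \<tau> x < s n" using s(2) by (auto dest: order_tendstoD)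
      then show ?thesis by eventually_elim (use True in auto)
    next
      case False
      then have "\<not> \<tau> x \<le> s n" for n using s(1)[of n] by auto
      then show ?thesis using False by (intro always_eventually) auto
    qed
    then show "(\<lambda>n. indicator {x. \<tau> x \<le> s n} x *\<^sub>R h x) \<longlonglongrightarrow> indicator {x. \<tau> x < l} x *\<^sub>R h x"
      by (rule tendsto_eventually)
  qed
qed (use h in auto)

text \<open>
  A path of finite variation with finitely many jumps: the absolutely continuous part has density
  \<open>b\<close>, the point measure \<open>Q\<close> carries the jumps, and \<open>H\<close> has no atoms in time.
\<close>

locale jump_path =
  fixes t :: real and b :: "real \<Rightarrow> 'v::euclidean_space" and f :: "real \<times> 'e::metric_space \<Rightarrow> 'v"
    and Q H :: "(real \<times> 'e) measure" and K :: "nat set" and \<tau> :: "nat \<Rightarrow> real" and m :: "nat \<Rightarrow> 'e"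
    and D :: "real \<Rightarrow> 'v"
  assumes t: "0 \<le> t"
    and K: "finite K" "inj_on \<tau> K"
    and Q: "Q = distr (count_space K) (borel \<Otimes>\<^sub>M borel) (\<lambda>j. (\<tau> j, m j))"
    and sets_H: "sets H = sets (borel \<Otimes>\<^sub>M borel)"
    and H_finite: "emeasure H ({0<..t} \<times> UNIV) < \<infinity>"
    and H_null: "\<And>s. emeasure H ({s} \<times> UNIV) = 0"
    and b: "set_integrable lborel {0..t} b"
    and fQ: "set_integrable Q ({0<..t} \<times> UNIV) f"
    and fH: "set_integrable H ({0<..t} \<times> UNIV) f"
    and D: "\<And>r. r \<in> {0..t} \<Longrightarrow> D r = D 0 + (LINT s:{0..r}|lborel. b s)
      + ((LINT p:{0<..r} \<times> UNIV|Q. f p) - (LINT p:{0<..r} \<times> UNIV|H. f p))"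
begin

text \<open>Index 0 is the drift, lifted to the product space by a dummy mark; 1 the jumps; 2 the
  compensator. On one space with the common clock \<open>fst\<close> all three fit
  \<open>norm_square_sum_integrals\<close>, which asks for finite measures; hence the restriction to
  \<open>{0<..t}\<close>.\<close>

definition M :: "nat \<Rightarrow> (real \<times> 'e) measure" where
  "M i = (if i = 0 then distr (density lborel (indicator {0<..t})) (borel \<Otimes>\<^sub>M borel) (\<lambda>s. (s, undefined))
    else if i = 1 then Q else density H (indicator ({0<..t} \<times> UNIV)))"

text \<open>The minus sign of the compensator sits in the integrand, because \<open>M 2\<close> is a
  nonnegative measure.\<close>

definition g :: "nat \<Rightarrow> real \<times> 'e \<Rightarrow> 'v" where
  "g i p = (if i = 0 then indicator ({0<..t} \<times> UNIV) p *\<^sub>R b (fst p)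
    else if i = 1 then indicator ({0<..t} \<times> UNIV) p *\<^sub>R f p else - (indicator ({0<..t} \<times> UNIV) p *\<^sub>R f p))"

lemma lessThan_3_eq: "{..<3::nat} = {0, 1, 2}" by auto

lemma sets_Q [simp]: "sets Q = sets (borel \<Otimes>\<^sub>M borel)" by (simp add: Q)

lemma space_QH [simp]: "space Q = UNIV" "space H = UNIV"
  using sets_eq_imp_space_eq[OF sets_Q] sets_eq_imp_space_eq[OF sets_H] by (auto simp: space_pair_measure)

lemma sets_M [simp, measurable_cong]: "sets (M i) = sets (borel \<Otimes>\<^sub>M borel)"
  by (simp add: M_def sets_H)

lemma space_M [simp]: "space (M i) = UNIV"
  using sets_eq_imp_space_eq[OF sets_M] by (auto simp: space_pair_measure)

lemma strip_sets: "A \<in> sets borel \<Longrightarrow> A \<times> UNIV \<in> sets (borel \<Otimes>\<^sub>M borel :: (real \<times> 'e) measure)"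
  by (intro pair_measureI) auto

lemma finite_M: "finite_measure (M i)"
proof -
  have "finite_measure (density lborel (indicator {0<..t} :: real \<Rightarrow> ennreal))"
    by (rule finite_measureI) (use t in \<open>simp add: emeasure_density\<close>)
  then have 0: "finite_measure (M 0)"
    unfolding M_def by (auto intro!: finite_measure.finite_measure_distr)
  have "finite_measure Q"
    unfolding Q using K(1) by (intro finite_measure.finite_measure_distr finite_measure_count_space) (auto simp: space_pair_measure)
  then have 1: "finite_measure (M 1)" by (simp add: M_def)
  have "{0<..t} \<times> UNIV \<in> sets H" using strip_sets sets_H by auto
  then have "emeasure (density H (indicator ({0<..t} \<times> UNIV))) UNIV = emeasure H ({0<..t} \<times> UNIV)"
    using sets.top[of H] by (subst emeasure_density) auto
  then have "finite_measure (density H (indicator ({0<..t} \<times> UNIV)))"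
    using H_finite by (intro finite_measureI) simp
  then show ?thesis using 0 1 by (cases "i = 0 \<or> i = 1") (auto simp: M_def)
qed

lemma b_meas: "(\<lambda>s. indicator {0<..t} s *\<^sub>R b s) \<in> borel_measurable borel" and b_int: "integrable lborel (\<lambda>s. indicator {0<..t} s *\<^sub>R b s)"
proof -
  have "set_integrable lborel {0<..t} b"
    by (rule set_integrable_subset[OF b]) auto
  then show "integrable lborel (\<lambda>s. indicator {0<..t} s *\<^sub>R b s)" by (simp add: set_integrable_def)
  then show "(\<lambda>s. indicator {0<..t} s *\<^sub>R b s) \<in> borel_measurable borel" by auto
qed

lemma fH_meas: "(\<lambda>p. indicator ({0<..t} \<times> UNIV) p *\<^sub>R f p) \<in> borel_measurable (borel \<Otimes>\<^sub>M borel)"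
proof -
  have "(\<lambda>p. indicator ({0<..t} \<times> UNIV) p *\<^sub>R f p) \<in> borel_measurable H"
    using fH unfolding set_integrable_def by auto
  then show ?thesis by (simp add: measurable_cong_sets[OF sets_H refl])
qed

lemma integral_M0:
  fixes k :: "real \<times> 'e \<Rightarrow> 'z::euclidean_space"
  assumes k: "k \<in> borel_measurable (borel \<Otimes>\<^sub>M borel)"
  shows "(\<integral>p. k p \<partial>M 0) = (\<integral>s. indicator {0<..t} s *\<^sub>R k (s, undefined) \<partial>lborel)"
    and "integrable (M 0) k \<longleftrightarrow> integrable lborel (\<lambda>s. indicator {0<..t} s *\<^sub>R k (s, undefined))"
proof -
  have m: "(\<lambda>s. (s, undefined)) \<in> borel \<rightarrow>\<^sub>M (borel \<Otimes>\<^sub>M borel :: (real \<times> 'e) measure)" by measurable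
  have mk: "(\<lambda>s. k (s, undefined)) \<in> borel_measurable borel" using measurable_compose[OF m k] .
  have e: "(indicator {0<..t} :: real \<Rightarrow> ennreal) = (\<lambda>s. ennreal (indicator {0<..t} s))" by (auto simp: indicator_def)
  show "(\<integral>p. k p \<partial>M 0) = (\<integral>s. indicator {0<..t} s *\<^sub>R k (s, undefined) \<partial>lborel)"
    unfolding M_def e using m k mk by (simp add: integral_distr integral_density)
  show "integrable (M 0) k \<longleftrightarrow> integrable lborel (\<lambda>s. indicator {0<..t} s *\<^sub>R k (s, undefined))"
    unfolding M_def e using m k mk by (simp add: integrable_distr_eq integrable_density)
qed

lemma integral_M2:
  fixes k :: "real \<times> 'e \<Rightarrow> 'z::euclidean_space"
  assumes k: "k \<in> borel_measurable (borel \<Otimes>\<^sub>M borel)"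
  shows "(\<integral>p. k p \<partial>M 2) = (\<integral>p. indicator ({0<..t} \<times> UNIV) p *\<^sub>R k p \<partial>H)"
    and "integrable (M 2) k \<longleftrightarrow> integrable H (\<lambda>p. indicator ({0<..t} \<times> UNIV) p *\<^sub>R k p)"
proof -
  have e: "(indicator ({0<..t} \<times> UNIV) :: real \<times> 'e \<Rightarrow> ennreal) = (\<lambda>s. ennreal (indicator ({0<..t} \<times> UNIV) s))" by (auto simp: indicator_def)
  have [measurable]: "{0<..t} \<times> UNIV \<in> sets H" using strip_sets sets_H by auto
  have mk: "k \<in> borel_measurable H" using k by (simp add: measurable_cong_sets[OF sets_H refl])
  show "(\<integral>p. k p \<partial>M 2) = (\<integral>p. indicator ({0<..t} \<times> UNIV) p *\<^sub>R k p \<partial>H)"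
    unfolding M_def e using mk by (simp add: integral_density)
  show "integrable (M 2) k \<longleftrightarrow> integrable H (\<lambda>p. indicator ({0<..t} \<times> UNIV) p *\<^sub>R k p)"
    unfolding M_def e using mk by (simp add: integrable_density)
qed

lemma g_meas: "g i \<in> borel_measurable (borel \<Otimes>\<^sub>M borel)"
proof -
  have "(\<lambda>p :: real \<times> 'e. indicator {0<..t} (fst p) *\<^sub>R b (fst p)) \<in> borel_measurable (borel \<Otimes>\<^sub>M borel)"
    by (rule measurable_compose[OF measurable_fst b_meas])
  then have "g 0 \<in> borel_measurable (borel \<Otimes>\<^sub>M borel)" by (simp add: g_def[abs_def] indicator_times)
  moreover have "g i \<in> borel_measurable (borel \<Otimes>\<^sub>M borel)" if "i \<noteq> 0"
    using fH_meas that unfolding g_def[abs_def] by (cases "i = 1") auto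
  ultimately show ?thesis by (cases "i = 0") auto
qed

lemma g_int: "i < 3 \<Longrightarrow> integrable (M i) (g i)"
proof -
  have "(\<lambda>s. indicator {0<..t} s *\<^sub>R g 0 (s, undefined)) = (\<lambda>s. indicator {0<..t} s *\<^sub>R b s)"
    by (auto simp: g_def split: split_indicator)
  then have "integrable (M 0) (g 0)"
    using b_int by (subst integral_M0(2)[OF g_meas]) simp
  moreover have "integrable (M 1) (g 1)" using fQ by (simp add: g_def[abs_def] M_def set_integrable_def)
  moreover have "integrable (M 2) (g 2)"
  proof -
    have "(\<lambda>p. indicator ({0<..t} \<times> UNIV) p *\<^sub>R g 2 p) = (\<lambda>p. - (indicator ({0<..t} \<times> UNIV) p *\<^sub>R f p))"
      by (auto simp: g_def indicator_def)
    then show ?thesis using fH by (subst integral_M2(2)[OF g_meas]) (simp add: set_integrable_def)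
  qed
  moreover assume "i < 3"
  then have "i = 0 \<or> i = 1 \<or> i = 2" by linarith
  ultimately show ?thesis by metis
qed

text \<open>The left limit of \<open>D\<close> as an integral over the strict past. It is defined
  and measurable on the whole line, whereas \<open>left_lim\<close> is controlled on
  \<open>{0<..t}\<close> only.\<close>

definition F :: "real \<Rightarrow> 'v" where
  "F s = D 0 + (\<Sum>i<3. \<integral>p. indicator {p. fst p < s} p *\<^sub>R g i p \<partial>M i)"

lemma D_eq: "D r = D 0 + (\<Sum>i<3. \<integral>p. indicator {p. fst p \<le> r} p *\<^sub>R g i p \<partial>M i)" if r: "r \<in> {0..t}"
proof -
  have m: "(\<lambda>p. indicator {p. fst p \<le> r} p *\<^sub>R g i p) \<in> borel_measurable (borel \<Otimes>\<^sub>M borel)" for i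
    using g_meas[of i] by measurable
  have "(\<integral>p. indicator {p. fst p \<le> r} p *\<^sub>R g 0 p \<partial>M 0) = (\<integral>s. indicator {0<..r} s *\<^sub>R b s \<partial>lborel)"
    unfolding integral_M0(1)[OF m] using r by (intro Bochner_Integration.integral_cong) (auto simp: g_def split: split_indicator)
  also have "\<dots> = (LINT s:{0..r}|lborel. b s)"
  proof -
    have "(\<lambda>s. indicator {0<..r} s *\<^sub>R (indicator {0<..t} s *\<^sub>R b s)) \<in> borel_measurable borel" using b_meas by measurable
    then have 1: "(\<lambda>s. indicator {0<..r} s *\<^sub>R b s) \<in> borel_measurable borel"
      by (rule measurable_cong[THEN iffD1, rotated]) (use r in \<open>auto simp: indicator_def\<close>)
    have "set_integrable lborel {0..r} b" by (rule set_integrable_subset[OF b]) (use r in auto)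
    then have 2: "(\<lambda>s. indicator {0..r} s *\<^sub>R b s) \<in> borel_measurable borel" unfolding set_integrable_def by auto
    have "AE s in lborel. indicator {0<..r} s *\<^sub>R b s = indicator {0..r} s *\<^sub>R b s"
      using AE_lborel_singleton[of 0] by eventually_elim (auto split: split_indicator)
    then show ?thesis unfolding set_lebesgue_integral_def
      using 1 2 by (intro integral_cong_AE) simp_all
  qed
  finally have 0: "(\<integral>p. indicator {p. fst p \<le> r} p *\<^sub>R g 0 p \<partial>M 0) = \<dots>" .
  have 1: "(\<integral>p. indicator {p. fst p \<le> r} p *\<^sub>R g 1 p \<partial>M 1) = (LINT p:{0<..r} \<times> UNIV|Q. f p)"
    unfolding M_def set_lebesgue_integral_def using r by (auto intro!: Bochner_Integration.integral_cong simp: g_def split: split_indicator)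
  have "(\<integral>p. indicator {p. fst p \<le> r} p *\<^sub>R g 2 p \<partial>M 2) = (\<integral>p. - (indicator ({0<..r} \<times> UNIV) p *\<^sub>R f p) \<partial>H)"
    unfolding integral_M2(1)[OF m] using r by (intro Bochner_Integration.integral_cong) (auto simp: g_def split: split_indicator)
  then have 2: "(\<integral>p. indicator {p. fst p \<le> r} p *\<^sub>R g 2 p \<partial>M 2) = - (LINT p:{0<..r} \<times> UNIV|H. f p)"
    by (simp add: set_lebesgue_integral_def)
  show ?thesis unfolding D[OF r] lessThan_3_eq using 0 1 2 by simp
qed

lemma tendsto_F: "s \<in> {0<..t} \<Longrightarrow> (D \<longlongrightarrow> F s) (at_left s)"
proof (rule tendsto_at_left_sequentially[where b=0])
  fix x assume s: "s \<in> {0<..t}" and x: "\<And>n. x n < s" "\<And>n. 0 < x n" "x \<longlonglongrightarrow> s"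
  have "(\<lambda>n. D 0 + (\<Sum>i<3. \<integral>p. indicator {p. fst p \<le> x n} p *\<^sub>R g i p \<partial>M i)) \<longlonglongrightarrow> F s"
    unfolding F_def
  proof (intro tendsto_add[OF tendsto_const] tendsto_sum)
    fix i assume "i \<in> {..<3::nat}"
    then have i: "i < 3" by simp
    have m: "fst \<in> borel_measurable (M i)" by measurable
    show "(\<lambda>n. \<integral>p. indicator {p. fst p \<le> x n} p *\<^sub>R g i p \<partial>M i) \<longlonglongrightarrow> (\<integral>p. indicator {p. fst p < s} p *\<^sub>R g i p \<partial>M i)"
      by (rule tendsto_integral_below[OF g_int[OF i] m x(1) x(3)])
  qed
  moreover have "D (x n) = D 0 + (\<Sum>i<3. \<integral>p. indicator {p. fst p \<le> x n} p *\<^sub>R g i p \<partial>M i)" for n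
    using x(1,2)[of n] s by (intro D_eq) auto
  ultimately show "(\<lambda>n. D (x n)) \<longlonglongrightarrow> F s" by (simp only:)
qed simp

lemma left_lim_eq: "s \<in> {0<..t} \<Longrightarrow> left_lim D s = F s"
  unfolding left_lim_def by (rule tendsto_Lim[OF _ tendsto_F]) simp_all

lemma M_null: "i \<noteq> 1 \<Longrightarrow> emeasure (M i) ({s} \<times> UNIV) = 0"
proof -
  have m: "(\<lambda>s. (s, undefined)) \<in> borel \<rightarrow>\<^sub>M (borel \<Otimes>\<^sub>M borel :: (real \<times> 'e) measure)" by measurable
  have "emeasure (M 0) ({s} \<times> UNIV) = emeasure (density lborel (indicator {0<..t})) {s}"
  proof -
    have "(\<lambda>s. (s, undefined)) -` ({s} \<times> (UNIV :: 'e set)) \<inter> space (density lborel (indicator {0<..t})) = {s}" by auto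
    then show ?thesis unfolding M_def using m strip_sets[of "{s}"] by (simp add: emeasure_distr)
  qed
  also have "\<dots> = 0"
  proof -
    have "AE x in lborel. x \<noteq> s" by (rule AE_lborel_singleton)
    then have "AE x in lborel. indicator {0<..t} x * indicator {s} x = (0::ennreal)"
      by eventually_elim simp
    then show ?thesis by (subst emeasure_density) (simp_all add: nn_integral_0_iff_AE)
  qed
  finally have 0: "emeasure (M 0) ({s} \<times> UNIV) = 0" .
  have "{s} \<times> UNIV \<in> null_sets H" using H_null strip_sets sets_H by auto
  then have "AE p in H. p \<notin> {s} \<times> UNIV" by (rule AE_not_in)
  moreover have "{s} \<times> UNIV \<in> sets H" "{0<..t} \<times> UNIV \<in> sets H" using strip_sets sets_H by auto
  ultimately have "emeasure (density H (indicator ({0<..t} \<times> UNIV))) ({s} \<times> UNIV) = 0"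
    by (subst emeasure_density) (auto simp: nn_integral_0_iff_AE split: split_indicator)
  with 0 show "i \<noteq> 1 \<Longrightarrow> emeasure (M i) ({s} \<times> UNIV) = 0" by (cases "i = 0") (auto simp: M_def)
qed

lemma AE_M_time: "i \<noteq> 1 \<Longrightarrow> AE p in M i. fst p \<noteq> s"
proof -
  assume "i \<noteq> 1"
  then have "{s} \<times> UNIV \<in> null_sets (M i)" using M_null[of i s] strip_sets[of "{s}"] by auto
  then have "AE p in M i. p \<notin> {s} \<times> UNIV" by (rule AE_not_in)
  then show ?thesis by eventually_elim auto
qed

lemma integral_at_time: "i \<noteq> 1 \<Longrightarrow> (\<integral>p. indicator {p. fst p = s} p *\<^sub>R k p \<partial>M i) = (0::'v)"
  using AE_M_time[of i s] by (intro integral_eq_zero_AE) auto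

lemma AE_Q: "AE p in Q. fst p \<in> \<tau> ` K"
proof -
  have "{p :: real \<times> 'e. fst p \<in> \<tau> ` K} = (\<tau> ` K) \<times> UNIV" by auto
  then have "{p :: real \<times> 'e. fst p \<in> \<tau> ` K} \<in> sets (borel \<Otimes>\<^sub>M borel)"
    using K by (simp add: strip_sets borel_closed finite_imp_closed)
  then show ?thesis unfolding Q by (subst AE_distr_iff) (auto simp: AE_count_space space_pair_measure)
qed

lemma integral_Q:
  fixes k :: "real \<times> 'e \<Rightarrow> 'z::euclidean_space"
  assumes "k \<in> borel_measurable (borel \<Otimes>\<^sub>M borel)"
  shows "(\<integral>p. k p \<partial>Q) = (\<Sum>j\<in>K. k (\<tau> j, m j))"
  unfolding Q using assms K by (subst integral_distr) (auto simp: space_pair_measure lebesgue_integral_count_space_finite)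

text \<open>The value and the left limit at \<open>s\<close> differ by what happens at the single
  time \<open>s\<close>: drift and compensator do not charge it, and \<open>Q\<close> charges only
  its finitely many jump times.\<close>

lemma D_continuous_off_jumps: "s \<in> {0<..t} \<Longrightarrow> s \<notin> \<tau> ` K \<Longrightarrow> left_lim D s = D s"
proof -
  assume s: "s \<in> {0<..t}" "s \<notin> \<tau> ` K"
  have "(\<integral>p. indicator {p. fst p \<le> s} p *\<^sub>R g i p \<partial>M i) = (\<integral>p. indicator {p. fst p < s} p *\<^sub>R g i p \<partial>M i)" if "i < 3" for i
  proof (rule integral_cong_AE)
    have "AE p in M i. fst p \<noteq> s"
    proof (cases "i = 1")
      case True
      have Mi: "M i = Q" using True by (simp add: M_def)
      show ?thesis unfolding Mi using AE_Q by eventually_elim (use s in auto)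
    qed (rule AE_M_time)
    then show "AE p in M i. indicator {p. fst p \<le> s} p *\<^sub>R g i p = indicator {p. fst p < s} p *\<^sub>R g i p"
      by eventually_elim (auto split: split_indicator)
  qed (use g_meas[of i] in measurable)
  then have "(\<Sum>i<3. \<integral>p. indicator {p. fst p < s} p *\<^sub>R g i p \<partial>M i) = (\<Sum>i<3. \<integral>p. indicator {p. fst p \<le> s} p *\<^sub>R g i p \<partial>M i)"
    by (intro sum.cong[OF refl]) (simp only: lessThan_iff)
  moreover have "s \<in> {0..t}" using s by simp
  ultimately show ?thesis unfolding left_lim_eq[OF s(1)] F_def by (simp only: D_eq)
qed

text \<open>Among the diagonal terms only the pair (1, 1) survives: drift and compensator have no
  atoms in time, so they share no time of positive mass with each other or with the jumps. The
  surviving term is the sum of the squared jumps.\<close>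

lemma energy_identity_end:
  "(norm (D t))\<^sup>2 = (norm (D 0))\<^sup>2 + 2 * (\<Sum>i<3. \<integral>p. inner (g i p) (F (fst p)) \<partial>M i) + (\<integral>p. (norm (g 1 p))\<^sup>2 \<partial>Q)"
proof -
  have "(\<integral>p. indicator {p. fst p \<le> t} p *\<^sub>R g i p \<partial>M i) = (\<integral>p. g i p \<partial>M i)" for i
    by (intro Bochner_Integration.integral_cong refl) (auto simp: g_def split: split_indicator)
  then have Dt: "D t = D 0 + (\<Sum>i<3. \<integral>p. g i p \<partial>M i)" using D_eq[of t] t by simp
  have fst_m: "fst \<in> borel_measurable (M i)" for i by measurable
  let ?C = "\<lambda>i k. \<integral>p. inner (g i p) (\<integral>y. indicator {y. fst y = fst p} y *\<^sub>R g k y \<partial>M k) \<partial>M i"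
  have M1: "M 1 = Q" by (simp add: M_def)
  have C0: "?C i k = 0" if "k \<noteq> 1" for i k
    using that by (simp add: integral_at_time)
  have jump_at: "(\<integral>y. indicator {y. fst y = s} y *\<^sub>R g 1 y \<partial>Q) = (\<Sum>j\<in>K. indicator {y. fst y = s} (\<tau> j, m j) *\<^sub>R g 1 (\<tau> j, m j))" for s
    using g_meas[of 1] by (intro integral_Q) measurable
  \<comment> \<open>Here the inner measure is the one with atoms: the inner integral can be nonzero
    at finitely many times only, and \<open>M i\<close> charges none of them.\<close>
  have C1: "?C i 1 = 0" if "i \<noteq> 1" for i
  proof -
    have ae: "AE p in M i. \<forall>s\<in>\<tau> ` K. fst p \<noteq> s"
      using K AE_M_time[OF that] by (intro AE_finite_allI) auto
    have z: "(\<integral>y. indicator {y. fst y = s} y *\<^sub>R g 1 y \<partial>Q) = 0" if "\<forall>r\<in>\<tau> ` K. s \<noteq> r" for s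
      unfolding jump_at using that by (intro sum.neutral) (auto simp: indicator_def)
    have "AE p in M i. inner (g i p) (\<integral>y. indicator {y. fst y = fst p} y *\<^sub>R g 1 y \<partial>Q) = 0"
      using ae by eventually_elim (simp only: z inner_zero_right)
    then show ?thesis unfolding M1 by (rule integral_eq_zero_AE)
  qed
  have "?C 1 1 = (\<Sum>j\<in>K. inner (g 1 (\<tau> j, m j)) (\<Sum>i\<in>K. indicator {y. fst y = \<tau> j} (\<tau> i, m i) *\<^sub>R g 1 (\<tau> i, m i)))"
    unfolding M1 jump_at using g_meas[of 1] by (subst integral_Q) auto
  also have "\<dots> = (\<Sum>j\<in>K. (norm (g 1 (\<tau> j, m j)))\<^sup>2)"
  proof (rule sum.cong[OF refl])
    fix j assume j: "j \<in> K"
    \<comment> \<open>Distinct indices have distinct jump times, so only the term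
      \<open>i = j\<close> remains.\<close>
    have "(\<Sum>i\<in>K. indicator {y. fst y = \<tau> j} (\<tau> i, m i) *\<^sub>R g 1 (\<tau> i, m i)) = (\<Sum>i\<in>{j}. g 1 (\<tau> i, m i))"
      using K j by (intro sum.mono_neutral_cong_right) (auto simp: indicator_def inj_on_def)
    then show "inner (g 1 (\<tau> j, m j)) (\<Sum>i\<in>K. indicator {y. fst y = \<tau> j} (\<tau> i, m i) *\<^sub>R g 1 (\<tau> i, m i)) = (norm (g 1 (\<tau> j, m j)))\<^sup>2"
      by (simp add: power2_norm_eq_inner)
  qed
  also have "\<dots> = (\<integral>p. (norm (g 1 p))\<^sup>2 \<partial>Q)"
    using g_meas[of 1] by (intro integral_Q[symmetric]) measurable
  finally have C11: "?C 1 1 = (\<integral>p. (norm (g 1 p))\<^sup>2 \<partial>Q)" .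
  have "(\<Sum>i<3. \<Sum>k<3. ?C i k) = (\<integral>p. (norm (g 1 p))\<^sup>2 \<partial>Q)"
    unfolding lessThan_3_eq using C0 C1 C11 by simp
  then show ?thesis
    unfolding Dt using norm_square_sum_integrals[where I="{..<3}" and M=M and h=g and \<tau>=fst and c="D 0", OF _ finite_M g_int fst_m]
    by (simp add: F_def)
qed

end

lemma (in jump_path) energy_identity:
  "(norm (D t))\<^sup>2 = (norm (D 0))\<^sup>2 + 2 * ((LINT s:{0<..t}|lborel. inner (left_lim D s) (b s))
      + (LINT p:{0<..t} \<times> UNIV|Q. inner (left_lim D (fst p)) (f p))
      - (LINT p:{0<..t} \<times> UNIV|H. inner (left_lim D (fst p)) (f p)))
      + (LINT p:{0<..t} \<times> UNIV|Q. (norm (f p))\<^sup>2)"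
proof -
  \<comment> \<open>Measurability of the parameter integral is required to pull the integrals back
    to \<open>lborel\<close> and \<open>H\<close>. There \<open>F\<close> is replaced by
    \<open>left_lim\<close>, to which it is equal on \<open>{0<..t}\<close>.\<close>
  have [measurable]: "F \<in> borel_measurable borel"
  proof -
    have "(\<lambda>s. \<integral>p. indicator {p. fst p < s} p *\<^sub>R g i p \<partial>M i) \<in> borel_measurable borel" for i
    proof -
      interpret finite_measure "M i" by (rule finite_M)
      have [measurable]: "(\<lambda>q. g i (snd q)) \<in> borel_measurable (borel \<Otimes>\<^sub>M M i)"
        using g_meas[of i] by measurable
      have "(\<lambda>q. indicator {q :: real \<times> (real \<times> 'e). fst (snd q) < fst q} q *\<^sub>R g i (snd q)) \<in> borel_measurable (borel \<Otimes>\<^sub>M M i)"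
        by measurable
      then have "(\<lambda>(s, p). indicator {p. fst p < s} p *\<^sub>R g i p) \<in> borel_measurable (borel \<Otimes>\<^sub>M M i)"
        by (simp add: case_prod_beta indicator_def)
      then show ?thesis by (rule borel_measurable_lebesgue_integral)
    qed
    then show ?thesis unfolding F_def[abs_def] by measurable
  qed
  have m: "(\<lambda>p. inner (g i p) (F (fst p))) \<in> borel_measurable (borel \<Otimes>\<^sub>M borel)" for i
    using g_meas[of i] by measurable
  have 0: "(\<integral>p. inner (g 0 p) (F (fst p)) \<partial>M 0) = (LINT s:{0<..t}|lborel. inner (left_lim D s) (b s))"
    unfolding integral_M0(1)[OF m] set_lebesgue_integral_def
    by (intro Bochner_Integration.integral_cong refl) (auto simp: g_def left_lim_eq inner_commute split: split_indicator)
  have 1: "(\<integral>p. inner (g 1 p) (F (fst p)) \<partial>M 1) = (LINT p:{0<..t} \<times> UNIV|Q. inner (left_lim D (fst p)) (f p))"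
    unfolding M_def set_lebesgue_integral_def
    by (auto intro!: Bochner_Integration.integral_cong simp: g_def left_lim_eq inner_commute split: split_indicator)
  have "(\<integral>p. inner (g 2 p) (F (fst p)) \<partial>M 2) = (\<integral>p. - (indicator ({0<..t} \<times> UNIV) p *\<^sub>R inner (left_lim D (fst p)) (f p)) \<partial>H)"
    unfolding integral_M2(1)[OF m] set_lebesgue_integral_def
    by (intro Bochner_Integration.integral_cong refl) (auto simp: g_def left_lim_eq inner_commute split: split_indicator)
  then have 2: "(\<integral>p. inner (g 2 p) (F (fst p)) \<partial>M 2) = - (LINT p:{0<..t} \<times> UNIV|H. inner (left_lim D (fst p)) (f p))"
    by (simp add: set_lebesgue_integral_def)
  have 3: "(\<integral>p. (norm (g 1 p))\<^sup>2 \<partial>Q) = (LINT p:{0<..t} \<times> UNIV|Q. (norm (f p))\<^sup>2)"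
    unfolding set_lebesgue_integral_def
    by (intro Bochner_Integration.integral_cong refl) (auto simp: g_def split: split_indicator)
  have "(\<Sum>i<3. \<integral>p. inner (g i p) (F (fst p)) \<partial>M i) = (LINT s:{0<..t}|lborel. inner (left_lim D s) (b s))
      + (LINT p:{0<..t} \<times> UNIV|Q. inner (left_lim D (fst p)) (f p))
      - (LINT p:{0<..t} \<times> UNIV|H. inner (left_lim D (fst p)) (f p))"
    unfolding lessThan_3_eq using 0 1 2 by simp
  then show ?thesis using energy_identity_end 3 by simp
qed

section \<open>Predictable left limits\<close>

text \<open>The \<open>norm\<close> of a matrix is here the Euclidean norm of all entries, so the
  Cauchy-Schwarz inequality in each row is enough.\<close>

lemma norm_matrix_vector_mult_le: "norm (A *v x) \<le> norm A * norm x" for A :: "real^'n^'m"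
proof -
  have "norm (A *v x) = L2_set (\<lambda>i. norm ((A *v x) $ i)) UNIV" by (simp add: norm_vec_def)
  also have "\<dots> \<le> L2_set (\<lambda>i. norm (A $ i) * norm x) UNIV"
    by (intro L2_set_mono) (auto simp: matrix_vector_mul_component Cauchy_Schwarz_ineq2)
  also have "\<dots> = norm A * norm x" by (simp add: norm_vec_def L2_set_left_distrib)
  finally show ?thesis .
qed

lemma borel_measurable_matrix_vector_mult [measurable (raw)]:
  fixes A :: "'a \<Rightarrow> real^'n^'m"
  assumes "A \<in> borel_measurable M" "x \<in> borel_measurable M"
  shows "(\<lambda>a. A a *v x a) \<in> borel_measurable M"
proof (rule borel_measurable_continuous_Pair[OF assms])
  show "continuous_on UNIV (\<lambda>p :: (real^'n^'m) \<times> (real^'n). fst p *v snd p)"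
    unfolding matrix_vector_mult_def
    by (intro continuous_on_vec_lambda continuous_intros continuous_on_component)
qed

text \<open>
  The Bochner integral against a kernel is split into two nonnegative parts, because the integral
  itself is measurable in the parameter only up to a null set.
\<close>

lemma kernel_integral:
  fixes \<kappa> :: "'a \<Rightarrow> 'b measure" and u :: "'a \<Rightarrow> 'b \<Rightarrow> real"
  assumes u: "\<And>x. x \<in> space M \<Longrightarrow> u x \<in> borel_measurable (\<kappa> x)"
    and P[measurable]: "(\<lambda>x. \<integral>\<^sup>+y. ennreal (u x y) \<partial>\<kappa> x) \<in> borel_measurable M"
    and N[measurable]: "(\<lambda>x. \<integral>\<^sup>+y. ennreal (- u x y) \<partial>\<kappa> x) \<in> borel_measurable M"
    and fin: "(\<integral>\<^sup>+x. (\<integral>\<^sup>+y. ennreal (u x y) \<partial>\<kappa> x) \<partial>M) < \<infinity>" "(\<integral>\<^sup>+x. (\<integral>\<^sup>+y. ennreal (- u x y) \<partial>\<kappa> x) \<partial>M) < \<infinity>"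
  shows "AE x in M. integrable (\<kappa> x) (u x) \<and> (\<integral>y. u x y \<partial>\<kappa> x) = enn2real ((\<integral>\<^sup>+y. ennreal (u x y) \<partial>\<kappa> x)) - enn2real ((\<integral>\<^sup>+y. ennreal (- u x y) \<partial>\<kappa> x))"
    and "integrable M (\<lambda>x. enn2real ((\<integral>\<^sup>+y. ennreal (u x y) \<partial>\<kappa> x)) - enn2real ((\<integral>\<^sup>+y. ennreal (- u x y) \<partial>\<kappa> x)))"
    and "(\<integral>x. enn2real ((\<integral>\<^sup>+y. ennreal (u x y) \<partial>\<kappa> x)) - enn2real ((\<integral>\<^sup>+y. ennreal (- u x y) \<partial>\<kappa> x)) \<partial>M) = enn2real (\<integral>\<^sup>+x. (\<integral>\<^sup>+y. ennreal (u x y) \<partial>\<kappa> x) \<partial>M) - enn2real (\<integral>\<^sup>+x. (\<integral>\<^sup>+y. ennreal (- u x y) \<partial>\<kappa> x) \<partial>M)"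
proof -
  let ?P = "\<lambda>x. \<integral>\<^sup>+y. ennreal (u x y) \<partial>\<kappa> x" and ?N = "\<lambda>x. \<integral>\<^sup>+y. ennreal (- u x y) \<partial>\<kappa> x"
  have aeP: "AE x in M. ?P x \<noteq> \<infinity>" and aeN: "AE x in M. ?N x \<noteq> \<infinity>"
    using fin by (intro nn_integral_PInf_AE; simp)+
  show "AE x in M. integrable (\<kappa> x) (u x) \<and> (\<integral>y. u x y \<partial>\<kappa> x) = enn2real (?P x) - enn2real (?N x)"
    using aeP aeN AE_space
  proof eventually_elim
    case (elim x)
    have "integrable (\<kappa> x) (u x)" using elim u[of x] by (simp add: real_integrable_def)
    then show ?case by (simp add: real_lebesgue_integral_def)
  qed
  have iP: "has_bochner_integral M (\<lambda>x. enn2real (?P x)) (enn2real (\<integral>\<^sup>+x. ?P x \<partial>M))"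
  proof (rule has_bochner_integral_nn_integral)
    have "(\<integral>\<^sup>+x. ennreal (enn2real (?P x)) \<partial>M) = (\<integral>\<^sup>+x. ?P x \<partial>M)"
      using aeP by (intro nn_integral_cong_AE, eventually_elim) (simp add: less_top)
    then show "(\<integral>\<^sup>+x. ennreal (enn2real (?P x)) \<partial>M) = ennreal (enn2real (\<integral>\<^sup>+x. ?P x \<partial>M))"
      using fin by simp
  qed auto
  have iN: "has_bochner_integral M (\<lambda>x. enn2real (?N x)) (enn2real (\<integral>\<^sup>+x. ?N x \<partial>M))"
  proof (rule has_bochner_integral_nn_integral)
    have "(\<integral>\<^sup>+x. ennreal (enn2real (?N x)) \<partial>M) = (\<integral>\<^sup>+x. ?N x \<partial>M)"
      using aeN by (intro nn_integral_cong_AE, eventually_elim) (simp add: less_top)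
    then show "(\<integral>\<^sup>+x. ennreal (enn2real (?N x)) \<partial>M) = ennreal (enn2real (\<integral>\<^sup>+x. ?N x \<partial>M))"
      using fin by simp
  qed auto
  show "integrable M (\<lambda>x. enn2real (?P x) - enn2real (?N x))"
    "(\<integral>x. enn2real (?P x) - enn2real (?N x) \<partial>M) = enn2real (\<integral>\<^sup>+x. ?P x \<partial>M) - enn2real (\<integral>\<^sup>+x. ?N x \<partial>M)"
    using has_bochner_integral_diff[OF iP iN] by (auto simp: has_bochner_integral_iff)
qed

context mode_process
begin

lemma predictable_rectangle:
  assumes "0 \<le> r" "r \<le> s" "s \<le> t" "G \<in> sets (filt S r)"
  shows "G \<times> {r<..s} \<in> sets (predictable S t)"
  and "0 \<le> t \<Longrightarrow> H \<in> sets (filt S 0) \<Longrightarrow> H \<times> {0} \<in> sets (predictable S t)"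
proof -
  have sp: "G \<subseteq> space (Prb S)" if "G \<in> sets (filt S r)" for G r
    using sets.sets_into_space[OF that] by simp
  have sub: "{G \<times> {0} | G. G \<in> sets (filt S 0)} \<union>
      {G \<times> {r<..s} | G r s. 0 \<le> r \<and> r \<le> s \<and> s \<le> t \<and> G \<in> sets (filt S r)} \<subseteq> Pow (space (Prb S) \<times> {0..t})" if "0 \<le> t"
    using sp that by fastforce
  have "0 \<le> t" using assms by simp
  from sets_measure_of[OF sub[OF this]] show "G \<times> {r<..s} \<in> sets (predictable S t)"
    unfolding predictable_def using assms by (auto intro!: sigma_sets.Basic)
  assume "0 \<le> t" "H \<in> sets (filt S 0)"
  from sets_measure_of[OF sub[OF this(1)]] this(2) show "H \<times> {0} \<in> sets (predictable S t)"
    unfolding predictable_def by (auto intro!: sigma_sets.Basic)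
qed

lemma space_in_filt: "space (Prb S) \<in> sets (filt S r)"
  using sets.top[of "filt S r"] by simp

lemma measurable_time_predictable:
  assumes t: "0 \<le> t"
  shows "snd \<in> borel_measurable (predictable S t)"
  unfolding borel_measurable_iff_le
proof
  fix a :: real
  consider "a < 0" | "0 \<le> a" "a \<le> t" | "t < a" by linarith
  then show "{w \<in> space (predictable S t). snd w \<le> a} \<in> sets (predictable S t)"
  proof cases
    case 1
    then have "{w \<in> space (predictable S t). snd w \<le> a} = {}" by auto
    then show ?thesis by (simp only: sets.empty_sets)
  next
    case 2
    then have "{w \<in> space (predictable S t). snd w \<le> a} = space (predictable S t) - space (Prb S) \<times> {a<..t}" by auto
    then show ?thesis using predictable_rectangle(1)[of a t t "space (Prb S)"] 2 space_in_filt by (simp only: sets.compl_sets)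
  next
    case 3
    then have "{w \<in> space (predictable S t). snd w \<le> a} = space (predictable S t)" by auto
    then show ?thesis by (simp only: sets.top)
  qed
qed

text \<open>A generator over the longer interval, cut down to the shorter one, is again a generator
  or empty. The coefficients and controls live on the whole horizon and are brought to
  \<open>[0,t]\<close> in this way.\<close>

lemma id_predictable_mono:
  assumes "0 \<le> t" "t \<le> T"
  shows "(\<lambda>p. p) \<in> predictable S t \<rightarrow>\<^sub>M predictable S T"
  unfolding predictable_def[of S T]
proof (rule measurable_measure_of)
  have sp: "G \<subseteq> space (Prb S)" if "G \<in> sets (filt S r)" for G r
    using sets.sets_into_space[OF that] by simp
  show "{G \<times> {0} | G. G \<in> sets (filt S 0)} \<union>
      {G \<times> {r<..s} | G r s. 0 \<le> r \<and> r \<le> s \<and> s \<le> T \<and> G \<in> sets (filt S r)} \<subseteq> Pow (space (Prb S) \<times> {0..T})"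
    using sp assms by fastforce
  show "(\<lambda>p. p) \<in> space (predictable S t) \<rightarrow> space (Prb S) \<times> {0..T}" using assms by auto
  fix y assume y: "y \<in> {G \<times> {0} | G. G \<in> sets (filt S 0)} \<union>
      {G \<times> {r<..s} | G r s. 0 \<le> r \<and> r \<le> s \<and> s \<le> T \<and> G \<in> sets (filt S r)}"
  show "(\<lambda>p. p) -` y \<inter> space (predictable S t) \<in> sets (predictable S t)"
  proof (cases "y \<in> {G \<times> {0} | G. G \<in> sets (filt S 0)}")
    case True
    then obtain G where G: "y = G \<times> {0}" "G \<in> sets (filt S 0)" by auto
    then have "(\<lambda>p. p) -` y \<inter> space (predictable S t) = G \<times> {0}" using sp[of G] assms by auto
    \<comment> \<open>The empty rectangle discharges the hypotheses that the two conclusions of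
      \<open>predictable_rectangle\<close> share.\<close>
    then show ?thesis using predictable_rectangle(2)[of 0 0 t "{}" G] G assms by simp
  next
    case False
    then obtain G r s where G: "y = G \<times> {r<..s}" "G \<in> sets (filt S r)" "0 \<le> r" "r \<le> s" using y by auto
    show ?thesis
    proof (cases "r \<le> t")
      case True
      have "(\<lambda>p. p) -` y \<inter> space (predictable S t) = G \<times> {r<..min s t}" using sp[OF G(2)] G by auto
      then show ?thesis using predictable_rectangle(1)[of r "min s t" t G] True G by simp
    next
      case False
      then have "(\<lambda>p. p) -` y \<inter> space (predictable S t) = {}" using G by auto
      then show ?thesis by simp
    qed
  qed
qed

lemma progressive_adapted:
  assumes "progressive S t X" "s \<in> {0..t}"
  shows "X s \<in> borel_measurable (filt S s)"
proof -
  have m: "(\<lambda>(\<omega>, r). X r \<omega>) \<in> borel_measurable (filt S s \<Otimes>\<^sub>M restrict_space borel {0..s})"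
    using assms by (auto simp: progressive_def)
  have "(\<lambda>\<omega>. (\<omega>, s)) \<in> filt S s \<rightarrow>\<^sub>M filt S s \<Otimes>\<^sub>M restrict_space borel {0..s}"
    using assms by (intro measurable_Pair) (auto simp: space_restrict_space)
  from measurable_compose[OF this m] show ?thesis by simp
qed

lemma progressive_measurable:
  assumes "progressive S t X" "0 \<le> t"
  shows "(\<lambda>p. X (snd p) (fst p)) \<in> borel_measurable (Prb S \<Otimes>\<^sub>M restrict_space lborel {0..t})"
proof -
  have m: "(\<lambda>p. X (snd p) (fst p)) \<in> borel_measurable (filt S t \<Otimes>\<^sub>M restrict_space borel {0..t})"
    using assms(1)[unfolded progressive_def, rule_format, of t] assms(2) by (simp add: case_prod_unfold)
  have 1: "(\<lambda>\<omega>. \<omega>) \<in> Prb S \<rightarrow>\<^sub>M filt S t" by (rule measurable_from_subalg[OF subalgebra_filt[of t]]) simp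
  have "sets (restrict_space lborel {0..t}) = sets (restrict_space borel {0..t})" by (simp add: sets_restrict_space)
  then have 2: "(\<lambda>r. r) \<in> restrict_space lborel {0..t} \<rightarrow>\<^sub>M restrict_space borel {0..t}"
    by (simp add: measurable_ident_sets)
  have "(\<lambda>p. (fst p, snd p)) \<in> Prb S \<Otimes>\<^sub>M restrict_space lborel {0..t} \<rightarrow>\<^sub>M filt S t \<Otimes>\<^sub>M restrict_space borel {0..t}"
    by (intro measurable_Pair measurable_compose[OF measurable_fst 1] measurable_compose[OF measurable_snd 2])
  from measurable_compose[OF this m] show ?thesis by simp
qed

text \<open>A nonempty level set in a trivial sigma-field is the whole space. Applied to the initial
  value of the backward solution, this supplies a deterministic starting point.\<close>

lemma filt_0_measurable_const:
  fixes X :: "'w \<Rightarrow> 'v::euclidean_space"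
  assumes "X \<in> borel_measurable (filt S 0)"
  shows "\<exists>x. \<forall>\<omega>\<in>space (Prb S). X \<omega> = x"
proof -
  obtain \<omega>0 where \<omega>0: "\<omega>0 \<in> space (Prb S)" using not_empty by auto
  have "X -` {X \<omega>0} \<inter> space (filt S 0) \<in> sets (filt S 0)"
    using assms by (rule measurable_sets) simp
  from filt_0_trivial[OF this] \<omega>0 have "X -` {X \<omega>0} \<inter> space (Prb S) = space (Prb S)" by auto
  then show ?thesis by auto
qed

text \<open>\<open>left_lim\<close> is junk at time \<open>0\<close>; the value \<open>0\<close> keeps the process predictable.\<close>

definition left_proc :: "(real \<Rightarrow> 'w \<Rightarrow> 'v::euclidean_space) \<Rightarrow> real \<Rightarrow> 'w \<Rightarrow> 'v" where
  "left_proc X r \<omega> = (if r = 0 then 0 else left_lim (\<lambda>s. X s \<omega>) r)"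

lemma cadlag_left_lim:
  assumes "cadlag_on t x" "r \<in> {0<..t}"
  shows "(x \<longlongrightarrow> left_lim x r) (at_left r)"
proof -
  obtain l where "(x \<longlongrightarrow> l) (at_left r)" using assms unfolding cadlag_on_def by blast
  then show ?thesis unfolding left_lim_def by (subst tendsto_Lim[of _ _ l]) auto
qed

lemma left_lim_cong_diff:
  assumes "cadlag_on t x" "cadlag_on t y" "r \<in> {0<..t}"
  shows "left_lim (\<lambda>s. x s - y s) r = left_lim x r - left_lim y r"
  unfolding left_lim_def[of "\<lambda>s. x s - y s"]
  by (rule tendsto_Lim) (use assms in \<open>auto intro!: tendsto_diff cadlag_left_lim\<close>)

text \<open>The left-limit process is the pointwise limit of step processes that show, at time
  \<open>r\<close>, the value of \<open>X\<close> at the last grid point strictly before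
  \<open>r\<close>. Each step is a variable known at its left endpoint, spread over a half-open
  interval, hence predictable.\<close>

lemma measurable_left_proc:
  fixes X :: "real \<Rightarrow> 'w \<Rightarrow> 'v::euclidean_space"
  assumes t: "0 \<le> t" and X: "progressive S t X" "\<And>\<omega>. \<omega> \<in> space (Prb S) \<Longrightarrow> cadlag_on t (\<lambda>r. X r \<omega>)"
  shows "(\<lambda>p. left_proc X (snd p) (fst p)) \<in> borel_measurable (predictable S t)"
proof -
  note measurable_time_predictable[OF t, measurable]
  \<comment> \<open>For \<open>r > 0\<close> this is the largest index whose grid point lies
    strictly below \<open>r\<close>. Strictness matters: a grid point equal to \<open>r\<close>
    would show the value after a jump at \<open>r\<close>.\<close>
  define k where "k n r = nat (\<lceil>r * real (Suc n)\<rceil> - 1)" for n and r :: real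
  define g where "g n i p = indicator {p. real i / real (Suc n) < snd p} p *\<^sub>R X (real i / real (Suc n)) (fst p)" for n i and p :: "'w \<times> real"
  have g: "g n i \<in> borel_measurable (predictable S t)" for n i
  proof (cases "real i / real (Suc n) \<le> t")
    case False
    have "g n i p = 0" if "p \<in> space (predictable S t)" for p
      using that False by (auto simp: g_def indicator_def)
    then show ?thesis by (subst measurable_cong[of _ _ "\<lambda>_. 0"]) auto
  next
    case True
    define s where "s = real i / real (Suc n)"
    have s: "0 \<le> s" "s \<le> t" using True by (auto simp: s_def)
    have gs: "g n i = (\<lambda>p. indicator {p. s < snd p} p *\<^sub>R X s (fst p))" unfolding g_def s_def ..
    have Xs: "X s \<in> borel_measurable (filt S s)" using X(1) s by (intro progressive_adapted) auto
    show ?thesis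
    proof (rule measurableI)
      fix B :: "'v set" assume B: "B \<in> sets borel"
      have "(X s -` B \<inter> space (filt S s)) \<times> {s<..t} \<in> sets (predictable S t)"
        using s measurable_sets[OF Xs B] by (intro predictable_rectangle) auto
      moreover have "{p \<in> space (predictable S t). snd p \<le> s} \<in> sets (predictable S t)" by measurable
      moreover have "g n i -` B \<inter> space (predictable S t) = (X s -` B \<inter> space (filt S s)) \<times> {s<..t}
          \<union> (if 0 \<in> B then {p \<in> space (predictable S t). snd p \<le> s} else {})"
        unfolding gs using s by (auto split: split_indicator_asm split_indicator)
      ultimately show "g n i -` B \<inter> space (predictable S t) \<in> sets (predictable S t)" by auto
    qed simp
  qed
  have gk: "(\<lambda>p. g n (k n (snd p)) p) \<in> borel_measurable (predictable S t)" for n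
    by (rule measurable_compose_countable[OF g]) (unfold k_def, measurable)
  have lim: "(\<lambda>n. g n (k n (snd p)) p) \<longlonglongrightarrow> left_proc X (snd p) (fst p)" if pp: "p \<in> space (predictable S t)" for p
  proof -
    obtain \<omega> r where p: "p = (\<omega>, r)" "\<omega> \<in> space (Prb S)" "0 \<le> r" "r \<le> t" using pp by auto
    show ?thesis
    proof (cases "r = 0")
      case True
      \<comment> \<open>At time 0 the index is 0 and the strict indicator in \<open>g\<close> fails,
        so all approximations are 0, the convention of \<open>left_proc\<close>.\<close>
      then show ?thesis by (simp add: p g_def k_def left_proc_def)
    next
      case False
      then have r: "0 < r" using p by simp
      define s where "s n = real (k n r) / real (Suc n)" for n
      have s1: "s n < r" and s2: "r - 1 / real (Suc n) \<le> s n" for n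
      proof -
        have "0 < \<lceil>r * real (Suc n)\<rceil>" using r by (simp add: zero_less_ceiling)
        then have eq: "real (k n r) = real_of_int \<lceil>r * real (Suc n)\<rceil> - 1" by (simp add: k_def of_nat_nat)
        have "real (k n r) < r * real (Suc n)" unfolding eq by linarith
        then show "s n < r" by (simp add: s_def divide_less_eq)
        have "r * real (Suc n) - 1 \<le> real (k n r)" unfolding eq by linarith
        then have "(r * real (Suc n) - 1) / real (Suc n) \<le> s n" unfolding s_def by (intro divide_right_mono) auto
        then show "r - 1 / real (Suc n) \<le> s n" by (simp add: diff_divide_distrib)
      qed
      have "s \<longlonglongrightarrow> r"
      proof (rule real_tendsto_sandwich[OF _ _ _ tendsto_const])
        show "(\<lambda>n. r - 1 / real (Suc n)) \<longlonglongrightarrow> r"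
          using tendsto_diff[OF tendsto_const LIMSEQ_inverse_real_of_nat, of r] by (simp add: inverse_eq_divide)
      qed (use s1 s2 in \<open>auto intro!: always_eventually less_imp_le\<close>)
      moreover have "s n \<in> {..<r} \<and> s n \<noteq> r" for n using s1[of n] by simp
      ultimately have fl: "filterlim s (at_left r) sequentially"
        unfolding filterlim_at by (intro conjI always_eventually) auto
      have "r \<in> {0<..t}" using r p by simp
      then have "((\<lambda>s. X s \<omega>) \<longlongrightarrow> left_lim (\<lambda>s. X s \<omega>) r) (at_left r)"
        by (rule cadlag_left_lim[OF X(2)[OF p(2)]])
      then have "(\<lambda>n. X (s n) \<omega>) \<longlonglongrightarrow> left_lim (\<lambda>s. X s \<omega>) r"
        by (rule filterlim_compose[OF _ fl])
      moreover have "g n (k n (snd p)) p = X (s n) \<omega>" for n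
        using s1[of n] by (simp add: g_def p s_def)
      ultimately show ?thesis using False by (simp add: left_proc_def p)
    qed
  qed
  show ?thesis by (rule borel_measurable_LIMSEQ_metric[OF gk lim])
qed

definition sup_norm :: "real \<Rightarrow> (real \<Rightarrow> 'w \<Rightarrow> 'v::euclidean_space) \<Rightarrow> 'w \<Rightarrow> ennreal" where
  "sup_norm t X \<omega> = (SUP r\<in>{0..t}. ennreal (norm (X r \<omega>)))"

lemma norm_le_sup_norm: "r \<in> {0..t} \<Longrightarrow> ennreal (norm (X r \<omega>)) \<le> sup_norm t X \<omega>"
  unfolding sup_norm_def by (rule SUP_upper)

text \<open>Countably many times suffice: by right continuity, a value above the supremum over
  rational times would persist at rational times just after it.\<close>

lemma measurable_sup_norm:
  fixes X :: "real \<Rightarrow> 'w \<Rightarrow> 'v::euclidean_space"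
  assumes t: "0 \<le> t" and X: "progressive S t X" "\<And>\<omega>. \<omega> \<in> space (Prb S) \<Longrightarrow> cadlag_on t (\<lambda>r. X r \<omega>)"
  shows "sup_norm t X \<in> borel_measurable (Prb S)"
proof -
  \<comment> \<open>The right endpoint is adjoined by hand, since right continuity gives no
    information about the value there.\<close>
  define R where "R = (\<rat> \<inter> {0..t}) \<union> {t}"
  have [measurable]: "X r \<in> borel_measurable (Prb S)" if "r \<in> R" for r
    using t that X(1) by (intro measurable_from_subalg[OF subalgebra_filt progressive_adapted]) (auto simp: R_def)
  have "countable R" unfolding R_def by (auto intro: countable_subset[OF _ countable_rat])
  then have "(\<lambda>\<omega>. SUP r\<in>R. ennreal (norm (X r \<omega>))) \<in> borel_measurable (Prb S)"
    by (intro borel_measurable_SUP) auto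
  moreover have "sup_norm t X \<omega> = (SUP r\<in>R. ennreal (norm (X r \<omega>)))" if \<omega>: "\<omega> \<in> space (Prb S)" for \<omega>
  proof (rule antisym)
    show "(SUP r\<in>R. ennreal (norm (X r \<omega>))) \<le> sup_norm t X \<omega>"
      unfolding sup_norm_def by (rule SUP_subset_mono) (use t in \<open>auto simp: R_def\<close>)
    show "sup_norm t X \<omega> \<le> (SUP r\<in>R. ennreal (norm (X r \<omega>)))"
      unfolding sup_norm_def
    proof (rule SUP_least)
      fix r assume r: "r \<in> {0..t}"
      show "ennreal (norm (X r \<omega>)) \<le> (SUP r\<in>R. ennreal (norm (X r \<omega>)))"
      proof (cases "r = t")
        case True
        then show ?thesis by (intro SUP_upper) (simp add: R_def)
      next
        case False
        then have rt: "r < t" using r by simp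
        have "((\<lambda>r. ennreal (norm (X r \<omega>))) \<longlongrightarrow> ennreal (norm (X r \<omega>))) (at_right r)"
          using X(2)[OF \<omega>] r rt by (intro tendsto_ennrealI tendsto_norm) (auto simp: cadlag_on_def)
        show ?thesis
        proof (rule ccontr)
          assume "\<not> ?thesis"
          then have "\<forall>\<^sub>F y in at_right r. (SUP r\<in>R. ennreal (norm (X r \<omega>))) < ennreal (norm (X y \<omega>))"
            using order_tendstoD(1)[OF \<open>(_ \<longlongrightarrow> _) (at_right r)\<close>] by (simp add: not_le)
          then obtain b where b: "r < b" "\<And>y. r < y \<Longrightarrow> y < b \<Longrightarrow> (SUP r\<in>R. ennreal (norm (X r \<omega>))) < ennreal (norm (X y \<omega>))"
            by (auto simp: eventually_at_right_field)
          obtain y where y: "y \<in> \<rat>" "r < y" "y < min b t" using Rats_dense_in_real[of r "min b t"] b(1) rt by auto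
          have "ennreal (norm (X y \<omega>)) \<le> (SUP r\<in>R. ennreal (norm (X r \<omega>)))"
            by (rule SUP_upper) (use y r in \<open>auto simp: R_def\<close>)
          with b(2)[of y] y show False by (auto dest: leD)
        qed
      qed
    qed
  qed
  ultimately show ?thesis by (simp cong: measurable_cong)
qed

lemma norm_left_proc_le:
  assumes t: "0 \<le> t" and X: "cadlag_on t (\<lambda>r. X r \<omega>)" and r: "r \<in> {0..t}"
  shows "ennreal (norm (left_proc X r \<omega>)) \<le> sup_norm t X \<omega>"
proof (cases "r = 0")
  case False
  then have r': "r \<in> {0<..t}" using r by auto
  have "((\<lambda>r. ennreal (norm (X r \<omega>))) \<longlongrightarrow> ennreal (norm (left_lim (\<lambda>s. X s \<omega>) r))) (at_left r)"
    by (intro tendsto_ennrealI tendsto_norm cadlag_left_lim[OF X r'])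
  moreover have "\<forall>\<^sub>F s in at_left r. ennreal (norm (X s \<omega>)) \<le> sup_norm t X \<omega>"
    using r' unfolding eventually_at_left_field
    by (intro exI[of _ 0]) (auto intro!: norm_le_sup_norm)
  ultimately show ?thesis using False unfolding left_proc_def
    by (auto intro: tendsto_upperbound)
qed (simp add: left_proc_def)

end

section \<open>Expected energy\<close>

text \<open>On a set of finite mass this turns square integrability into integrability.\<close>

lemma le_one_plus_square: "x \<le> 1 + x\<^sup>2" for x :: real
proof (cases "x \<le> 1")
  case False
  then have "x * 1 \<le> x * x" by (intro mult_left_mono) auto
  then show ?thesis by (simp add: power2_eq_square)
qed (simp add: add_increasing2)

context mode_process
begin

text \<open>A bound for the density in time of the compensator. The stages are bounded separately by
  the same rate bound, hence the factor \<open>max_jumps S\<close>.\<close>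

definition comp_bound :: real where
  "comp_bound = real (max_jumps S) * (SOME K. \<forall>\<gamma>. \<forall>t\<ge>0. rate S \<gamma> t \<le> K)"

lemma rate_le_bound: "0 \<le> t \<Longrightarrow> rate S \<gamma> t \<le> (SOME K. \<forall>\<gamma>. \<forall>t\<ge>0. rate S \<gamma> t \<le> K)"
  using someI_ex[OF rate_bounded] by simp

lemma comp_bound_nonneg: "0 \<le> comp_bound"
  unfolding comp_bound_def using rate_le_bound[of 0] rate_nonneg[of 0] by (meson mult_nonneg_nonneg of_nat_0_le_iff order.trans order_refl)

text \<open>The transition laws have mass 1, so an integrand depending on time alone meets at most
  the rate bound in each stage.\<close>

lemma nn_integral_q_hat_time_le:
  assumes [measurable]: "h \<in> borel_measurable borel" and \<omega>: "\<omega> \<in> space (Prb S)"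
  shows "(\<integral>\<^sup>+p. h (fst p) \<partial>q_hat S \<omega>) \<le> ennreal comp_bound * (\<integral>\<^sup>+v. h v \<partial>lborel)"
proof -
  define K where "K = (SOME K. \<forall>\<gamma>. \<forall>t\<ge>0. rate S \<gamma> t \<le> K)"
  have K: "rate S \<gamma> (max 0 v) \<le> K" for \<gamma> v unfolding K_def by (rule rate_le_bound) simp
  have "(\<integral>\<^sup>+p. h (fst p) \<partial>q_hat S \<omega>) = (\<integral>\<^sup>+v. (\<Sum>j<max_jumps S.
         indicator {v. jump S j \<omega> < ereal v \<and> ereal v \<le> jump S (Suc j) \<omega>} v
         * ennreal (rate S (mark S j \<omega>) (max 0 v))
         * (\<integral>\<^sup>+\<theta>. h v \<partial>trans_law S (mark S j \<omega>) (max 0 v))) \<partial>lborel)"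
    using \<omega> by (subst nn_integral_q_hat) auto
  also have "\<dots> \<le> (\<integral>\<^sup>+v. (\<Sum>j<max_jumps S. ennreal K * h v) \<partial>lborel)"
  proof (intro nn_integral_mono sum_mono)
    fix v j
    interpret Q: prob_space "trans_law S (mark S j \<omega>) (max 0 v)" by (rule prob_space_trans_law) simp
    have "indicator {v. jump S j \<omega> < ereal v \<and> ereal v \<le> jump S (Suc j) \<omega>} v * ennreal (rate S (mark S j \<omega>) (max 0 v)) \<le> 1 * ennreal K"
      using K by (intro mult_mono ennreal_leI) (auto split: split_indicator)
    then show "indicator {v. jump S j \<omega> < ereal v \<and> ereal v \<le> jump S (Suc j) \<omega>} v * ennreal (rate S (mark S j \<omega>) (max 0 v))
      * (\<integral>\<^sup>+\<theta>. h v \<partial>trans_law S (mark S j \<omega>) (max 0 v)) \<le> ennreal K * h v"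
      by (simp add: Q.emeasure_space_1 mult_right_mono)
  qed
  also have "\<dots> = ennreal comp_bound * (\<integral>\<^sup>+v. h v \<partial>lborel)"
    unfolding comp_bound_def K_def[symmetric]
    by (simp add: nn_integral_cmult ennreal_mult' ennreal_of_nat_eq_real_of_nat mult.assoc)
  finally show ?thesis .
qed

text \<open>There are at most \<open>max_jumps S\<close> points. The bound \<open>c\<close> may be
  specific to one path, such as its squared supremum.\<close>

lemma nn_integral_q_meas_le:
  assumes "f \<in> borel_measurable (borel \<Otimes>\<^sub>M borel)" "\<And>p. f p \<le> c"
  shows "(\<integral>\<^sup>+p. f p \<partial>q_meas S \<omega>) \<le> of_nat (max_jumps S) * c"
proof -
  have "(\<integral>\<^sup>+p. f p \<partial>q_meas S \<omega>) \<le> (\<Sum>j<max_jumps S. c)"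
    unfolding nn_integral_q_meas[OF assms(1)] using assms(2) by (intro sum_mono) (auto split: split_indicator)
  then show ?thesis by simp
qed

text \<open>It yields both finite mass on bounded time intervals and zero mass at single
  times.\<close>

lemma q_hat_strip:
  assumes "A \<in> sets borel" "\<omega> \<in> space (Prb S)"
  shows "emeasure (q_hat S \<omega>) (A \<times> UNIV) \<le> ennreal comp_bound * emeasure lborel A"
proof -
  have A: "A \<times> UNIV \<in> sets (q_hat S \<omega>)" using assms by (auto intro!: pair_measureI)
  have "emeasure (q_hat S \<omega>) (A \<times> UNIV) = (\<integral>\<^sup>+p. indicator A (fst p) \<partial>q_hat S \<omega>)"
  proof -
    have "(\<integral>\<^sup>+p. indicator A (fst p) \<partial>q_hat S \<omega>) = (\<integral>\<^sup>+p. indicator (A \<times> UNIV) p \<partial>q_hat S \<omega>)"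
      by (intro nn_integral_cong) (simp add: indicator_times)
    then show ?thesis using A by (simp only: nn_integral_indicator)
  qed
  also have "\<dots> \<le> ennreal comp_bound * (\<integral>\<^sup>+v. indicator A v \<partial>lborel)"
    using assms by (intro nn_integral_q_hat_time_le) auto
  finally show ?thesis using assms by simp
qed

lemma measurable_joint_indicator:
  fixes g :: "'w \<times> real \<Rightarrow> 'v::euclidean_space"
  assumes g: "g \<in> borel_measurable (Prb S \<Otimes>\<^sub>M restrict_space lborel {0..t})"
  shows "(\<lambda>p. indicator {0..t} (snd p) *\<^sub>R g p) \<in> borel_measurable (Prb S \<Otimes>\<^sub>M lborel)"
proof -
  let ?R = "restrict_space (Prb S \<Otimes>\<^sub>M lborel) (UNIV \<times> {0..t})"
  have "UNIV \<times> {0..t} \<inter> space (Prb S \<Otimes>\<^sub>M lborel) = space (Prb S) \<times> {0..t}" by (auto simp: space_pair_measure)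
  then have sA: "UNIV \<times> {0..t} \<inter> space (Prb S \<Otimes>\<^sub>M lborel) \<in> sets (Prb S \<Otimes>\<^sub>M lborel)" by auto
  have "(\<lambda>p. (fst p, snd p)) \<in> ?R \<rightarrow>\<^sub>M Prb S \<Otimes>\<^sub>M restrict_space lborel {0..t}"
    by (intro measurable_Pair measurable_restrict_space2) (auto simp: space_restrict_space intro!: measurable_restrict_space1)
  from measurable_compose[OF this g] have "g \<in> borel_measurable ?R" by simp
  then show ?thesis
    by (subst (asm) borel_measurable_restrict_space_iff[OF sA]) (simp add: indicator_times)
qed

lemma L2_q_measurable:
  "f \<in> L2_q S t \<Longrightarrow> (\<lambda>x. f (snd (fst x)) (snd x) (fst (fst x))) \<in> borel_measurable (predictable S t \<Otimes>\<^sub>M borel)"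
  by (simp add: L2_q_def case_prod_beta')

text \<open>Membership in \<open>L2_q\<close> is measured by \<open>q_meas\<close>; the compensator
  formula moves the norm to \<open>q_hat\<close>.\<close>

lemma L2_q_finite:
  assumes "0 \<le> t" "f \<in> L2_q S t"
  shows "(\<integral>\<^sup>+\<omega>. (\<integral>\<^sup>+p. ennreal ((norm (f (fst p) (snd p) \<omega>))\<^sup>2) * indicator ({0..t} \<times> UNIV) p \<partial>q_hat S \<omega>) \<partial>Prb S) < \<infinity>"
proof -
  have 1: "(\<integral>\<^sup>+\<omega>. (\<integral>\<^sup>+p. ennreal ((norm (f (fst p) (snd p) \<omega>))\<^sup>2) * indicator ({0..t} \<times> UNIV) p \<partial>q_meas S \<omega>) \<partial>Prb S) < \<infinity>"
    using assms(2) by (simp add: L2_q_def case_prod_beta')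
  have "(\<lambda>x. ennreal ((norm (f (snd (fst x)) (snd x) (fst (fst x))))\<^sup>2)) \<in> borel_measurable (predictable S t \<Otimes>\<^sub>M borel)"
    using L2_q_measurable[OF assms(2)] by measurable
  from compensator_formula(1)[OF assms(1) this] 1
  show "(\<integral>\<^sup>+\<omega>. (\<integral>\<^sup>+p. ennreal ((norm (f (fst p) (snd p) \<omega>))\<^sup>2) * indicator ({0..t} \<times> UNIV) p \<partial>q_hat S \<omega>) \<partial>Prb S) < \<infinity>"
    by simp
qed

text \<open>Against \<open>q_meas\<close> the integral is a finite sum. Against \<open>q_hat\<close>
  the norm of the integrand is dominated by \<open>1 + |f|^2\<close> on a strip of finite mass. One
  exceptional null set serves every \<open>r\<close>.\<close>

lemma L2_q_AE_integrable:
  assumes t: "0 \<le> t" and f: "f \<in> L2_q S t"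
  shows "AE \<omega> in Prb S. \<forall>r\<in>{0..t}. set_integrable (q_meas S \<omega>) ({0<..r} \<times> UNIV) (\<lambda>p. f (fst p) (snd p) \<omega>)
    \<and> set_integrable (q_hat S \<omega>) ({0<..r} \<times> UNIV) (\<lambda>p. f (fst p) (snd p) \<omega>)"
proof -
  note f_meas = L2_q_measurable[OF f]
  have sq: "(\<lambda>x. ennreal ((norm (f (snd (fst x)) (snd x) (fst (fst x))))\<^sup>2)) \<in> borel_measurable (predictable S t \<Otimes>\<^sub>M borel)"
    using f_meas by measurable
  have "AE \<omega> in Prb S. (\<integral>\<^sup>+p. ennreal ((norm (f (fst p) (snd p) \<omega>))\<^sup>2) * indicator ({0..t} \<times> UNIV) p \<partial>q_hat S \<omega>) \<noteq> \<infinity>"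
    using L2_q_finite[OF t f] compensator_formula(3)[OF t sq] by (intro nn_integral_PInf_AE) auto
  then show ?thesis using AE_space
  proof eventually_elim
    case (elim \<omega>)
    have \<omega>: "\<omega> \<in> space (Prb S)" by fact
    have fm: "(\<lambda>p. indicator ({0..t} \<times> UNIV) p *\<^sub>R f (fst p) (snd p) \<omega>) \<in> borel_measurable (borel \<Otimes>\<^sub>M borel)"
      using measurable_section[OF t \<omega> f_meas]
      by (subst (asm) borel_measurable_restrict_space_iff) (auto simp: space_pair_measure)
    show ?case
    proof
      fix r assume r: "r \<in> {0..t}"
      have "(\<lambda>p :: real \<times> 'e. indicator {0<..r} (fst p) *\<^sub>R (indicator ({0..t} \<times> UNIV) p *\<^sub>R f (fst p) (snd p) \<omega>)) \<in> borel_measurable (borel \<Otimes>\<^sub>M borel)"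
        using fm by measurable
      also have "(\<lambda>p :: real \<times> 'e. indicator {0<..r} (fst p) *\<^sub>R (indicator ({0..t} \<times> UNIV) p *\<^sub>R f (fst p) (snd p) \<omega>))
        = (\<lambda>p. indicator ({0<..r} \<times> UNIV) p *\<^sub>R f (fst p) (snd p) \<omega>)"
        using r by (auto simp: fun_eq_iff split: split_indicator)
      finally have fmr: "(\<lambda>p. indicator ({0<..r} \<times> UNIV) p *\<^sub>R f (fst p) (snd p) \<omega>) \<in> borel_measurable (borel \<Otimes>\<^sub>M borel)" .
      have "set_integrable (q_meas S \<omega>) ({0<..r} \<times> UNIV) (\<lambda>p. f (fst p) (snd p) \<omega>)"
        unfolding set_integrable_def q_meas_def using fmr r
        by (subst integrable_distr_eq) (auto simp: space_pair_measure intro!: integrable_count_space)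
      moreover have "set_integrable (q_hat S \<omega>) ({0<..r} \<times> UNIV) (\<lambda>p. f (fst p) (snd p) \<omega>)"
        unfolding set_integrable_def
      proof (rule integrableI_bounded)
        show "(\<lambda>p. indicator ({0<..r} \<times> UNIV) p *\<^sub>R f (fst p) (snd p) \<omega>) \<in> borel_measurable (q_hat S \<omega>)"
          using fmr by (simp add: measurable_cong_sets[OF sets_q_hat refl])
        have "(\<integral>\<^sup>+p. ennreal (norm (indicator ({0<..r} \<times> UNIV) p *\<^sub>R f (fst p) (snd p) \<omega>)) \<partial>q_hat S \<omega>)
          \<le> (\<integral>\<^sup>+p. indicator ({0<..r} \<times> UNIV) p + ennreal ((norm (f (fst p) (snd p) \<omega>))\<^sup>2) * indicator ({0..t} \<times> UNIV) p \<partial>q_hat S \<omega>)"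
        proof (rule nn_integral_mono)
          fix p :: "real \<times> 'e"
          define x where "x = norm (f (fst p) (snd p) \<omega>)"
          have "ennreal x \<le> 1 + ennreal (x\<^sup>2)"
            using le_one_plus_square[of x] by (metis ennreal_1 ennreal_leI ennreal_plus zero_le_one zero_le_power2)
          then show "ennreal (norm (indicator ({0<..r} \<times> UNIV) p *\<^sub>R f (fst p) (snd p) \<omega>))
            \<le> indicator ({0<..r} \<times> UNIV) p + ennreal ((norm (f (fst p) (snd p) \<omega>))\<^sup>2) * indicator ({0..t} \<times> UNIV) p"
            using r by (auto simp: x_def split: split_indicator)
        qed
        also have "\<dots> = emeasure (q_hat S \<omega>) ({0<..r} \<times> UNIV) + (\<integral>\<^sup>+p. ennreal ((norm (f (fst p) (snd p) \<omega>))\<^sup>2) * indicator ({0..t} \<times> UNIV) p \<partial>q_hat S \<omega>)"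
        proof -
          have "{0<..r} \<times> UNIV \<in> sets (borel \<Otimes>\<^sub>M borel :: (real \<times> 'e) measure)" by (intro pair_measureI) auto
          then show ?thesis using measurable_section_indicator[OF t \<omega> sq]
            by (subst nn_integral_add) (auto simp: measurable_cong_sets[OF sets_q_hat refl])
        qed
        also have "\<dots> < \<infinity>"
        proof -
          have "emeasure (q_hat S \<omega>) ({0<..r} \<times> UNIV) \<le> ennreal comp_bound * ennreal r"
            using q_hat_strip[of "{0<..r}" \<omega>] \<omega> r by simp
          also have "\<dots> < \<infinity>" by (simp add: ennreal_mult_less_top)
          finally show ?thesis using elim(1) by (simp add: less_top)
        qed
        finally show "(\<integral>\<^sup>+p. ennreal (norm (indicator ({0<..r} \<times> UNIV) p *\<^sub>R f (fst p) (snd p) \<omega>)) \<partial>q_hat S \<omega>) < \<infinity>" .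
      qed
      ultimately show "set_integrable (q_meas S \<omega>) ({0<..r} \<times> UNIV) (\<lambda>p. f (fst p) (snd p) \<omega>)
        \<and> set_integrable (q_hat S \<omega>) ({0<..r} \<times> UNIV) (\<lambda>p. f (fst p) (snd p) \<omega>)" ..
    qed
  qed
qed

end

text \<open>
  To be applied to the difference \<open>D\<close> of the forward and the backward solution, with \<open>b = A D\<close> and
  \<open>f = C D\<^sub>- - Z\<close>, where \<open>D\<^sub>-\<close> is the left-limit process.
\<close>

locale energy_system = mode_process S
  for S :: "('w, 'e::metric_space, 'n::finite, 'd::finite) switch_system" +
  fixes t :: real and D :: "real \<Rightarrow> 'w \<Rightarrow> real^'n" and f :: "real \<Rightarrow> 'e \<Rightarrow> 'w \<Rightarrow> real^'n"
    and b :: "real \<Rightarrow> 'w \<Rightarrow> real^'n" and a :: real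
  assumes t: "0 \<le> t" and a: "0 \<le> a"
    and D: "D \<in> L2_cadlag S t" and f: "f \<in> L2_q S t"
    and b_meas: "(\<lambda>p. b (snd p) (fst p)) \<in> borel_measurable (Prb S \<Otimes>\<^sub>M restrict_space lborel {0..t})"
    and b_le: "AE \<omega> in Prb S. AE s in lborel. s \<in> {0..t} \<longrightarrow> norm (b s \<omega>) \<le> a * norm (D s \<omega>)"
    and eq: "AE \<omega> in Prb S. \<forall>r\<in>{0..t}. D r \<omega> = D 0 \<omega> + (LINT s:{0..r}|lborel. b s \<omega>)
      + q_tilde_int S \<omega> r (\<lambda>(s, \<theta>). f s \<theta> \<omega>)"
begin

abbreviation "P \<equiv> Prb S"
abbreviation "L \<equiv> restrict_space lborel {0..t}"

lemma D_prog: "progressive S t D" and D_cadlag: "\<omega> \<in> space P \<Longrightarrow> cadlag_on t (\<lambda>r. D r \<omega>)"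
  using D by (auto simp: L2_cadlag_def)

lemma measurable_sup_D [measurable]: "sup_norm t D \<in> borel_measurable P"
  by (rule measurable_sup_norm[OF t D_prog D_cadlag])

lemma sup_D_finite: "(\<integral>\<^sup>+\<omega>. (sup_norm t D \<omega>)\<^sup>2 \<partial>P) < \<infinity>"
  using D by (simp add: L2_cadlag_def sup_norm_def)

lemma AE_sup_D: "AE \<omega> in P. sup_norm t D \<omega> < \<infinity>"
proof -
  have "AE \<omega> in P. (sup_norm t D \<omega>)\<^sup>2 \<noteq> \<infinity>"
    using sup_D_finite by (intro nn_integral_PInf_AE) auto
  then show ?thesis by eventually_elim (auto simp: less_top power2_eq_square ennreal_mult_eq_top_iff)
qed

lemma D_le: "r \<in> {0..t} \<Longrightarrow> ennreal ((norm (D r \<omega>))\<^sup>2) \<le> (sup_norm t D \<omega>)\<^sup>2"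
  using norm_le_sup_norm[of r t D \<omega>] power_mono[of "ennreal (norm (D r \<omega>))" "sup_norm t D \<omega>" 2] by (simp add: ennreal_power)

lemma left_D_le: "r \<in> {0..t} \<Longrightarrow> \<omega> \<in> space P \<Longrightarrow> ennreal ((norm (left_proc D r \<omega>))\<^sup>2) \<le> (sup_norm t D \<omega>)\<^sup>2"
  using norm_left_proc_le[where X=D and \<omega>=\<omega>, OF t D_cadlag, of r] power_mono[of "ennreal (norm (left_proc D r \<omega>))" "sup_norm t D \<omega>" 2] by (simp add: ennreal_power)

lemma measurable_D_joint [measurable]: "(\<lambda>p. indicator {0..t} (snd p) *\<^sub>R D (snd p) (fst p)) \<in> borel_measurable (P \<Otimes>\<^sub>M lborel)"
  and measurable_left_joint [measurable]: "(\<lambda>p. indicator {0..t} (snd p) *\<^sub>R left_proc D (snd p) (fst p)) \<in> borel_measurable (P \<Otimes>\<^sub>M lborel)"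
  and measurable_b_joint [measurable]: "(\<lambda>p. indicator {0..t} (snd p) *\<^sub>R b (snd p) (fst p)) \<in> borel_measurable (P \<Otimes>\<^sub>M lborel)"
proof -
  note * = measurable_joint_indicator
  show "(\<lambda>p. indicator {0..t} (snd p) *\<^sub>R D (snd p) (fst p)) \<in> borel_measurable (P \<Otimes>\<^sub>M lborel)"
    by (rule *[OF progressive_measurable[OF D_prog t]])
  show "(\<lambda>p. indicator {0..t} (snd p) *\<^sub>R b (snd p) (fst p)) \<in> borel_measurable (P \<Otimes>\<^sub>M lborel)"
    by (rule *[OF b_meas])
  show "(\<lambda>p. indicator {0..t} (snd p) *\<^sub>R left_proc D (snd p) (fst p)) \<in> borel_measurable (P \<Otimes>\<^sub>M lborel)"
    by (rule *[OF measurable_compose[OF id_predictable[OF t] measurable_left_proc[OF t D_prog D_cadlag]]])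
qed

lemma f_meas: "(\<lambda>x. f (snd (fst x)) (snd x) (fst (fst x))) \<in> borel_measurable (predictable S t \<Otimes>\<^sub>M borel)"
  using f by (simp add: L2_q_def case_prod_beta')

lemma left_meas: "(\<lambda>x. left_proc D (snd (fst x)) (fst (fst x))) \<in> borel_measurable (predictable S t \<Otimes>\<^sub>M borel)"
  using measurable_compose[OF measurable_fst measurable_left_proc[OF t D_prog D_cadlag]] by simp

lemma time_meas: "(\<lambda>x. snd (fst x)) \<in> borel_measurable (predictable S t \<Otimes>\<^sub>M borel)"
  by (rule measurable_compose[OF measurable_fst measurable_time_predictable[OF t]])

text \<open>Neither random measure charges time \<open>0\<close>, so the compensator formula may be read on \<open>(0, r]\<close>.\<close>

lemma compensator_strip:
  assumes \<Phi>: "\<Phi> \<in> borel_measurable (predictable S t \<Otimes>\<^sub>M borel)" and r: "r \<le> t"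
  shows "(\<integral>\<^sup>+\<omega>. (\<integral>\<^sup>+p. \<Phi> ((\<omega>, fst p), snd p) * indicator ({0<..r} \<times> UNIV) p \<partial>q_meas S \<omega>) \<partial>P)
    = (\<integral>\<^sup>+\<omega>. (\<integral>\<^sup>+p. \<Phi> ((\<omega>, fst p), snd p) * indicator ({0<..r} \<times> UNIV) p \<partial>q_hat S \<omega>) \<partial>P)"
    and "(\<lambda>\<omega>. \<integral>\<^sup>+p. \<Phi> ((\<omega>, fst p), snd p) * indicator ({0<..r} \<times> UNIV) p \<partial>q_meas S \<omega>) \<in> borel_measurable P"
    and "(\<lambda>\<omega>. \<integral>\<^sup>+p. \<Phi> ((\<omega>, fst p), snd p) * indicator ({0<..r} \<times> UNIV) p \<partial>q_hat S \<omega>) \<in> borel_measurable P"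
    and "\<omega> \<in> space P \<Longrightarrow> (\<lambda>p. \<Phi> ((\<omega>, fst p), snd p) * indicator ({0<..r} \<times> UNIV) p) \<in> borel_measurable (borel \<Otimes>\<^sub>M borel)"
proof -
  note [measurable] = \<Phi> time_meas
  let ?\<Phi> = "\<lambda>x. \<Phi> x * indicator {0<..r} (snd (fst x))"
  have m: "?\<Phi> \<in> borel_measurable (predictable S t \<Otimes>\<^sub>M borel)" by measurable
  have e: "\<Phi> ((\<omega>, fst p), snd p) * indicator {0<..r} (fst p) * indicator ({0..t} \<times> UNIV) p
    = \<Phi> ((\<omega>, fst p), snd p) * indicator ({0<..r} \<times> UNIV) p" for \<omega> p
    using r by (auto split: split_indicator)
  show "(\<integral>\<^sup>+\<omega>. (\<integral>\<^sup>+p. \<Phi> ((\<omega>, fst p), snd p) * indicator ({0<..r} \<times> UNIV) p \<partial>q_meas S \<omega>) \<partial>P)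
    = (\<integral>\<^sup>+\<omega>. (\<integral>\<^sup>+p. \<Phi> ((\<omega>, fst p), snd p) * indicator ({0<..r} \<times> UNIV) p \<partial>q_hat S \<omega>) \<partial>P)"
    "(\<lambda>\<omega>. \<integral>\<^sup>+p. \<Phi> ((\<omega>, fst p), snd p) * indicator ({0<..r} \<times> UNIV) p \<partial>q_meas S \<omega>) \<in> borel_measurable P"
    "(\<lambda>\<omega>. \<integral>\<^sup>+p. \<Phi> ((\<omega>, fst p), snd p) * indicator ({0<..r} \<times> UNIV) p \<partial>q_hat S \<omega>) \<in> borel_measurable P"
    using compensator_formula[OF t m] by (simp_all only: fst_conv snd_conv e)
  show "(\<lambda>p. \<Phi> ((\<omega>, fst p), snd p) * indicator ({0<..r} \<times> UNIV) p) \<in> borel_measurable (borel \<Otimes>\<^sub>M borel)" if "\<omega> \<in> space P"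
    using measurable_section_indicator[OF t that m] by (simp only: fst_conv snd_conv e)
qed

text \<open>The jumps of \<open>D\<close> are the values of \<open>f\<close> at the points of
  \<open>q_meas\<close>, so this is the expected sum of squared jumps on
  \<open>{0<..r}\<close>.\<close>

definition jump_energy :: "real \<Rightarrow> ennreal" where
  "jump_energy r = (\<integral>\<^sup>+\<omega>. (\<integral>\<^sup>+p. ennreal ((norm (f (fst p) (snd p) \<omega>))\<^sup>2) * indicator ({0<..r} \<times> UNIV) p \<partial>q_meas S \<omega>) \<partial>P)"

lemma jump_energy_finite: "r \<le> t \<Longrightarrow> jump_energy r < \<infinity>"
proof -
  assume r: "r \<le> t"
  have "jump_energy r \<le> (\<integral>\<^sup>+\<omega>. (\<integral>\<^sup>+p\<in>{0..t} \<times> UNIV. (case p of (r, \<theta>) \<Rightarrow> ennreal ((norm (f r \<theta> \<omega>))\<^sup>2)) \<partial>q_meas S \<omega>) \<partial>P)"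
    unfolding jump_energy_def using r by (intro nn_integral_mono) (auto split: split_indicator)
  also have "\<dots> < \<infinity>" using f by (simp add: L2_q_def)
  finally show ?thesis .
qed

lemma jump_energy_mono: "r \<le> r' \<Longrightarrow> jump_energy r \<le> jump_energy r'"
  unfolding jump_energy_def by (intro nn_integral_mono) (auto split: split_indicator)

lemma fsq_meas: "(\<lambda>x. ennreal ((norm (f (snd (fst x)) (snd x) (fst (fst x))))\<^sup>2)) \<in> borel_measurable (predictable S t \<Otimes>\<^sub>M borel)"
  using f_meas by measurable

text \<open>The identity for \<open>jump_path\<close> concerns the final time of the path, so each
  \<open>r\<close> gets its own instance, all of them off one common null set.\<close>

lemma AE_jump_path:
  "AE \<omega> in P. \<forall>r\<in>{0..t}. jump_path r (\<lambda>s. b s \<omega>) (\<lambda>p. f (fst p) (snd p) \<omega>) (q_meas S \<omega>) (q_hat S \<omega>)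
     {j \<in> {1..max_jumps S}. jump S j \<omega> < \<infinity>} (\<lambda>j. rjump S j \<omega>) (\<lambda>j. mark S j \<omega>) (\<lambda>s. D s \<omega>)"
  using L2_q_AE_integrable[OF t f] AE_sup_D b_le eq AE_space
proof eventually_elim
  case (elim \<omega>)
  have \<omega>: "\<omega> \<in> space P" by fact
  obtain N where N: "sup_norm t D \<omega> = ennreal N" "0 \<le> N" using elim(2) by (cases "sup_norm t D \<omega>") auto
  have DN: "norm (D s \<omega>) \<le> N" if "s \<in> {0..t}" for s
    using norm_le_sup_norm[OF that, of D \<omega>] N by simp
  have "(\<lambda>s. indicator {0..t} s *\<^sub>R b s \<omega>) \<in> borel_measurable lborel"
    using measurable_compose[OF measurable_Pair1'[OF \<omega>] measurable_b_joint] by simp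
  \<comment> \<open>On a path with finite supremum \<open>N\<close> the drift is bounded almost
    everywhere by the constant \<open>a * N\<close> on \<open>[0,t]\<close>.\<close>
  then have "integrable lborel (\<lambda>s. indicator {0..t} s *\<^sub>R b s \<omega>)"
  proof (rule Bochner_Integration.integrable_bound[rotated])
    show "integrable lborel (\<lambda>s. indicator {0..t} s * (a * N))" by (intro integrable_mult_left integrable_real_indicator) (use t in auto)
    show "AE s in lborel. norm (indicator {0..t} s *\<^sub>R b s \<omega>) \<le> norm (indicator {0..t} s * (a * N))"
      using elim(3)
    proof eventually_elim
      case (elim s)
      have "0 \<le> a * N" using a N by simp
      moreover have "norm (b s \<omega>) \<le> a * N" if "s \<in> {0..t}"
        using elim mult_left_mono[OF DN[OF that] a] that by linarith
      ultimately show ?case by (simp split: split_indicator)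
    qed
  qed
  then have b_int: "set_integrable lborel {0..t} (\<lambda>s. b s \<omega>)" by (simp add: set_integrable_def)
  show ?case
  proof
    fix r assume r: "r \<in> {0..t}"
    let ?K = "{j \<in> {1..max_jumps S}. jump S j \<omega> < \<infinity>}"
    show "jump_path r (\<lambda>s. b s \<omega>) (\<lambda>p. f (fst p) (snd p) \<omega>) (q_meas S \<omega>) (q_hat S \<omega>)
      ?K (\<lambda>j. rjump S j \<omega>) (\<lambda>j. mark S j \<omega>) (\<lambda>s. D s \<omega>)"
    proof
      show "0 \<le> r" using r by simp
      show K: "finite ?K" by simp
      show "inj_on (\<lambda>j. rjump S j \<omega>) ?K"
      proof (rule inj_onI)
        fix i j assume ij: "i \<in> ?K" "j \<in> ?K" "rjump S i \<omega> = rjump S j \<omega>"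
        then have "jump S i \<omega> = jump S j \<omega>" using ereal_rjump[of i \<omega>] ereal_rjump[of j \<omega>] \<omega> by auto
        then show "i = j" using jump_strict_mono[of i j \<omega>] jump_strict_mono[of j i \<omega>] ij(1,2) \<omega>
          by (cases i j rule: linorder_cases) auto
      qed
      show Q: "q_meas S \<omega> = distr (count_space ?K) (borel \<Otimes>\<^sub>M borel) (\<lambda>j. (rjump S j \<omega>, mark S j \<omega>))"
        unfolding q_meas_def rjump_def ..
      show "sets (q_hat S \<omega>) = sets (borel \<Otimes>\<^sub>M borel)" by simp
      have "emeasure (q_hat S \<omega>) ({0<..r} \<times> UNIV) \<le> ennreal comp_bound * ennreal r"
        using q_hat_strip[of "{0<..r}" \<omega>] \<omega> r by simp
      also have "\<dots> < \<infinity>" by (simp add: ennreal_mult_less_top)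
      finally show Hf: "emeasure (q_hat S \<omega>) ({0<..r} \<times> UNIV) < \<infinity>" .
      show "emeasure (q_hat S \<omega>) ({s} \<times> UNIV) = 0" for s
        using q_hat_strip[of "{s}" \<omega>] \<omega> by simp
      show "set_integrable lborel {0..r} (\<lambda>s. b s \<omega>)"
        by (rule set_integrable_subset[OF b_int]) (use r in auto)
      show "set_integrable (q_meas S \<omega>) ({0<..r} \<times> UNIV) (\<lambda>p. f (fst p) (snd p) \<omega>)"
        "set_integrable (q_hat S \<omega>) ({0<..r} \<times> UNIV) (\<lambda>p. f (fst p) (snd p) \<omega>)"
        using elim(1) r by auto
      show "D x \<omega> = D 0 \<omega> + (LINT s:{0..x}|lborel. b s \<omega>)
        + ((LINT p:{0<..x} \<times> UNIV|q_meas S \<omega>. f (fst p) (snd p) \<omega>) - (LINT p:{0<..x} \<times> UNIV|q_hat S \<omega>. f (fst p) (snd p) \<omega>))"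
        if "x \<in> {0..r}" for x
      proof -
        have "x \<in> {0..t}" using that r by auto
        from bspec[OF elim(4) this] show ?thesis unfolding q_tilde_int_def case_prod_beta' .
      qed
    qed
  qed
qed

text \<open>Left limit and value differ at finitely many jump times only, so either may stand in an
  integral over time.\<close>

lemma AE_left: "AE \<omega> in P. AE s in lborel. s \<in> {0<..t} \<longrightarrow> left_proc D s \<omega> = D s \<omega>"
  using AE_jump_path
proof eventually_elim
  case (elim \<omega>)
  let ?T = "(\<lambda>j. rjump S j \<omega>) ` {j \<in> {1..max_jumps S}. jump S j \<omega> < \<infinity>}"
  interpret jump_path t "\<lambda>s. b s \<omega>" "\<lambda>p. f (fst p) (snd p) \<omega>" "q_meas S \<omega>" "q_hat S \<omega>"
     "{j \<in> {1..max_jumps S}. jump S j \<omega> < \<infinity>}" "\<lambda>j. rjump S j \<omega>" "\<lambda>j. mark S j \<omega>" "\<lambda>s. D s \<omega>"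
    using elim t by simp
  have "AE s in lborel. \<forall>x\<in>?T. s \<noteq> x"
    by (intro AE_finite_allI AE_lborel_singleton) auto
  then show ?case by eventually_elim (use D_continuous_off_jumps in \<open>auto simp: left_proc_def\<close>)
qed

end

text \<open>Gronwall by a weighted supremum: the weight halves the integral term.\<close>

lemma gronwall_weighted:
  fixes g w :: "real \<Rightarrow> real"
  assumes g: "\<And>r. r \<in> {0..t} \<Longrightarrow> g r \<le> c + k * (LINT s:I r|lborel. g s)"
    and I: "\<And>r. r \<in> {0..t} \<Longrightarrow> I r \<subseteq> {0..t}" "\<And>r. I r \<in> sets borel"
    and int: "\<And>r. r \<in> {0..t} \<Longrightarrow> set_integrable lborel (I r) g" "\<And>r. r \<in> {0..t} \<Longrightarrow> set_integrable lborel (I r) w"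
    and w: "\<And>r. r \<in> {0..t} \<Longrightarrow> k * (LINT s:I r|lborel. w s) \<le> w r / 2" "\<And>r. r \<in> {0..t} \<Longrightarrow> 1 \<le> w r"
    and B: "\<And>r. r \<in> {0..t} \<Longrightarrow> 0 \<le> g r \<and> g r \<le> B" and c: "0 \<le> c" and k: "0 \<le> k" and r: "r \<in> {0..t}"
  shows "g r \<le> 2 * c * w r"
proof -
  define m where "m = (SUP r\<in>{0..t}. g r / w r)"
  have w0: "0 < w r" if "r \<in> {0..t}" for r using w(2)[OF that] by simp
  have bdd: "bdd_above ((\<lambda>r. g r / w r) ` {0..t})"
  proof (rule bdd_aboveI2)
    fix r assume r: "r \<in> {0..t}"
    have "g r / w r \<le> g r / 1" using B[OF r] w(2)[OF r] by (intro divide_left_mono) auto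
    then show "g r / w r \<le> B" using B[OF r] by simp
  qed
  have gm: "g r \<le> m * w r" if r: "r \<in> {0..t}" for r
  proof -
    have "g r / w r \<le> m" unfolding m_def by (rule cSUP_upper[OF r bdd])
    then show ?thesis using w0[OF r] by (simp add: divide_le_eq)
  qed
  have m0: "0 \<le> m"
  proof -
    have "0 \<le> g r / w r" using B[OF r] w0[OF r] by simp
    also have "\<dots> \<le> m" unfolding m_def by (rule cSUP_upper[OF r bdd])
    finally show ?thesis .
  qed
  \<comment> \<open>The condition on the weight returns only half of \<open>m\<close>. As
    \<open>g\<close> is bounded, \<open>m\<close> is a genuine supremum, so the half can be absorbed
    and \<open>m \<le> 2 * c\<close>.\<close>
  have "m \<le> c + m / 2"
    unfolding m_def
  proof (rule cSUP_least)
    show "{0..t} \<noteq> {}" using r by auto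
    fix r assume r: "r \<in> {0..t}"
    have "(LINT s:I r|lborel. g s) \<le> (LINT s:I r|lborel. m * w s)"
    proof (rule set_integral_mono)
      show "set_integrable lborel (I r) (\<lambda>s. m * w s)" using int(2)[OF r] by simp
      show "set_integrable lborel (I r) g" by (rule int(1)[OF r])
      show "g s \<le> m * w s" if "s \<in> I r" for s using gm I(1)[OF r] that by blast
    qed
    then have "k * (LINT s:I r|lborel. g s) \<le> m * (k * (LINT s:I r|lborel. w s))"
      using mult_left_mono[OF _ k] by (simp add: mult.left_commute)
    also have "\<dots> \<le> m * (w r / 2)" using w(1)[OF r] m0 by (intro mult_left_mono) auto
    finally have "g r \<le> c + m * w r / 2" using g[OF r] by simp
    also have "\<dots> \<le> c * w r + m * w r / 2" using mult_left_mono[OF w(2)[OF r] c] by simp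
    finally have "g r / w r \<le> c + m / 2" using w0[OF r] by (simp add: divide_le_eq algebra_simps)
    then show "g r / w r \<le> c + (SUP r\<in>{0..t}. g r / w r) / 2" by (simp add: m_def)
  qed
  then have "m * w r \<le> 2 * c * w r" using w0[OF r] by simp
  then show ?thesis using gm[OF r] by simp
qed

lemma set_integral_half_open:
  fixes w :: "real \<Rightarrow> real"
  assumes "continuous_on UNIV w"
  shows "(LINT s:{x<..y}|lborel. w s) = (LINT s:{x..y}|lborel. w s)"
proof -
  have [measurable]: "w \<in> borel_measurable borel" by (rule borel_measurable_continuous_onI[OF assms])
  have "AE s in lborel. indicator {x<..y} s *\<^sub>R w s = indicator {x..y} s *\<^sub>R w s"
    using AE_lborel_singleton[of x] by eventually_elim (auto split: split_indicator)
  then show ?thesis unfolding set_lebesgue_integral_def by (intro integral_cong_AE) auto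
qed

lemma exp_weight:
  fixes k x y l :: real
  assumes xy: "x \<le> y"
  shows "(LINT s:{x<..y}|lborel. k * exp (k * s + l)) = exp (k * y + l) - exp (k * x + l)"
    and "set_integrable lborel {x<..y} (\<lambda>s. exp (k * s + l))"
proof -
  have c: "continuous_on UNIV (\<lambda>s. k * exp (k * s + l))" "continuous_on UNIV (\<lambda>s. exp (k * s + l))"
    by (intro continuous_intros)+
  have "(LINT s:{x..y}|lborel. k * exp (k * s + l)) = exp (k * y + l) - exp (k * x + l)"
    unfolding set_lebesgue_integral_def
  proof (rule integral_FTC_atLeastAtMost[OF xy])
    show "((\<lambda>s. exp (k * s + l)) has_vector_derivative k * exp (k * s + l)) (at s within {x..y})" for s
      unfolding has_real_derivative_iff_has_vector_derivative[symmetric] by (auto intro!: derivative_eq_intros)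
    show "continuous_on {x..y} (\<lambda>s. k * exp (k * s + l))" by (rule continuous_on_subset[OF c(1)]) simp
  qed
  then show "(LINT s:{x<..y}|lborel. k * exp (k * s + l)) = exp (k * y + l) - exp (k * x + l)"
    by (simp only: set_integral_half_open[OF c(1)])
  have "set_integrable lborel {x..y} (\<lambda>s. exp (k * s + l))"
    by (intro borel_integrable_atLeastAtMost' continuous_on_subset[OF c(2)]) simp
  then show "set_integrable lborel {x<..y} (\<lambda>s. exp (k * s + l))"
    by (rule set_integrable_subset) auto
qed

text \<open>The exponent \<open>2 * k * r\<close> is made for the weight condition: \<open>k\<close>
  times the integral of the weight over \<open>{0<..r}\<close> is
  \<open>(exp (2 * k * r) - 1) / 2\<close>.\<close>

lemma gronwall_forward:
  fixes g :: "real \<Rightarrow> real"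
  assumes g: "\<And>r. r \<in> {0..t} \<Longrightarrow> g r \<le> c + k * (LINT s:{0<..r}|lborel. g s)"
    and int: "set_integrable lborel {0<..t} g"
    and B: "\<And>r. r \<in> {0..t} \<Longrightarrow> 0 \<le> g r \<and> g r \<le> B" and c: "0 \<le> c" and k: "0 \<le> k" and r: "r \<in> {0..t}"
  shows "g r \<le> 2 * c * exp (2 * k * r)"
proof (rule gronwall_weighted[where I="\<lambda>r. {0<..r}" and w="\<lambda>r. exp (2 * k * r)" and k=k and t=t])
  fix x assume x: "x \<in> {0..t}"
  show "set_integrable lborel {0<..x} g" by (rule set_integrable_subset[OF int]) (use x in auto)
  show "set_integrable lborel {0<..x} (\<lambda>r. exp (2 * k * r))" using exp_weight(2)[of 0 x "2 * k" 0] x by simp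
  show "k * (LINT s:{0<..x}|lborel. exp (2 * k * s)) \<le> exp (2 * k * x) / 2"
    using exp_weight(1)[of 0 x "2 * k" 0] x by simp
  show "g x \<le> c + k * (LINT s:{0<..x}|lborel. g s)" by (rule g[OF x])
  show "0 \<le> g x \<and> g x \<le> B" by (rule B[OF x])
  show "1 \<le> exp (2 * k * x)" "{0<..x} \<subseteq> {0..t}" using k x by auto
qed (rule c k r | simp)+

text \<open>The mirrored weight \<open>exp (2 * k * (t - r))\<close> satisfies the same halving
  condition for integrals over \<open>{r<..t}\<close>.\<close>

lemma gronwall_backward:
  fixes g :: "real \<Rightarrow> real"
  assumes g: "\<And>r. r \<in> {0..t} \<Longrightarrow> g r \<le> c + k * (LINT s:{r<..t}|lborel. g s)"
    and int: "set_integrable lborel {0<..t} g"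
    and B: "\<And>r. r \<in> {0..t} \<Longrightarrow> 0 \<le> g r \<and> g r \<le> B" and c: "0 \<le> c" and k: "0 \<le> k" and r: "r \<in> {0..t}"
  shows "g r \<le> 2 * c * exp (2 * k * (t - r))"
proof (rule gronwall_weighted[where I="\<lambda>r. {r<..t}" and w="\<lambda>r. exp (2 * k * (t - r))" and k=k and t=t])
  fix x assume x: "x \<in> {0..t}"
  have e: "(\<lambda>r. exp (2 * k * (t - r))) = (\<lambda>r. exp (- (2 * k) * r + 2 * k * t))" by (auto simp: algebra_simps)
  show "set_integrable lborel {x<..t} g" by (rule set_integrable_subset[OF int]) (use x in auto)
  show "set_integrable lborel {x<..t} (\<lambda>r. exp (2 * k * (t - r)))" unfolding e using x by (intro exp_weight(2)) simp
  have "(LINT s:{x<..t}|lborel. - (2 * k) * exp (- (2 * k) * s + 2 * k * t)) = 1 - exp (2 * k * (t - x))"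
    using x by (subst exp_weight(1)) (auto simp: algebra_simps)
  then have "- (2 * k) * (LINT s:{x<..t}|lborel. exp (2 * k * (t - s))) = 1 - exp (2 * k * (t - x))"
    unfolding e by (simp only: set_integral_mult_right)
  then show "k * (LINT s:{x<..t}|lborel. exp (2 * k * (t - s))) \<le> exp (2 * k * (t - x)) / 2"
    by simp
  show "g x \<le> c + k * (LINT s:{x<..t}|lborel. g s)" by (rule g[OF x])
  show "0 \<le> g x \<and> g x \<le> B" by (rule B[OF x])
  show "1 \<le> exp (2 * k * (t - x))" "{x<..t} \<subseteq> {0..t}" using k x by auto
qed (rule c k r | simp)+

section \<open>Moments and the expected energy balance\<close>

context energy_system
begin

sublocale PL: pair_sigma_finite P lborel by unfold_locales

definition second_moment :: "real \<Rightarrow> real" where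
  "second_moment r = (\<integral>\<omega>. (norm (D r \<omega>))\<^sup>2 \<partial>P)"

lemma measurable_D: "r \<in> {0..t} \<Longrightarrow> D r \<in> borel_measurable P"
  by (rule measurable_from_subalg[OF subalgebra_filt progressive_adapted[OF D_prog]])

lemma integrable_D: "r \<in> {0..t} \<Longrightarrow> integrable P (\<lambda>\<omega>. (norm (D r \<omega>))\<^sup>2)"
proof (rule integrableI_bounded)
  assume r: "r \<in> {0..t}"
  show "(\<lambda>\<omega>. (norm (D r \<omega>))\<^sup>2) \<in> borel_measurable P" using measurable_D[OF r] by measurable
  have "(\<integral>\<^sup>+\<omega>. ennreal (norm ((norm (D r \<omega>))\<^sup>2)) \<partial>P) \<le> (\<integral>\<^sup>+\<omega>. (sup_norm t D \<omega>)\<^sup>2 \<partial>P)"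
    using D_le[OF r] by (intro nn_integral_mono) simp
  then show "(\<integral>\<^sup>+\<omega>. ennreal (norm ((norm (D r \<omega>))\<^sup>2)) \<partial>P) < \<infinity>" using sup_D_finite by (rule le_less_trans)
qed

lemma second_moment_nn: "r \<in> {0..t} \<Longrightarrow> ennreal (second_moment r) = (\<integral>\<^sup>+\<omega>. ennreal ((norm (D r \<omega>))\<^sup>2) \<partial>P)"
  unfolding second_moment_def by (rule nn_integral_eq_integral[symmetric, OF integrable_D]) auto

lemma second_moment_bounds: "r \<in> {0..t} \<Longrightarrow> 0 \<le> second_moment r \<and> second_moment r \<le> enn2real (\<integral>\<^sup>+\<omega>. (sup_norm t D \<omega>)\<^sup>2 \<partial>P)"
proof
  assume r: "r \<in> {0..t}"
  show "0 \<le> second_moment r" unfolding second_moment_def by (intro integral_nonneg_AE) simp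
  have "ennreal (second_moment r) \<le> (\<integral>\<^sup>+\<omega>. (sup_norm t D \<omega>)\<^sup>2 \<partial>P)"
    unfolding second_moment_nn[OF r] using D_le[OF r] by (intro nn_integral_mono) simp
  then have "enn2real (ennreal (second_moment r)) \<le> enn2real (\<integral>\<^sup>+\<omega>. (sup_norm t D \<omega>)\<^sup>2 \<partial>P)"
    using sup_D_finite by (intro enn2real_mono) auto
  then show "second_moment r \<le> enn2real (\<integral>\<^sup>+\<omega>. (sup_norm t D \<omega>)\<^sup>2 \<partial>P)"
    using \<open>0 \<le> second_moment r\<close> by simp
qed

lemma integrable_D_joint: "integrable (P \<Otimes>\<^sub>M lborel) (\<lambda>p. indicator {0<..t} (snd p) * (norm (D (snd p) (fst p)))\<^sup>2)"
proof (rule integrableI_bounded)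
  have "(\<lambda>p. indicator {0<..t} (snd p) * (norm (indicator {0..t} (snd p) *\<^sub>R D (snd p) (fst p)))\<^sup>2) \<in> borel_measurable (P \<Otimes>\<^sub>M lborel)"
    by measurable
  also have "(\<lambda>p. indicator {0<..t} (snd p) * (norm (indicator {0..t} (snd p) *\<^sub>R D (snd p) (fst p)))\<^sup>2)
    = (\<lambda>p. indicator {0<..t} (snd p) * (norm (D (snd p) (fst p)))\<^sup>2)"
    by (auto simp: fun_eq_iff split: split_indicator)
  finally show m: "(\<lambda>p. indicator {0<..t} (snd p) * (norm (D (snd p) (fst p)))\<^sup>2) \<in> borel_measurable (P \<Otimes>\<^sub>M lborel)" .
  have "(\<integral>\<^sup>+p. ennreal (norm (indicator {0<..t} (snd p) * (norm (D (snd p) (fst p)))\<^sup>2)) \<partial>(P \<Otimes>\<^sub>M lborel))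
    = (\<integral>\<^sup>+\<omega>. \<integral>\<^sup>+s. ennreal (norm (indicator {0<..t} s * (norm (D s \<omega>))\<^sup>2)) \<partial>lborel \<partial>P)"
    using m by (subst lborel.nn_integral_fst[symmetric]) auto
  also have "\<dots> \<le> (\<integral>\<^sup>+\<omega>. \<integral>\<^sup>+s. (sup_norm t D \<omega>)\<^sup>2 * indicator {0<..t} s \<partial>lborel \<partial>P)"
    using D_le by (intro nn_integral_mono) (auto split: split_indicator)
  also have "\<dots> = (\<integral>\<^sup>+\<omega>. (sup_norm t D \<omega>)\<^sup>2 * ennreal t \<partial>P)"
    using t by (simp add: nn_integral_cmult_indicator)
  also have "\<dots> < \<infinity>" using sup_D_finite by (simp add: nn_integral_multc ennreal_mult_less_top)
  finally show "(\<integral>\<^sup>+p. ennreal (norm (indicator {0<..t} (snd p) * (norm (D (snd p) (fst p)))\<^sup>2)) \<partial>(P \<Otimes>\<^sub>M lborel)) < \<infinity>" .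
qed

lemma integrable_D_strip: "0 \<le> r \<Longrightarrow> r' \<le> t \<Longrightarrow> integrable (P \<Otimes>\<^sub>M lborel) (\<lambda>p. indicator {r<..r'} (snd p) * (norm (D (snd p) (fst p)))\<^sup>2)"
proof -
  assume r: "0 \<le> r" "r' \<le> t"
  have "integrable (P \<Otimes>\<^sub>M lborel) (\<lambda>p. indicator {r<..r'} (snd p) *\<^sub>R (indicator {0<..t} (snd p) * (norm (D (snd p) (fst p)))\<^sup>2))"
  proof -
    have "space P \<times> {r<..r'} \<in> sets (P \<Otimes>\<^sub>M lborel)" by auto
    from integrable_mult_indicator[OF this integrable_D_joint] show ?thesis
      by (rule Bochner_Integration.integrable_cong[THEN iffD1, rotated -1]) (auto simp: space_pair_measure split: split_indicator)
  qed
  also have "(\<lambda>p. indicator {r<..r'} (snd p) *\<^sub>R (indicator {0<..t} (snd p) * (norm (D (snd p) (fst p)))\<^sup>2))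
    = (\<lambda>p. indicator {r<..r'} (snd p) * (norm (D (snd p) (fst p)))\<^sup>2)"
    using r by (auto simp: fun_eq_iff split: split_indicator)
  finally show ?thesis .
qed

text \<open>The joint integrand is dominated by the squared supremum on a strip of finite length,
  which permits exchanging expectation and time. The integrability in time is what the Gronwall
  lemmas ask of \<open>second_moment\<close>.\<close>

lemma second_moment_Fubini:
  assumes r: "0 \<le> r" "r' \<le> t"
  shows "set_integrable lborel {r<..r'} second_moment"
    and "(\<integral>\<omega>. \<integral>s. indicator {r<..r'} s * (norm (D s \<omega>))\<^sup>2 \<partial>lborel \<partial>P) = (LINT s:{r<..r'}|lborel. second_moment s)"
    and "integrable P (\<lambda>\<omega>. \<integral>s. indicator {r<..r'} s * (norm (D s \<omega>))\<^sup>2 \<partial>lborel)"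
proof -
  note i = integrable_D_strip[OF r]
  have i': "integrable (P \<Otimes>\<^sub>M lborel) (\<lambda>(\<omega>, s). indicator {r<..r'} s * (norm (D s \<omega>))\<^sup>2)" using i by (simp add: case_prod_unfold)
  have e: "(\<integral>\<omega>. indicator {r<..r'} s * (norm (D s \<omega>))\<^sup>2 \<partial>P) = indicator {r<..r'} s *\<^sub>R second_moment s" for s
    by (simp add: second_moment_def)
  show "set_integrable lborel {r<..r'} second_moment"
    using PL.integrable_snd[OF i'] unfolding set_integrable_def e .
  show "integrable P (\<lambda>\<omega>. \<integral>s. indicator {r<..r'} s * (norm (D s \<omega>))\<^sup>2 \<partial>lborel)"
    using PL.integrable_fst'[OF i] by simp
  show "(\<integral>\<omega>. \<integral>s. indicator {r<..r'} s * (norm (D s \<omega>))\<^sup>2 \<partial>lborel \<partial>P) = (LINT s:{r<..r'}|lborel. second_moment s)"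
    using PL.Fubini_integral[OF i'] unfolding e set_lebesgue_integral_def by simp
qed

text \<open>Left limits are predictable, so the integral passes from \<open>q_meas\<close> to
  \<open>q_hat\<close>, whose density in time is at most \<open>comp_bound\<close>; under the time
  integral the left limit is \<open>D\<close> almost everywhere. This lets Gronwall absorb the
  coefficient of the jumps.\<close>

lemma left_energy_le:
  assumes r: "0 \<le> r" "r \<le> t"
  shows "(\<integral>\<^sup>+\<omega>. (\<integral>\<^sup>+p. ennreal ((norm (left_proc D (fst p) \<omega>))\<^sup>2) * indicator ({0<..r} \<times> UNIV) p \<partial>q_meas S \<omega>) \<partial>P)
    \<le> ennreal (comp_bound * (LINT s:{0<..r}|lborel. second_moment s))"
proof -
  have lm: "(\<lambda>x. ennreal ((norm (left_proc D (snd (fst x)) (fst (fst x))))\<^sup>2)) \<in> borel_measurable (predictable S t \<Otimes>\<^sub>M borel)"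
    using left_meas by measurable
  have hm: "(\<lambda>p. ennreal ((norm (left_proc D (snd p) (fst p)))\<^sup>2) * indicator {0<..r} (snd p)) \<in> borel_measurable (P \<Otimes>\<^sub>M lborel)"
  proof -
    have "(\<lambda>p. ennreal ((norm (indicator {0..t} (snd p) *\<^sub>R left_proc D (snd p) (fst p)))\<^sup>2) * indicator {0<..r} (snd p)) \<in> borel_measurable (P \<Otimes>\<^sub>M lborel)"
      by measurable
    also have "(\<lambda>p. ennreal ((norm (indicator {0..t} (snd p) *\<^sub>R left_proc D (snd p) (fst p)))\<^sup>2) * indicator {0<..r} (snd p))
      = (\<lambda>p. ennreal ((norm (left_proc D (snd p) (fst p)))\<^sup>2) * indicator {0<..r} (snd p))"
      using r by (auto simp: fun_eq_iff split: split_indicator)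
    finally show ?thesis .
  qed
  have "(\<integral>\<^sup>+\<omega>. (\<integral>\<^sup>+p. ennreal ((norm (left_proc D (fst p) \<omega>))\<^sup>2) * indicator ({0<..r} \<times> UNIV) p \<partial>q_meas S \<omega>) \<partial>P)
    = (\<integral>\<^sup>+\<omega>. (\<integral>\<^sup>+p. ennreal ((norm (left_proc D (fst p) \<omega>))\<^sup>2) * indicator ({0<..r} \<times> UNIV) p \<partial>q_hat S \<omega>) \<partial>P)"
    using compensator_strip(1)[OF lm r(2)] by simp
  also have "\<dots> \<le> (\<integral>\<^sup>+\<omega>. ennreal comp_bound * (\<integral>\<^sup>+s. ennreal ((norm (left_proc D s \<omega>))\<^sup>2) * indicator {0<..r} s \<partial>lborel) \<partial>P)"
  proof (rule nn_integral_mono)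
    fix \<omega> assume \<omega>: "\<omega> \<in> space P"
    have "(\<lambda>s. ennreal ((norm (left_proc D s \<omega>))\<^sup>2) * indicator {0<..r} s) \<in> borel_measurable borel"
      using measurable_compose[OF measurable_Pair1'[OF \<omega>] hm] by simp
    from nn_integral_q_hat_time_le[OF this \<omega>]
    show "(\<integral>\<^sup>+p. ennreal ((norm (left_proc D (fst p) \<omega>))\<^sup>2) * indicator ({0<..r} \<times> UNIV) p \<partial>q_hat S \<omega>)
      \<le> ennreal comp_bound * (\<integral>\<^sup>+s. ennreal ((norm (left_proc D s \<omega>))\<^sup>2) * indicator {0<..r} s \<partial>lborel)"
      by (simp add: indicator_times)
  qed
  also have "\<dots> = (\<integral>\<^sup>+\<omega>. ennreal comp_bound * (\<integral>\<^sup>+s. ennreal (indicator {0<..r} s * (norm (D s \<omega>))\<^sup>2) \<partial>lborel) \<partial>P)"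
  proof (rule nn_integral_cong_AE)
    show "AE \<omega> in P. ennreal comp_bound * (\<integral>\<^sup>+s. ennreal ((norm (left_proc D s \<omega>))\<^sup>2) * indicator {0<..r} s \<partial>lborel)
      = ennreal comp_bound * (\<integral>\<^sup>+s. ennreal (indicator {0<..r} s * (norm (D s \<omega>))\<^sup>2) \<partial>lborel)"
      using AE_left
    proof eventually_elim
      case (elim \<omega>)
      then have "AE s in lborel. ennreal ((norm (left_proc D s \<omega>))\<^sup>2) * indicator {0<..r} s = ennreal (indicator {0<..r} s * (norm (D s \<omega>))\<^sup>2)"
        by eventually_elim (use r in \<open>auto split: split_indicator\<close>)
      from nn_integral_cong_AE[OF this] show ?case by simp
    qed
  qed
  also have "\<dots> = ennreal comp_bound * (\<integral>\<^sup>+\<omega>. \<integral>\<^sup>+s. ennreal (indicator {0<..r} s * (norm (D s \<omega>))\<^sup>2) \<partial>lborel \<partial>P)"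
    using integrable_D_strip[of 0 r] r
    by (intro nn_integral_cmult lborel.borel_measurable_nn_integral) (auto simp: case_prod_unfold)
  also have "(\<integral>\<^sup>+\<omega>. \<integral>\<^sup>+s. ennreal (indicator {0<..r} s * (norm (D s \<omega>))\<^sup>2) \<partial>lborel \<partial>P)
    = (\<integral>\<^sup>+p. ennreal (indicator {0<..r} (snd p) * (norm (D (snd p) (fst p)))\<^sup>2) \<partial>(P \<Otimes>\<^sub>M lborel))"
    using integrable_D_strip[of 0 r] r by (subst lborel.nn_integral_fst[symmetric]) auto
  also have "\<dots> = ennreal (\<integral>p. indicator {0<..r} (snd p) * (norm (D (snd p) (fst p)))\<^sup>2 \<partial>(P \<Otimes>\<^sub>M lborel))"
    using integrable_D_strip[of 0 r] r by (intro nn_integral_eq_integral) auto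
  also have "(\<integral>p. indicator {0<..r} (snd p) * (norm (D (snd p) (fst p)))\<^sup>2 \<partial>(P \<Otimes>\<^sub>M lborel)) = (LINT s:{0<..r}|lborel. second_moment s)"
    using PL.integral_fst'[OF integrable_D_strip[of 0 r]] second_moment_Fubini(2)[of 0 r] r by simp
  finally show ?thesis using comp_bound_nonneg by (simp add: ennreal_mult')
qed

definition drift :: "real \<Rightarrow> 'w \<Rightarrow> real" where
  "drift r \<omega> = (LINT s:{0<..r}|lborel. inner (left_proc D s \<omega>) (b s \<omega>))"

definition jump_square :: "real \<Rightarrow> 'w \<Rightarrow> real" where
  "jump_square r \<omega> = enn2real (\<integral>\<^sup>+p. ennreal ((norm (f (fst p) (snd p) \<omega>))\<^sup>2) * indicator ({0<..r} \<times> UNIV) p \<partial>q_meas S \<omega>)"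

text \<open>The integrand whose integral against \<open>q_meas\<close> minus that against
  \<open>q_hat\<close> is the mean-zero part of the energy identity.\<close>

definition cross :: "real \<Rightarrow> 'w \<Rightarrow> real \<times> 'e \<Rightarrow> real" where
  "cross r \<omega> p = indicator ({0<..r} \<times> UNIV) p * inner (left_proc D (fst p) \<omega>) (f (fst p) (snd p) \<omega>)"

lemma drift_integrand_meas: "(\<lambda>p. indicator {0<..r} (snd p) *\<^sub>R inner (left_proc D (snd p) (fst p)) (b (snd p) (fst p))) \<in> borel_measurable (P \<Otimes>\<^sub>M lborel)"
  if "r \<le> t" for r
proof -
  have "(\<lambda>p. indicator {0<..r} (snd p) *\<^sub>R inner (indicator {0..t} (snd p) *\<^sub>R left_proc D (snd p) (fst p)) (indicator {0..t} (snd p) *\<^sub>R b (snd p) (fst p))) \<in> borel_measurable (P \<Otimes>\<^sub>M lborel)"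
    by measurable
  also have "(\<lambda>p. indicator {0<..r} (snd p) *\<^sub>R inner (indicator {0..t} (snd p) *\<^sub>R left_proc D (snd p) (fst p)) (indicator {0..t} (snd p) *\<^sub>R b (snd p) (fst p)))
    = (\<lambda>p. indicator {0<..r} (snd p) *\<^sub>R inner (left_proc D (snd p) (fst p)) (b (snd p) (fst p)))"
    using that by (auto simp: fun_eq_iff split: split_indicator)
  finally show ?thesis .
qed

lemma measurable_drift: "r \<le> t \<Longrightarrow> drift r \<in> borel_measurable P"
  unfolding drift_def[abs_def] set_lebesgue_integral_def
  using drift_integrand_meas[of r] by (intro lborel.borel_measurable_lebesgue_integral) (simp add: case_prod_unfold)

lemma AE_drift_integrand:
  "AE \<omega> in P. (AE s in lborel. s \<in> {0<..t} \<longrightarrow> \<bar>inner (left_proc D s \<omega>) (b s \<omega>)\<bar> \<le> a * (norm (D s \<omega>))\<^sup>2)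
    \<and> set_integrable lborel {0<..t} (\<lambda>s. inner (left_proc D s \<omega>) (b s \<omega>))
    \<and> integrable lborel (\<lambda>s. indicator {0<..t} s * (norm (D s \<omega>))\<^sup>2)"
proof -
  have "AE \<omega> in P. integrable lborel (\<lambda>s. indicator {0<..t} s * (norm (D s \<omega>))\<^sup>2)"
    using PL.AE_integrable_fst'[OF integrable_D_joint] by simp
  then show ?thesis using AE_left b_le AE_space
  proof eventually_elim
    case (elim \<omega>)
    have 1: "AE s in lborel. s \<in> {0<..t} \<longrightarrow> \<bar>inner (left_proc D s \<omega>) (b s \<omega>)\<bar> \<le> a * (norm (D s \<omega>))\<^sup>2"
      using elim(2,3)
    proof eventually_elim
      case (elim s)
      show ?case
      proof
        assume s: "s \<in> {0<..t}"
        then have "left_proc D s \<omega> = D s \<omega>" "norm (b s \<omega>) \<le> a * norm (D s \<omega>)" using elim by auto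
        then have "\<bar>inner (left_proc D s \<omega>) (b s \<omega>)\<bar> \<le> norm (D s \<omega>) * (a * norm (D s \<omega>))"
          using Cauchy_Schwarz_ineq2[of "D s \<omega>" "b s \<omega>"] mult_left_mono[of "norm (b s \<omega>)" "a * norm (D s \<omega>)" "norm (D s \<omega>)"] by simp
        then show "\<bar>inner (left_proc D s \<omega>) (b s \<omega>)\<bar> \<le> a * (norm (D s \<omega>))\<^sup>2"
          by (simp add: power2_eq_square mult_ac)
      qed
    qed
    have m: "(\<lambda>s. indicator {0<..t} s *\<^sub>R inner (left_proc D s \<omega>) (b s \<omega>)) \<in> borel_measurable lborel"
      using measurable_compose[OF measurable_Pair1'[OF elim(4)] drift_integrand_meas[of t]] by simp
    have ae: "AE s in lborel. norm (indicator {0<..t} s *\<^sub>R inner (left_proc D s \<omega>) (b s \<omega>)) \<le> norm (a * (indicator {0<..t} s * (norm (D s \<omega>))\<^sup>2))"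
      using 1
    proof eventually_elim
      case (elim s)
      have "0 \<le> a * (norm (D s \<omega>))\<^sup>2" using a by simp
      then show ?case using elim by (cases "s \<in> {0<..t}") simp_all
    qed
    have "integrable lborel (\<lambda>s. a * (indicator {0<..t} s * (norm (D s \<omega>))\<^sup>2))"
      using elim(1) by (rule integrable_mult_right)
    then have "integrable lborel (\<lambda>s. indicator {0<..t} s *\<^sub>R inner (left_proc D s \<omega>) (b s \<omega>))"
      by (rule Bochner_Integration.integrable_bound[OF _ m ae])
    then show ?case using 1 elim(1) unfolding set_integrable_def by (intro conjI)
  qed
qed

text \<open>Stated for increments because the forward balance uses them from 0 and the backward one
  up to \<open>t\<close>.\<close>

lemma AE_drift_diff:
  assumes r: "0 \<le> r" "r \<le> r'" "r' \<le> t"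
  shows "AE \<omega> in P. \<bar>drift r' \<omega> - drift r \<omega>\<bar> \<le> a * (\<integral>s. indicator {r<..r'} s * (norm (D s \<omega>))\<^sup>2 \<partial>lborel)"
  using AE_drift_integrand
proof eventually_elim
  case (elim \<omega>)
  let ?h = "\<lambda>s. inner (left_proc D s \<omega>) (b s \<omega>)"
  have i: "set_integrable lborel {x<..y} ?h" if "0 \<le> x" "y \<le> t" for x y
    by (rule set_integrable_subset[of _ "{0<..t}"]) (use elim that in auto)
  have "{0<..r'} = {0<..r} \<union> {r<..r'}" using r by auto
  moreover have "(LINT s:{0<..r} \<union> {r<..r'}|lborel. ?h s) = (LINT s:{0<..r}|lborel. ?h s) + (LINT s:{r<..r'}|lborel. ?h s)"
    by (rule set_integral_Un) (use i r in auto)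
  ultimately have "drift r' \<omega> - drift r \<omega> = (\<integral>s. indicator {r<..r'} s *\<^sub>R ?h s \<partial>lborel)"
    by (simp add: drift_def set_lebesgue_integral_def)
  also have "\<bar>\<dots>\<bar> \<le> (\<integral>s. \<bar>indicator {r<..r'} s *\<^sub>R ?h s\<bar> \<partial>lborel)"
    by (rule integral_abs_bound)
  also have "\<dots> \<le> (\<integral>s. a * (indicator {r<..r'} s * (norm (D s \<omega>))\<^sup>2) \<partial>lborel)"
  proof (rule integral_mono_AE)
    show "integrable lborel (\<lambda>s. \<bar>indicator {r<..r'} s *\<^sub>R ?h s\<bar>)"
      using i[of r r'] r unfolding set_integrable_def by (intro integrable_abs) auto
    have "integrable lborel (\<lambda>s. indicator {r<..r'} s *\<^sub>R (indicator {0<..t} s * (norm (D s \<omega>))\<^sup>2))"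
      using elim by (intro integrable_mult_indicator) auto
    also have "(\<lambda>s. indicator {r<..r'} s *\<^sub>R (indicator {0<..t} s * (norm (D s \<omega>))\<^sup>2)) = (\<lambda>s. indicator {r<..r'} s * (norm (D s \<omega>))\<^sup>2)"
      using r by (auto simp: fun_eq_iff split: split_indicator)
    finally show "integrable lborel (\<lambda>s. a * (indicator {r<..r'} s * (norm (D s \<omega>))\<^sup>2))" by simp
    show "AE s in lborel. \<bar>indicator {r<..r'} s *\<^sub>R ?h s\<bar> \<le> a * (indicator {r<..r'} s * (norm (D s \<omega>))\<^sup>2)"
      using elim[THEN conjunct1]
    proof eventually_elim
      case (elim s)
      show ?case
      proof (cases "s \<in> {r<..r'}")
        case True
        then have "s \<in> {0<..t}" using r by auto
        then show ?thesis using elim True by simp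
      qed simp
    qed
  qed
  also have "\<dots> = a * (\<integral>s. indicator {r<..r'} s * (norm (D s \<omega>))\<^sup>2 \<partial>lborel)" by simp
  finally show ?case .
qed

lemma jump_square_integral:
  assumes r: "r \<le> t"
  shows "integrable P (jump_square r)" "(\<integral>\<omega>. jump_square r \<omega> \<partial>P) = enn2real (jump_energy r)"
proof -
  note m = compensator_strip(2)[OF fsq_meas r, simplified]
  have "AE \<omega> in P. (\<integral>\<^sup>+p. ennreal ((norm (f (fst p) (snd p) \<omega>))\<^sup>2) * indicator ({0<..r} \<times> UNIV) p \<partial>q_meas S \<omega>) \<noteq> \<infinity>"
    using jump_energy_finite[OF r] m unfolding jump_energy_def by (intro nn_integral_PInf_AE) auto
  then have "(\<integral>\<^sup>+\<omega>. ennreal (jump_square r \<omega>) \<partial>P) = jump_energy r"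
    unfolding jump_energy_def by (intro nn_integral_cong_AE, eventually_elim) (simp add: jump_square_def less_top)
  then have "has_bochner_integral P (jump_square r) (enn2real (jump_energy r))"
    using jump_energy_finite[OF r] m
    by (intro has_bochner_integral_nn_integral) (auto simp: jump_square_def[abs_def])
  then show "integrable P (jump_square r)" "(\<integral>\<omega>. jump_square r \<omega> \<partial>P) = enn2real (jump_energy r)"
    by (auto simp: has_bochner_integral_iff)
qed

text \<open>The sign \<open>\<sigma>\<close> treats the positive and the negative part at once,
  since the compensator formula is for nonnegative integrands. For finiteness the inner product is
  bounded by the sum of the squares: the left limits are controlled by the supremum and the number
  of jumps, \<open>f\<close> by its energy.\<close>

lemma cross_parts:
  assumes r: "r \<le> t" and \<sigma>: "\<sigma> = 1 \<or> \<sigma> = - 1"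
  shows "(\<integral>\<^sup>+\<omega>. (\<integral>\<^sup>+p. ennreal (\<sigma> * cross r \<omega> p) \<partial>q_meas S \<omega>) \<partial>P) = (\<integral>\<^sup>+\<omega>. (\<integral>\<^sup>+p. ennreal (\<sigma> * cross r \<omega> p) \<partial>q_hat S \<omega>) \<partial>P)"
    and "(\<lambda>\<omega>. \<integral>\<^sup>+p. ennreal (\<sigma> * cross r \<omega> p) \<partial>q_meas S \<omega>) \<in> borel_measurable P"
    and "(\<lambda>\<omega>. \<integral>\<^sup>+p. ennreal (\<sigma> * cross r \<omega> p) \<partial>q_hat S \<omega>) \<in> borel_measurable P"
    and "(\<integral>\<^sup>+\<omega>. (\<integral>\<^sup>+p. ennreal (\<sigma> * cross r \<omega> p) \<partial>q_meas S \<omega>) \<partial>P) < \<infinity>"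
proof -
  let ?\<Phi> = "\<lambda>x. ennreal (\<sigma> * inner (left_proc D (snd (fst x)) (fst (fst x))) (f (snd (fst x)) (snd x) (fst (fst x))))"
  have \<Phi>: "?\<Phi> \<in> borel_measurable (predictable S t \<Otimes>\<^sub>M borel)"
    using left_meas f_meas by measurable
  have e: "?\<Phi> ((\<omega>, fst p), snd p) * indicator ({0<..r} \<times> UNIV) p = ennreal (\<sigma> * cross r \<omega> p)" for \<omega> p
    by (simp add: cross_def split: split_indicator)
  show "(\<integral>\<^sup>+\<omega>. (\<integral>\<^sup>+p. ennreal (\<sigma> * cross r \<omega> p) \<partial>q_meas S \<omega>) \<partial>P) = (\<integral>\<^sup>+\<omega>. (\<integral>\<^sup>+p. ennreal (\<sigma> * cross r \<omega> p) \<partial>q_hat S \<omega>) \<partial>P)"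
    "(\<lambda>\<omega>. \<integral>\<^sup>+p. ennreal (\<sigma> * cross r \<omega> p) \<partial>q_meas S \<omega>) \<in> borel_measurable P"
    "(\<lambda>\<omega>. \<integral>\<^sup>+p. ennreal (\<sigma> * cross r \<omega> p) \<partial>q_hat S \<omega>) \<in> borel_measurable P"
    using compensator_strip(1-3)[OF \<Phi> r] unfolding e .
  have lm: "(\<lambda>x. ennreal ((norm (left_proc D (snd (fst x)) (fst (fst x))))\<^sup>2)) \<in> borel_measurable (predictable S t \<Otimes>\<^sub>M borel)"
    using left_meas by measurable
  let ?l = "\<lambda>\<omega> p. ennreal ((norm (left_proc D (fst p) \<omega>))\<^sup>2) * indicator ({0<..r} \<times> UNIV) p"
    and ?f = "\<lambda>\<omega> p. ennreal ((norm (f (fst p) (snd p) \<omega>))\<^sup>2) * indicator ({0<..r} \<times> UNIV) p"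
  have "(\<integral>\<^sup>+\<omega>. (\<integral>\<^sup>+p. ennreal (\<sigma> * cross r \<omega> p) \<partial>q_meas S \<omega>) \<partial>P) \<le> (\<integral>\<^sup>+\<omega>. (\<integral>\<^sup>+p. ?l \<omega> p \<partial>q_meas S \<omega>) + (\<integral>\<^sup>+p. ?f \<omega> p \<partial>q_meas S \<omega>) \<partial>P)"
  proof (rule nn_integral_mono)
    fix \<omega> assume \<omega>: "\<omega> \<in> space P"
    have "(\<integral>\<^sup>+p. ennreal (\<sigma> * cross r \<omega> p) \<partial>q_meas S \<omega>) \<le> (\<integral>\<^sup>+p. ?l \<omega> p + ?f \<omega> p \<partial>q_meas S \<omega>)"
    proof (rule nn_integral_mono)
      fix p :: "real \<times> 'e"
      define x y where "x = left_proc D (fst p) \<omega>" and "y = f (fst p) (snd p) \<omega>"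
      have "0 \<le> (norm x - norm y)\<^sup>2" by simp
      then have "2 * (norm x * norm y) \<le> (norm x)\<^sup>2 + (norm y)\<^sup>2" by (simp add: power2_diff)
      moreover have "0 \<le> norm x * norm y" by simp
      ultimately have "norm x * norm y \<le> (norm x)\<^sup>2 + (norm y)\<^sup>2" by linarith
      then have "\<sigma> * inner x y \<le> (norm x)\<^sup>2 + (norm y)\<^sup>2"
        using Cauchy_Schwarz_ineq2[of x y] \<sigma> by auto
      then have "ennreal (\<sigma> * inner x y) \<le> ennreal ((norm x)\<^sup>2) + ennreal ((norm y)\<^sup>2)"
        by (metis ennreal_leI ennreal_plus zero_le_power2)
      then show "ennreal (\<sigma> * cross r \<omega> p) \<le> ?l \<omega> p + ?f \<omega> p"
        by (simp add: cross_def x_def y_def split: split_indicator)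
    qed
    also have "\<dots> = (\<integral>\<^sup>+p. ?l \<omega> p \<partial>q_meas S \<omega>) + (\<integral>\<^sup>+p. ?f \<omega> p \<partial>q_meas S \<omega>)"
      using compensator_strip(4)[OF lm r \<omega>] compensator_strip(4)[OF fsq_meas r \<omega>]
      by (intro nn_integral_add) (simp_all add: measurable_cong_sets[OF sets_q_meas refl])
    finally show "(\<integral>\<^sup>+p. ennreal (\<sigma> * cross r \<omega> p) \<partial>q_meas S \<omega>) \<le> (\<integral>\<^sup>+p. ?l \<omega> p \<partial>q_meas S \<omega>) + (\<integral>\<^sup>+p. ?f \<omega> p \<partial>q_meas S \<omega>)" .
  qed
  also have "\<dots> = (\<integral>\<^sup>+\<omega>. (\<integral>\<^sup>+p. ?l \<omega> p \<partial>q_meas S \<omega>) \<partial>P) + jump_energy r"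
    unfolding jump_energy_def using compensator_strip(2)[OF lm r] compensator_strip(2)[OF fsq_meas r]
    by (intro nn_integral_add) simp_all
  also have "\<dots> < \<infinity>"
  proof -
    have "(\<integral>\<^sup>+\<omega>. (\<integral>\<^sup>+p. ?l \<omega> p \<partial>q_meas S \<omega>) \<partial>P) \<le> (\<integral>\<^sup>+\<omega>. of_nat (max_jumps S) * (sup_norm t D \<omega>)\<^sup>2 \<partial>P)"
    proof (rule nn_integral_mono)
      fix \<omega> assume \<omega>: "\<omega> \<in> space P"
      show "(\<integral>\<^sup>+p. ?l \<omega> p \<partial>q_meas S \<omega>) \<le> of_nat (max_jumps S) * (sup_norm t D \<omega>)\<^sup>2"
        using compensator_strip(4)[OF lm r \<omega>] left_D_le[OF _ \<omega>] r
        by (intro nn_integral_q_meas_le) (auto split: split_indicator)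
    qed
    also have "\<dots> < \<infinity>" using sup_D_finite by (simp add: nn_integral_cmult ennreal_mult_less_top of_nat_less_top)
    finally show ?thesis using jump_energy_finite[OF r] by simp
  qed
  finally show "(\<integral>\<^sup>+\<omega>. (\<integral>\<^sup>+p. ennreal (\<sigma> * cross r \<omega> p) \<partial>q_meas S \<omega>) \<partial>P) < \<infinity>" .
qed

lemma measurable_cross: "r \<le> t \<Longrightarrow> \<omega> \<in> space P \<Longrightarrow> cross r \<omega> \<in> borel_measurable (borel \<Otimes>\<^sub>M borel)"
proof -
  assume r: "r \<le> t" and \<omega>: "\<omega> \<in> space P"
  have "(\<lambda>x. inner (left_proc D (snd (fst x)) (fst (fst x))) (f (snd (fst x)) (snd x) (fst (fst x)))) \<in> borel_measurable (predictable S t \<Otimes>\<^sub>M borel)"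
    using left_meas f_meas by measurable
  from measurable_section[OF t \<omega> this]
  have "(\<lambda>p. indicator ({0..t} \<times> UNIV) p *\<^sub>R inner (left_proc D (fst p) \<omega>) (f (fst p) (snd p) \<omega>)) \<in> borel_measurable (borel \<Otimes>\<^sub>M borel)"
    by (subst (asm) borel_measurable_restrict_space_iff) (auto simp: space_pair_measure)
  then have "(\<lambda>p :: real \<times> 'e. indicator {0<..r} (fst p) * (indicator ({0..t} \<times> UNIV) p *\<^sub>R inner (left_proc D (fst p) \<omega>) (f (fst p) (snd p) \<omega>))) \<in> borel_measurable (borel \<Otimes>\<^sub>M borel)"
    by measurable
  also have "(\<lambda>p :: real \<times> 'e. indicator {0<..r} (fst p) * (indicator ({0..t} \<times> UNIV) p *\<^sub>R inner (left_proc D (fst p) \<omega>) (f (fst p) (snd p) \<omega>))) = cross r \<omega>"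
    using r by (auto simp: fun_eq_iff cross_def split: split_indicator)
  finally show ?thesis .
qed

lemma AE_energy:
  assumes r: "r \<in> {0..t}"
  shows "AE \<omega> in P. (norm (D r \<omega>))\<^sup>2 = (norm (D 0 \<omega>))\<^sup>2
    + 2 * (drift r \<omega> + (\<integral>p. cross r \<omega> p \<partial>q_meas S \<omega>) - (\<integral>p. cross r \<omega> p \<partial>q_hat S \<omega>)) + jump_square r \<omega>"
  using AE_jump_path AE_space
proof eventually_elim
  case (elim \<omega>)
  interpret jump_path r "\<lambda>s. b s \<omega>" "\<lambda>p. f (fst p) (snd p) \<omega>" "q_meas S \<omega>" "q_hat S \<omega>"
     "{j \<in> {1..max_jumps S}. jump S j \<omega> < \<infinity>}" "\<lambda>j. rjump S j \<omega>" "\<lambda>j. mark S j \<omega>" "\<lambda>s. D s \<omega>"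
    using elim r by simp
  have 1: "(LINT s:{0<..r}|lborel. inner (left_lim (\<lambda>s. D s \<omega>) s) (b s \<omega>)) = drift r \<omega>"
    unfolding drift_def by (intro set_lebesgue_integral_cong) (auto simp: left_proc_def)
  have 2: "(LINT p:{0<..r} \<times> UNIV|\<kappa>. inner (left_lim (\<lambda>s. D s \<omega>) (fst p)) (f (fst p) (snd p) \<omega>)) = (\<integral>p. cross r \<omega> p \<partial>\<kappa>)" for \<kappa>
    unfolding set_lebesgue_integral_def
    by (intro Bochner_Integration.integral_cong refl) (auto simp: cross_def left_proc_def split: split_indicator)
  have 3: "(LINT p:{0<..r} \<times> UNIV|q_meas S \<omega>. (norm (f (fst p) (snd p) \<omega>))\<^sup>2) = jump_square r \<omega>"
  proof -
    have e: "ennreal (indicator ({0<..r} \<times> UNIV) p *\<^sub>R (norm (f (fst p) (snd p) \<omega>))\<^sup>2) = ennreal ((norm (f (fst p) (snd p) \<omega>))\<^sup>2) * indicator ({0<..r} \<times> UNIV) p" for p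
      by (simp split: split_indicator)
    have "(\<lambda>p. ennreal (indicator ({0<..r} \<times> UNIV) p *\<^sub>R (norm (f (fst p) (snd p) \<omega>))\<^sup>2)) \<in> borel_measurable (q_meas S \<omega>)"
      unfolding e using compensator_strip(4)[OF fsq_meas _ elim(2), of r] r by (simp add: measurable_cong_sets[OF sets_q_meas refl])
    from borel_measurable_enn2real[OF this]
    have "(\<lambda>p. indicator ({0<..r} \<times> UNIV) p *\<^sub>R (norm (f (fst p) (snd p) \<omega>))\<^sup>2) \<in> borel_measurable (q_meas S \<omega>)" by simp
    then show ?thesis unfolding set_lebesgue_integral_def jump_square_def e[symmetric]
      by (intro integral_eq_nn_integral) auto
  qed
  show ?case using energy_identity unfolding 1 2 3 .
qed

text \<open>Solved for the drift, the pathwise identity writes it through integrable terms, which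
  proves the drift integrable. The cross integrals against \<open>q_meas\<close> and
  \<open>q_hat\<close> have equal means by \<open>cross_parts\<close> and cancel.\<close>

lemma expected_energy:
  assumes r: "r \<in> {0..t}"
  shows "integrable P (drift r)"
    and "second_moment r = second_moment 0 + 2 * (\<integral>\<omega>. drift r \<omega> \<partial>P) + enn2real (jump_energy r)"
proof -
  have rt: "r \<le> t" and z: "0 \<in> {0..t}" using r t by auto
  \<comment> \<open>The version of the cross integral that is measurable in \<open>\<omega>\<close>;
    it equals the Bochner integral almost surely.\<close>
  let ?p = "\<lambda>\<kappa> \<omega>. enn2real (\<integral>\<^sup>+p. ennreal (cross r \<omega> p) \<partial>\<kappa> \<omega>) - enn2real (\<integral>\<^sup>+p. ennreal (- cross r \<omega> p) \<partial>\<kappa> \<omega>)"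
  note c1 = cross_parts[OF rt, of 1, simplified] and c2 = cross_parts[OF rt, of "-1", simplified]
  have q: "AE \<omega> in P. integrable (q_meas S \<omega>) (cross r \<omega>) \<and> (\<integral>p. cross r \<omega> p \<partial>q_meas S \<omega>) = ?p (q_meas S) \<omega>"
    "integrable P (?p (q_meas S))"
    "(\<integral>\<omega>. ?p (q_meas S) \<omega> \<partial>P) = enn2real (\<integral>\<^sup>+\<omega>. \<integral>\<^sup>+p. ennreal (cross r \<omega> p) \<partial>q_meas S \<omega> \<partial>P) - enn2real (\<integral>\<^sup>+\<omega>. \<integral>\<^sup>+p. ennreal (- cross r \<omega> p) \<partial>q_meas S \<omega> \<partial>P)"
    by (rule kernel_integral; use c1 c2 measurable_cross[OF rt] in \<open>simp add: measurable_cong_sets[OF sets_q_meas refl]\<close>)+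
  have h: "AE \<omega> in P. integrable (q_hat S \<omega>) (cross r \<omega>) \<and> (\<integral>p. cross r \<omega> p \<partial>q_hat S \<omega>) = ?p (q_hat S) \<omega>"
    "integrable P (?p (q_hat S))"
    "(\<integral>\<omega>. ?p (q_hat S) \<omega> \<partial>P) = enn2real (\<integral>\<^sup>+\<omega>. \<integral>\<^sup>+p. ennreal (cross r \<omega> p) \<partial>q_hat S \<omega> \<partial>P) - enn2real (\<integral>\<^sup>+\<omega>. \<integral>\<^sup>+p. ennreal (- cross r \<omega> p) \<partial>q_hat S \<omega> \<partial>P)"
    by (rule kernel_integral; use c1 c2 measurable_cross[OF rt] in \<open>simp add: measurable_cong_sets[OF sets_q_hat refl]\<close>)+
  have qh: "(\<integral>\<omega>. ?p (q_meas S) \<omega> \<partial>P) = (\<integral>\<omega>. ?p (q_hat S) \<omega> \<partial>P)"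
    unfolding q(3) h(3) using c1(1) c2(1) by simp
  have gen: "integrable P (\<lambda>\<omega>. (x \<omega> - y \<omega> - z \<omega>) / 2 - u \<omega> + v \<omega>)"
    "(\<integral>\<omega>. (x \<omega> - y \<omega> - z \<omega>) / 2 - u \<omega> + v \<omega> \<partial>P) = ((\<integral>\<omega>. x \<omega> \<partial>P) - (\<integral>\<omega>. y \<omega> \<partial>P) - (\<integral>\<omega>. z \<omega> \<partial>P)) / 2 - (\<integral>\<omega>. u \<omega> \<partial>P) + (\<integral>\<omega>. v \<omega> \<partial>P)"
    if "integrable P x" "integrable P y" "integrable P z" "integrable P u" "integrable P v" for x y z u v :: "'w \<Rightarrow> real"
    using that by simp_all
  note gens = gen[OF integrable_D[OF r] integrable_D[OF z] jump_square_integral(1)[OF rt] q(2) h(2)]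
  let ?R = "\<lambda>\<omega>. ((norm (D r \<omega>))\<^sup>2 - (norm (D 0 \<omega>))\<^sup>2 - jump_square r \<omega>) / 2 - ?p (q_meas S) \<omega> + ?p (q_hat S) \<omega>"
  have R: "AE \<omega> in P. drift r \<omega> = ?R \<omega>"
    using AE_energy[OF r] q(1) h(1) by eventually_elim (simp add: field_simps)
  have iR: "integrable P ?R" by (rule gens(1))
  have "drift r \<in> borel_measurable P" "?R \<in> borel_measurable P"
    using measurable_drift[OF rt] borel_measurable_integrable[OF iR] by auto
  with R iR show "integrable P (drift r)" by (subst integrable_cong_AE) auto
  have "(\<integral>\<omega>. drift r \<omega> \<partial>P) = (\<integral>\<omega>. ?R \<omega> \<partial>P)"
    by (rule integral_cong_AE) fact+
  also have "\<dots> = (second_moment r - second_moment 0 - enn2real (jump_energy r)) / 2 - (\<integral>\<omega>. ?p (q_meas S) \<omega> \<partial>P) + (\<integral>\<omega>. ?p (q_hat S) \<omega> \<partial>P)"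
    unfolding gens(2) jump_square_integral(2)[OF rt] second_moment_def ..
  finally show "second_moment r = second_moment 0 + 2 * (\<integral>\<omega>. drift r \<omega> \<partial>P) + enn2real (jump_energy r)"
    unfolding qh by simp
qed

lemma expected_drift_diff:
  assumes r: "0 \<le> r" "r \<le> r'" "r' \<le> t"
  shows "\<bar>(\<integral>\<omega>. drift r' \<omega> \<partial>P) - (\<integral>\<omega>. drift r \<omega> \<partial>P)\<bar> \<le> a * (LINT s:{r<..r'}|lborel. second_moment s)"
proof -
  have i: "integrable P (drift r)" "integrable P (drift r')" using expected_energy(1) r by auto
  have F: "integrable P (\<lambda>\<omega>. \<integral>s. indicator {r<..r'} s * (norm (D s \<omega>))\<^sup>2 \<partial>lborel)"
    using second_moment_Fubini(3)[of r r'] r by simp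
  have "\<bar>(\<integral>\<omega>. drift r' \<omega> \<partial>P) - (\<integral>\<omega>. drift r \<omega> \<partial>P)\<bar> = \<bar>\<integral>\<omega>. drift r' \<omega> - drift r \<omega> \<partial>P\<bar>" using i by simp
  also have "\<dots> \<le> (\<integral>\<omega>. \<bar>drift r' \<omega> - drift r \<omega>\<bar> \<partial>P)" by (rule integral_abs_bound)
  also have "\<dots> \<le> (\<integral>\<omega>. a * (\<integral>s. indicator {r<..r'} s * (norm (D s \<omega>))\<^sup>2 \<partial>lborel) \<partial>P)"
    using AE_drift_diff[OF r] i F by (intro integral_mono_AE) auto
  also have "\<dots> = a * (LINT s:{r<..r'}|lborel. second_moment s)"
    using second_moment_Fubini(2)[of r r'] r F by simp
  finally show ?thesis .
qed

lemma drift_0: "(\<integral>\<omega>. drift 0 \<omega> \<partial>P) = 0"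
  by (simp add: drift_def set_lebesgue_integral_def)

lemma energy_forward:
  assumes r: "r \<in> {0..t}"
  shows "second_moment r \<le> second_moment 0 + 2 * a * (LINT s:{0<..r}|lborel. second_moment s) + enn2real (jump_energy r)"
  using expected_energy(2)[OF r] expected_drift_diff[of 0 r] drift_0 r by simp

text \<open>The difference of the balances at \<open>t\<close> and at \<open>r\<close>. The squared
  jumps stand on the smaller side with a positive sign: dropping them allows backward Gronwall,
  keeping them at \<open>r = 0\<close> bounds the jump energy.\<close>

lemma energy_backward:
  assumes r: "r \<in> {0..t}"
  shows "second_moment r + (enn2real (jump_energy t) - enn2real (jump_energy r)) \<le> second_moment t + 2 * a * (LINT s:{r<..t}|lborel. second_moment s)"
  using expected_energy(2)[OF r] expected_energy(2)[of t] expected_drift_diff[of r t] r t by simp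

lemma jump_energy_real_mono: "r \<le> r' \<Longrightarrow> r' \<le> t \<Longrightarrow> enn2real (jump_energy r) \<le> enn2real (jump_energy r')"
  using jump_energy_mono[of r r'] jump_energy_finite[of r'] by (intro enn2real_mono) auto

text \<open>Backward Gronwall with rate \<open>2 * a\<close>, whose weight doubles the rate;
  bounding \<open>t - r\<close> by \<open>t\<close> leaves the exponent
  \<open>4 * a * t\<close>.\<close>

lemma second_moment_le_terminal:
  assumes r: "r \<in> {0..t}"
  shows "second_moment r \<le> 2 * second_moment t * exp (4 * a * t)"
proof -
  have "second_moment r \<le> 2 * second_moment t * exp (2 * (2 * a) * (t - r))"
  proof (rule gronwall_backward[OF _ _ second_moment_bounds])
    show "second_moment x \<le> second_moment t + 2 * a * (LINT s:{x<..t}|lborel. second_moment s)" if "x \<in> {0..t}" for x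
      using energy_backward[OF that] jump_energy_real_mono[of x t] that by simp
    show "set_integrable lborel {0<..t} second_moment" using second_moment_Fubini(1)[of 0 t] t by simp
    show "0 \<le> second_moment t" using second_moment_bounds[of t] t by simp
  qed (use r a in auto)
  also have "\<dots> \<le> 2 * second_moment t * exp (4 * a * t)"
    using second_moment_bounds[of t] t r a by (intro mult_left_mono) (auto simp: mult_left_mono)
  finally show ?thesis .
qed

lemma integral_second_moment_le:
  "(LINT s:{0<..t}|lborel. second_moment s) \<le> t * (2 * second_moment t * exp (4 * a * t))"
proof -
  have "(LINT s:{0<..t}|lborel. second_moment s) \<le> (LINT s:{0<..t}|lborel. 2 * second_moment t * exp (4 * a * t))"
  proof (rule set_integral_mono)
    show "set_integrable lborel {0<..t} second_moment" using second_moment_Fubini(1)[of 0 t] t by simp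
    show "set_integrable lborel {0<..t} (\<lambda>s. 2 * second_moment t * exp (4 * a * t))"
      unfolding set_integrable_def using t by (intro integrable_scaleR_left integrable_real_indicator) auto
  qed (use second_moment_le_terminal in auto)
  then show ?thesis using t by (simp add: set_lebesgue_integral_def mult_ac)
qed

text \<open>The backward balance at \<open>r = 0\<close>, with the time integral of the second
  moment replaced by its bound; \<open>2 * a\<close> times \<open>2 * t * exp (4 * a * t)\<close> is
  the second part of the constant.\<close>

lemma jump_energy_le_terminal:
  "enn2real (jump_energy t) \<le> (1 + 4 * a * t * exp (4 * a * t)) * second_moment t"
proof -
  have j0: "enn2real (jump_energy 0) = 0" by (simp add: jump_energy_def)
  have "enn2real (jump_energy t) \<le> second_moment t + 2 * a * (LINT s:{0<..t}|lborel. second_moment s)"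
    using energy_backward[of 0] j0 second_moment_bounds[of 0] t by simp
  also have "\<dots> \<le> second_moment t + 2 * a * (t * (2 * second_moment t * exp (4 * a * t)))"
    using integral_second_moment_le a by (intro add_left_mono mult_left_mono) auto
  also have "\<dots> = (1 + 4 * a * t * exp (4 * a * t)) * second_moment t" by (simp add: algebra_simps)
  finally show ?thesis .
qed

end

section \<open>The controlled system\<close>

lemma ennreal_add_square_le: "(x + y)\<^sup>2 \<le> 2 * (x\<^sup>2 + y\<^sup>2)" for x y :: ennreal
proof (cases "x = \<infinity> \<or> y = \<infinity>")
  case True
  then show ?thesis by (auto simp: power2_eq_square ennreal_mult_top ennreal_top_mult)
next
  case False
  then obtain a b where ab: "x = ennreal a" "y = ennreal b" "0 \<le> a" "0 \<le> b"
    by (cases x; cases y) auto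
  have "0 \<le> (a - b)\<^sup>2" by simp
  then have "(a + b)\<^sup>2 \<le> 2 * (a\<^sup>2 + b\<^sup>2)" by (simp add: power2_diff power2_sum)
  then have "ennreal ((a + b)\<^sup>2) \<le> ennreal (2 * (a\<^sup>2 + b\<^sup>2))" by (rule ennreal_leI)
  moreover have "ennreal (2 * (a\<^sup>2 + b\<^sup>2)) = 2 * (x\<^sup>2 + y\<^sup>2)"
    using ab by (simp add: ennreal_mult ennreal_power ennreal_plus)
  moreover have "ennreal ((a + b)\<^sup>2) = (x + y)\<^sup>2" using ab by (simp add: ennreal_power flip: ennreal_plus)
  ultimately show ?thesis by simp
qed

lemma norm_diff_square_le: "(norm (x - y))\<^sup>2 \<le> 2 * (norm x)\<^sup>2 + 2 * (norm y)\<^sup>2" for x y :: "'v::real_normed_vector"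
proof -
  have "(norm (x - y))\<^sup>2 \<le> (norm x + norm y)\<^sup>2" by (intro power_mono norm_triangle_ineq4) simp
  moreover have "0 \<le> (norm x - norm y)\<^sup>2" by simp
  ultimately show ?thesis by (simp add: power2_sum power2_diff)
qed

section \<open>Cadlag processes and square-integrable integrands\<close>

context mode_process
begin

lemma L2_cadlagD:
  assumes "X \<in> L2_cadlag S t"
  shows "progressive S t X" "\<And>\<omega>. \<omega> \<in> space (Prb S) \<Longrightarrow> cadlag_on t (\<lambda>r. X r \<omega>)"
    and "(\<integral>\<^sup>+\<omega>. (sup_norm t X \<omega>)\<^sup>2 \<partial>Prb S) < \<infinity>"
  using assms by (auto simp: L2_cadlag_def sup_norm_def)

lemma L2_cadlag_mono:
  assumes X: "X \<in> L2_cadlag S T" and t: "t \<le> T"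
  shows "X \<in> L2_cadlag S t"
proof -
  have "(\<integral>\<^sup>+\<omega>. (sup_norm t X \<omega>)\<^sup>2 \<partial>Prb S) \<le> (\<integral>\<^sup>+\<omega>. (sup_norm T X \<omega>)\<^sup>2 \<partial>Prb S)"
    unfolding sup_norm_def using t by (intro nn_integral_mono power_mono SUP_subset_mono) auto
  also have "\<dots> < \<infinity>" by (rule L2_cadlagD(3)[OF X])
  finally have "(\<integral>\<^sup>+\<omega>. (sup_norm t X \<omega>)\<^sup>2 \<partial>Prb S) < \<infinity>" .
  then show ?thesis using L2_cadlagD(1,2)[OF X] t
    by (auto simp: L2_cadlag_def sup_norm_def progressive_def cadlag_on_def)
qed

lemma L2_cadlag_diff:
  assumes t: "0 \<le> t" and X: "X \<in> L2_cadlag S t" and Y: "Y \<in> L2_cadlag S t"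
  shows "(\<lambda>r \<omega>. X r \<omega> - Y r \<omega>) \<in> L2_cadlag S t"
proof -
  note [measurable] = measurable_sup_norm[OF t L2_cadlagD(1,2)[OF X]] measurable_sup_norm[OF t L2_cadlagD(1,2)[OF Y]]
  have "sup_norm t (\<lambda>r \<omega>. X r \<omega> - Y r \<omega>) \<omega> \<le> sup_norm t X \<omega> + sup_norm t Y \<omega>" for \<omega>
    unfolding sup_norm_def[of t "\<lambda>r \<omega>. X r \<omega> - Y r \<omega>"]
  proof (rule SUP_least)
    fix r assume r: "r \<in> {0..t}"
    have "ennreal (norm (X r \<omega> - Y r \<omega>)) \<le> ennreal (norm (X r \<omega>)) + ennreal (norm (Y r \<omega>))"
      by (simp flip: ennreal_plus add: norm_triangle_ineq4)
    also have "\<dots> \<le> sup_norm t X \<omega> + sup_norm t Y \<omega>" by (intro add_mono norm_le_sup_norm r)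
    finally show "ennreal (norm (X r \<omega> - Y r \<omega>)) \<le> sup_norm t X \<omega> + sup_norm t Y \<omega>" .
  qed
  then have "(sup_norm t (\<lambda>r \<omega>. X r \<omega> - Y r \<omega>) \<omega>)\<^sup>2 \<le> 2 * ((sup_norm t X \<omega>)\<^sup>2 + (sup_norm t Y \<omega>)\<^sup>2)" for \<omega>
    using ennreal_add_square_le by (meson order_trans power_mono zero_le)
  then have "(\<integral>\<^sup>+\<omega>. (sup_norm t (\<lambda>r \<omega>. X r \<omega> - Y r \<omega>) \<omega>)\<^sup>2 \<partial>Prb S) \<le> (\<integral>\<^sup>+\<omega>. 2 * ((sup_norm t X \<omega>)\<^sup>2 + (sup_norm t Y \<omega>)\<^sup>2) \<partial>Prb S)"
    by (intro nn_integral_mono)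
  also have "\<dots> < \<infinity>"
    using L2_cadlagD(3)[OF X] L2_cadlagD(3)[OF Y] by (simp add: nn_integral_cmult nn_integral_add ennreal_mult_less_top)
  finally have "(\<integral>\<^sup>+\<omega>. (sup_norm t (\<lambda>r \<omega>. X r \<omega> - Y r \<omega>) \<omega>)\<^sup>2 \<partial>Prb S) < \<infinity>" .
  moreover have "progressive S t (\<lambda>r \<omega>. X r \<omega> - Y r \<omega>)"
    unfolding progressive_def
  proof
    fix s assume s: "s \<in> {0..t}"
    have "(\<lambda>p. X (snd p) (fst p)) \<in> borel_measurable (filt S s \<Otimes>\<^sub>M restrict_space borel {0..s})"
      "(\<lambda>p. Y (snd p) (fst p)) \<in> borel_measurable (filt S s \<Otimes>\<^sub>M restrict_space borel {0..s})"
      using L2_cadlagD(1)[OF X, unfolded progressive_def, rule_format, OF s] L2_cadlagD(1)[OF Y, unfolded progressive_def, rule_format, OF s]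
      by (simp_all add: case_prod_unfold)
    then show "(\<lambda>(\<omega>, r). X r \<omega> - Y r \<omega>) \<in> borel_measurable (filt S s \<Otimes>\<^sub>M restrict_space borel {0..s})"
      unfolding case_prod_unfold by (rule borel_measurable_diff)
  qed
  moreover have "cadlag_on t (\<lambda>r. X r \<omega> - Y r \<omega>)" if "\<omega> \<in> space (Prb S)" for \<omega>
    unfolding cadlag_on_def
  proof (intro conjI ballI)
    note c = L2_cadlagD(2)[OF X that, unfolded cadlag_on_def] L2_cadlagD(2)[OF Y that, unfolded cadlag_on_def]
    show "((\<lambda>r. X r \<omega> - Y r \<omega>) \<longlongrightarrow> X r \<omega> - Y r \<omega>) (at_right r)" if "r \<in> {0..<t}" for r
      using c that by (intro tendsto_diff) auto
    show "\<exists>l. ((\<lambda>r. X r \<omega> - Y r \<omega>) \<longlongrightarrow> l) (at_left r)" if "r \<in> {0<..t}" for r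
    proof -
      obtain k l where "((\<lambda>r. X r \<omega>) \<longlongrightarrow> k) (at_left r)" "((\<lambda>r. Y r \<omega>) \<longlongrightarrow> l) (at_left r)"
        using c[THEN conjunct2, THEN bspec, OF \<open>r \<in> {0<..t}\<close>] by blast
      then show ?thesis by (intro exI[of _ "k - l"] tendsto_diff)
    qed
  qed
  ultimately show ?thesis by (simp add: L2_cadlag_def sup_norm_def)
qed

text \<open>The squared norm of \<open>L2_q\<close> with a free set of times: the closed interval
  belongs to the spaces, the half-open ones to the energy balance.\<close>

definition q_energy :: "real set \<Rightarrow> (real \<Rightarrow> 'e \<Rightarrow> 'w \<Rightarrow> 'v::euclidean_space) \<Rightarrow> ennreal" where
  "q_energy I f = (\<integral>\<^sup>+\<omega>. (\<integral>\<^sup>+p. ennreal ((norm (f (fst p) (snd p) \<omega>))\<^sup>2) * indicator (I \<times> UNIV) p \<partial>q_meas S \<omega>) \<partial>Prb S)"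

abbreviation q_measurable :: "real \<Rightarrow> (real \<Rightarrow> 'e \<Rightarrow> 'w \<Rightarrow> 'v::euclidean_space) \<Rightarrow> bool" where
  "q_measurable t f \<equiv> (\<lambda>x. f (snd (fst x)) (snd x) (fst (fst x))) \<in> borel_measurable (predictable S t \<Otimes>\<^sub>M borel)"

lemma L2_q_iff: "f \<in> L2_q S t \<longleftrightarrow> q_measurable t f \<and> q_energy {0..t} f < \<infinity>"
  by (simp add: L2_q_def q_energy_def case_prod_beta')

text \<open>A pointwise quadratic bound passes to energies. It serves in both directions, to bound
  \<open>C D_- - Z\<close> by \<open>D_-\<close> and \<open>Z\<close>, and to bound \<open>Z\<close>
  by \<open>D_-\<close> and \<open>C D_- - Z\<close>.\<close>

lemma q_energy_le:
  fixes f g h :: "real \<Rightarrow> 'e \<Rightarrow> 'w \<Rightarrow> 'v::euclidean_space"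
  assumes t: "0 \<le> t" and f: "q_measurable t f" and g: "q_measurable t g" and h: "q_measurable t h"
    and I: "I \<in> sets borel" "I \<subseteq> {0..t}" and c: "0 \<le> c" "0 \<le> d"
    and le: "AE \<omega> in Prb S. \<forall>s\<in>I. \<forall>\<theta>. (norm (f s \<theta> \<omega>))\<^sup>2 \<le> c * (norm (g s \<theta> \<omega>))\<^sup>2 + d * (norm (h s \<theta> \<omega>))\<^sup>2"
  shows "q_energy I f \<le> ennreal c * q_energy I g + ennreal d * q_energy I h"
proof -
  have sq: "(\<lambda>x. ennreal ((norm (g (snd (fst x)) (snd x) (fst (fst x))))\<^sup>2) * indicator I (snd (fst x))) \<in> borel_measurable (predictable S t \<Otimes>\<^sub>M borel)"
    if [measurable]: "q_measurable t g" for g :: "real \<Rightarrow> 'e \<Rightarrow> 'w \<Rightarrow> 'v"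
  proof -
    have [measurable]: "(\<lambda>x. snd (fst x)) \<in> borel_measurable (predictable S t \<Otimes>\<^sub>M borel)"
      by (rule measurable_compose[OF measurable_fst measurable_time_predictable[OF t]])
    show ?thesis using I(1) by measurable
  qed
  have e: "ennreal ((norm (g (fst p) (snd p) \<omega>))\<^sup>2) * indicator I (fst p) * indicator ({0..t} \<times> UNIV) p = ennreal ((norm (g (fst p) (snd p) \<omega>))\<^sup>2) * indicator (I \<times> UNIV) p"
    for g :: "real \<Rightarrow> 'e \<Rightarrow> 'w \<Rightarrow> 'v" and p :: "real \<times> 'e" and \<omega>
    using I(2) by (cases p) (auto split: split_indicator)
  let ?q = "\<lambda>(g :: real \<Rightarrow> 'e \<Rightarrow> 'w \<Rightarrow> 'v) \<omega> p. ennreal ((norm (g (fst p) (snd p) \<omega>))\<^sup>2) * indicator (I \<times> UNIV) p"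
  have m1: "(\<lambda>\<omega>. \<integral>\<^sup>+p. ?q g \<omega> p \<partial>q_meas S \<omega>) \<in> borel_measurable (Prb S)" if "q_measurable t g" for g
    using compensator_formula(2)[OF t sq[OF that]] by (simp add: e)
  have m2: "?q g \<omega> \<in> borel_measurable (q_meas S \<omega>)" if "q_measurable t g" "\<omega> \<in> space (Prb S)" for g \<omega>
    using measurable_section_indicator[OF t that(2) sq[OF that(1)]] by (simp add: e measurable_cong_sets[OF sets_q_meas refl])
  have "q_energy I f \<le> (\<integral>\<^sup>+\<omega>. ennreal c * (\<integral>\<^sup>+p. ?q g \<omega> p \<partial>q_meas S \<omega>) + ennreal d * (\<integral>\<^sup>+p. ?q h \<omega> p \<partial>q_meas S \<omega>) \<partial>Prb S)"
    unfolding q_energy_def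
  proof (rule nn_integral_mono_AE)
    show "AE \<omega> in Prb S. (\<integral>\<^sup>+p. ?q f \<omega> p \<partial>q_meas S \<omega>) \<le> ennreal c * (\<integral>\<^sup>+p. ?q g \<omega> p \<partial>q_meas S \<omega>) + ennreal d * (\<integral>\<^sup>+p. ?q h \<omega> p \<partial>q_meas S \<omega>)"
      using le AE_space
    proof eventually_elim
      case (elim \<omega>)
      have "(\<integral>\<^sup>+p. ?q f \<omega> p \<partial>q_meas S \<omega>) \<le> (\<integral>\<^sup>+p. ennreal c * ?q g \<omega> p + ennreal d * ?q h \<omega> p \<partial>q_meas S \<omega>)"
      proof (rule nn_integral_mono)
        fix p :: "real \<times> 'e"
        show "?q f \<omega> p \<le> ennreal c * ?q g \<omega> p + ennreal d * ?q h \<omega> p"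
        proof (cases "fst p \<in> I")
          case True
          have "ennreal ((norm (f (fst p) (snd p) \<omega>))\<^sup>2) \<le> ennreal (c * (norm (g (fst p) (snd p) \<omega>))\<^sup>2 + d * (norm (h (fst p) (snd p) \<omega>))\<^sup>2)"
            using elim(1) True by (intro ennreal_leI) auto
          also have "\<dots> = ennreal c * ennreal ((norm (g (fst p) (snd p) \<omega>))\<^sup>2) + ennreal d * ennreal ((norm (h (fst p) (snd p) \<omega>))\<^sup>2)"
            using c by (simp add: ennreal_plus ennreal_mult)
          finally show ?thesis using True by (cases p) simp
        qed (cases p, simp)
      qed
      also have "\<dots> = ennreal c * (\<integral>\<^sup>+p. ?q g \<omega> p \<partial>q_meas S \<omega>) + ennreal d * (\<integral>\<^sup>+p. ?q h \<omega> p \<partial>q_meas S \<omega>)"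
        using m2[OF g elim(2)] m2[OF h elim(2)] by (simp add: nn_integral_add nn_integral_cmult)
      finally show ?case .
    qed
  qed
  also have "\<dots> = ennreal c * q_energy I g + ennreal d * q_energy I h"
    using m1[OF g] m1[OF h] by (simp add: nn_integral_add nn_integral_cmult q_energy_def)
  finally show ?thesis .
qed

text \<open>At most \<open>max_jumps S\<close> points are hit, and at each of them the left limit is
  bounded by the supremum of the path.\<close>

lemma left_proc_L2_q:
  assumes t: "0 \<le> t" and X: "X \<in> L2_cadlag S t"
  shows "(\<lambda>s \<theta>. left_proc X s) \<in> L2_q S t"
proof -
  have m: "(\<lambda>x. left_proc X (snd (fst x)) (fst (fst x))) \<in> borel_measurable (predictable S t \<Otimes>\<^sub>M borel)"
    by (rule measurable_compose[OF measurable_fst measurable_left_proc[OF t L2_cadlagD(1,2)[OF X]]])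
  have sq: "(\<lambda>x. ennreal ((norm (left_proc X (snd (fst x)) (fst (fst x))))\<^sup>2)) \<in> borel_measurable (predictable S t \<Otimes>\<^sub>M borel)"
    using m by measurable
  have "q_energy {0..t} (\<lambda>s \<theta>. left_proc X s) \<le> (\<integral>\<^sup>+\<omega>. of_nat (max_jumps S) * (sup_norm t X \<omega>)\<^sup>2 \<partial>Prb S)"
    unfolding q_energy_def
  proof (rule nn_integral_mono)
    fix \<omega> assume \<omega>: "\<omega> \<in> space (Prb S)"
    have le: "ennreal ((norm (left_proc X s \<omega>))\<^sup>2) \<le> (sup_norm t X \<omega>)\<^sup>2" if "s \<in> {0..t}" for s
      using power_mono[OF norm_left_proc_le[where X=X and \<omega>=\<omega>, OF t L2_cadlagD(2)[OF X \<omega>] that], of 2] by (simp add: ennreal_power)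
    show "(\<integral>\<^sup>+p. ennreal ((norm (left_proc X (fst p) \<omega>))\<^sup>2) * indicator ({0..t} \<times> UNIV) p \<partial>q_meas S \<omega>) \<le> of_nat (max_jumps S) * (sup_norm t X \<omega>)\<^sup>2"
      using measurable_section_indicator[OF t \<omega> sq] le
      by (intro nn_integral_q_meas_le) (auto split: split_indicator)
  qed
  also have "\<dots> < \<infinity>"
    using L2_cadlagD(3)[OF X] measurable_sup_norm[OF t L2_cadlagD(1,2)[OF X]]
    by (simp add: nn_integral_cmult ennreal_mult_less_top of_nat_less_top)
  finally show ?thesis using m by (simp add: L2_q_iff)
qed

lemma L2_q_diff:
  assumes t: "0 \<le> t" and f: "f \<in> L2_q S t" and g: "g \<in> L2_q S t"
  shows "(\<lambda>s \<theta> \<omega>. f s \<theta> \<omega> - g s \<theta> \<omega>) \<in> L2_q S t"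
proof -
  have m: "q_measurable t f" "q_measurable t g" using f g by (auto simp: L2_q_iff)
  have d: "q_measurable t (\<lambda>s \<theta> \<omega>. f s \<theta> \<omega> - g s \<theta> \<omega>)" using m by measurable
  have "q_energy {0..t} (\<lambda>s \<theta> \<omega>. f s \<theta> \<omega> - g s \<theta> \<omega>) \<le> ennreal 2 * q_energy {0..t} f + ennreal 2 * q_energy {0..t} g"
    by (rule q_energy_le[OF t d m]) (auto intro!: AE_I2 norm_diff_square_le)
  also have "\<dots> < \<infinity>" using f g by (simp add: L2_q_iff ennreal_mult_less_top)
  finally show ?thesis using d by (simp add: L2_q_iff)
qed

text \<open>The link between the value function, written with \<open>q_hat\<close>, and the energies
  against \<open>q_meas\<close>.\<close>

lemma q_energy_compensator:
  assumes t: "0 \<le> t" and f: "q_measurable t f"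
  shows "(\<integral>\<^sup>+\<omega>. (\<integral>\<^sup>+p. ennreal ((norm (f (fst p) (snd p) \<omega>))\<^sup>2) * indicator ({0..t} \<times> UNIV) p \<partial>q_hat S \<omega>) \<partial>Prb S) = q_energy {0..t} f"
proof -
  have "(\<lambda>x. ennreal ((norm (f (snd (fst x)) (snd x) (fst (fst x))))\<^sup>2)) \<in> borel_measurable (predictable S t \<Otimes>\<^sub>M borel)"
    using f by measurable
  from compensator_formula(1)[OF t this] show ?thesis by (simp add: q_energy_def)
qed

text \<open>All jump times are positive, so \<open>q_meas\<close> has no point at time 0.\<close>

lemma q_energy_half_open:
  assumes t: "0 \<le> t" and f: "q_measurable t f"
  shows "q_energy {0<..t} f = q_energy {0..t} f"
  unfolding q_energy_def
proof (rule nn_integral_cong)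
  fix \<omega> assume \<omega>: "\<omega> \<in> space (Prb S)"
  have "AE p in q_meas S \<omega>. 0 < fst p"
  proof -
    have "{p :: real \<times> 'e. 0 < fst p} = {0<..} \<times> UNIV" by auto
    then have "{p :: real \<times> 'e. 0 < fst p} \<in> sets (borel \<Otimes>\<^sub>M borel)" by (auto intro!: pair_measureI)
    moreover have "0 < real_of_ereal (jump S j \<omega>)" if "j \<in> {1..max_jumps S}" "jump S j \<omega> < \<infinity>" for j
      using jump_pos[of j \<omega>] ereal_rjump[of j \<omega>] that \<omega> by (auto simp: rjump_def zero_less_real_of_ereal)
    ultimately show ?thesis unfolding q_meas_def
      by (subst AE_distr_iff) (auto simp: AE_count_space space_pair_measure)
  qed
  then show "(\<integral>\<^sup>+p. ennreal ((norm (f (fst p) (snd p) \<omega>))\<^sup>2) * indicator ({0<..t} \<times> UNIV) p \<partial>q_meas S \<omega>)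
    = (\<integral>\<^sup>+p. ennreal ((norm (f (fst p) (snd p) \<omega>))\<^sup>2) * indicator ({0..t} \<times> UNIV) p \<partial>q_meas S \<omega>)"
    by (intro nn_integral_cong_AE, eventually_elim) (auto split: split_indicator)
qed

lemma predictable_section:
  fixes h :: "'w \<times> real \<Rightarrow> 'v::euclidean_space"
  assumes "h \<in> borel_measurable (Prb S \<Otimes>\<^sub>M restrict_space lborel {0..t})" "\<omega> \<in> space (Prb S)"
  shows "(\<lambda>s. indicator {0..t} s *\<^sub>R h (\<omega>, s)) \<in> borel_measurable lborel"
  using measurable_compose[OF measurable_Pair1'[OF assms(2)] measurable_joint_indicator[OF assms(1)]] by simp

lemma predictable_mono_joint:
  assumes "0 \<le> t" "t \<le> T" "h \<in> borel_measurable (predictable S T)"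
  shows "h \<in> borel_measurable (Prb S \<Otimes>\<^sub>M restrict_space lborel {0..t})"
  using measurable_compose[OF id_predictable[OF assms(1)] measurable_compose[OF id_predictable_mono[OF assms(1,2)] assms(3)]] by simp

end

lemma q_tilde_int_cong:
  assumes "\<And>s \<theta>. s \<in> {0<..r} \<Longrightarrow> f (s, \<theta>) = g (s, \<theta>)"
  shows "q_tilde_int S \<omega> r f = q_tilde_int S \<omega> r g"
proof -
  have "(LINT p:{0<..r} \<times> UNIV|M. f p) = (LINT p:{0<..r} \<times> UNIV|M. g p)" for M
    unfolding set_lebesgue_integral_def using assms
    by (intro Bochner_Integration.integral_cong refl) (auto split: split_indicator)
  then show ?thesis by (simp add: q_tilde_int_def)
qed

lemma q_tilde_int_diff:
  assumes "set_integrable (q_meas S \<omega>) ({0<..r} \<times> UNIV) f" "set_integrable (q_hat S \<omega>) ({0<..r} \<times> UNIV) f"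
    and "set_integrable (q_meas S \<omega>) ({0<..r} \<times> UNIV) g" "set_integrable (q_hat S \<omega>) ({0<..r} \<times> UNIV) g"
  shows "q_tilde_int S \<omega> r (\<lambda>p. f p - g p) = q_tilde_int S \<omega> r f - q_tilde_int S \<omega> r g"
  using assms by (simp add: q_tilde_int_def set_integral_diff)

section \<open>Comparison of the forward and the backward solution\<close>

context control_system
begin

lemma C_bound: "\<exists>K\<ge>0. AE \<omega> in Prb S. \<forall>r\<in>{0..horizon S}. \<forall>\<theta>. norm (coef_C S r \<theta> \<omega>) \<le> K"
proof -
  obtain K where K: "AE \<omega> in Prb S. \<forall>r\<in>{0..horizon S}. \<forall>\<theta>. norm (coef_C S r \<theta> \<omega>) \<le> K"
    using C_bounded by auto
  show ?thesis
    by (rule exI[of _ "max 0 K"], rule conjI, simp) (use K in eventually_elim, auto intro: max.coboundedI2)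
qed

lemma Linf_bound:
  assumes "A \<in> Linf_pred S"
  shows "\<exists>K\<ge>0. AE \<omega> in Prb S. AE s in lborel. s \<in> {0..horizon S} \<longrightarrow> norm (A s \<omega>) \<le> K"
proof -
  interpret PL: pair_sigma_finite "Prb S" lborel by unfold_locales
  obtain K where "AE p in Prb S \<Otimes>\<^sub>M lborel. snd p \<in> {0..horizon S} \<longrightarrow> norm (A (snd p) (fst p)) \<le> K"
    using assms by (auto simp: Linf_pred_def case_prod_unfold)
  then have "AE \<omega> in Prb S. AE s in lborel. snd (\<omega>, s) \<in> {0..horizon S} \<longrightarrow> norm (A (snd (\<omega>, s)) (fst (\<omega>, s))) \<le> K"
    by (rule PL.AE_pair)
  then have "AE \<omega> in Prb S. AE s in lborel. s \<in> {0..horizon S} \<longrightarrow> norm (A s \<omega>) \<le> max 0 K"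
  proof eventually_elim
    case (elim \<omega>)
    then show ?case by eventually_elim (auto intro: max.coboundedI2)
  qed
  then show ?thesis by (intro exI[of _ "max 0 K"]) simp
qed

lemma C_mult_le:
  assumes "norm (coef_C S s \<theta> \<omega>) \<le> K"
  shows "(norm (coef_C S s \<theta> \<omega> *v v))\<^sup>2 \<le> K\<^sup>2 * (norm v)\<^sup>2"
proof -
  have "norm (coef_C S s \<theta> \<omega> *v v) \<le> norm (coef_C S s \<theta> \<omega>) * norm v"
    by (rule norm_matrix_vector_mult_le)
  also have "\<dots> \<le> K * norm v" using assms by (rule mult_right_mono) simp
  finally show ?thesis using power_mono[of "norm (coef_C S s \<theta> \<omega> *v v)" "K * norm v" 2] by (simp add: power_mult_distrib)
qed

lemma C_measurable:
  assumes "0 \<le> t" "t \<le> horizon S"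
  shows "q_measurable t (coef_C S)"
proof -
  have "(\<lambda>x. (fst x, snd x)) \<in> predictable S t \<Otimes>\<^sub>M borel \<rightarrow>\<^sub>M predictable S (horizon S) \<Otimes>\<^sub>M (borel :: 'e measure)"
    by (intro measurable_Pair measurable_compose[OF measurable_fst id_predictable_mono[OF assms]]) simp
  from measurable_compose[OF this L2_q_measurable[OF C_L2]] show ?thesis by simp
qed

lemma C_left_L2_q:
  assumes t: "0 \<le> t" "t \<le> horizon S" and X: "X \<in> L2_cadlag S t"
  shows "(\<lambda>s \<theta> \<omega>. coef_C S s \<theta> \<omega> *v left_proc X s \<omega>) \<in> L2_q S t"
proof -
  obtain K where K: "0 \<le> K" "AE \<omega> in Prb S. \<forall>r\<in>{0..horizon S}. \<forall>\<theta>. norm (coef_C S r \<theta> \<omega>) \<le> K"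
    using C_bound by auto
  have l: "(\<lambda>s (\<theta>::'e). left_proc X s) \<in> L2_q S t" by (rule left_proc_L2_q[OF t(1) X])
  have m: "(\<lambda>x. left_proc X (snd (fst x)) (fst (fst x))) \<in> borel_measurable (predictable S t \<Otimes>\<^sub>M (borel :: 'e measure))"
    using L2_q_measurable[OF l] by simp
  have c: "q_measurable t (\<lambda>s \<theta> \<omega>. coef_C S s \<theta> \<omega> *v left_proc X s \<omega>)"
    using C_measurable[OF t] m by measurable
  have "q_energy {0..t} (\<lambda>s \<theta> \<omega>. coef_C S s \<theta> \<omega> *v left_proc X s \<omega>)
    \<le> ennreal (K\<^sup>2) * q_energy {0..t} (\<lambda>s (\<theta>::'e). left_proc X s) + ennreal 0 * q_energy {0..t} (\<lambda>s (\<theta>::'e). left_proc X s)"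
  proof (rule q_energy_le[OF t(1) c])
    show "AE \<omega> in Prb S. \<forall>s\<in>{0..t}. \<forall>\<theta>. (norm (coef_C S s \<theta> \<omega> *v left_proc X s \<omega>))\<^sup>2
      \<le> K\<^sup>2 * (norm (left_proc X s \<omega>))\<^sup>2 + 0 * (norm (left_proc X s \<omega>))\<^sup>2"
      using K(2) by eventually_elim (use t in \<open>auto intro!: C_mult_le\<close>)
  qed (use m in auto)
  also have "\<dots> < \<infinity>" using l by (simp add: L2_q_iff ennreal_mult_less_top)
  finally show ?thesis using c by (simp add: L2_q_iff)
qed

text \<open>It permits subtracting the drifts of the two equations. On almost every path
  \<open>X\<close> is bounded and \<open>u\<close> is square integrable in time, so
  \<open>A X\<close> is bounded and \<open>B u\<close> is dominated by a multiple of
  \<open>1 + |u|^2\<close>.\<close>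

lemma drift_integrable:
  assumes t: "0 \<le> t" "t \<le> horizon S" and u: "u \<in> admissible S" and X: "X \<in> L2_cadlag S t"
  shows "AE \<omega> in Prb S. set_integrable lborel {0..t} (\<lambda>s. coef_A S s \<omega> *v X s \<omega> + coef_B S s \<omega> *v u s \<omega>)"
proof -
  obtain KA where KA: "0 \<le> KA" "AE \<omega> in Prb S. AE s in lborel. s \<in> {0..horizon S} \<longrightarrow> norm (coef_A S s \<omega>) \<le> KA"
    using Linf_bound[OF A_Linf] by auto
  obtain KB where KB: "0 \<le> KB" "AE \<omega> in Prb S. AE s in lborel. s \<in> {0..horizon S} \<longrightarrow> norm (coef_B S s \<omega>) \<le> KB"
    using Linf_bound[OF B_Linf] by auto
  have um: "(\<lambda>p. u (snd p) (fst p)) \<in> borel_measurable (predictable S (horizon S))"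
    using u by (simp add: L2_pred_def case_prod_unfold)
  have m: "(\<lambda>p. coef_A S (snd p) (fst p)) \<in> borel_measurable (predictable S (horizon S))"
    "(\<lambda>p. coef_B S (snd p) (fst p)) \<in> borel_measurable (predictable S (horizon S))"
    using A_Linf B_Linf by (simp_all add: Linf_pred_def case_prod_unfold)
  note mj = predictable_mono_joint[OF t m(1)] predictable_mono_joint[OF t m(2)] predictable_mono_joint[OF t um]
    progressive_measurable[OF L2_cadlagD(1)[OF X] t(1)]
  have gm: "(\<lambda>p. coef_A S (snd p) (fst p) *v X (snd p) (fst p) + coef_B S (snd p) (fst p) *v u (snd p) (fst p))
    \<in> borel_measurable (Prb S \<Otimes>\<^sub>M restrict_space lborel {0..t})"
    using mj by measurable
  have [measurable]: "(\<lambda>p. indicator {0..t} (snd p) *\<^sub>R u (snd p) (fst p)) \<in> borel_measurable (Prb S \<Otimes>\<^sub>M lborel)"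
    by (rule measurable_joint_indicator[OF mj(3)])
  have "(\<integral>\<^sup>+p. ennreal ((norm (indicator {0..t} (snd p) *\<^sub>R u (snd p) (fst p)))\<^sup>2) \<partial>(Prb S \<Otimes>\<^sub>M lborel))
    \<le> (\<integral>\<^sup>+ (\<omega>, r) \<in> space (Prb S) \<times> {0..horizon S}. ennreal ((norm (u r \<omega>))\<^sup>2) \<partial>(Prb S \<Otimes>\<^sub>M lborel))"
    using t by (intro nn_integral_mono) (auto simp: space_pair_measure split: split_indicator)
  also have "\<dots> < \<infinity>" using u by (simp add: L2_pred_def)
  finally have fin: "(\<integral>\<^sup>+p. ennreal ((norm (indicator {0..t} (snd p) *\<^sub>R u (snd p) (fst p)))\<^sup>2) \<partial>(Prb S \<Otimes>\<^sub>M lborel)) < \<infinity>" .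
  have vmj: "(\<lambda>p. ennreal ((norm (indicator {0..t} (snd p) *\<^sub>R u (snd p) (fst p)))\<^sup>2)) \<in> borel_measurable (Prb S \<Otimes>\<^sub>M lborel)"
    by measurable
  have "(\<integral>\<^sup>+\<omega>. \<integral>\<^sup>+s. ennreal ((norm (indicator {0..t} s *\<^sub>R u s \<omega>))\<^sup>2) \<partial>lborel \<partial>Prb S) \<noteq> \<infinity>"
    using lborel.nn_integral_fst[OF vmj] fin unfolding fst_conv snd_conv by (metis less_irrefl)
  moreover have "(\<lambda>\<omega>. \<integral>\<^sup>+s. ennreal ((norm (indicator {0..t} s *\<^sub>R u s \<omega>))\<^sup>2) \<partial>lborel) \<in> borel_measurable (Prb S)"
    using lborel.borel_measurable_nn_integral_fst[OF vmj] unfolding fst_conv snd_conv .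
  ultimately have "AE \<omega> in Prb S. (\<integral>\<^sup>+s. ennreal ((norm (indicator {0..t} s *\<^sub>R u s \<omega>))\<^sup>2) \<partial>lborel) \<noteq> \<infinity>"
    by (rule nn_integral_PInf_AE[rotated])
  moreover have "AE \<omega> in Prb S. sup_norm t X \<omega> < \<infinity>"
  proof -
    have "AE \<omega> in Prb S. (sup_norm t X \<omega>)\<^sup>2 \<noteq> \<infinity>"
      using L2_cadlagD(3)[OF X] measurable_sup_norm[OF t(1) L2_cadlagD(1,2)[OF X]] by (intro nn_integral_PInf_AE) auto
    then show ?thesis by eventually_elim (auto simp: less_top power2_eq_square ennreal_mult_eq_top_iff)
  qed
  ultimately show ?thesis using KA(2) KB(2) AE_space
  proof eventually_elim
    case (elim \<omega>)
    obtain N where N: "sup_norm t X \<omega> = ennreal N" "0 \<le> N" using elim(2) by (cases "sup_norm t X \<omega>") auto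
    have XN: "norm (X s \<omega>) \<le> N" if "s \<in> {0..t}" for s
      using norm_le_sup_norm[OF that, of X \<omega>] N by simp
    let ?g = "\<lambda>s. coef_A S s \<omega> *v X s \<omega> + coef_B S s \<omega> *v u s \<omega>"
    let ?v = "\<lambda>s. ennreal ((norm (indicator {0..t} s *\<^sub>R u s \<omega>))\<^sup>2)"
    have vm: "?v \<in> borel_measurable lborel"
      using predictable_section[OF mj(3) elim(5)] by (simp del: norm_scaleR) measurable
    have "AE s in lborel. ennreal (norm (indicator {0..t} s *\<^sub>R ?g s)) \<le> ennreal (KA * N + KB) * indicator {0..t} s + ennreal KB * ?v s"
      using elim(3,4)
    proof eventually_elim
      case (elim s)
      show ?case
      proof (cases "s \<in> {0..t}")
        case True
        define y where "y = norm (u s \<omega>)"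
        have y0: "0 \<le> y" by (simp add: y_def)
        note y = le_one_plus_square[of y]
        have "norm (coef_A S s \<omega> *v X s \<omega>) \<le> norm (coef_A S s \<omega>) * norm (X s \<omega>)" by (rule norm_matrix_vector_mult_le)
        also have "\<dots> \<le> KA * N" using elim(1) True t XN[OF True] KA(1) by (intro mult_mono) auto
        finally have 1: "norm (coef_A S s \<omega> *v X s \<omega>) \<le> KA * N" .
        have "norm (coef_B S s \<omega> *v u s \<omega>) \<le> norm (coef_B S s \<omega>) * y" unfolding y_def by (rule norm_matrix_vector_mult_le)
        also have "\<dots> \<le> KB * (1 + y\<^sup>2)" using elim(2) True t y y0 KB(1) by (intro mult_mono) auto
        finally have 2: "norm (coef_B S s \<omega> *v u s \<omega>) \<le> KB * (1 + y\<^sup>2)" .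
        have "norm (?g s) \<le> (KA * N + KB) + KB * y\<^sup>2"
          using norm_triangle_ineq[of "coef_A S s \<omega> *v X s \<omega>" "coef_B S s \<omega> *v u s \<omega>"] 1 2 by (simp add: distrib_left)
        then have "ennreal (norm (?g s)) \<le> ennreal ((KA * N + KB) + KB * y\<^sup>2)" by (rule ennreal_leI)
        also have "\<dots> = ennreal (KA * N + KB) + ennreal KB * ennreal (y\<^sup>2)"
          using KA(1) KB(1) N(2) by (simp add: ennreal_plus ennreal_mult)
        finally show ?thesis using True by (simp add: y_def)
      qed simp
    qed
    then have "(\<integral>\<^sup>+s. ennreal (norm (indicator {0..t} s *\<^sub>R ?g s)) \<partial>lborel)
      \<le> (\<integral>\<^sup>+s. ennreal (KA * N + KB) * indicator {0..t} s + ennreal KB * ?v s \<partial>lborel)"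
      by (rule nn_integral_mono_AE)
    also have "\<dots> = ennreal (KA * N + KB) * ennreal t + ennreal KB * (\<integral>\<^sup>+s. ?v s \<partial>lborel)"
      using vm t by (simp add: nn_integral_add nn_integral_cmult nn_integral_cmult_indicator del: norm_scaleR)
    also have "\<dots> < \<infinity>" using elim(1) by (simp add: ennreal_mult_less_top less_top del: norm_scaleR)
    finally show "set_integrable lborel {0..t} ?g"
      unfolding set_integrable_def using predictable_section[OF gm elim(5)] by (intro integrableI_bounded) auto
  qed
qed

text \<open>Both equations are driven by the same control, so \<open>B u\<close> cancels and the
  drift of the difference is \<open>A D\<close>. Subtracting the integrals is legitimate because
  each of them converges separately on almost every path.\<close>

lemma energy_system_difference:
  assumes t: "0 \<le> t" "t \<le> horizon S" and u: "u \<in> admissible S"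
    and Y: "sde_solution S x u Y" and X: "bsde_solution S u t \<xi> X Z"
    and KA: "0 \<le> KA" "AE \<omega> in Prb S. AE s in lborel. s \<in> {0..horizon S} \<longrightarrow> norm (coef_A S s \<omega>) \<le> KA"
  shows "energy_system S t (\<lambda>r \<omega>. Y r \<omega> - X r \<omega>)
    (\<lambda>s \<theta> \<omega>. coef_C S s \<theta> \<omega> *v left_proc (\<lambda>r \<omega>. Y r \<omega> - X r \<omega>) s \<omega> - Z s \<theta> \<omega>)
    (\<lambda>s \<omega>. coef_A S s \<omega> *v (Y s \<omega> - X s \<omega>)) KA"
    and "AE \<omega> in Prb S. Y 0 \<omega> = x"
proof -
  let ?D = "\<lambda>r \<omega>. Y r \<omega> - X r \<omega>"
  have YL: "Y \<in> L2_cadlag S t" using L2_cadlag_mono[of Y "horizon S" t] Y t by (simp add: sde_solution_def)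
  have XL: "X \<in> L2_cadlag S t" and ZL: "Z \<in> L2_q S t" using X by (simp_all add: bsde_solution_def)
  have DL: "?D \<in> L2_cadlag S t" by (rule L2_cadlag_diff[OF t(1) YL XL])
  have Y_eq: "AE \<omega> in Prb S. \<forall>r\<in>{0..horizon S}. Y r \<omega> = x
          + (LINT s:{0..r}|lborel. coef_A S s \<omega> *v Y s \<omega> + coef_B S s \<omega> *v u s \<omega>)
          + q_tilde_int S \<omega> r (\<lambda>(s, \<theta>). coef_C S s \<theta> \<omega> *v left_lim (\<lambda>s. Y s \<omega>) s)"
    using Y by (simp add: sde_solution_def)
  have X_eq: "AE \<omega> in Prb S. \<forall>r\<in>{0..t}. X r \<omega> = X 0 \<omega>
          + (LINT s:{0..r}|lborel. coef_A S s \<omega> *v X s \<omega> + coef_B S s \<omega> *v u s \<omega>)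
          + q_tilde_int S \<omega> r (\<lambda>(s, \<theta>). coef_C S s \<theta> \<omega> *v left_lim (\<lambda>s. X s \<omega>) s)
          + q_tilde_int S \<omega> r (\<lambda>(s, \<theta>). Z s \<theta> \<omega>)"
    using X by (simp add: bsde_solution_def)
  \<comment> \<open>The forward equation at \<open>r = 0\<close> reads \<open>Y 0 = x\<close>; the
    interval \<open>{0..0}\<close> is a null set, not empty.\<close>
  have zero: "(LINT s:{0..0}|lborel. h s) = 0" "q_tilde_int S \<omega> 0 k = 0" for h :: "real \<Rightarrow> real^'n" and k \<omega>
  proof -
    have "AE s in lborel. indicator {0..0} s *\<^sub>R h s = 0"
      using AE_lborel_singleton[of 0] by eventually_elim auto
    then show "(LINT s:{0..0}|lborel. h s) = 0" unfolding set_lebesgue_integral_def by (rule integral_eq_zero_AE)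
  qed (simp add: q_tilde_int_def set_lebesgue_integral_def)
  show Y0: "AE \<omega> in Prb S. Y 0 \<omega> = x"
    using Y_eq
  proof eventually_elim
    case (elim \<omega>)
    have "0 \<in> {0..horizon S}" using t by simp
    from bspec[OF elim this] show ?case by (simp only: zero add_0_right)
  qed
  show "energy_system S t ?D (\<lambda>s \<theta> \<omega>. coef_C S s \<theta> \<omega> *v left_proc ?D s \<omega> - Z s \<theta> \<omega>)
    (\<lambda>s \<omega>. coef_A S s \<omega> *v (Y s \<omega> - X s \<omega>)) KA"
  proof
    show "0 \<le> t" "0 \<le> KA" by fact+
    show "?D \<in> L2_cadlag S t" by fact
    show "(\<lambda>s \<theta> \<omega>. coef_C S s \<theta> \<omega> *v left_proc ?D s \<omega> - Z s \<theta> \<omega>) \<in> L2_q S t"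
      by (rule L2_q_diff[OF t(1) C_left_L2_q[OF t DL] ZL])
    have m: "(\<lambda>p. coef_A S (snd p) (fst p)) \<in> borel_measurable (predictable S (horizon S))"
      using A_Linf by (simp add: Linf_pred_def case_prod_unfold)
    show "(\<lambda>p. coef_A S (snd p) (fst p) *v (Y (snd p) (fst p) - X (snd p) (fst p))) \<in> borel_measurable (Prb S \<Otimes>\<^sub>M restrict_space lborel {0..t})"
      using predictable_mono_joint[OF t m] progressive_measurable[OF L2_cadlagD(1)[OF YL] t(1)] progressive_measurable[OF L2_cadlagD(1)[OF XL] t(1)]
      by measurable
    show "AE \<omega> in Prb S. AE s in lborel. s \<in> {0..t} \<longrightarrow> norm (coef_A S s \<omega> *v (Y s \<omega> - X s \<omega>)) \<le> KA * norm (Y s \<omega> - X s \<omega>)"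
      using KA(2)
    proof eventually_elim
      case (elim \<omega>)
      then show ?case
      proof eventually_elim
        case (elim s)
        then show ?case using t norm_matrix_vector_mult_le[of "coef_A S s \<omega>" "Y s \<omega> - X s \<omega>"]
          mult_right_mono[of "norm (coef_A S s \<omega>)" KA "norm (Y s \<omega> - X s \<omega>)"] by auto
      qed
    qed
    show "AE \<omega> in Prb S. \<forall>r\<in>{0..t}. Y r \<omega> - X r \<omega> = Y 0 \<omega> - X 0 \<omega> + (LINT s:{0..r}|lborel. coef_A S s \<omega> *v (Y s \<omega> - X s \<omega>))
      + q_tilde_int S \<omega> r (\<lambda>(s, \<theta>). coef_C S s \<theta> \<omega> *v left_proc ?D s \<omega> - Z s \<theta> \<omega>)"
      using Y_eq X_eq Y0 drift_integrable[OF t u YL] drift_integrable[OF t u XL]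
        L2_q_AE_integrable[OF t(1) C_left_L2_q[OF t YL]] L2_q_AE_integrable[OF t(1) C_left_L2_q[OF t XL]]
        L2_q_AE_integrable[OF t(1) ZL] AE_space
    proof eventually_elim
      case (elim \<omega>)
      show ?case
      proof
        fix r assume r: "r \<in> {0..t}"
        let ?gY = "\<lambda>s. coef_A S s \<omega> *v Y s \<omega> + coef_B S s \<omega> *v u s \<omega>" and ?gX = "\<lambda>s. coef_A S s \<omega> *v X s \<omega> + coef_B S s \<omega> *v u s \<omega>"
        let ?hY = "\<lambda>p. coef_C S (fst p) (snd p) \<omega> *v left_proc Y (fst p) \<omega>" and ?hX = "\<lambda>p. coef_C S (fst p) (snd p) \<omega> *v left_proc X (fst p) \<omega>"
          and ?Z = "\<lambda>p. Z (fst p) (snd p) \<omega>"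
        have "set_integrable lborel {0..r} ?gY" "set_integrable lborel {0..r} ?gX"
          by (rule set_integrable_subset[OF elim(4)] set_integrable_subset[OF elim(5)]; use r in auto)+
        then have "(LINT s:{0..r}|lborel. ?gY s) - (LINT s:{0..r}|lborel. ?gX s) = (LINT s:{0..r}|lborel. ?gY s - ?gX s)"
          by (rule set_integral_diff(2)[symmetric])
        also have "(\<lambda>s. ?gY s - ?gX s) = (\<lambda>s. coef_A S s \<omega> *v (Y s \<omega> - X s \<omega>))"
          by (simp add: matrix_vector_mult_diff_distrib)
        finally have lin: "(LINT s:{0..r}|lborel. ?gY s) - (LINT s:{0..r}|lborel. ?gX s) = (LINT s:{0..r}|lborel. coef_A S s \<omega> *v (Y s \<omega> - X s \<omega>))" .
        note iY = elim(6)[rule_format, OF r] and iX = elim(7)[rule_format, OF r] and iZ = elim(8)[rule_format, OF r]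
        \<comment> \<open>The integrals run over \<open>{0<..r}\<close>, where
          \<open>left_lim\<close> and the predictable \<open>left_proc\<close> agree.\<close>
        have qY: "q_tilde_int S \<omega> r (\<lambda>(s, \<theta>). coef_C S s \<theta> \<omega> *v left_lim (\<lambda>s. Y s \<omega>) s) = q_tilde_int S \<omega> r ?hY"
          and qX: "q_tilde_int S \<omega> r (\<lambda>(s, \<theta>). coef_C S s \<theta> \<omega> *v left_lim (\<lambda>s. X s \<omega>) s) = q_tilde_int S \<omega> r ?hX"
          and qZ: "q_tilde_int S \<omega> r (\<lambda>(s, \<theta>). Z s \<theta> \<omega>) = q_tilde_int S \<omega> r ?Z"
          by (rule q_tilde_int_cong; simp add: left_proc_def)+
        have iYX: "set_integrable (q_meas S \<omega>) ({0<..r} \<times> UNIV) (\<lambda>p. ?hY p - ?hX p)" "set_integrable (q_hat S \<omega>) ({0<..r} \<times> UNIV) (\<lambda>p. ?hY p - ?hX p)"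
          using iY iX by (auto intro!: set_integral_diff(1))
        have "q_tilde_int S \<omega> r ?hY - q_tilde_int S \<omega> r ?hX - q_tilde_int S \<omega> r ?Z = q_tilde_int S \<omega> r (\<lambda>p. ?hY p - ?hX p - ?Z p)"
          using iY iX iZ iYX by (simp add: q_tilde_int_diff)
        also have "\<dots> = q_tilde_int S \<omega> r (\<lambda>(s, \<theta>). coef_C S s \<theta> \<omega> *v left_proc ?D s \<omega> - Z s \<theta> \<omega>)"
        proof (rule q_tilde_int_cong)
          fix s and \<theta> :: 'e assume "s \<in> {0<..r}"
          then have "s \<in> {0<..t}" using r by auto
          from left_lim_cong_diff[OF L2_cadlagD(2)[OF YL elim(9)] L2_cadlagD(2)[OF XL elim(9)] this]
          have "left_proc ?D s \<omega> = left_proc Y s \<omega> - left_proc X s \<omega>" by (simp add: left_proc_def)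
          then show "?hY (s, \<theta>) - ?hX (s, \<theta>) - ?Z (s, \<theta>) = (case (s, \<theta>) of (s, \<theta>) \<Rightarrow> coef_C S s \<theta> \<omega> *v left_proc ?D s \<omega> - Z s \<theta> \<omega>)"
            by (simp add: matrix_vector_mult_diff_distrib)
        qed
        finally have q: "q_tilde_int S \<omega> r ?hY - q_tilde_int S \<omega> r ?hX - q_tilde_int S \<omega> r ?Z = \<dots>" .
        have "r \<in> {0..horizon S}" using r t by auto
        from bspec[OF elim(1) this] bspec[OF elim(2) r]
        have "Y r \<omega> - X r \<omega> = (x + (LINT s:{0..r}|lborel. ?gY s) + q_tilde_int S \<omega> r ?hY)
          - (X 0 \<omega> + (LINT s:{0..r}|lborel. ?gX s) + q_tilde_int S \<omega> r ?hX + q_tilde_int S \<omega> r ?Z)"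
          unfolding qY qX qZ by (rule arg_cong2)
        also have "\<dots> = Y 0 \<omega> - X 0 \<omega> + ((LINT s:{0..r}|lborel. ?gY s) - (LINT s:{0..r}|lborel. ?gX s))
          + (q_tilde_int S \<omega> r ?hY - q_tilde_int S \<omega> r ?hX - q_tilde_int S \<omega> r ?Z)"
          unfolding elim(3) by (simp add: algebra_simps)
        finally show "Y r \<omega> - X r \<omega> = Y 0 \<omega> - X 0 \<omega> + (LINT s:{0..r}|lborel. coef_A S s \<omega> *v (Y s \<omega> - X s \<omega>))
          + q_tilde_int S \<omega> r (\<lambda>(s, \<theta>). coef_C S s \<theta> \<omega> *v left_proc ?D s \<omega> - Z s \<theta> \<omega>)"
          unfolding lin q .
      qed
    qed
  qed
qed

text \<open>The order of quantifiers is the point: \<open>c\<close> precedes the control, the data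
  and the solutions. Equal initial values are required for the second bound only, where Gronwall
  runs forward.\<close>

lemma terminal_estimates:
  assumes t: "0 \<le> t" "t \<le> horizon S"
  shows "\<exists>c\<ge>0. \<forall>u\<in>admissible S. \<forall>x Y \<xi> X Z. sde_solution S x u Y \<longrightarrow> bsde_solution S u t \<xi> X Z \<longrightarrow>
    q_energy {0..t} Z \<le> ennreal (c * (\<integral>\<omega>. (norm (Y t \<omega> - X t \<omega>))\<^sup>2 \<partial>Prb S)) \<and>
    ((\<forall>\<omega>\<in>space (Prb S). X 0 \<omega> = x) \<longrightarrow> (\<integral>\<omega>. (norm (Y t \<omega> - X t \<omega>))\<^sup>2 \<partial>Prb S) \<le> c * enn2real (q_energy {0..t} Z))"
proof -
  obtain KA where KA: "0 \<le> KA" "AE \<omega> in Prb S. AE s in lborel. s \<in> {0..horizon S} \<longrightarrow> norm (coef_A S s \<omega>) \<le> KA"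
    using Linf_bound[OF A_Linf] by auto
  obtain KC where KC: "0 \<le> KC" "AE \<omega> in Prb S. \<forall>r\<in>{0..horizon S}. \<forall>\<theta>. norm (coef_C S r \<theta> \<omega>) \<le> KC"
    using C_bound by auto
  \<comment> \<open>\<open>\<kappa>\<close> is the price of \<open>C D_-\<close>: the factor 2 comes
    from squaring a difference, \<open>KC\<^sup>2\<close> from the bound on \<open>C\<close>,
    \<open>comp_bound\<close> from \<open>left_energy_le\<close>. The rate \<open>k\<close> adds the
    contribution \<open>2 * KA\<close> of the drift. \<open>c1\<close> is the outcome of forward
    Gronwall, \<open>c2\<close> that of the backward estimates, and their sum serves both
    bounds.\<close>
  define \<kappa> where "\<kappa> = 2 * KC\<^sup>2 * comp_bound"
  define k where "k = 2 * KA + \<kappa>"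
  define c1 where "c1 = 4 * exp (2 * k * t)"
  define c2 where "c2 = \<kappa> * (t * (2 * exp (4 * KA * t))) + 2 * (1 + 4 * KA * t * exp (4 * KA * t))"
  have \<kappa>: "0 \<le> \<kappa>" using comp_bound_nonneg by (simp add: \<kappa>_def)
  have k: "0 \<le> k" using \<kappa> KA(1) by (simp add: k_def)
  have c: "0 \<le> c1" "0 \<le> c2" using \<kappa> KA(1) t(1) by (simp_all add: c1_def c2_def)
  show ?thesis
  proof (intro exI[of _ "c1 + c2"] conjI ballI allI impI)
    show "0 \<le> c1 + c2" using c by simp
  next
    fix u x Y \<xi> X Z
    assume u: "u \<in> admissible S" and Y: "sde_solution S x u Y" and X: "bsde_solution S u t \<xi> X Z"
    let ?D = "\<lambda>r \<omega>. Y r \<omega> - X r \<omega>"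
    let ?l = "\<lambda>s (\<theta>::'e). left_proc ?D s"
    let ?f = "\<lambda>s \<theta> \<omega>. coef_C S s \<theta> \<omega> *v left_proc ?D s \<omega> - Z s \<theta> \<omega>"
    interpret E: energy_system S t ?D ?f "\<lambda>s \<omega>. coef_A S s \<omega> *v (Y s \<omega> - X s \<omega>)" KA
      by (rule energy_system_difference(1)[OF t u Y X KA])
    have Y0: "AE \<omega> in Prb S. Y 0 \<omega> = x" by (rule energy_system_difference(2)[OF t u Y X KA])
    have ZL: "Z \<in> L2_q S t" using X by (simp add: bsde_solution_def)
    have Zm: "q_measurable t Z" and Zfin: "q_energy {0..t} Z < \<infinity>" using ZL by (simp_all add: L2_q_iff)
    have lm: "q_measurable t ?l" using L2_q_measurable[OF left_proc_L2_q[OF t(1) E.D]] .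
    have fm: "q_measurable t ?f" using E.f_meas .
    have J: "E.jump_energy r = q_energy {0<..r} ?f" for r by (simp add: E.jump_energy_def q_energy_def)
    define z where "z = enn2real (q_energy {0..t} Z)"
    have z0: "0 \<le> z" by (simp add: z_def)
    have z: "q_energy {0..t} Z = ennreal z" using Zfin by (simp add: z_def)
    have zr: "q_energy {0<..r} Z \<le> ennreal z" if "r \<le> t" for r
      unfolding z[symmetric] q_energy_def using that by (intro nn_integral_mono) (auto split: split_indicator)
    define g where "g = E.second_moment"
    have gt: "g t = (\<integral>\<omega>. (norm (Y t \<omega> - X t \<omega>))\<^sup>2 \<partial>Prb S)" by (simp add: g_def E.second_moment_def)
    have g_nn: "0 \<le> (LINT s:{0<..r}|lborel. g s)" if "r \<le> t" for r
      unfolding set_lebesgue_integral_def using E.second_moment_bounds that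
      by (intro integral_nonneg_AE AE_I2) (auto simp: g_def split: split_indicator)
    have l: "q_energy {0<..r} ?l \<le> ennreal (comp_bound * (LINT s:{0<..r}|lborel. g s))" if "r \<in> {0..t}" for r
      using E.left_energy_le[of r] that unfolding q_energy_def g_def by simp
    have Cl: "AE \<omega> in Prb S. \<forall>s\<in>{0..t}. \<forall>\<theta>. (norm (coef_C S s \<theta> \<omega> *v left_proc ?D s \<omega>))\<^sup>2 \<le> KC\<^sup>2 * (norm (left_proc ?D s \<omega>))\<^sup>2"
      using KC(2) by eventually_elim (use t in \<open>auto intro!: C_mult_le\<close>)
    have f_le: "E.jump_energy r \<le> ennreal (2 * KC\<^sup>2) * q_energy {0<..r} ?l + ennreal 2 * q_energy {0<..r} Z" if "r \<in> {0..t}" for r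
      unfolding J
    proof (rule q_energy_le[OF t(1) fm lm Zm])
      show "AE \<omega> in Prb S. \<forall>s\<in>{0<..r}. \<forall>\<theta>. (norm (?f s \<theta> \<omega>))\<^sup>2 \<le> 2 * KC\<^sup>2 * (norm (left_proc ?D s \<omega>))\<^sup>2 + 2 * (norm (Z s \<theta> \<omega>))\<^sup>2"
        using Cl
      proof eventually_elim
        case (elim \<omega>)
        show ?case
        proof (intro ballI allI)
          fix s \<theta> assume "s \<in> {0<..r}"
          then have "s \<in> {0..t}" using that by auto
          then show "(norm (?f s \<theta> \<omega>))\<^sup>2 \<le> 2 * KC\<^sup>2 * (norm (left_proc ?D s \<omega>))\<^sup>2 + 2 * (norm (Z s \<theta> \<omega>))\<^sup>2"
            using elim[rule_format, of s \<theta>] norm_diff_square_le[of "coef_C S s \<theta> \<omega> *v left_proc ?D s \<omega>" "Z s \<theta> \<omega>"] by simp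
        qed
      qed
    qed (use that KC(1) in auto)
    \<comment> \<open>\<open>Z\<close> is \<open>C D_-\<close> minus the integrand
      \<open>?f\<close>, so the same inequality holds with the roles of \<open>Z\<close> and
      \<open>?f\<close> exchanged.\<close>
    have Z_le: "q_energy {0<..t} Z \<le> ennreal (2 * KC\<^sup>2) * q_energy {0<..t} ?l + ennreal 2 * E.jump_energy t"
      unfolding J
    proof (rule q_energy_le[OF t(1) Zm lm fm])
      show "AE \<omega> in Prb S. \<forall>s\<in>{0<..t}. \<forall>\<theta>. (norm (Z s \<theta> \<omega>))\<^sup>2 \<le> 2 * KC\<^sup>2 * (norm (left_proc ?D s \<omega>))\<^sup>2 + 2 * (norm (?f s \<theta> \<omega>))\<^sup>2"
        using Cl
      proof eventually_elim
        case (elim \<omega>)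
        show ?case
        proof (intro ballI allI)
          fix s \<theta> assume "s \<in> {0<..t}"
          then have "s \<in> {0..t}" by auto
          then show "(norm (Z s \<theta> \<omega>))\<^sup>2 \<le> 2 * KC\<^sup>2 * (norm (left_proc ?D s \<omega>))\<^sup>2 + 2 * (norm (?f s \<theta> \<omega>))\<^sup>2"
            using elim[rule_format, of s \<theta>] norm_diff_square_le[of "coef_C S s \<theta> \<omega> *v left_proc ?D s \<omega>" "?f s \<theta> \<omega>"] by simp
        qed
      qed
    qed auto
    have l\<kappa>: "ennreal (2 * KC\<^sup>2) * q_energy {0<..r} ?l \<le> ennreal (\<kappa> * (LINT s:{0<..r}|lborel. g s))" if "r \<in> {0..t}" for r
    proof -
      have "ennreal (2 * KC\<^sup>2) * q_energy {0<..r} ?l \<le> ennreal (2 * KC\<^sup>2) * ennreal (comp_bound * (LINT s:{0<..r}|lborel. g s))"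
        by (intro mult_left_mono l that) simp
      also have "\<dots> = ennreal (2 * KC\<^sup>2 * (comp_bound * (LINT s:{0<..r}|lborel. g s)))"
        by (rule ennreal_mult'[symmetric]) simp
      finally show ?thesis by (simp add: \<kappa>_def mult.assoc)
    qed
    define j where "j r = enn2real (E.jump_energy r)" for r
    have j: "E.jump_energy r = ennreal (j r)" if "r \<le> t" for r
      using E.jump_energy_finite[OF that] by (simp add: j_def)
    have j0: "0 \<le> j r" for r by (simp add: j_def)
    have j_le: "j r \<le> \<kappa> * (LINT s:{0<..r}|lborel. g s) + 2 * z" if r: "r \<in> {0..t}" for r
    proof -
      have "ennreal (j r) \<le> ennreal (2 * KC\<^sup>2) * q_energy {0<..r} ?l + ennreal 2 * q_energy {0<..r} Z"
        using f_le[OF r] j r by simp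
      also have "\<dots> \<le> ennreal (\<kappa> * (LINT s:{0<..r}|lborel. g s)) + ennreal 2 * ennreal z"
        using zr[of r] r by (intro add_mono l\<kappa> mult_left_mono) auto
      also have "\<dots> = ennreal (\<kappa> * (LINT s:{0<..r}|lborel. g s) + 2 * z)"
        using z0 \<kappa> g_nn[of r] r by (simp add: ennreal_plus ennreal_mult)
      finally have le: "ennreal (j r) \<le> ennreal (\<kappa> * (LINT s:{0<..r}|lborel. g s) + 2 * z)" .
      have "0 \<le> \<kappa> * (LINT s:{0<..r}|lborel. g s) + 2 * z" using z0 \<kappa> g_nn[of r] r by simp
      from iffD1[OF ennreal_le_iff[OF this] le] show ?thesis .
    qed
    have z_le: "z \<le> \<kappa> * (LINT s:{0<..t}|lborel. g s) + 2 * j t"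
    proof -
      have "ennreal z \<le> ennreal (2 * KC\<^sup>2) * q_energy {0<..t} ?l + ennreal 2 * E.jump_energy t"
        using Z_le q_energy_half_open[OF t(1) Zm] z by simp
      also have "\<dots> \<le> ennreal (\<kappa> * (LINT s:{0<..t}|lborel. g s)) + ennreal 2 * ennreal (j t)"
        using t j[of t] by (intro add_mono l\<kappa> mult_left_mono) auto
      also have "\<dots> = ennreal (\<kappa> * (LINT s:{0<..t}|lborel. g s) + 2 * j t)"
        using j0 \<kappa> g_nn[of t] t by (simp add: ennreal_plus ennreal_mult)
      finally have le: "ennreal z \<le> ennreal (\<kappa> * (LINT s:{0<..t}|lborel. g s) + 2 * j t)" .
      have "0 \<le> \<kappa> * (LINT s:{0<..t}|lborel. g s) + 2 * j t" using j0[of t] \<kappa> g_nn[of t] by simp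
      from iffD1[OF ennreal_le_iff[OF this] le] show ?thesis .
    qed
    have g_t0: "0 \<le> g t" using E.second_moment_bounds[of t] t by (simp add: g_def)
    \<comment> \<open>Backward bound: the time integral of the second moment and the jump energy are
      both multiples of the terminal second moment.\<close>
    have "z \<le> \<kappa> * (t * (2 * g t * exp (4 * KA * t))) + 2 * ((1 + 4 * KA * t * exp (4 * KA * t)) * g t)"
      using z_le mult_left_mono[OF E.integral_second_moment_le \<kappa>] E.jump_energy_le_terminal
      unfolding g_def[symmetric] j_def[symmetric] by linarith
    also have "\<dots> = c2 * g t" by (simp add: c2_def algebra_simps)
    also have "\<dots> \<le> (c1 + c2) * g t" using g_t0 c by (simp add: mult_right_mono)
    finally show "q_energy {0..t} Z \<le> ennreal ((c1 + c2) * (\<integral>\<omega>. (norm (Y t \<omega> - X t \<omega>))\<^sup>2 \<partial>Prb S))"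
      unfolding z gt by (rule ennreal_leI)
    assume X0: "\<forall>\<omega>\<in>space (Prb S). X 0 \<omega> = x"
    have "AE \<omega> in Prb S. (norm (Y 0 \<omega> - X 0 \<omega>))\<^sup>2 = 0"
      using Y0 AE_space by eventually_elim (use X0 in simp)
    then have g0: "g 0 = 0" unfolding g_def E.second_moment_def by (rule integral_eq_zero_AE)
    \<comment> \<open>Forward bound: as \<open>g 0 = 0\<close>, the only source term is
      \<open>2 * z\<close>, which comes from the energy of \<open>Z\<close> in
      \<open>j_le\<close>.\<close>
    have "g t \<le> 2 * (2 * z) * exp (2 * k * t)"
    proof (rule gronwall_forward[where t=t])
      fix r assume r: "r \<in> {0..t}"
      have "g r \<le> 2 * KA * (LINT s:{0<..r}|lborel. g s) + j r"
        using E.energy_forward[OF r] g0 unfolding g_def[symmetric] j_def[symmetric] by simp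
      also have "\<dots> \<le> 2 * z + k * (LINT s:{0<..r}|lborel. g s)"
        using j_le[OF r] by (simp add: k_def distrib_right)
      finally show "g r \<le> 2 * z + k * (LINT s:{0<..r}|lborel. g s)" .
      show "0 \<le> g r \<and> g r \<le> enn2real (\<integral>\<^sup>+\<omega>. (sup_norm t ?D \<omega>)\<^sup>2 \<partial>Prb S)"
        unfolding g_def by (rule E.second_moment_bounds[OF r])
    next
      show "set_integrable lborel {0<..t} g" unfolding g_def using E.second_moment_Fubini(1)[of 0 t] t by simp
    qed (use z0 k t in auto)
    also have "\<dots> = c1 * z" by (simp add: c1_def)
    also have "\<dots> \<le> (c1 + c2) * z" using z0 c by (simp add: mult_right_mono)
    finally show "(\<integral>\<omega>. (norm (Y t \<omega> - X t \<omega>))\<^sup>2 \<partial>Prb S) \<le> (c1 + c2) * enn2real (q_energy {0..t} Z)"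
      unfolding gt z_def .
  qed
qed

text \<open>The backward solution meets its datum only almost surely; measurability of all three
  variables makes the integrals agree.\<close>

lemma terminal_integral_cong:
  assumes t: "0 \<le> t" "t \<le> horizon S" and Y: "sde_solution S x u Y" and X: "bsde_solution S u t \<xi> X Z" and \<xi>: "\<xi> \<in> L2_at S t"
  shows "(\<integral>\<omega>. (norm (Y t \<omega> - \<xi> \<omega>))\<^sup>2 \<partial>Prb S) = (\<integral>\<omega>. (norm (Y t \<omega> - X t \<omega>))\<^sup>2 \<partial>Prb S)"
proof (rule integral_cong_AE)
  have "X t \<in> borel_measurable (filt S t)" "Y t \<in> borel_measurable (filt S t)"
    using X Y t by (auto intro!: progressive_adapted L2_cadlagD(1) simp: bsde_solution_def sde_solution_def)
  moreover have "\<xi> \<in> borel_measurable (filt S t)" using \<xi> by (simp add: L2_at_def)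
  ultimately have [measurable]: "X t \<in> borel_measurable (Prb S)" "Y t \<in> borel_measurable (Prb S)" "\<xi> \<in> borel_measurable (Prb S)"
    by (auto intro: measurable_from_subalg[OF subalgebra_filt])
  show "(\<lambda>\<omega>. (norm (Y t \<omega> - \<xi> \<omega>))\<^sup>2) \<in> borel_measurable (Prb S)" "(\<lambda>\<omega>. (norm (Y t \<omega> - X t \<omega>))\<^sup>2) \<in> borel_measurable (Prb S)"
    by measurable
  have "AE \<omega> in Prb S. X t \<omega> = \<xi> \<omega>" using X by (simp add: bsde_solution_def)
  then show "AE \<omega> in Prb S. (norm (Y t \<omega> - \<xi> \<omega>))\<^sup>2 = (norm (Y t \<omega> - X t \<omega>))\<^sup>2" by eventually_elim simp
qed

end

section \<open>Reachability and vanishing of the value function\<close>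

theorem proposition4p1:
  fixes S :: "('w, 'e::metric_space, 'n::finite, 'd::finite) switch_system"
    and t :: real and \<xi> :: "'w \<Rightarrow> real^'n"
  assumes "control_system S"
    and "sde_well_posed S" and "bsde_well_posed S"
    and "0 \<le> t" and "t \<le> horizon S"
    and "\<xi> \<in> L2_at S t"
  shows "approx_reachable S t \<xi> \<longleftrightarrow> V_value S t \<xi> = 0"
proof -
  interpret control_system S by (rule assms(1))
  note t = assms(4,5)
  \<comment> \<open>Well-posedness turns the choices in \<open>state\<close> and
    \<open>bsde_Z\<close> into genuine solutions; for the latter a matching first component exists
    but is not chosen.\<close>
  have sde: "sde_solution S x u (state S x u)" if "u \<in> admissible S" for x u
  proof -
    have "\<exists>X. sde_solution S x u X" using assms(2) that unfolding sde_well_posed_def by blast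
    then show ?thesis unfolding state_def by (rule someI_ex)
  qed
  have bsde: "\<exists>X. bsde_solution S u t \<xi> X (bsde_Z S u t \<xi>)" if "u \<in> admissible S" for u
  proof -
    have "t \<in> {0..horizon S}" using t by simp
    then have "\<exists>Z X. bsde_solution S u t \<xi> X Z" using assms(3,6) that unfolding bsde_well_posed_def by blast
    then show ?thesis unfolding bsde_Z_def by (rule someI_ex)
  qed
  have V: "V_value S t \<xi> = (INF u\<in>admissible S. q_energy {0..t} (bsde_Z S u t \<xi>))"
    unfolding V_value_def
  proof (rule INF_cong[OF refl])
    fix u assume "u \<in> admissible S"
    then obtain X where "bsde_solution S u t \<xi> X (bsde_Z S u t \<xi>)" using bsde by auto
    then have "q_measurable t (bsde_Z S u t \<xi>)" by (intro L2_q_measurable) (simp add: bsde_solution_def)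
    from q_energy_compensator[OF t(1) this]
    show "(\<integral>\<^sup>+ \<omega>. (\<integral>\<^sup>+ (r, \<theta>) \<in> {0..t} \<times> UNIV. ennreal ((norm (bsde_Z S u t \<xi> r \<theta> \<omega>))\<^sup>2) \<partial>q_hat S \<omega>) \<partial>Prb S)
      = q_energy {0..t} (bsde_Z S u t \<xi>)" by (simp add: case_prod_unfold)
  qed
  obtain c where c: "0 \<le> c"
    and up: "\<And>u x Y X Z. u \<in> admissible S \<Longrightarrow> sde_solution S x u Y \<Longrightarrow> bsde_solution S u t \<xi> X Z \<Longrightarrow>
      q_energy {0..t} Z \<le> ennreal (c * (\<integral>\<omega>. (norm (Y t \<omega> - X t \<omega>))\<^sup>2 \<partial>Prb S))"
    and low: "\<And>u x Y X Z. u \<in> admissible S \<Longrightarrow> sde_solution S x u Y \<Longrightarrow> bsde_solution S u t \<xi> X Z \<Longrightarrow>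
      \<forall>\<omega>\<in>space (Prb S). X 0 \<omega> = x \<Longrightarrow>
      (\<integral>\<omega>. (norm (Y t \<omega> - X t \<omega>))\<^sup>2 \<partial>Prb S) \<le> c * enn2real (q_energy {0..t} Z)"
    using terminal_estimates[OF t] by blast
  show ?thesis
  proof
    assume R: "approx_reachable S t \<xi>"
    have "V_value S t \<xi> \<le> 0 + ennreal \<delta>" if \<delta>: "0 < \<delta>" for \<delta>
    proof -
      \<comment> \<open>Dividing by \<open>c + 1\<close> avoids a zero denominator and still gives
        \<open>c * \<epsilon>\<^sup>2 \<le> \<delta>\<close>.\<close>
      define \<epsilon> where "\<epsilon> = sqrt (\<delta> / (c + 1))"
      have \<epsilon>: "0 < \<epsilon>" "\<epsilon>\<^sup>2 = \<delta> / (c + 1)" using \<delta> c by (simp_all add: \<epsilon>_def)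
      obtain x u where u: "u \<in> admissible S"
        and le: "sqrt (\<integral>\<omega>. (norm (state S x u t \<omega> - \<xi> \<omega>))\<^sup>2 \<partial>Prb S) \<le> \<epsilon>"
        using R \<epsilon>(1) unfolding approx_reachable_def by blast
      obtain X where X: "bsde_solution S u t \<xi> X (bsde_Z S u t \<xi>)" using bsde[OF u] by auto
      let ?E = "\<integral>\<omega>. (norm (state S x u t \<omega> - X t \<omega>))\<^sup>2 \<partial>Prb S"
      have "?E \<le> \<epsilon>\<^sup>2"
        using le terminal_integral_cong[OF t sde[OF u] X assms(6)] by (simp add: sqrt_le_D)
      then have "c * ?E \<le> c * (\<delta> / (c + 1))" unfolding \<epsilon>(2) using c by (rule mult_left_mono)
      also have "\<dots> \<le> \<delta>" using c \<delta> by (simp add: field_simps)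
      finally have "q_energy {0..t} (bsde_Z S u t \<xi>) \<le> ennreal \<delta>"
        using up[OF u sde[OF u] X] by (meson ennreal_leI order_trans)
      then show ?thesis unfolding V using u by (simp add: INF_lower2)
    qed
    then have "V_value S t \<xi> \<le> 0" by (rule ennreal_le_epsilon)
    then show "V_value S t \<xi> = 0" by simp
  next
    assume V0: "V_value S t \<xi> = 0"
    show "approx_reachable S t \<xi>"
      unfolding approx_reachable_def
    proof (intro allI impI)
      fix \<epsilon> :: real assume \<epsilon>: "0 < \<epsilon>"
      \<comment> \<open>Chosen so that \<open>c * \<delta>\<close> is at most
        \<open>\<epsilon>\<^sup>2\<close>, the bound wanted for the squared distance.\<close>
      define \<delta> where "\<delta> = \<epsilon>\<^sup>2 / (c + 1)"
      have \<delta>: "0 < \<delta>" using \<epsilon> c by (simp add: \<delta>_def)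
      then have "(INF u\<in>admissible S. q_energy {0..t} (bsde_Z S u t \<xi>)) < ennreal \<delta>"
        using V0 unfolding V by simp
      then obtain u where u: "u \<in> admissible S" and q: "q_energy {0..t} (bsde_Z S u t \<xi>) < ennreal \<delta>"
        by (auto simp: INF_less_iff)
      obtain X where X: "bsde_solution S u t \<xi> X (bsde_Z S u t \<xi>)" using bsde[OF u] by auto
      have "X 0 \<in> borel_measurable (filt S 0)"
        using X t by (intro progressive_adapted[of t] L2_cadlagD(1)) (auto simp: bsde_solution_def)
      \<comment> \<open>The constant initial value of the backward solution becomes the starting
        point of the forward equation, run with the same near-optimal control.\<close>
      from filt_0_measurable_const[OF this] obtain x where x: "\<forall>\<omega>\<in>space (Prb S). X 0 \<omega> = x" by auto
      have "enn2real (q_energy {0..t} (bsde_Z S u t \<xi>)) \<le> enn2real (ennreal \<delta>)"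
        using q by (intro enn2real_mono) auto
      then have "enn2real (q_energy {0..t} (bsde_Z S u t \<xi>)) \<le> \<delta>" using \<delta> by simp
      then have "c * enn2real (q_energy {0..t} (bsde_Z S u t \<xi>)) \<le> c * \<delta>" using c by (rule mult_left_mono)
      also have "\<dots> \<le> \<epsilon>\<^sup>2" using c by (simp add: \<delta>_def field_simps)
      finally have "(\<integral>\<omega>. (norm (state S x u t \<omega> - \<xi> \<omega>))\<^sup>2 \<partial>Prb S) \<le> \<epsilon>\<^sup>2"
        using low[OF u sde[OF u] X x] terminal_integral_cong[OF t sde[OF u] X assms(6)] by simp
      then have "sqrt (\<integral>\<omega>. (norm (state S x u t \<omega> - \<xi> \<omega>))\<^sup>2 \<partial>Prb S) \<le> \<epsilon>"
        using \<epsilon> by (simp add: real_le_lsqrt)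
      then show "\<exists>x. \<exists>u\<in>admissible S. sqrt (\<integral>\<omega>. (norm (state S x u t \<omega> - \<xi> \<omega>))\<^sup>2 \<partial>Prb S) \<le> \<epsilon>"
        using u by blast
    qed
  qed
qed

end
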